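(* The forward operator $F:D(F)\subset H^2(\underline u,\overline u)\to L^2(0,T)$, $a\mapsto\triangle p$ (defined in the context), is Fréchet differentiable with Lipschitz continuous derivative, i.e. there is a constant $L$ such that $$\|F'(a)-F'(\tilde a)\|_{H^2(\underline u,\overline u)\to L^2(0,T)}\le L\,\|a-\tilde a\|_{H^2(\underline u,\overline u)}\qquad\text{for all } a,\tilde a\in D(F).$$
   Context: Fix $T>0$ and positive constants $a_0,a_1,a_2,a_3$. Consider the condition (A1) $a\in W^{3,\infty}_{loc}(\mathbb R)$ with $a(0)=0$, $a_0\le a'(\cdot)\le a_1$, $|a''(\cdot)|\le a_2$, $|a'''(\cdot)|\le a_3$. Fix data satisfying (A2) $u_0=0$ and $p_0=c$ with $c\in\mathbb R$; (A3) $g_0,g_1\in C^4([0,T])$, $g_0(0)=g_1(0)=0$, $g_0'(0)=g_1'(0)=0$. State system: for $a$ satisfying (A1), $(p(a),u(a))\in C^1([0,T];L^2(0,1)^2)\cap C([0,T];H^1(0,1)^2)$ denotes the unique classical solution $(p,u)$ of $\partial_t p+\partial_x u=0$, $\partial_t u+\partial_x p+a(u)=0$ on $(0,1)\times(0,T)$ with $u(0,t)=g_0(t)$, $u(1,t)=g_1(t)$, $p(\cdot,0)=p_0$, $u(\cdot,0)=u_0$. There are constants $\underline u<\overline u$, independent of $a$, such that $\underline u\le u(x,t)\le\overline u$ for all $x\in[0,1]$, $t\in[0,T]$ and every $a$ satisfying (A1); fix such constants. Parameters are restricted to $[\underline u,\overline u]$ (the solution only depends on this restriction), and $D(F)=\{a\in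 H^2(\underline u,\overline u): \text{(A1) holds}\}$, i.e. the set of restrictions to $[\underline u,\overline u]$ of functions satisfying (A1) with the fixed constants; $D(F)$ is closed and convex. The forward operator is $F(a)=\triangle p:=p(0,\cdot)-p(1,\cdot)$ with $(p,u)=(p(a),u(a))$. Derivative: for $a\in D(F)$ and $b\in H^2(\underline u,\overline u)$, $F'(a)b:=r(0,\cdot)-r(1,\cdot)$, where $(r,w)$ is the classical solution of the sensitivity system $\partial_t r+\partial_x w=0$, $\partial_t w+\partial_x r=-a'(u(a))w-b(u(a))$ on $(0,1)\times(0,T)$ with $r(x,0)=w(x,0)=0$ and $w(0,t)=w(1,t)=0$. Fréchet differentiability is understood relative to $D(F)$: $F'(a):H^2(\underline u,\overline u)\to L^2(0,T)$ is bounded and linear, and $\|F(\tilde a)-F(a)-F'(a)(\tilde a-a)\|_{L^2(0,T)}/\|\tilde a-a\|_{H^2(\underline u,\overline u)}\to 0$ as $\tilde a\to a$ in $H^2(\underline u,\overline u)$ with $\tilde a\in D(F)\setminus\{a\}$. *)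

theory Defs
  imports "HOL-Analysis.Analysis"
begin

section \<open>Sobolev spaces in one dimension\<close>

definition L2 :: "real set \<Rightarrow> (real \<Rightarrow> real) set" where
  "L2 S = {f. f \<in> borel_measurable (lebesgue_on S) \<and> integrable (lebesgue_on S) (\<lambda>x. (f x)\<^sup>2)}"

definition L2_norm :: "real set \<Rightarrow> (real \<Rightarrow> real) \<Rightarrow> real" where
  "L2_norm S f = sqrt (\<integral>x. (f x)\<^sup>2 \<partial>lebesgue_on S)"

definition loc_integrable :: "real set \<Rightarrow> (real \<Rightarrow> real) \<Rightarrow> bool" where
  "loc_integrable S f \<longleftrightarrow> (\<forall>K. compact K \<and> K \<subseteq> S \<longrightarrow> integrable (lebesgue_on K) f)"

definition test_functions :: "real set \<Rightarrow> (real \<Rightarrow> real) set" where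
  "test_functions S = {\<phi>. \<phi> C1_differentiable_on UNIV \<and>
     (\<exists>K. compact K \<and> K \<subseteq> S \<and> (\<forall>x. x \<notin> K \<longrightarrow> \<phi> x = 0))}"

text \<open>\<open>weak_deriv S f g\<close>: on the open set \<open>S\<close>, \<open>g\<close> is a weak derivative of \<open>f\<close>. Test functions are
  $C^1$ with compact support, as in Brezis' treatment of Sobolev spaces on intervals; by
  mollification this is the same notion as with smooth test functions.\<close>

definition weak_deriv :: "real set \<Rightarrow> (real \<Rightarrow> real) \<Rightarrow> (real \<Rightarrow> real) \<Rightarrow> bool" where
  "weak_deriv S f g \<longleftrightarrow> loc_integrable S f \<and> loc_integrable S g \<and>
     (\<forall>\<phi>\<in>test_functions S.
        (\<integral>x. f x * deriv \<phi> x \<partial>lebesgue_on S) = - (\<integral>x. g x * \<phi> x \<partial>lebesgue_on S))"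

text \<open>Weak derivatives are unique up to null sets, and \<open>wd\<close> picks one of them; it is only used under
  integrals and almost-everywhere quantifiers.\<close>

definition wd :: "real set \<Rightarrow> (real \<Rightarrow> real) \<Rightarrow> real \<Rightarrow> real" where
  "wd S f = (SOME g. weak_deriv S f g)"

text \<open>Elements of $H^1(l,r)$ and $H^2(l,r)$ are represented by functions that agree on \<open>{l..r}\<close> with
  the continuous representative, so that traces and compositions are pointwise values. Values outside
  \<open>{l..r}\<close> are irrelevant.\<close>

definition H1 :: "real \<Rightarrow> real \<Rightarrow> (real \<Rightarrow> real) set" where
  "H1 l r = {f. continuous_on {l..r} f \<and> f \<in> L2 {l<..<r} \<and>
     (\<exists>g\<in>L2 {l<..<r}. weak_deriv {l<..<r} f g)}"

definition H1_norm :: "real \<Rightarrow> real \<Rightarrow> (real \<Rightarrow> real) \<Rightarrow> real" where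
  "H1_norm l r f = sqrt ((L2_norm {l<..<r} f)\<^sup>2 + (L2_norm {l<..<r} (wd {l<..<r} f))\<^sup>2)"

definition H2 :: "real \<Rightarrow> real \<Rightarrow> (real \<Rightarrow> real) set" where
  "H2 l r = {f. continuous_on {l..r} f \<and> f \<in> L2 {l<..<r} \<and>
     (\<exists>g\<in>L2 {l<..<r}. \<exists>h\<in>L2 {l<..<r}. weak_deriv {l<..<r} f g \<and> weak_deriv {l<..<r} g h)}"

definition H2_norm :: "real \<Rightarrow> real \<Rightarrow> (real \<Rightarrow> real) \<Rightarrow> real" where
  "H2_norm l r f = sqrt ((L2_norm {l<..<r} f)\<^sup>2 + (L2_norm {l<..<r} (wd {l<..<r} f))\<^sup>2
     + (L2_norm {l<..<r} (wd {l<..<r} (wd {l<..<r} f)))\<^sup>2)"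

definition Linf_loc :: "(real \<Rightarrow> real) set" where
  "Linf_loc = {f. f \<in> borel_measurable lebesgue \<and>
     (\<forall>R. \<exists>C. AE x in lebesgue. \<bar>x\<bar> \<le> R \<longrightarrow> \<bar>f x\<bar> \<le> C)}"

text \<open>Condition (A1). Here \<open>d1\<close>, \<open>d2\<close>, \<open>d3\<close> are the weak derivatives of orders 1, 2, 3, the first line
  says $a \in W^{3,\infty}_{loc}(\mathbb{R})$, and \<open>a\<close> is again its continuous representative (which
  is then $C^2$, so that \<open>deriv a\<close> is $a'$).\<close>

definition A1 :: "real \<Rightarrow> real \<Rightarrow> real \<Rightarrow> real \<Rightarrow> (real \<Rightarrow> real) \<Rightarrow> bool" where
  "A1 a0 a1 a2 a3 a \<longleftrightarrow> continuous_on UNIV a \<and> a 0 = 0 \<and>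
     (\<exists>d1 d2 d3. a \<in> Linf_loc \<and> d1 \<in> Linf_loc \<and> d2 \<in> Linf_loc \<and> d3 \<in> Linf_loc \<and>
        weak_deriv UNIV a d1 \<and> weak_deriv UNIV d1 d2 \<and> weak_deriv UNIV d2 d3 \<and>
        (AE x in lebesgue. a0 \<le> d1 x \<and> d1 x \<le> a1 \<and> \<bar>d2 x\<bar> \<le> a2 \<and> \<bar>d3 x\<bar> \<le> a3))"

definition C_k_on_interval :: "nat \<Rightarrow> real \<Rightarrow> (real \<Rightarrow> real) \<Rightarrow> bool" where
  "C_k_on_interval k T g \<longleftrightarrow> (\<exists>D :: nat \<Rightarrow> real \<Rightarrow> real. D 0 = g \<and>
     (\<forall>j<k. \<forall>t\<in>{0..T}. (D j has_real_derivative D (Suc j) t) (at t within {0..T})) \<and>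
     continuous_on {0..T} (D k))"

section \<open>Classical solutions\<close>

text \<open>\<open>cont_path T X N f\<close>: the map \<open>t \<mapsto> f t\<close> lies in $C([0,T];X)$, where \<open>N\<close> is the norm of \<open>X\<close>.
  Functions of time and space take the time argument first.\<close>

definition cont_path ::
  "real \<Rightarrow> (real \<Rightarrow> real) set \<Rightarrow> ((real \<Rightarrow> real) \<Rightarrow> real) \<Rightarrow> (real \<Rightarrow> real \<Rightarrow> real) \<Rightarrow> bool" where
  "cont_path T X N f \<longleftrightarrow> (\<forall>t\<in>{0..T}. f t \<in> X \<and>
     ((\<lambda>s. N (\<lambda>x. f s x - f t x)) \<longlongrightarrow> 0) (at t within {0..T}))"

text \<open>\<open>C1_path T X N f f'\<close>: the map \<open>t \<mapsto> f t\<close> lies in $C^1([0,T];X)$, with derivative \<open>f'\<close>.\<close>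

definition C1_path ::
  "real \<Rightarrow> (real \<Rightarrow> real) set \<Rightarrow> ((real \<Rightarrow> real) \<Rightarrow> real) \<Rightarrow>
   (real \<Rightarrow> real \<Rightarrow> real) \<Rightarrow> (real \<Rightarrow> real \<Rightarrow> real) \<Rightarrow> bool" where
  "C1_path T X N f f' \<longleftrightarrow> cont_path T X N f \<and> cont_path T X N f' \<and>
     (\<forall>t\<in>{0..T}. ((\<lambda>s. N (\<lambda>x. (f s x - f t x) / (s - t) - f' t x)) \<longlongrightarrow> 0) (at t within {0..T}))"

text \<open>Classical solutions of
  $\partial_t p + \partial_x u = 0$, $\partial_t u + \partial_x p + f(t,x,u) = 0$ on $(0,1)\times(0,T)$
  with $u(0,t) = h_0(t)$, $u(1,t) = h_1(t)$, $p(x,0) = p_0$, $u(x,0) = u_0$ (constants),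
  in the class $C^1([0,T];L^2(0,1)^2) \cap C([0,T];H^1(0,1)^2)$.\<close>

definition classical_solution ::
  "real \<Rightarrow> (real \<Rightarrow> real \<Rightarrow> real \<Rightarrow> real) \<Rightarrow> real \<Rightarrow> real \<Rightarrow> (real \<Rightarrow> real) \<Rightarrow> (real \<Rightarrow> real) \<Rightarrow>
   (real \<Rightarrow> real \<Rightarrow> real) \<Rightarrow> (real \<Rightarrow> real \<Rightarrow> real) \<Rightarrow> bool" where
  "classical_solution T f p0 u0 h0 h1 p u \<longleftrightarrow>
     cont_path T (H1 0 1) (H1_norm 0 1) p \<and> cont_path T (H1 0 1) (H1_norm 0 1) u \<and>
     (\<exists>pt ut. C1_path T (L2 {0<..<1}) (L2_norm {0<..<1}) p pt \<and>
        C1_path T (L2 {0<..<1}) (L2_norm {0<..<1}) u ut \<and>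
        (\<forall>t\<in>{0<..<T}. AE x in lebesgue_on {0<..<1}.
           pt t x + wd {0<..<1} (u t) x = 0 \<and>
           ut t x + wd {0<..<1} (p t) x + f t x (u t x) = 0)) \<and>
     (\<forall>t\<in>{0..T}. u t 0 = h0 t \<and> u t 1 = h1 t) \<and>
     (\<forall>x\<in>{0..1}. p 0 x = p0 \<and> u 0 x = u0)"

definition state_solution ::
  "real \<Rightarrow> real \<Rightarrow> (real \<Rightarrow> real) \<Rightarrow> (real \<Rightarrow> real) \<Rightarrow> (real \<Rightarrow> real) \<Rightarrow>
   (real \<Rightarrow> real \<Rightarrow> real) \<Rightarrow> (real \<Rightarrow> real \<Rightarrow> real) \<Rightarrow> bool" where
  "state_solution T c g0 g1 a p u \<longleftrightarrow> classical_solution T (\<lambda>t x v. a v) c 0 g0 g1 p u"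

definition sensitivity_solution ::
  "real \<Rightarrow> (real \<Rightarrow> real) \<Rightarrow> (real \<Rightarrow> real \<Rightarrow> real) \<Rightarrow> (real \<Rightarrow> real) \<Rightarrow>
   (real \<Rightarrow> real \<Rightarrow> real) \<Rightarrow> (real \<Rightarrow> real \<Rightarrow> real) \<Rightarrow> bool" where
  "sensitivity_solution T a u b r w \<longleftrightarrow>
     classical_solution T (\<lambda>t x v. deriv a (u t x) * v + b (u t x)) 0 0 (\<lambda>t. 0) (\<lambda>t. 0) r w"

text \<open>The solution \<open>(p(a), u(a))\<close>; it is unique on $[0,1]\times[0,T]$.\<close>

definition the_state ::
  "real \<Rightarrow> real \<Rightarrow> (real \<Rightarrow> real) \<Rightarrow> (real \<Rightarrow> real) \<Rightarrow> (real \<Rightarrow> real) \<Rightarrow>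
   (real \<Rightarrow> real \<Rightarrow> real) \<times> (real \<Rightarrow> real \<Rightarrow> real)" where
  "the_state T c g0 g1 a = (SOME (p, u). state_solution T c g0 g1 a p u)"

definition the_sensitivity ::
  "real \<Rightarrow> (real \<Rightarrow> real) \<Rightarrow> (real \<Rightarrow> real \<Rightarrow> real) \<Rightarrow> (real \<Rightarrow> real) \<Rightarrow>
   (real \<Rightarrow> real \<Rightarrow> real) \<times> (real \<Rightarrow> real \<Rightarrow> real)" where
  "the_sensitivity T a u b = (SOME (r, w). sensitivity_solution T a u b r w)"

section \<open>The forward operator and its derivative\<close>

definition DF :: "real \<Rightarrow> real \<Rightarrow> real \<Rightarrow> real \<Rightarrow> real \<Rightarrow> real \<Rightarrow> (real \<Rightarrow> real) set" where
  "DF a0 a1 a2 a3 ul ur = {a \<in> H2 ul ur. \<exists>A. A1 a0 a1 a2 a3 A \<and> (\<forall>y\<in>{ul..ur}. A y = a y)}"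

text \<open>Parameters are only given on \<open>{ul..ur}\<close>; the equations are solved with an extension satisfying
  (A1). As the states take values in \<open>{ul..ur}\<close>, the choice of the extension does not matter.\<close>

definition extension ::
  "real \<Rightarrow> real \<Rightarrow> real \<Rightarrow> real \<Rightarrow> real \<Rightarrow> real \<Rightarrow> (real \<Rightarrow> real) \<Rightarrow> real \<Rightarrow> real" where
  "extension a0 a1 a2 a3 ul ur a = (SOME A. A1 a0 a1 a2 a3 A \<and> (\<forall>y\<in>{ul..ur}. A y = a y))"

definition forward_op ::
  "real \<Rightarrow> real \<Rightarrow> real \<Rightarrow> real \<Rightarrow> real \<Rightarrow> real \<Rightarrow> real \<Rightarrow> real \<Rightarrow> (real \<Rightarrow> real) \<Rightarrow> (real \<Rightarrow> real) \<Rightarrow>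
   (real \<Rightarrow> real) \<Rightarrow> real \<Rightarrow> real" where
  "forward_op T a0 a1 a2 a3 ul ur c g0 g1 a =
     (let (p, u) = the_state T c g0 g1 (extension a0 a1 a2 a3 ul ur a)
      in (\<lambda>t. p t 0 - p t 1))"

definition forward_deriv ::
  "real \<Rightarrow> real \<Rightarrow> real \<Rightarrow> real \<Rightarrow> real \<Rightarrow> real \<Rightarrow> real \<Rightarrow> real \<Rightarrow> (real \<Rightarrow> real) \<Rightarrow> (real \<Rightarrow> real) \<Rightarrow>
   (real \<Rightarrow> real) \<Rightarrow> (real \<Rightarrow> real) \<Rightarrow> real \<Rightarrow> real" where
  "forward_deriv T a0 a1 a2 a3 ul ur c g0 g1 a b =
     (let A = extension a0 a1 a2 a3 ul ur a;
          (p, u) = the_state T c g0 g1 A;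
          (r, w) = the_sensitivity T A u b
      in (\<lambda>t. r t 0 - r t 1))"

section \<open>Bounded operators from $H^2(l,r)$ to $L^2(0,T)$ and Frechet derivatives\<close>

definition bounded_linear_H2_L2 ::
  "real \<Rightarrow> real \<Rightarrow> real \<Rightarrow> ((real \<Rightarrow> real) \<Rightarrow> real \<Rightarrow> real) \<Rightarrow> bool" where
  "bounded_linear_H2_L2 l r T B \<longleftrightarrow>
     (\<forall>b\<in>H2 l r. B b \<in> L2 {0<..<T}) \<and>
     (\<forall>b\<in>H2 l r. \<forall>d\<in>H2 l r. AE t in lebesgue_on {0<..<T}. B (\<lambda>y. b y + d y) t = B b t + B d t) \<and>
     (\<forall>k. \<forall>b\<in>H2 l r. AE t in lebesgue_on {0<..<T}. B (\<lambda>y. k * b y) t = k * B b t) \<and>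
     (\<exists>C. \<forall>b\<in>H2 l r. L2_norm {0<..<T} (B b) \<le> C * H2_norm l r b)"

text \<open>The operator norm, in the form of the library's \<open>onorm\<close>. It is meaningful for operators that are
  bounded, since otherwise the supremum is unspecified.\<close>

definition onorm_H2_L2 ::
  "real \<Rightarrow> real \<Rightarrow> real \<Rightarrow> ((real \<Rightarrow> real) \<Rightarrow> real \<Rightarrow> real) \<Rightarrow> real" where
  "onorm_H2_L2 l r T B = (SUP b\<in>H2 l r. L2_norm {0<..<T} (B b) / H2_norm l r b)"

text \<open>Frechet derivative at \<open>a\<close> relative to the set \<open>D\<close>, which need not have interior points.\<close>

definition has_frechet_derivative_within ::
  "real \<Rightarrow> real \<Rightarrow> real \<Rightarrow> ((real \<Rightarrow> real) \<Rightarrow> real \<Rightarrow> real) \<Rightarrow> ((real \<Rightarrow> real) \<Rightarrow> real \<Rightarrow> real) \<Rightarrow>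
   (real \<Rightarrow> real) \<Rightarrow> (real \<Rightarrow> real) set \<Rightarrow> bool" where
  "has_frechet_derivative_within l r T F B a D \<longleftrightarrow> bounded_linear_H2_L2 l r T B \<and>
     (\<forall>\<epsilon>>0. \<exists>\<delta>>0. \<forall>a'\<in>D.
        0 < H2_norm l r (\<lambda>y. a' y - a y) \<and> H2_norm l r (\<lambda>y. a' y - a y) < \<delta> \<longrightarrow>
        L2_norm {0<..<T} (\<lambda>t. F a' t - F a t - B (\<lambda>y. a' y - a y) t)
          / H2_norm l r (\<lambda>y. a' y - a y) < \<epsilon>)"

end

theory Submission imports Defs begin

text \<open>The Riemann invariants turn the system into transport equations. Reflecting at the boundary
  unfolds the strip to a single outgoing invariant \<open>v\<close> on the whole line, with \<open>u\<close> and \<open>p\<close> its odd and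
  even parts (up to a lift of the boundary data), and \<open>v\<close> satisfies an integral equation along
  characteristics. Because the extended forcing jumps at integers, the contraction argument is run
  for the time derivative of \<open>v\<close>, which is bounded and continuous off the characteristics through the
  corners; this yields a classical solution, and the energy method shows that it is the only one. The
  pressure drop is \<open>v t 0 - v t 1\<close>. Gronwall's inequality for the integral equation bounds, uniformly on
  $[0,T]$, the difference of two states, the sensitivity, the linearisation error (quadratically) and the
  difference of two sensitivities. As $H^2$ embeds into $C^1$ on an interval, these are bounds in terms of
  $H^2$ norms of the parameters.\<close>

section \<open>Primitives and weak derivatives\<close>

text \<open>A contraction for \<open>v\<close> itself would not control the derivatives that a
  classical solution needs in L2. After differentiating Duhamel's formula in time, the forcing
  enters only through its partial derivatives in time and in the unknown. No space derivative of the
  extended forcing is taken, which is why its jumps at the integers do no harm; the space derivative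
  of \<open>v\<close> then comes from the transport equation, as forcing minus time derivative. The
  sensitivity equation has coefficients evaluated along \<open>u\<close>, whose time derivative may
  jump across the corner characteristics. The locale \<open>forcing\<close> therefore asks for
  differentiability at \<open>good\<close> points only, and one existence result serves both
  systems. States, sensitivities and extensions of parameters are all fixed by Hilbert choice:
  uniqueness ties the chosen solutions to the constructed ones, and parameters are compared only at
  values of states, which lie in \<open>{ul..ur}\<close>, where the extension is prescribed.\<close>

text \<open>A variable endpoint becomes a kernel on a fixed measure space, the form that Fubini's
  theorem accepts.\<close>

lemma integral_lebesgue_on_upto:
  fixes f :: "real \<Rightarrow> real"
  assumes "integrable (lebesgue_on {a..b}) f" "x \<in> {a..b}"
  shows "integral {a..x} f = (\<integral>y. (if y \<le> x then f y else 0) \<partial>lebesgue_on {a..b})"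
    and "integral {x..b} f = (\<integral>y. (if x \<le> y then f y else 0) \<partial>lebesgue_on {a..b})"
proof -
  have sub: "{a..x} \<subseteq> {a..b}" "{x..b} \<subseteq> {a..b}" using assms by auto
  have i: "integrable (lebesgue_on {a..x}) f" "integrable (lebesgue_on {x..b}) f"
    using integrable_subinterval[OF assms(1)] sub by auto
  have "integral {a..x} f = (\<integral>y. f y \<partial>lebesgue_on {a..x})"
    by (simp add: lebesgue_integral_eq_integral[OF i(1)])
  also have "\<dots> = (\<integral>y. (if y \<in> {a..x} then f y else 0) \<partial>lebesgue_on {a..b})"
    by (rule integral_restrict[symmetric]) (use sub in auto)
  also have "\<dots> = (\<integral>y. (if y \<le> x then f y else 0) \<partial>lebesgue_on {a..b})"
    by (rule Bochner_Integration.integral_cong) auto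
  finally show "integral {a..x} f = (\<integral>y. (if y \<le> x then f y else 0) \<partial>lebesgue_on {a..b})" .
  have "integral {x..b} f = (\<integral>y. f y \<partial>lebesgue_on {x..b})"
    by (simp add: lebesgue_integral_eq_integral[OF i(2)])
  also have "\<dots> = (\<integral>y. (if y \<in> {x..b} then f y else 0) \<partial>lebesgue_on {a..b})"
    by (rule integral_restrict[symmetric]) (use sub in auto)
  also have "\<dots> = (\<integral>y. (if x \<le> y then f y else 0) \<partial>lebesgue_on {a..b})"
    by (rule Bochner_Integration.integral_cong) auto
  finally show "integral {x..b} f = (\<integral>y. (if x \<le> y then f y else 0) \<partial>lebesgue_on {a..b})" .
qed

lemma measurable_ident_lebesgue_on: "(\<lambda>x. x) \<in> borel_measurable (lebesgue_on S)"
  using id_borel_measurable_lebesgue_on[of S] by (simp add: id_def)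

text \<open>Fubini on the triangle \<open>y \<le> x\<close>: both products reduce to the same double
  integral of \<open>p x * f y\<close>, with opposite signs. Only integrability of the two
  derivatives enters, so the rule covers absolutely continuous functions.\<close>

lemma integration_by_parts_ac:
  fixes f p F P :: "real \<Rightarrow> real"
  assumes ab: "a \<le> b"
    and f: "integrable (lebesgue_on {a..b}) f" and p: "integrable (lebesgue_on {a..b}) p"
    and F: "\<And>x. x \<in> {a..b} \<Longrightarrow> F x = F a + integral {a..x} f"
    and P: "\<And>x. x \<in> {a..b} \<Longrightarrow> P x = P a + integral {a..x} p"
  shows "integrable (lebesgue_on {a..b}) (\<lambda>x. F x * p x)"
    and "integrable (lebesgue_on {a..b}) (\<lambda>x. f x * P x)"
    and "(\<integral>x. F x * p x \<partial>lebesgue_on {a..b}) + (\<integral>x. f x * P x \<partial>lebesgue_on {a..b})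
      = F b * P b - F a * P a"
proof -
  define M where "M = lebesgue_on {a..b}"
  have fin: "finite_measure M" unfolding M_def by (rule finite_measure_lebesgue_on) auto
  interpret finite_measure M by fact
  interpret pair_sigma_finite M M ..
  have [measurable]: "f \<in> borel_measurable M" "p \<in> borel_measurable M" "(\<lambda>x. x) \<in> borel_measurable M"
    using f p measurable_ident_lebesgue_on by (auto simp: M_def)
  have fM: "integrable M f" and pM: "integrable M p" using f p by (auto simp: M_def)
  have prod: "integrable (M \<Otimes>\<^sub>M M) (\<lambda>(x,y). p x * f y)"
  proof (rule Fubini_integrable)
    show "integrable M (\<lambda>x. \<integral>y. norm (case (x,y) of (x,y) \<Rightarrow> p x * f y) \<partial>M)"
      using pM by (simp add: abs_mult)
    show "AE x in M. integrable M (\<lambda>y. case (x,y) of (x,y) \<Rightarrow> p x * f y)"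
      using fM by simp
  qed measurable
  have k: "integrable (M \<Otimes>\<^sub>M M) (\<lambda>(x,y). p x * (if y \<le> x then f y else 0))"
  proof (rule Bochner_Integration.integrable_bound[OF prod])
    have "(\<lambda>z. fst z) \<in> borel_measurable (M \<Otimes>\<^sub>M M)" "(\<lambda>z. snd z) \<in> borel_measurable (M \<Otimes>\<^sub>M M)"
      by measurable
    then have "(\<lambda>z. p (fst z) * (if snd z \<le> fst z then f (snd z) else 0)) \<in> borel_measurable (M \<Otimes>\<^sub>M M)"
      by measurable
    then show "(\<lambda>(x,y). p x * (if y \<le> x then f y else 0)) \<in> borel_measurable (M \<Otimes>\<^sub>M M)"
      by (simp add: case_prod_beta)
  qed (auto simp: split_beta)
  have sp: "space M = {a..b}" by (simp add: M_def)
  have Fi: "integral {a..x} f = (\<integral>y. (if y \<le> x then f y else 0) \<partial>M)" if "x \<in> {a..b}" for x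
    using integral_lebesgue_on_upto(1)[OF f that] by (simp add: M_def)
  have Pi: "integral {a..x} p = (\<integral>y. (if y \<le> x then p y else 0) \<partial>M)" if "x \<in> {a..b}" for x
    using integral_lebesgue_on_upto(1)[OF p that] by (simp add: M_def)
  have Pi2: "integral {x..b} p = (\<integral>y. (if x \<le> y then p y else 0) \<partial>M)" if "x \<in> {a..b}" for x
    using integral_lebesgue_on_upto(2)[OF p that] by (simp add: M_def)
  have pab: "p integrable_on {a..b}" and fab: "f integrable_on {a..b}"
    using integrable_on_lebesgue_on[OF p] integrable_on_lebesgue_on[OF f] by auto
  have I1: "integrable M (\<lambda>x. p x * integral {a..x} f)"
  proof -
    have "integrable M (\<lambda>x. \<integral>y. p x * (if y \<le> x then f y else 0) \<partial>M)"
      using integrable_fst'[OF k] by simp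
    then show ?thesis
      by (rule Bochner_Integration.integrable_cong[THEN iffD1, rotated -1]) (auto simp: sp Fi)
  qed
  \<comment> \<open>Exchanging the order of integration over the triangle changes the inner range
    from \<open>{a..x}\<close> to \<open>{y..b}\<close>.\<close>
  have A: "(\<integral>x. p x * integral {a..x} f \<partial>M) = (\<integral>y. f y * integral {y..b} p \<partial>M)"
  proof -
    have "(\<integral>x. p x * integral {a..x} f \<partial>M) = (\<integral>x. (\<integral>y. p x * (if y \<le> x then f y else 0) \<partial>M) \<partial>M)"
      by (rule Bochner_Integration.integral_cong) (auto simp: sp Fi)
    also have "\<dots> = (\<integral>y. (\<integral>x. p x * (if y \<le> x then f y else 0) \<partial>M) \<partial>M)"
      by (rule Fubini_integral[symmetric]) (use k in simp)
    also have "\<dots> = (\<integral>y. f y * (\<integral>x. (if y \<le> x then p x else 0) \<partial>M) \<partial>M)"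
    proof (intro Bochner_Integration.integral_cong refl)
      fix y
      have "(\<integral>x. p x * (if y \<le> x then f y else 0) \<partial>M) = (\<integral>x. f y * (if y \<le> x then p x else 0) \<partial>M)"
        by (rule Bochner_Integration.integral_cong) auto
      then show "(\<integral>x. p x * (if y \<le> x then f y else 0) \<partial>M) = f y * (\<integral>x. (if y \<le> x then p x else 0) \<partial>M)"
        by simp
    qed
    also have "\<dots> = (\<integral>y. f y * integral {y..b} p \<partial>M)"
      by (rule Bochner_Integration.integral_cong) (auto simp: sp Pi2)
    finally show ?thesis .
  qed
  have k2: "integrable (M \<Otimes>\<^sub>M M) (\<lambda>(x,y). p y * (if y \<le> x then f x else 0))"
  proof -
    have "integrable (M \<Otimes>\<^sub>M M) (\<lambda>(x,y). f x * p y)"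
      using integrable_product_swap[OF prod] by (simp add: mult.commute)
    then show ?thesis
    proof (rule Bochner_Integration.integrable_bound)
      have "(\<lambda>z. fst z) \<in> borel_measurable (M \<Otimes>\<^sub>M M)" "(\<lambda>z. snd z) \<in> borel_measurable (M \<Otimes>\<^sub>M M)"
        by measurable
      then have "(\<lambda>z. p (snd z) * (if snd z \<le> fst z then f (fst z) else 0)) \<in> borel_measurable (M \<Otimes>\<^sub>M M)"
        by measurable
      then show "(\<lambda>(x,y). p y * (if y \<le> x then f x else 0)) \<in> borel_measurable (M \<Otimes>\<^sub>M M)"
        by (simp add: case_prod_beta)
    qed (auto simp: split_beta abs_mult mult.commute)
  qed
  have I2: "integrable M (\<lambda>x. f x * integral {a..x} p)"
  proof -
    have i: "integrable M (\<lambda>x. \<integral>y. p y * (if y \<le> x then f x else 0) \<partial>M)"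
      using integrable_fst'[OF k2] by simp
    have eq: "(\<integral>y. p y * (if y \<le> x then f x else 0) \<partial>M) = f x * integral {a..x} p" if "x \<in> {a..b}" for x
    proof -
      have "(\<integral>y. p y * (if y \<le> x then f x else 0) \<partial>M) = (\<integral>y. f x * (if y \<le> x then p y else 0) \<partial>M)"
        by (rule Bochner_Integration.integral_cong) auto
      then show ?thesis unfolding Pi[OF that] by simp
    qed
    show ?thesis
      by (rule Bochner_Integration.integrable_cong[THEN iffD1, OF refl _ i]) (simp add: eq sp)
  qed
  have Fp: "integrable M (\<lambda>x. F x * p x)"
  proof -
    have "integrable M (\<lambda>x. F a * p x + p x * integral {a..x} f)" using I1 pM by auto
    then show ?thesis
    proof (rule Bochner_Integration.integrable_cong[THEN iffD1, OF refl, rotated])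
      fix x assume "x \<in> space M"
      then have "F x = F a + integral {a..x} f" by (intro F) (simp add: sp)
      then show "F a * p x + p x * integral {a..x} f = F x * p x" by (metis distrib_left distrib_right mult.commute)
    qed
  qed
  have fP: "integrable M (\<lambda>x. f x * P x)"
  proof -
    have "integrable M (\<lambda>x. P a * f x + f x * integral {a..x} p)" using I2 fM by auto
    then show ?thesis
    proof (rule Bochner_Integration.integrable_cong[THEN iffD1, OF refl, rotated])
      fix x assume "x \<in> space M"
      then have "P x = P a + integral {a..x} p" by (intro P) (simp add: sp)
      then show "P a * f x + f x * integral {a..x} p = f x * P x" by (metis distrib_left distrib_right mult.commute)
    qed
  qed
  show "integrable (lebesgue_on {a..b}) (\<lambda>x. F x * p x)" "integrable (lebesgue_on {a..b}) (\<lambda>x. f x * P x)"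
    using Fp fP by (auto simp: M_def)
  have "(\<integral>x. F x * p x \<partial>M) = (\<integral>x. F a * p x + p x * integral {a..x} f \<partial>M)"
  proof (rule Bochner_Integration.integral_cong)
    fix x assume "x \<in> space M"
    then have "F x = F a + integral {a..x} f" by (intro F) (simp add: sp)
    then show "F x * p x = F a * p x + p x * integral {a..x} f" by (metis distrib_right mult.commute)
  qed simp
  also have "\<dots> = F a * integral\<^sup>L M p + (\<integral>y. f y * integral {y..b} p \<partial>M)"
    using I1 pM by (simp add: A)
  finally have e1: "(\<integral>x. F x * p x \<partial>M) = F a * integral\<^sup>L M p + (\<integral>y. f y * integral {y..b} p \<partial>M)" .
  \<comment> \<open>\<open>P\<close> is expanded from the right endpoint, so that the remaining
    double integral is the one produced by \<open>A\<close> and cancels.\<close>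
  have "(\<integral>x. f x * P x \<partial>M) = (\<integral>x. P b * f x - f x * integral {x..b} p \<partial>M)"
  proof (rule Bochner_Integration.integral_cong)
    fix x assume "x \<in> space M"
    then have x: "x \<in> {a..b}" by (simp add: sp)
    have "integral {a..x} p + integral {x..b} p = integral {a..b} p"
      by (rule Henstock_Kurzweil_Integration.integral_combine) (use x pab in auto)
    then have "P x = P b - integral {x..b} p" using P[OF x] P[of b] ab by simp
    then show "f x * P x = P b * f x - f x * integral {x..b} p"
      by (metis mult.commute right_diff_distrib)
  qed simp
  also have "\<dots> = P b * integral\<^sup>L M f - (\<integral>y. f y * integral {y..b} p \<partial>M)"
  proof -
    have "integrable M (\<lambda>x. f x * integral {x..b} p)"
    proof -
      have "integrable M (\<lambda>x. f x * integral {a..b} p - f x * integral {a..x} p)"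
        using fM I2 by auto
      then show ?thesis
      proof (rule Bochner_Integration.integrable_cong[THEN iffD1, rotated -1])
        fix x assume "x \<in> space M"
        then have x: "x \<in> {a..b}" by (simp add: sp)
        have "integral {a..x} p + integral {x..b} p = integral {a..b} p"
          by (rule Henstock_Kurzweil_Integration.integral_combine) (use x pab in auto)
        then show "f x * integral {a..b} p - f x * integral {a..x} p = f x * integral {x..b} p"
          by (metis add_diff_cancel_left' right_diff_distrib)
      qed simp
    qed
    then show ?thesis using fM by simp
  qed
  finally have e2: "(\<integral>x. f x * P x \<partial>M) = P b * integral\<^sup>L M f - (\<integral>y. f y * integral {y..b} p \<partial>M)" .
  have e3: "integral\<^sup>L M p = P b - P a" "integral\<^sup>L M f = F b - F a"
    using P[of b] F[of b] ab lebesgue_integral_eq_integral[OF f] lebesgue_integral_eq_integral[OF p]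
    by (simp_all add: M_def)
  have "(\<integral>x. F x * p x \<partial>M) + (\<integral>x. f x * P x \<partial>M) = F b * P b - F a * P a"
    unfolding e1 e2 e3 by (simp add: algebra_simps)
  then show "(\<integral>x. F x * p x \<partial>lebesgue_on {a..b}) + (\<integral>x. f x * P x \<partial>lebesgue_on {a..b})
      = F b * P b - F a * P a"
    by (simp add: M_def)
qed

text \<open>Lebesgue differentiation: off a null set \<open>q x\<close> is the limit of the averages
  of \<open>q\<close> over short intervals to the right of \<open>x\<close>, and these vanish. The
  extension by zero makes the function integrable on every box.\<close>

lemma AE_eq_0_if_interval_integrals_0:
  fixes q :: "real \<Rightarrow> real"
  assumes q: "q integrable_on {a..b}"
    and z: "\<And>x y. a < x \<Longrightarrow> x \<le> y \<Longrightarrow> y < b \<Longrightarrow> integral {x..y} q = 0"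
  shows "\<exists>N. negligible N \<and> (\<forall>x\<in>{a<..<b} - N. q x = 0)"
proof -
  define h where "h = (\<lambda>x. if x \<in> {a..b} then q x else 0)"
  have "h integrable_on cbox c d" for c d
  proof -
    have "h integrable_on UNIV" unfolding h_def using q Henstock_Kurzweil_Integration.integrable_restrict_UNIV[of "{a..b}" q] by simp
    then show ?thesis by (rule integrable_on_subcbox) auto
  qed
  then obtain N where N: "negligible N"
    "\<And>x e. \<lbrakk>x \<notin> N; 0 < e\<rbrakk> \<Longrightarrow> \<exists>d>0. \<forall>k. 0 < k \<and> k < d \<longrightarrow>
       norm (integral (cbox x (x + k *\<^sub>R One)) h /\<^sub>R k ^ DIM(real) - h x) < e"
    using integrable_ccontinuous_explicit[of h] by metis
  have "q x = 0" if x: "x \<in> {a<..<b} - N" for x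
  proof (rule ccontr)
    assume "q x \<noteq> 0"
    then obtain d where d: "d > 0" "\<And>k. 0 < k \<Longrightarrow> k < d \<Longrightarrow>
       norm (integral (cbox x (x + k *\<^sub>R One)) h /\<^sub>R k ^ DIM(real) - h x) < \<bar>q x\<bar>"
      using N(2)[of x "\<bar>q x\<bar>"] x by auto
    define k where "k = min (d/2) ((b - x)/2)"
    have k: "0 < k" "k < d" "x + k < b" using d x by (auto simp: k_def min_def field_simps)
    have "integral {x..x+k} h = integral {x..x+k} q"
      by (rule Henstock_Kurzweil_Integration.integral_cong) (use x k in \<open>auto simp: h_def\<close>)
    also have "\<dots> = 0" using z[of x "x+k"] x k by auto
    finally show False using d(2)[OF k(1,2)] x by (simp add: h_def)
  qed
  then show ?thesis using N by blast
qed

text \<open>Rests on completeness of Lebesgue measure, applied to the extensions by zero to the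
  whole line.\<close>

lemma measurable_on_AE_cong:
  fixes f g :: "real \<Rightarrow> real"
  assumes S: "S \<in> sets lebesgue" and f: "f \<in> borel_measurable (lebesgue_on S)"
    and ae: "AE x in lebesgue_on S. f x = g x"
  shows "g \<in> borel_measurable (lebesgue_on S)"
proof -
  have "(\<lambda>x. if x \<in> S then f x else 0) \<in> borel_measurable lebesgue"
    using borel_measurable_if[OF S] f by blast
  moreover have "AE x in lebesgue. (if x \<in> S then f x else 0) = (if x \<in> S then g x else 0)"
    using ae S by (auto simp: AE_restrict_space_iff)
  ultimately have "(\<lambda>x. if x \<in> S then g x else 0) \<in> borel_measurable lebesgue"
    by (rule borel_measurable_AE)
  then show ?thesis using borel_measurable_if[OF S] by blast
qed

lemma integrable_on_AE_cong:
  fixes f g :: "real \<Rightarrow> real"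
  assumes S: "S \<in> sets lebesgue" and f: "integrable (lebesgue_on S) f"
    and ae: "AE x in lebesgue_on S. f x = g x"
  shows "integrable (lebesgue_on S) g"
  using integrable_cong_AE_imp[OF f measurable_on_AE_cong[OF S _ ae] ae] f by auto

lemma AE_lebesgue_on_subset:
  assumes "AE x in lebesgue_on S. P x" "T \<subseteq> S" "S \<in> sets lebesgue" "T \<in> sets lebesgue"
  shows "AE x in lebesgue_on T. P x"
  using assms by (auto simp: AE_restrict_space_iff elim!: eventually_mono)

lemma integral_lebesgue_on_supp:
  fixes h :: "real \<Rightarrow> real"
  assumes "T \<subseteq> S" "S \<in> sets lebesgue" "T \<in> sets lebesgue" "\<And>x. x \<in> S - T \<Longrightarrow> h x = 0"
  shows "(\<integral>x. h x \<partial>lebesgue_on S) = (\<integral>x. h x \<partial>lebesgue_on T)"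
proof -
  have "(\<integral>x. h x \<partial>lebesgue_on S) = (\<integral>x. (if x \<in> T then h x else 0) \<partial>lebesgue_on S)"
    by (rule Bochner_Integration.integral_cong) (use assms in auto)
  also have "\<dots> = (\<integral>x. h x \<partial>lebesgue_on T)"
    by (rule integral_restrict) (use assms in auto)
  finally show ?thesis .
qed

text \<open>The extreme points of \<open>insert x0 K\<close> have some room in the open set
  \<open>S\<close>; widening by that room stays in \<open>S\<close> by convexity. Including
  \<open>x0\<close> covers the case of empty \<open>K\<close>.\<close>

lemma compact_subset_interval:
  fixes S K :: "real set"
  assumes "open S" "is_interval S" "compact K" "K \<subseteq> S" "x0 \<in> S"
  obtains a b where "a < x0" "x0 < b" "{a..b} \<subseteq> S" "K \<subseteq> {a<..<b}"
proof -
  let ?K = "insert x0 K"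
  have K: "compact ?K" "?K \<noteq> {}" "?K \<subseteq> S" using assms by auto
  obtain m where m: "m \<in> ?K" "\<And>y. y \<in> ?K \<Longrightarrow> m \<le> y" using compact_attains_inf[OF K(1,2)] by blast
  obtain M where M: "M \<in> ?K" "\<And>y. y \<in> ?K \<Longrightarrow> y \<le> M" using compact_attains_sup[OF K(1,2)] by blast
  obtain e where e: "e > 0" "cball m e \<subseteq> S" using open_contains_cball[of S] assms m K(3) by blast
  obtain d where d: "d > 0" "cball M d \<subseteq> S" using open_contains_cball[of S] assms M K(3) by blast
  have mem: "m - e \<in> S" "M + d \<in> S" using e d by (auto simp: dist_real_def subset_iff)
  show ?thesis
  proof
    show "{m - e..M + d} \<subseteq> S" using mem assms(2) unfolding is_interval_1 by (meson atLeastAtMost_iff subsetI)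
    show "K \<subseteq> {m - e<..<M + d}" using m(2) M(2) e d by force
    show "m - e < x0" "x0 < M + d" using m(2)[of x0] M(2)[of x0] e d by auto
  qed
qed

section \<open>Absolutely continuous functions described by their integrable derivatives\<close>

text \<open>\<open>g\<close> is the derivative of \<open>F\<close> on \<open>S\<close> in the sense of absolutely continuous functions.\<close>

definition primitive_on :: "real set \<Rightarrow> (real \<Rightarrow> real) \<Rightarrow> (real \<Rightarrow> real) \<Rightarrow> bool" where
  "primitive_on S F g \<longleftrightarrow> (\<forall>x\<in>S. \<forall>y\<in>S. x \<le> y \<longrightarrow>
     integrable (lebesgue_on {x..y}) g \<and> F y - F x = integral {x..y} g)"

lemma primitive_on_subset: "primitive_on S F g \<Longrightarrow> T \<subseteq> S \<Longrightarrow> primitive_on T F g"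
  unfolding primitive_on_def by blast

lemma primitive_on_add:
  assumes "primitive_on S F g" "primitive_on S F' g'"
  shows "primitive_on S (\<lambda>x. F x + F' x) (\<lambda>x. g x + g' x)"
  unfolding primitive_on_def
proof (intro ballI impI conjI)
  fix x y assume xy: "x \<in> S" "y \<in> S" "x \<le> y"
  have i: "integrable (lebesgue_on {x..y}) g" "integrable (lebesgue_on {x..y}) g'"
    and e: "F y - F x = integral {x..y} g" "F' y - F' x = integral {x..y} g'"
    using assms xy unfolding primitive_on_def by auto
  show "integrable (lebesgue_on {x..y}) (\<lambda>x. g x + g' x)" using i by simp
  show "F y + F' y - (F x + F' x) = integral {x..y} (\<lambda>x. g x + g' x)"
    using e by (subst Henstock_Kurzweil_Integration.integral_add)
      (auto intro: integrable_on_lebesgue_on i)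
qed

lemma primitive_on_cmult:
  assumes "primitive_on S F g"
  shows "primitive_on S (\<lambda>x. c * F x) (\<lambda>x. c * g x)"
  unfolding primitive_on_def
proof (intro ballI impI conjI)
  fix x y assume xy: "x \<in> S" "y \<in> S" "x \<le> y"
  have i: "integrable (lebesgue_on {x..y}) g" and e: "F y - F x = integral {x..y} g"
    using assms xy unfolding primitive_on_def by auto
  show "integrable (lebesgue_on {x..y}) (\<lambda>x. c * g x)" using i by simp
  show "c * F y - c * F x = integral {x..y} (\<lambda>x. c * g x)"
    using e by (simp add: right_diff_distrib[symmetric])
qed

lemma primitive_on_cong:
  assumes "primitive_on S F g" "\<And>x. x \<in> S \<Longrightarrow> F x = F' x"
  shows "primitive_on S F' g"
  using assms unfolding primitive_on_def by simp

lemma primitive_on_cong_AE: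
  assumes p: "primitive_on S F g" and S: "is_interval S" "S \<in> sets lebesgue"
    and ae: "AE x in lebesgue_on S. g x = g' x"
  shows "primitive_on S F g'"
  unfolding primitive_on_def
proof (intro ballI impI)
  fix x y assume xy: "x \<in> S" "y \<in> S" "x \<le> y"
  have i: "integrable (lebesgue_on {x..y}) g" and e: "F y - F x = integral {x..y} g"
    using p xy unfolding primitive_on_def by auto
  have sub: "{x..y} \<subseteq> S" using xy S(1) unfolding is_interval_1 by (meson atLeastAtMost_iff subsetI)
  have ae': "AE x in lebesgue_on {x..y}. g x = g' x"
    by (rule AE_lebesgue_on_subset[OF ae sub S(2)]) auto
  have i': "integrable (lebesgue_on {x..y}) g'"
    by (rule integrable_on_AE_cong[OF _ i ae']) auto
  have "integral {x..y} g = integral {x..y} g'"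
    using integral_cong_AE[OF _ _ ae'] i i' lebesgue_integral_eq_integral[OF i] lebesgue_integral_eq_integral[OF i']
    by auto
  then show "integrable (lebesgue_on {x..y}) g' \<and> F y - F x = integral {x..y} g'"
    using e i' by simp
qed

lemma primitive_on_continuous_Icc:
  assumes "primitive_on {a..b} F g"
  shows "continuous_on {a..b} F"
proof (cases "a \<le> b")
  case True
  have i: "g integrable_on {a..b}"
    using assms True integrable_on_lebesgue_on[of "{a..b}" g] unfolding primitive_on_def by auto
  have "continuous_on {a..b} (\<lambda>x. F a + integral {a..x} g)"
    by (intro continuous_intros indefinite_integral_continuous_1 i)
  then show ?thesis
  proof (rule continuous_on_eq)
    fix x assume "x \<in> {a..b}"
    then have "F x - F a = integral {a..x} g" using assms True unfolding primitive_on_def by auto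
    then show "F a + integral {a..x} g = F x" by simp
  qed
qed simp

lemma primitive_on_continuous:
  assumes "primitive_on S F g" "open S" "is_interval S"
  shows "continuous_on S F"
proof (subst continuous_on_eq_continuous_at[OF assms(2)], intro ballI)
  fix x assume x: "x \<in> S"
  obtain a b where ab: "a < x" "x < b" "{a..b} \<subseteq> S"
    using compact_subset_interval[OF assms(2,3), of "{}" x] x by auto
  have "continuous_on {a<..<b} F"
    using primitive_on_continuous_Icc[OF primitive_on_subset[OF assms(1) ab(3)]]
    by (rule continuous_on_subset) auto
  then show "isCont F x" using ab by (simp add: continuous_on_eq_continuous_at)
qed

text \<open>The difference is the oriented integral from \<open>x0\<close> to \<open>x\<close>: an
  integral over a reversed interval is 0, so at most one of the two terms is nonzero.\<close>

lemma primitive_on_exists: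
  assumes i: "\<And>x y. x \<in> S \<Longrightarrow> y \<in> S \<Longrightarrow> integrable (lebesgue_on {x..y}) g"
    and x0: "x0 \<in> S"
  shows "primitive_on S (\<lambda>x. integral {x0..x} g - integral {x..x0} g) g"
  unfolding primitive_on_def
proof (intro ballI impI conjI)
  fix x y assume xy: "x \<in> S" "y \<in> S" "x \<le> y"
  show "integrable (lebesgue_on {x..y}) g" using i xy by auto
  have ii: "g integrable_on {u..v}" if "u \<in> S" "v \<in> S" for u v
    using integrable_on_lebesgue_on[OF i[OF that]] by auto
  have z: "integral {u..v} g = 0" if "v \<le> u" for u v
    using that by (cases "u = v") auto
  consider "x0 \<le> x" | "x < x0" "x0 \<le> y" | "y < x0" by linarith
  then show "integral {x0..y} g - integral {y..x0} g - (integral {x0..x} g - integral {x..x0} g)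
    = integral {x..y} g"
  proof cases
    case 1
    have "integral {x0..x} g + integral {x..y} g = integral {x0..y} g"
      by (rule Henstock_Kurzweil_Integration.integral_combine) (use 1 xy ii x0 in auto)
    moreover have "integral {y..x0} g = 0" "integral {x..x0} g = 0"
      by (intro z; use 1 xy in simp)+
    ultimately show ?thesis by simp
  next
    case 2
    have "integral {x..x0} g + integral {x0..y} g = integral {x..y} g"
      by (rule Henstock_Kurzweil_Integration.integral_combine) (use 2 xy ii x0 in auto)
    moreover have "integral {y..x0} g = 0" "integral {x0..x} g = 0"
      by (intro z; use 2 xy in simp)+
    ultimately show ?thesis by simp
  next
    case 3
    have "integral {x..y} g + integral {y..x0} g = integral {x..x0} g"
      by (rule Henstock_Kurzweil_Integration.integral_combine) (use 3 xy ii x0 in auto)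
    moreover have "integral {x0..y} g = 0" "integral {x0..x} g = 0"
      by (intro z; use 3 xy in simp)+
    ultimately show ?thesis by simp
  qed
qed

lemma primitive_on_by_parts:
  assumes "primitive_on {a..b} F f" "primitive_on {a..b} P p" "a \<le> b"
  shows "integrable (lebesgue_on {a..b}) (\<lambda>x. F x * p x)"
    and "integrable (lebesgue_on {a..b}) (\<lambda>x. f x * P x)"
    and "(\<integral>x. F x * p x \<partial>lebesgue_on {a..b}) + (\<integral>x. f x * P x \<partial>lebesgue_on {a..b})
      = F b * P b - F a * P a"
proof -
  have f: "integrable (lebesgue_on {a..b}) f" and p: "integrable (lebesgue_on {a..b}) p"
    using assms unfolding primitive_on_def by auto
  have F: "F x = F a + integral {a..x} f" if "x \<in> {a..b}" for x
  proof -
    have "F x - F a = integral {a..x} f" using assms that unfolding primitive_on_def by auto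
    then show ?thesis by simp
  qed
  have P: "P x = P a + integral {a..x} p" if "x \<in> {a..b}" for x
  proof -
    have "P x - P a = integral {a..x} p" using assms that unfolding primitive_on_def by auto
    then show ?thesis by simp
  qed
  note * = integration_by_parts_ac[OF assms(3) f p, of F P, OF F P]
  show "integrable (lebesgue_on {a..b}) (\<lambda>x. F x * p x)" using * by blast
  show "integrable (lebesgue_on {a..b}) (\<lambda>x. f x * P x)" using * by blast
  show "(\<integral>x. F x * p x \<partial>lebesgue_on {a..b}) + (\<integral>x. f x * P x \<partial>lebesgue_on {a..b})
      = F b * P b - F a * P a" using * by blast
qed

lemma primitive_on_C1:
  assumes "\<And>x. (\<phi> has_real_derivative D x) (at x)" "continuous_on UNIV D"
  shows "primitive_on S \<phi> D"
  unfolding primitive_on_def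
proof (intro ballI impI conjI)
  fix x y :: real assume "x \<le> y"
  show "integrable (lebesgue_on {x..y}) D"
    by (rule continuous_imp_integrable_real) (rule continuous_on_subset[OF assms(2)], simp)
  have "(D has_integral (\<phi> y - \<phi> x)) {x..y}"
    by (rule fundamental_theorem_of_calculus[OF \<open>x \<le> y\<close>])
      (metis assms(1) has_real_derivative_iff_has_vector_derivative has_vector_derivative_at_within)
  then show "\<phi> y - \<phi> x = integral {x..y} D" by (simp add: integral_unique)
qed

section \<open>Weak derivatives and absolute continuity\<close>

text \<open>Both integrals live on a closed interval in \<open>S\<close> around the support of the
  test function, where integration by parts has zero boundary terms. Asking for \<open>F = f\<close>
  only almost everywhere makes the rule applicable to functions picked by \<open>wd\<close>.\<close>

lemma weak_deriv_primitiveI: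
  assumes S: "open S" "is_interval S" and p: "primitive_on S F g"
    and ae: "AE x in lebesgue_on S. F x = f x"
  shows "weak_deriv S f g"
proof (cases "S = {}")
  case True
  then show ?thesis by (simp add: weak_deriv_def loc_integrable_def)
next
  case False
  then obtain x0 where x0: "x0 \<in> S" by auto
  have SS: "S \<in> sets lebesgue" using S by (simp add: borel_open)
  have locg: "loc_integrable S g"
    unfolding loc_integrable_def
  proof (intro allI impI)
    fix K :: "real set" assume K: "compact K \<and> K \<subseteq> S"
    obtain a b where ab: "a < x0" "x0 < b" "{a..b} \<subseteq> S" "K \<subseteq> {a<..<b}"
      using compact_subset_interval[OF S, of K x0] x0 K by metis
    then have "a \<in> S" "b \<in> S" "a \<le> b" by auto
    then have "integrable (lebesgue_on {a..b}) g" using p unfolding primitive_on_def by auto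
    then have "set_integrable lebesgue {a..b} g"
      by (simp add: integrable_restrict_space set_integrable_def)
    then have "set_integrable lebesgue K g"
      by (rule set_integrable_subset) (use ab K in \<open>auto simp: borel_compact\<close>)
    then show "integrable (lebesgue_on K) g"
      by (rule absolutely_integrable_imp_integrable) (use K in \<open>auto simp: borel_compact\<close>)
  qed
  have cF: "continuous_on S F" by (rule primitive_on_continuous[OF p S])
  have locf: "loc_integrable S f"
    unfolding loc_integrable_def
  proof (intro allI impI)
    fix K :: "real set" assume K: "compact K \<and> K \<subseteq> S"
    have KS: "K \<in> sets lebesgue" using K by (auto simp: borel_compact)
    obtain a b where ab: "a < x0" "x0 < b" "{a..b} \<subseteq> S" "K \<subseteq> {a<..<b}"
      using compact_subset_interval[OF S, of K x0] x0 K by metis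
    have "integrable (lebesgue_on {a..b}) F"
      by (rule continuous_imp_integrable_real) (rule continuous_on_subset[OF cF ab(3)])
    then have "set_integrable lebesgue {a..b} F"
      by (simp add: integrable_restrict_space set_integrable_def)
    then have "set_integrable lebesgue K F"
      by (rule set_integrable_subset) (use ab K in \<open>auto simp: borel_compact\<close>)
    then have "integrable (lebesgue_on K) F"
      by (rule absolutely_integrable_imp_integrable[OF _ KS])
    then show "integrable (lebesgue_on K) f"
      by (rule integrable_on_AE_cong[OF KS _ AE_lebesgue_on_subset[OF ae _ SS KS]]) (use K in auto)
  qed
  show ?thesis
    unfolding weak_deriv_def
  proof (intro conjI ballI locf locg)
    fix \<phi> assume "\<phi> \<in> test_functions S"
    then obtain K where \<phi>: "\<phi> C1_differentiable_on UNIV" "compact K" "K \<subseteq> S" "\<And>x. x \<notin> K \<Longrightarrow> \<phi> x = 0"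
      unfolding test_functions_def by auto
    obtain D where D: "\<And>x. (\<phi> has_real_derivative D x) (at x)" "continuous_on UNIV D"
      using \<phi>(1) unfolding C1_differentiable_on_def has_real_derivative_iff_has_vector_derivative by auto
    have dD: "deriv \<phi> = D" using D(1) by (auto intro: DERIV_imp_deriv)
    obtain a b where ab: "a < x0" "x0 < b" "{a..b} \<subseteq> S" "K \<subseteq> {a<..<b}"
      using compact_subset_interval[OF S \<phi>(2,3) x0] by metis
    have out: "x \<notin> K" if "x \<notin> {a<..<b}" for x using ab that by auto
    \<comment> \<open>The derivative inherits the support, since off the closed set \<open>K\<close>
      the test function is locally zero.\<close>
    have D0: "D x = 0" if "x \<notin> K" for x
    proof -
      have o: "open (- K)" using \<phi>(2) by (simp add: compact_imp_closed open_Compl)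
      have "((\<lambda>x. 0) has_real_derivative D x) (at x)"
        by (rule has_field_derivative_transform_within_open[OF D(1) o]) (use that \<phi>(4) in auto)
      then show ?thesis using DERIV_unique DERIV_const by blast
    qed
    have "(\<integral>x. f x * deriv \<phi> x \<partial>lebesgue_on S) = (\<integral>x. f x * D x \<partial>lebesgue_on {a..b})"
      unfolding dD by (rule integral_lebesgue_on_supp) (use ab SS D0 out in force)+
    also have "\<dots> = (\<integral>x. F x * D x \<partial>lebesgue_on {a..b})"
    proof (rule integral_cong_AE)
      have ae': "AE x in lebesgue_on {a..b}. F x = f x"
        by (rule AE_lebesgue_on_subset[OF ae ab(3) SS]) auto
      have F: "F \<in> borel_measurable (lebesgue_on {a..b})"
        by (rule borel_measurable_integrable, rule continuous_imp_integrable_real)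
          (rule continuous_on_subset[OF cF ab(3)])
      have Dm: "D \<in> borel_measurable (lebesgue_on {a..b})"
        by (rule borel_measurable_integrable, rule continuous_imp_integrable_real)
          (rule continuous_on_subset[OF D(2)], simp)
      show "(\<lambda>x. F x * D x) \<in> borel_measurable (lebesgue_on {a..b})" using F Dm by simp
      show "(\<lambda>x. f x * D x) \<in> borel_measurable (lebesgue_on {a..b})"
        using measurable_on_AE_cong[OF _ F ae'] Dm by simp
      show "AE x in lebesgue_on {a..b}. f x * D x = F x * D x" using ae' by auto
    qed
    also have "\<dots> = - (\<integral>x. g x * \<phi> x \<partial>lebesgue_on {a..b})"
    proof -
      have "\<phi> a = 0" "\<phi> b = 0" by (rule \<phi>(4), rule out, simp)+
      then show ?thesis
        using primitive_on_by_parts(3)[OF primitive_on_subset[OF p ab(3)] primitive_on_C1[OF D]] ab by auto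
    qed
    also have "(\<integral>x. g x * \<phi> x \<partial>lebesgue_on {a..b}) = (\<integral>x. g x * \<phi> x \<partial>lebesgue_on S)"
      by (rule integral_lebesgue_on_supp[symmetric]) (use ab SS \<phi>(4) out in force)+
    finally show "(\<integral>x. f x * deriv \<phi> x \<partial>lebesgue_on S) = - (\<integral>x. g x * \<phi> x \<partial>lebesgue_on S)" .
  qed
qed

lemma primitive_on_has_derivative:
  assumes p: "primitive_on S F g" and S: "open S" "is_interval S" "x \<in> S" and c: "isCont g x"
  shows "(F has_real_derivative g x) (at x)"
proof -
  obtain a b where ab: "a < x" "x < b" "{a..b} \<subseteq> S"
    using compact_subset_interval[OF S(1,2), of "{}" x] S(3) by auto
  have mem: "a \<in> S" "b \<in> S" "a \<le> b" using ab by auto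
  have i: "g integrable_on {a..b}"
    using p mem integrable_on_lebesgue_on[of "{a..b}" g] unfolding primitive_on_def by auto
  have "((\<lambda>u. integral {a..u} g) has_vector_derivative g x) (at x within ({a..b} - {}))"
    by (rule integral_has_vector_derivative_continuous_at[OF i])
      (use ab c in \<open>auto intro: continuous_at_imp_continuous_within\<close>)
  then have "((\<lambda>u. F a + integral {a..u} g) has_vector_derivative g x) (at x within {a..b})"
    by (auto intro!: derivative_eq_intros)
  then have "((\<lambda>u. F a + integral {a..u} g) has_real_derivative g x) (at x)"
    using ab by (simp add: has_real_derivative_iff_has_vector_derivative at_within_Icc_at)
  then show ?thesis
  proof (rule has_field_derivative_transform_within_open[where S="{a<..<b}"])
    fix u assume u: "u \<in> {a<..<b}"
    then have "u \<in> S" using ab by auto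
    then have "F u - F a = integral {a..u} g" using p mem(1) u unfolding primitive_on_def by auto
    then show "F a + integral {a..u} g = F u" by simp
  qed (use ab in auto)
qed

lemma negligible_imp_AE_lebesgue_on:
  assumes "negligible {x \<in> S. \<not> P x}" "S \<in> sets lebesgue"
  shows "AE x in lebesgue_on S. P x"
proof -
  have "AE x in lebesgue. x \<notin> {x \<in> S. \<not> P x}"
    using assms(1) by (intro AE_not_in) (simp add: negligible_iff_null_sets)
  then show ?thesis using assms(2) by (auto simp: AE_restrict_space_iff elim!: eventually_mono)
qed

text \<open>Negligibility is a local property, so the result on closed intervals around each point
  of \<open>S\<close> suffices.\<close>

lemma AE_eq_0_on_interval:
  fixes q :: "real \<Rightarrow> real"
  assumes S: "open S" "is_interval S"
    and q: "\<And>x y. x \<in> S \<Longrightarrow> y \<in> S \<Longrightarrow> q integrable_on {x..y}"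
    and z: "\<And>x y. x \<in> S \<Longrightarrow> y \<in> S \<Longrightarrow> x \<le> y \<Longrightarrow> integral {x..y} q = 0"
  shows "AE x in lebesgue_on S. q x = 0"
proof (rule negligible_imp_AE_lebesgue_on)
  show "negligible {x \<in> S. \<not> q x = 0}"
    unfolding locally_negligible_alt[of "{x \<in> S. \<not> q x = 0}"]
  proof
    fix x assume x: "x \<in> {x \<in> S. \<not> q x = 0}"
    obtain a b where ab: "a < x" "x < b" "{a..b} \<subseteq> S"
      using compact_subset_interval[OF S, of "{}" x] x by auto
    then have mem: "\<And>u. a \<le> u \<Longrightarrow> u \<le> b \<Longrightarrow> u \<in> S" by auto
    obtain N where N: "negligible N" "\<And>x. x \<in> {a<..<b} - N \<Longrightarrow> q x = 0"
      using AE_eq_0_if_interval_integrals_0[of q a b] q z mem ab by fastforce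
    let ?U = "{x \<in> S. \<not> q x = 0} \<inter> {a<..<b}"
    have "openin (top_of_set {x \<in> S. \<not> q x = 0}) ?U" by (rule openin_open_Int) auto
    moreover have "negligible ?U" by (rule negligible_subset[OF N(1)]) (use N(2) in blast)
    ultimately show "\<exists>U. openin (top_of_set {x \<in> S. \<not> q x = 0}) U \<and> x \<in> U \<and> negligible U"
      using x ab by (intro exI[of _ ?U]) auto
  qed
qed (use S in \<open>simp add: borel_open\<close>)

text \<open>The set where two continuous functions differ is open, and a nonempty open set is not
  negligible.\<close>

lemma AE_eq_continuous_imp_eq:
  fixes F G :: "real \<Rightarrow> real"
  assumes S: "open S" and c: "continuous_on S F" "continuous_on S G"
    and ae: "AE x in lebesgue_on S. F x = G x" and x: "x \<in> S"
  shows "F x = G x"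
proof (rule ccontr)
  assume ne: "F x \<noteq> G x"
  let ?U = "{x \<in> S. F x - G x \<in> - {0}}"
  have "open ?U"
    by (rule continuous_open_preimage[OF _ S, of "\<lambda>x. F x - G x" "-{0}", unfolded vimage_def Int_def mem_Collect_eq])
      (auto intro!: continuous_intros c)
  moreover have "negligible ?U"
  proof -
    have "AE x in lebesgue. x \<notin> ?U"
      using ae S by (auto simp: AE_restrict_space_iff borel_open elim!: eventually_mono)
    then show ?thesis
      using AE_iff_null_sets[of ?U lebesgue] \<open>open ?U\<close> by (simp add: negligible_iff_null_sets borel_open)
  qed
  ultimately have "?U = {}" using open_not_negligible by blast
  then show False using x ne by auto
qed

lemma integrable_mult_bounded:
  fixes f w :: "'a \<Rightarrow> real"
  assumes "integrable M f" "w \<in> borel_measurable M" "\<And>x. x \<in> space M \<Longrightarrow> \<bar>w x\<bar> \<le> B"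
  shows "integrable M (\<lambda>x. f x * w x)"
proof (rule Bochner_Integration.integrable_bound)
  show "integrable M (\<lambda>x. B * f x)" using assms(1) by simp
  show "AE x in M. norm (f x * w x) \<le> norm (B * f x)"
  proof (rule AE_I2)
    fix x assume "x \<in> space M"
    then have "\<bar>w x\<bar> \<le> \<bar>B\<bar>" using assms(3) by fastforce
    then show "norm (f x * w x) \<le> norm (B * f x)"
      by (simp add: abs_mult mult.commute[of "\<bar>f x\<bar>"] mult_right_mono)
  qed
qed (use assms in auto)

lemma integrable_mult_continuous:
  fixes f w :: "real \<Rightarrow> real"
  assumes f: "integrable (lebesgue_on {a..b}) f" and w: "continuous_on {a..b} w"
  shows "integrable (lebesgue_on {a..b}) (\<lambda>x. f x * w x)"
proof -
  have "bounded (w ` {a..b})" by (intro compact_imp_bounded compact_continuous_image w) auto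
  then obtain B where "\<And>x. x \<in> {a..b} \<Longrightarrow> \<bar>w x\<bar> \<le> B"
    unfolding bounded_iff by (metis imageI real_norm_def)
  then show ?thesis
    by (intro integrable_mult_bounded[OF f, of w B])
      (auto intro: borel_measurable_integrable continuous_imp_integrable_real w)
qed

text \<open>A continuous approximation of the indicator of \<open>{x..y}\<close>: it falls from 1 to
  0 with slope \<open>N\<close> on both sides, so it vanishes at distance \<open>1/N\<close>. For
  \<open>x = y\<close> it is a hat function.\<close>

definition trapezoid :: "real \<Rightarrow> real \<Rightarrow> real \<Rightarrow> real \<Rightarrow> real" where
  "trapezoid N x y t = max 0 (1 - N * (max 0 (x - t) + max 0 (t - y)))"

lemma trapezoid_continuous: "continuous_on A (trapezoid N x y)"
  unfolding trapezoid_def by (intro continuous_intros)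

lemma trapezoid_bounds: "N \<ge> 0 \<Longrightarrow> 0 \<le> trapezoid N x y t" "N \<ge> 0 \<Longrightarrow> trapezoid N x y t \<le> 1"
  unfolding trapezoid_def by (auto simp: mult_nonneg_nonneg)

lemma trapezoid_eq_1: "t \<in> {x..y} \<Longrightarrow> trapezoid N x y t = 1"
  unfolding trapezoid_def by (auto simp: max_def)

lemma trapezoid_eq_0:
  assumes "N > 0" "N * d \<ge> 1" "x \<le> y" "t \<le> x - d \<or> y + d \<le> t"
  shows "trapezoid N x y t = 0"
proof -
  have "0 < N * d" using assms(2) by linarith
  then have "d > 0" using assms(1) by (rule zero_less_mult_pos)
  then have "d \<le> max 0 (x - t) + max 0 (t - y)" using assms(3,4) by auto
  then have "N * d \<le> N * (max 0 (x - t) + max 0 (t - y))" using assms(1) by (intro mult_left_mono) auto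
  then show ?thesis unfolding trapezoid_def using assms(2) by (simp add: max_def)
qed

lemma trapezoid_limit:
  assumes "x \<le> y" and N: "filterlim N at_top sequentially"
  shows "(\<lambda>n. trapezoid (N n) x y t) \<longlonglongrightarrow> (if t \<in> {x..y} then 1 else 0)"
proof (cases "t \<in> {x..y}")
  case True
  then show ?thesis by (simp add: trapezoid_eq_1)
next
  case False
  define d where "d = max (x - t) (t - y)"
  have d: "d > 0" using False by (auto simp: d_def)
  have "eventually (\<lambda>n. N n \<ge> max 1 (1/d)) sequentially" 
    using N unfolding filterlim_at_top by blast
  then have "eventually (\<lambda>n. trapezoid (N n) x y t = 0) sequentially"
  proof eventually_elim
    case (elim n)
    have "1/d \<le> N n" "1 \<le> N n" using elim by auto
    then have "N n * d \<ge> 1" using d by (simp add: field_simps)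
    then show ?case
      by (intro trapezoid_eq_0[of _ d]) (use \<open>1 \<le> N n\<close> assms(1) in \<open>auto simp: d_def max_def\<close>)
  qed
  then show ?thesis using False by (auto intro: tendsto_eventually)
qed

text \<open>The du Bois-Reymond lemma. Let \<open>q\<close> be \<open>f\<close> minus a primitive
  \<open>G\<close> of \<open>g\<close>. A compactly supported continuous \<open>w\<close> of mean
  zero is the derivative of a test function, so \<open>q\<close> integrates to 0 against it
  (\<open>key\<close>). For general \<open>w\<close> the result is then \<open>k\<close> times the
  integral of \<open>w\<close>, and letting \<open>w\<close> tend to the indicator of
  \<open>{x..y}\<close> gives \<open>k * (y - x)\<close>. Hence \<open>q = k\<close> almost
  everywhere.\<close>

lemma weak_deriv_primitiveD:
  assumes S: "open S" "is_interval S" and wk: "weak_deriv S f g"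
  shows "\<exists>F. primitive_on S F g \<and> (AE x in lebesgue_on S. F x = f x)"
proof (cases "S = {}")
  case True
  then show ?thesis by (auto simp: primitive_on_def AE_restrict_space_iff)
next
  case False
  then obtain x0 where x0: "x0 \<in> S" by auto
  have SS: "S \<in> sets lebesgue" using S by (simp add: borel_open)
  have Icc: "{x..y} \<subseteq> S" if "x \<in> S" "y \<in> S" for x y
    using that S(2) unfolding is_interval_1 by (meson atLeastAtMost_iff subsetI)
  have gi: "integrable (lebesgue_on {x..y}) g" if "x \<in> S" "y \<in> S" for x y
    using wk Icc[OF that] compact_Icc unfolding weak_deriv_def loc_integrable_def by blast
  have fi: "integrable (lebesgue_on {x..y}) f" if "x \<in> S" "y \<in> S" for x y
    using wk Icc[OF that] compact_Icc unfolding weak_deriv_def loc_integrable_def by blast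
  define G where "G = (\<lambda>x. integral {x0..x} g - integral {x..x0} g)"
  have G: "primitive_on S G g" unfolding G_def by (rule primitive_on_exists[OF gi x0])
  have cG: "continuous_on S G" by (rule primitive_on_continuous[OF G S])
  define q where "q = (\<lambda>x. f x - G x)"
  have qi: "integrable (lebesgue_on {x..y}) q" if "x \<in> S" "y \<in> S" for x y
    unfolding q_def using fi[OF that] continuous_imp_integrable_real[OF continuous_on_subset[OF cG Icc[OF that]]]
    by simp
  have key: "(\<integral>x. q x * w x \<partial>lebesgue_on {a..b}) = 0"
    if ab: "{a..b} \<subseteq> S" "a < b" and w: "continuous_on UNIV w" "\<And>x. x \<notin> {a<..<b} \<Longrightarrow> w x = 0"
      "(\<integral>x. w x \<partial>lebesgue_on {a..b}) = 0" for a b w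
  proof -
    have abS: "a \<in> S" "b \<in> S" using ab by auto
    \<comment> \<open>The antiderivative of \<open>w\<close> from \<open>a\<close>; mean zero makes
      it vanish beyond \<open>b\<close> as well, so it is an admissible test function.\<close>
    define \<phi> where "\<phi> = (\<lambda>x. integral {a..x} w - integral {x..a} w)"
    have wi: "integrable (lebesgue_on {x..y}) w" for x y
      by (rule continuous_imp_integrable_real) (rule continuous_on_subset[OF w(1)], simp)
    have p: "primitive_on UNIV \<phi> w" unfolding \<phi>_def by (rule primitive_on_exists[OF wi]) simp
    have wc: "isCont w x" for x using w(1) by (simp add: continuous_on_eq_continuous_at)
    have d: "(\<phi> has_real_derivative w x) (at x)" for x
      by (rule primitive_on_has_derivative[OF p]) (auto simp: wc is_interval_univ)
    have \<phi>a: "\<phi> a = 0" by (simp add: \<phi>_def)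
    have \<phi>b: "\<phi> b = 0"
      using w(3) lebesgue_integral_eq_integral[OF wi[of a b]] ab(2) by (simp add: \<phi>_def)
    have \<phi>0: "\<phi> x = 0" if "x \<notin> {a..b}" for x
    proof (cases "x < a")
      case True
      have "\<phi> a - \<phi> x = integral {x..a} w" using p True unfolding primitive_on_def by auto
      also have "\<dots> = integral {x..a} (\<lambda>x. 0)"
        by (rule Henstock_Kurzweil_Integration.integral_cong) (use w(2) in auto)
      finally show ?thesis using \<phi>a by simp
    next
      case False
      then have "b < x" using that by auto
      then have "\<phi> x - \<phi> b = integral {b..x} w" using p unfolding primitive_on_def by auto
      also have "\<dots> = integral {b..x} (\<lambda>x. 0)"
        by (rule Henstock_Kurzweil_Integration.integral_cong) (use w(2) in auto)
      finally show ?thesis using \<phi>b by simp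
    qed
    have "\<phi> \<in> test_functions S"
      unfolding test_functions_def C1_differentiable_on_def mem_Collect_eq
    proof (intro conjI exI)
      show "\<forall>x\<in>UNIV. (\<phi> has_vector_derivative w x) (at x)"
        using d by (simp add: has_real_derivative_iff_has_vector_derivative)
      show "\<forall>x. x \<notin> {a..b} \<longrightarrow> \<phi> x = 0" using \<phi>0 by blast
    qed (use w(1) ab in auto)
    moreover have "deriv \<phi> = w" using d by (auto intro: DERIV_imp_deriv)
    ultimately have "(\<integral>x. f x * w x \<partial>lebesgue_on S) = - (\<integral>x. g x * \<phi> x \<partial>lebesgue_on S)"
      using wk unfolding weak_deriv_def by auto
    moreover have "(\<integral>x. f x * w x \<partial>lebesgue_on S) = (\<integral>x. f x * w x \<partial>lebesgue_on {a..b})"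
      by (rule integral_lebesgue_on_supp) (use ab SS w(2) in auto)
    moreover have "(\<integral>x. g x * \<phi> x \<partial>lebesgue_on S) = (\<integral>x. g x * \<phi> x \<partial>lebesgue_on {a..b})"
      by (rule integral_lebesgue_on_supp) (use ab SS \<phi>0 in auto)
    moreover have "(\<integral>x. G x * w x \<partial>lebesgue_on {a..b}) + (\<integral>x. g x * \<phi> x \<partial>lebesgue_on {a..b}) = 0"
      using primitive_on_by_parts(3)[OF primitive_on_subset[OF G ab(1)] primitive_on_subset[OF p]] ab(2)
      by (simp add: \<phi>a \<phi>b)
    ultimately have "(\<integral>x. f x * w x \<partial>lebesgue_on {a..b}) - (\<integral>x. G x * w x \<partial>lebesgue_on {a..b}) = 0"
      by linarith
    moreover have "integrable (lebesgue_on {a..b}) (\<lambda>x. f x * w x)"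
      by (rule integrable_mult_continuous[OF fi[OF abS]]) (rule continuous_on_subset[OF w(1)], simp)
    moreover have "integrable (lebesgue_on {a..b}) (\<lambda>x. G x * w x)"
      by (rule integrable_mult_continuous)
        (auto intro!: continuous_imp_integrable_real continuous_on_subset[OF cG] continuous_on_subset[OF w(1)] ab)
    ultimately show ?thesis by (simp add: q_def left_diff_distrib)
  qed
  obtain e where e: "e > 0" "cball x0 e \<subseteq> S" using open_contains_cball[of S] S x0 by blast
  \<comment> \<open>A fixed bump around \<open>x0\<close>, whose multiples correct any
    \<open>w\<close> to mean zero; \<open>k\<close> is the mean of \<open>q\<close> weighted by
    it.\<close>
  define \<psi> where "\<psi> = trapezoid (1/e) x0 x0"
  have \<psi>0: "\<psi> t = 0" if "t \<notin> {x0 - e<..<x0 + e}" for t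
    unfolding \<psi>_def by (rule trapezoid_eq_0[of _ e]) (use e that in auto)
  define k where "k = (\<integral>x. q x * \<psi> x \<partial>lebesgue_on S) / (\<integral>x. \<psi> x \<partial>lebesgue_on S)"
  have lin: "integral {x..y} q = k * (y - x)" if xy: "x \<in> S" "y \<in> S" "x \<le> y" for x y
  proof -
    have e2: "x0 - e \<in> S" "x0 + e \<in> S" using e by (auto simp: dist_real_def subset_iff)
    have "min x (x0 - e) \<in> S" "max y (x0 + e) \<in> S" using xy e2 by (auto simp: min_def max_def)
    then obtain a b where ab: "a < x0" "x0 < b" "{a..b} \<subseteq> S" "{min x (x0 - e)..max y (x0 + e)} \<subseteq> {a<..<b}"
      using compact_subset_interval[OF S compact_Icc Icc x0] by metis
    have lim: "a < x" "y < b" "a < x0 - e" "x0 + e < b"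
      using ab(4) xy e(1) by (auto simp: subset_iff min_def max_def split: if_splits)
    \<comment> \<open>The room between \<open>{x..y}\<close> and the ends of \<open>{a..b}\<close>.
      Slopes of at least \<open>1/d\<close> confine the supports of all trapezoids to this
      interval.\<close>
    define d where "d = min (x - a) (b - y)"
    have d: "d > 0" using lim by (auto simp: d_def)
    define N where "N = (\<lambda>n. real n + 1/d)"
    have N: "N n > 0" "N n * d \<ge> 1" for n
      using d by (auto simp: N_def algebra_simps add_nonneg_pos)
    have Ninf: "filterlim N at_top sequentially"
      unfolding N_def by (rule filterlim_tendsto_add_at_top[of "\<lambda>_. 1/d", THEN filterlim_cong[THEN iffD1, rotated -1]])
        (auto simp: add.commute intro: filterlim_real_sequentially)
    define w where "w = (\<lambda>n. trapezoid (N n) x y)"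
    have w0: "w n t = 0" if "t \<notin> {a<..<b}" for n t
      unfolding w_def by (rule trapezoid_eq_0[OF N]) (use that xy in \<open>auto simp: d_def min_def\<close>)
    let ?M = "lebesgue_on {a..b}"
    have abS: "a \<in> S" "b \<in> S" using ab by auto
    have qM: "integrable ?M q" by (rule qi[OF abS])
    have wM: "integrable ?M (w n)" for n
      unfolding w_def by (rule continuous_imp_integrable_real) (rule trapezoid_continuous)
    have \<psi>M: "integrable ?M \<psi>"
      unfolding \<psi>_def by (rule continuous_imp_integrable_real) (rule trapezoid_continuous)
    have qw: "integrable ?M (\<lambda>x. q x * w n x)" for n
      unfolding w_def by (rule integrable_mult_continuous[OF qM]) (rule trapezoid_continuous)
    have q\<psi>: "integrable ?M (\<lambda>x. q x * \<psi> x)"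
      unfolding \<psi>_def by (rule integrable_mult_continuous[OF qM]) (rule trapezoid_continuous)
    have pos: "(\<integral>x. \<psi> x \<partial>?M) \<noteq> 0"
    proof
      assume "(\<integral>x. \<psi> x \<partial>?M) = 0"
      then have "(\<psi> has_integral 0) (cbox a b)"
        using has_integral_integral_lebesgue_on[OF \<psi>M] by simp
      then have "\<psi> x0 = 0"
        by (rule has_integral_0_cbox_imp_0[rotated 2])
          (use ab e in \<open>auto simp: \<psi>_def intro: trapezoid_continuous trapezoid_bounds\<close>)
      then show False by (simp add: \<psi>_def trapezoid_eq_1)
    qed
    have eq: "(\<integral>x. q x * w n x \<partial>?M) = (\<integral>x. w n x \<partial>?M) / (\<integral>x. \<psi> x \<partial>?M) * (\<integral>x. q x * \<psi> x \<partial>?M)" for n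
    proof -
      \<comment> \<open>Chosen so that \<open>w n - c * \<psi>\<close> has mean zero and
        \<open>key\<close> applies.\<close>
      define c where "c = (\<integral>x. w n x \<partial>?M) / (\<integral>x. \<psi> x \<partial>?M)"
      have "(\<integral>x. q x * (w n x - c * \<psi> x) \<partial>?M) = 0"
      proof (rule key[OF ab(3)])
        show "continuous_on UNIV (\<lambda>x. w n x - c * \<psi> x)"
          unfolding w_def \<psi>_def by (intro continuous_intros trapezoid_continuous)
        show "w n t - c * \<psi> t = 0" if "t \<notin> {a<..<b}" for t
          using w0[OF that] \<psi>0[of t] that lim by auto
        show "(\<integral>x. w n x - c * \<psi> x \<partial>?M) = 0"
          using wM \<psi>M pos by (simp add: c_def)
      qed (use ab in auto)
      moreover have "(\<lambda>x. q x * (w n x - c * \<psi> x)) = (\<lambda>x. q x * w n x - c * (q x * \<psi> x))"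
        by (auto simp: algebra_simps)
      ultimately have "(\<integral>x. q x * w n x \<partial>?M) - c * (\<integral>x. q x * \<psi> x \<partial>?M) = 0"
        using qw q\<psi> by simp
      then show ?thesis by (simp add: c_def)
    qed
    have meas: "(\<lambda>t. (if t \<in> {x..y} then 1 else 0) :: real) \<in> borel_measurable ?M"
      using measurable_ident_lebesgue_on by measurable
    have L1: "(\<lambda>n. \<integral>t. q t * w n t \<partial>?M) \<longlonglongrightarrow> (\<integral>t. q t * (if t \<in> {x..y} then 1 else 0) \<partial>?M)"
    proof (rule integral_dominated_convergence[where w="\<lambda>t. \<bar>q t\<bar>"])
      show "AE t in ?M. (\<lambda>n. q t * w n t) \<longlonglongrightarrow> q t * (if t \<in> {x..y} then 1 else 0)"
        unfolding w_def using trapezoid_limit[OF xy(3) Ninf] by (intro AE_I2 tendsto_intros)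
      show "AE t in ?M. norm (q t * w n t) \<le> \<bar>q t\<bar>" for n
        using trapezoid_bounds[of "N n" x y] N(1)[of n]
        by (intro AE_I2) (auto simp: w_def abs_mult intro!: mult_left_le)
      show "(\<lambda>t. q t * (if t \<in> {x..y} then 1 else 0)) \<in> borel_measurable ?M"
        using qM meas by (intro borel_measurable_times) auto
    qed (use qM qw in auto)
    have L2: "(\<lambda>n. \<integral>t. w n t \<partial>?M) \<longlonglongrightarrow> (\<integral>t. (if t \<in> {x..y} then 1 else 0) \<partial>?M)"
    proof (rule integral_dominated_convergence[where w="\<lambda>t. 1"])
      show "AE t in ?M. (\<lambda>n. w n t) \<longlonglongrightarrow> (if t \<in> {x..y} then 1 else 0)"
        unfolding w_def using trapezoid_limit[OF xy(3) Ninf] by (intro AE_I2 tendsto_intros)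
      show "AE t in ?M. norm (w n t) \<le> 1" for n
        using trapezoid_bounds[of "N n" x y] N(1)[of n] by (intro AE_I2) (auto simp: w_def)
    qed (use wM meas in auto)
    have R1: "(\<integral>t. q t * (if t \<in> {x..y} then 1 else 0) \<partial>?M) = integral {x..y} q"
    proof -
      have "(\<integral>t. q t * (if t \<in> {x..y} then 1 else 0) \<partial>?M) = (\<integral>t. (if t \<in> {x..y} then q t else 0) \<partial>?M)"
        by (rule Bochner_Integration.integral_cong) auto
      also have "\<dots> = (\<integral>t. q t \<partial>lebesgue_on {x..y})"
        by (rule integral_restrict) (use lim in auto)
      finally show ?thesis using lebesgue_integral_eq_integral[OF qi[OF xy(1,2)]] by simp
    qed
    have R2: "(\<integral>t. (if t \<in> {x..y} then 1 else 0) \<partial>?M) = y - x"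
    proof -
      have "(\<integral>t. (if t \<in> {x..y} then 1 else 0 :: real) \<partial>?M) = (\<integral>t. 1 \<partial>lebesgue_on {x..y})"
        by (rule integral_restrict) (use lim in auto)
      then show ?thesis
        using xy(3) lebesgue_integral_eq_integral[OF Lebesgue_Measure.integrable_const_ivl[where c="1::real" and a=x and b=y]] by simp
    qed
    have "integral {x..y} q = (y - x) / (\<integral>x. \<psi> x \<partial>?M) * (\<integral>x. q x * \<psi> x \<partial>?M)"
      using LIMSEQ_unique[OF L1[unfolded R1 eq]
          tendsto_mult[OF tendsto_divide[OF L2[unfolded R2] tendsto_const pos] tendsto_const]] .
    moreover have "(\<integral>x. \<psi> x \<partial>lebesgue_on S) = (\<integral>x. \<psi> x \<partial>?M)"
      by (rule integral_lebesgue_on_supp) (use ab SS \<psi>0 lim in auto)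
    moreover have "(\<integral>x. q x * \<psi> x \<partial>lebesgue_on S) = (\<integral>x. q x * \<psi> x \<partial>?M)"
      by (rule integral_lebesgue_on_supp) (use ab SS \<psi>0 lim in auto)
    ultimately show ?thesis by (simp add: k_def)
  qed
  have "AE x in lebesgue_on S. q x - k = 0"
  proof (rule AE_eq_0_on_interval[OF S])
    fix x y assume xy: "x \<in> S" "y \<in> S"
    have i: "q integrable_on {x..y}" using integrable_on_lebesgue_on[OF qi[OF xy]] by simp
    then show "(\<lambda>x. q x - k) integrable_on {x..y}" by (intro integrable_diff) auto
    assume "x \<le> y"
    then show "integral {x..y} (\<lambda>x. q x - k) = 0"
      using i lin[OF xy] by (subst Henstock_Kurzweil_Integration.integral_diff) auto
  qed
  then have "AE x in lebesgue_on S. G x + k = f x" by (rule AE_mp) (auto simp: q_def)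
  moreover have "primitive_on S (\<lambda>x. G x + k) g" using G unfolding primitive_on_def by simp
  ultimately show ?thesis by blast
qed

lemma primitive_onD:
  assumes "primitive_on S F g" "x \<in> S" "y \<in> S" "x \<le> y"
  shows "integrable (lebesgue_on {x..y}) g" "F y - F x = integral {x..y} g" "g integrable_on {x..y}"
proof -
  show i: "integrable (lebesgue_on {x..y}) g" and "F y - F x = integral {x..y} g"
    using assms unfolding primitive_on_def by blast+
  show "g integrable_on {x..y}" by (rule integrable_on_lebesgue_on[OF i]) simp
qed

lemma primitive_on_add_const: "primitive_on S F g \<Longrightarrow> primitive_on S (\<lambda>x. F x + c) g"
  by (simp add: primitive_on_def)

lemma primitive_on_eq_diff:
  assumes "primitive_on S F g" "primitive_on S G g" "x \<in> S" "y \<in> S"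
  shows "F x - G x = F y - G y"
proof (cases "x \<le> y")
  case True
  have "F y - F x = G y - G x"
    using primitive_onD(2)[OF assms(1,3,4) True] primitive_onD(2)[OF assms(2,3,4) True] by linarith
  then show ?thesis by linarith
next
  case False
  then have le: "y \<le> x" by simp
  have "F x - F y = G x - G y"
    using primitive_onD(2)[OF assms(1,4,3) le] primitive_onD(2)[OF assms(2,4,3) le] by linarith
  then show ?thesis by linarith
qed

section \<open>The spaces $L^2$, $H^1$ and $H^2$\<close>

lemma L2D: "f \<in> L2 S \<Longrightarrow> f \<in> borel_measurable (lebesgue_on S)"
  "f \<in> L2 S \<Longrightarrow> integrable (lebesgue_on S) (\<lambda>x. (f x)\<^sup>2)"
  by (auto simp: L2_def)

lemma L2_mult_integrable:
  assumes "f \<in> L2 S" "g \<in> L2 S"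
  shows "integrable (lebesgue_on S) (\<lambda>x. f x * g x)"
proof (rule Bochner_Integration.integrable_bound)
  show "integrable (lebesgue_on S) (\<lambda>x. (f x)\<^sup>2 + (g x)\<^sup>2)"
    using L2D(2)[OF assms(1)] L2D(2)[OF assms(2)] by simp
  have "\<bar>f x * g x\<bar> \<le> (f x)\<^sup>2 + (g x)\<^sup>2" for x
  proof -
    have "2 * \<bar>f x * g x\<bar> \<le> (f x)\<^sup>2 + (g x)\<^sup>2"
      using sum_squares_bound[of "\<bar>f x\<bar>" "\<bar>g x\<bar>"] by (simp add: abs_mult)
    then show ?thesis using abs_ge_zero[of "f x * g x"] by linarith
  qed
  then show "AE x in lebesgue_on S. norm (f x * g x) \<le> norm ((f x)\<^sup>2 + (g x)\<^sup>2)"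
    by (intro AE_I2) simp
qed (use L2D(1)[OF assms(1)] L2D(1)[OF assms(2)] in simp)

lemma L2_add:
  assumes f: "f \<in> L2 S" and g: "g \<in> L2 S"
  shows "(\<lambda>x. f x + g x) \<in> L2 S"
proof -
  have "(\<lambda>x. (f x + g x)\<^sup>2) = (\<lambda>x. (f x)\<^sup>2 + (g x)\<^sup>2 + 2 * (f x * g x))"
    by (auto simp: power2_sum)
  moreover have "integrable (lebesgue_on S) (\<lambda>x. (f x)\<^sup>2 + (g x)\<^sup>2 + 2 * (f x * g x))"
    by (intro Bochner_Integration.integrable_add integrable_mult_right L2_mult_integrable L2D(2) f g)
  moreover have "(\<lambda>x. f x + g x) \<in> borel_measurable (lebesgue_on S)"
    by (intro borel_measurable_add L2D(1) f g)
  ultimately show ?thesis by (simp add: L2_def)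
qed

lemma L2_cmult: "f \<in> L2 S \<Longrightarrow> (\<lambda>x. c * f x) \<in> L2 S"
  by (auto simp: L2_def power_mult_distrib)

lemma L2_diff: "f \<in> L2 S \<Longrightarrow> g \<in> L2 S \<Longrightarrow> (\<lambda>x. f x - g x) \<in> L2 S"
  using L2_add[of f S "\<lambda>x. (-1) * g x"] L2_cmult[of g S "-1"] by simp

lemma L2_norm_nonneg: "0 \<le> L2_norm S f"
  by (simp add: L2_norm_def)

lemma L2_norm_sq: "(L2_norm S f)\<^sup>2 = (\<integral>x. (f x)\<^sup>2 \<partial>lebesgue_on S)"
  by (simp add: L2_norm_def)

text \<open>The squared norm of \<open>f + t * g\<close> is a nonnegative quadratic in
  \<open>t\<close>; evaluating it at its minimum \<open>-B/C\<close> gives the inequality.\<close>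

lemma L2_Cauchy_Schwarz:
  assumes f: "f \<in> L2 S" and g: "g \<in> L2 S"
  shows "\<bar>\<integral>x. f x * g x \<partial>lebesgue_on S\<bar> \<le> L2_norm S f * L2_norm S g"
proof -
  let ?M = "lebesgue_on S"
  define A B C where "A = (\<integral>x. (f x)\<^sup>2 \<partial>?M)" and "B = (\<integral>x. f x * g x \<partial>?M)" and "C = (\<integral>x. (g x)\<^sup>2 \<partial>?M)"
  have fg: "integrable ?M (\<lambda>x. f x * g x)" by (rule L2_mult_integrable[OF f g])
  have q: "0 \<le> A + 2 * t * B + t\<^sup>2 * C" for t
  proof -
    have "0 \<le> (\<integral>x. (f x + t * g x)\<^sup>2 \<partial>?M)" by simp
    also have "\<dots> = (\<integral>x. (f x)\<^sup>2 + 2 * t * (f x * g x) + t\<^sup>2 * (g x)\<^sup>2 \<partial>?M)"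
      by (intro Bochner_Integration.integral_cong refl) (simp add: power2_eq_square algebra_simps)
    also have "\<dots> = A + 2 * t * B + t\<^sup>2 * C"
      using L2D(2)[OF f] L2D(2)[OF g] fg by (simp add: A_def B_def C_def)
    finally show ?thesis .
  qed
  have A0: "A \<ge> 0" "C \<ge> 0" by (auto simp: A_def C_def)
  have "B\<^sup>2 \<le> A * C"
  proof (cases "C = 0")
    case True
    have "B = 0"
    proof (rule ccontr)
      assume "B \<noteq> 0"
      \<comment> \<open>With \<open>C = 0\<close> the quadratic degenerates to an affine function of
        \<open>t\<close>, and this \<open>t\<close> makes it equal to -1.\<close>
      then show False using q[of "- (A + 1) / (2 * B)"] True by (simp add: field_simps)
    qed
    then show ?thesis using True by simp
  next
    case False
    then have "C > 0" using A0 by simp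
    have "0 \<le> C * (A + 2 * (-B/C) * B + (-B/C)\<^sup>2 * C)"
      using q[of "-B/C"] \<open>C > 0\<close> by simp
    also have "\<dots> = A * C - B\<^sup>2" using \<open>C > 0\<close> by (simp add: field_simps power2_eq_square)
    finally show ?thesis by simp
  qed
  then have "\<bar>B\<bar> \<le> sqrt (A * C)" by (metis real_sqrt_abs real_sqrt_le_mono)
  then show ?thesis by (simp add: L2_norm_def A_def B_def C_def real_sqrt_mult)
qed

lemma L2_norm_cong_AE:
  assumes S: "S \<in> sets lebesgue" and f: "f \<in> borel_measurable (lebesgue_on S)"
    and ae: "AE x in lebesgue_on S. f x = g x"
  shows "L2_norm S f = L2_norm S g"
proof -
  have "(\<integral>x. (f x)\<^sup>2 \<partial>lebesgue_on S) = (\<integral>x. (g x)\<^sup>2 \<partial>lebesgue_on S)"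
    using f measurable_on_AE_cong[OF S f ae] ae by (intro integral_cong_AE) auto
  then show ?thesis by (simp add: L2_norm_def)
qed

lemma L2_cong_AE:
  assumes S: "S \<in> sets lebesgue" and f: "f \<in> L2 S"
    and ae: "AE x in lebesgue_on S. f x = g x"
  shows "g \<in> L2 S"
proof -
  have "AE x in lebesgue_on S. (f x)\<^sup>2 = (g x)\<^sup>2" using ae by auto
  then have "integrable (lebesgue_on S) (\<lambda>x. (g x)\<^sup>2)"
    by (rule integrable_on_AE_cong[OF S L2D(2)[OF f]])
  then show ?thesis using measurable_on_AE_cong[OF S L2D(1)[OF f] ae] by (simp add: L2_def)
qed

lemma emeasure_Ioo_finite: "finite_measure (lebesgue_on {l<..<(r::real)})"
  by (rule finite_measure_lebesgue_on) (metis box_real(1) lmeasurable_box)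

lemma measure_Ioo: "l \<le> r \<Longrightarrow> measure (lebesgue_on {l<..<r::real}) {l<..<r} = r - l"
  by (simp add: measure_restrict_space)

lemma L2_bounded:
  assumes f: "f \<in> borel_measurable (lebesgue_on {l<..<r})"
    and B: "\<And>x. x \<in> {l<..<r} \<Longrightarrow> \<bar>f x\<bar> \<le> B" and lr: "l \<le> r"
  shows "f \<in> L2 {l<..<r}" and "(L2_norm {l<..<r} f)\<^sup>2 \<le> (r - l) * B\<^sup>2"
proof -
  interpret finite_measure "lebesgue_on {l<..<r}" by (rule emeasure_Ioo_finite)
  have le: "(f x)\<^sup>2 \<le> B\<^sup>2" if "x \<in> {l<..<r}" for x
    using B[OF that] by (metis abs_ge_zero power2_abs power_mono)
  have i: "integrable (lebesgue_on {l<..<r}) (\<lambda>x. (f x)\<^sup>2)"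
    by (rule integrable_const_bound[of _ "B\<^sup>2"]) (use f le in \<open>auto intro!: AE_I2\<close>)
  then show "f \<in> L2 {l<..<r}" using f by (simp add: L2_def)
  have "(\<integral>x. (f x)\<^sup>2 \<partial>lebesgue_on {l<..<r}) \<le> (\<integral>x. B\<^sup>2 \<partial>lebesgue_on {l<..<r})"
    by (rule integral_mono[OF i]) (use le in auto)
  then show "(L2_norm {l<..<r} f)\<^sup>2 \<le> (r - l) * B\<^sup>2"
    using measure_Ioo[OF lr] by (simp add: L2_norm_sq)
qed

lemma L2_norm_bounded:
  assumes f: "f \<in> borel_measurable (lebesgue_on {l<..<r})"
    and B: "\<And>x. x \<in> {l<..<r} \<Longrightarrow> \<bar>f x\<bar> \<le> B" and lr: "l \<le> r" and B0: "0 \<le> B"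
  shows "L2_norm {l<..<r} f \<le> sqrt (r - l) * B"
proof -
  have "L2_norm {l<..<r} f \<le> sqrt ((r - l) * B\<^sup>2)"
    using L2_bounded(2)[OF f B lr] by (metis L2_norm_nonneg abs_of_nonneg real_sqrt_abs real_sqrt_le_mono)
  then show ?thesis using B0 by (simp add: real_sqrt_mult)
qed

lemma continuous_on_measurable_Ioo:
  "continuous_on {l..r} f \<Longrightarrow> f \<in> borel_measurable (lebesgue_on {l<..<r::real})" for f :: "real \<Rightarrow> real"
  by (rule continuous_imp_measurable_on_sets_lebesgue) (auto intro: continuous_on_subset)

lemma L2_continuous:
  fixes f :: "real \<Rightarrow> real"
  assumes c: "continuous_on {l..r} f" and lr: "l \<le> r"
  shows "f \<in> L2 {l<..<r}"
proof -
  have "bounded (f ` {l..r})" by (intro compact_imp_bounded compact_continuous_image c) auto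
  then obtain B where "\<And>x. x \<in> {l..r} \<Longrightarrow> \<bar>f x\<bar> \<le> B"
    unfolding bounded_iff by (metis imageI real_norm_def)
  then show ?thesis by (intro L2_bounded(1)[OF continuous_on_measurable_Ioo[OF c], of B]) (use lr in auto)
qed

lemma L2_integrable:
  assumes "g \<in> L2 {l<..<r}"
  shows "integrable (lebesgue_on {l<..<r}) g"
proof -
  interpret finite_measure "lebesgue_on {l<..<r}" by (rule emeasure_Ioo_finite)
  have one: "(\<lambda>x. 1) \<in> L2 {l<..<r}" by (simp add: L2_def)
  show ?thesis using L2_mult_integrable[OF assms one] by simp
qed

lemma integrable_Ioo_Icc:
  assumes "integrable (lebesgue_on {l<..<r}) g"
  shows "integrable (lebesgue_on {l..r}) (g :: real \<Rightarrow> real)"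
proof -
  have "set_integrable lebesgue {l<..<r} g"
    using assms by (simp add: integrable_restrict_space set_integrable_def)
  then have "set_integrable lebesgue {l..r} g"
    by (simp add: absolutely_integrable_on_Icc_iff_Ioo)
  then show ?thesis by (rule absolutely_integrable_imp_integrable) auto
qed

section \<open>Continuous representatives in H1 and H2\<close>

text \<open>On the open interval \<open>f\<close> differs from a primitive by a constant. Both
  functions are continuous on the closed interval, so the constant persists at the endpoints; this
  gives access to boundary traces.\<close>

lemma primitive_on_closure:
  assumes lr: "l < r" and c: "continuous_on {l..r} f" and p: "primitive_on {l<..<r} f g"
    and i: "integrable (lebesgue_on {l..r}) g"
  shows "primitive_on {l..r} f g"
proof -
  have gi: "integrable (lebesgue_on {x..y}) g" if "x \<in> {l..r}" "y \<in> {l..r}" for x y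
    by (rule integrable_subinterval[OF i]) (use that in auto)
  define G where "G = (\<lambda>x. integral {l..x} g - integral {x..l} g)"
  have G: "primitive_on {l..r} G g"
    unfolding G_def by (rule primitive_on_exists[OF gi]) (use lr in auto)
  have const0: "f x - G x = f ((l+r)/2) - G ((l+r)/2)" if "x \<in> {l<..<r}" for x
    by (rule primitive_on_eq_diff[OF p primitive_on_subset[OF G] that]) (use lr in auto)
  have const: "f x - G x = f ((l+r)/2) - G ((l+r)/2)" if "x \<in> {l..r}" for x
  proof (rule continuous_constant_on_closure[of "{l<..<r}" "\<lambda>x. f x - G x"])
    show "continuous_on (closure {l<..<r}) (\<lambda>x. f x - G x)"
      using lr c primitive_on_continuous_Icc[OF G] by (simp add: continuous_on_diff)
    show "x \<in> closure {l<..<r}" using that lr by simp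
    show "f y - G y = f ((l+r)/2) - G ((l+r)/2)" if "y \<in> {l<..<r}" for y by (rule const0[OF that])
  qed
  have "primitive_on {l..r} (\<lambda>x. G x + (f ((l+r)/2) - G ((l+r)/2))) g"
    by (rule primitive_on_add_const[OF G])
  then show ?thesis
  proof (rule primitive_on_cong)
    fix x assume "x \<in> {l..r}"
    from const[OF this] show "G x + (f ((l+r)/2) - G ((l+r)/2)) = f x" by linarith
  qed
qed

text \<open>The primitives attached to \<open>g\<close> and \<open>h\<close> agree with
  \<open>f\<close> almost everywhere, hence with each other everywhere by continuity; so all
  interval integrals of \<open>g - h\<close> vanish.\<close>

lemma weak_deriv_unique:
  assumes S: "open S" "is_interval S" and w: "weak_deriv S f g" "weak_deriv S f h"
  shows "AE x in lebesgue_on S. g x = h x"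
proof -
  obtain F where F: "primitive_on S F g" "AE x in lebesgue_on S. F x = f x"
    using weak_deriv_primitiveD[OF S w(1)] by auto
  obtain H where H: "primitive_on S H h" "AE x in lebesgue_on S. H x = f x"
    using weak_deriv_primitiveD[OF S w(2)] by auto
  have "AE x in lebesgue_on S. F x = H x" using F(2) H(2) by auto
  then have eq: "F x = H x" if "x \<in> S" for x
    using AE_eq_continuous_imp_eq[OF S(1) primitive_on_continuous[OF F(1) S] primitive_on_continuous[OF H(1) S] _ that]
    by blast
  have "AE x in lebesgue_on S. g x - h x = 0"
  proof (rule AE_eq_0_on_interval[OF S])
    fix x y assume xy: "x \<in> S" "y \<in> S"
    have gi: "g integrable_on {x..y}" "h integrable_on {x..y}"
    proof -
      have "g integrable_on {x..y} \<and> h integrable_on {x..y}"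
      proof (cases "x \<le> y")
        case True
        then show ?thesis using primitive_onD(3)[OF F(1) xy] primitive_onD(3)[OF H(1) xy] by simp
      qed auto
      then show "g integrable_on {x..y}" "h integrable_on {x..y}" by auto
    qed
    then show "(\<lambda>x. g x - h x) integrable_on {x..y}" by (rule integrable_diff)
    assume "x \<le> y"
    then have "integral {x..y} g = integral {x..y} h"
      using primitive_onD(2)[OF F(1) xy] primitive_onD(2)[OF H(1) xy] eq[OF xy(1)] eq[OF xy(2)] by linarith
    then show "integral {x..y} (\<lambda>x. g x - h x) = 0"
      using gi by (subst Henstock_Kurzweil_Integration.integral_diff) auto
  qed
  then show ?thesis by (rule AE_mp) auto
qed

lemma weak_deriv_wd:
  assumes "open S" "is_interval S" "weak_deriv S f g"
  shows "weak_deriv S f (wd S f)" "AE x in lebesgue_on S. g x = wd S f x"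
proof -
  show w: "weak_deriv S f (wd S f)" unfolding wd_def by (rule someI[of "weak_deriv S f", OF assms(3)])
  show "AE x in lebesgue_on S. g x = wd S f x" by (rule weak_deriv_unique[OF assms w])
qed

lemma primitive_on_wd:
  assumes p: "primitive_on {l..r} f g"
  shows "weak_deriv {l<..<r} f g" "AE x in lebesgue_on {l<..<r}. g x = wd {l<..<r} f x"
proof -
  have S: "open {l<..<r}" "is_interval {l<..<r}" by (auto simp: is_interval_oo)
  have p': "primitive_on {l<..<r} f g" by (rule primitive_on_subset[OF p]) auto
  show w: "weak_deriv {l<..<r} f g" by (rule weak_deriv_primitiveI[OF S p']) auto
  show "AE x in lebesgue_on {l<..<r}. g x = wd {l<..<r} f x" by (rule weak_deriv_wd(2)[OF S w])
qed

lemma H1I: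
  assumes lr: "l < r" and p: "primitive_on {l..r} f g" and g: "g \<in> L2 {l<..<r}"
  shows "f \<in> H1 l r" "H1_norm l r f = sqrt ((L2_norm {l<..<r} f)\<^sup>2 + (L2_norm {l<..<r} g)\<^sup>2)"
proof -
  have c: "continuous_on {l..r} f" by (rule primitive_on_continuous_Icc[OF p])
  then have "f \<in> L2 {l<..<r}" using lr by (intro L2_continuous) auto
  then show "f \<in> H1 l r" using c g primitive_on_wd(1)[OF p] unfolding H1_def by blast
  have "L2_norm {l<..<r} g = L2_norm {l<..<r} (wd {l<..<r} f)"
    by (rule L2_norm_cong_AE[OF _ L2D(1)[OF g] primitive_on_wd(2)[OF p]]) simp
  then show "H1_norm l r f = sqrt ((L2_norm {l<..<r} f)\<^sup>2 + (L2_norm {l<..<r} g)\<^sup>2)"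
    unfolding H1_norm_def by simp
qed

lemma weak_deriv_primitive_on_Icc:
  assumes lr: "l < r" and c: "continuous_on {l..r} f" and w: "weak_deriv {l<..<r} f g"
    and g: "g \<in> L2 {l<..<r}"
  shows "primitive_on {l..r} f g"
proof -
  have S: "open {l<..<r}" "is_interval {l<..<r}" by (auto simp: is_interval_oo)
  obtain F where F: "primitive_on {l<..<r} F g" "AE x in lebesgue_on {l<..<r}. F x = f x"
    using weak_deriv_primitiveD[OF S w] by auto
  have c': "continuous_on {l<..<r} f" by (rule continuous_on_subset[OF c]) auto
  have "F x = f x" if "x \<in> {l<..<r}" for x
    by (rule AE_eq_continuous_imp_eq[OF S(1) primitive_on_continuous[OF F(1) S] c' F(2) that])
  then have "primitive_on {l<..<r} f g" by (rule primitive_on_cong[OF F(1)])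
  then show ?thesis
    by (intro primitive_on_closure[OF lr c] integrable_Ioo_Icc L2_integrable g)
qed

lemma H1D:
  assumes lr: "l < r" and f: "f \<in> H1 l r"
  shows "primitive_on {l..r} f (wd {l<..<r} f)" "wd {l<..<r} f \<in> L2 {l<..<r}"
proof -
  have S: "open {l<..<r}" "is_interval {l<..<r}" by (auto simp: is_interval_oo)
  obtain g where g: "g \<in> L2 {l<..<r}" "weak_deriv {l<..<r} f g" and c: "continuous_on {l..r} f"
    using f unfolding H1_def by auto
  show w: "wd {l<..<r} f \<in> L2 {l<..<r}"
    by (rule L2_cong_AE[OF _ g(1) weak_deriv_wd(2)[OF S g(2)]]) simp
  show "primitive_on {l..r} f (wd {l<..<r} f)"
    by (rule weak_deriv_primitive_on_Icc[OF lr c weak_deriv_wd(1)[OF S g(2)] w])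
qed

text \<open>\<open>H2_norm\<close> takes \<open>wd\<close> of \<open>wd f\<close>, and
  \<open>wd f\<close> equals \<open>g\<close> only almost everywhere. Weak derivatives do not see
  the difference, so \<open>h\<close> still represents the second derivative.\<close>

lemma H2I:
  assumes lr: "l < r" and p: "primitive_on {l..r} f g" "primitive_on {l..r} g h" and h: "h \<in> L2 {l<..<r}"
  shows "f \<in> H2 l r" "H2_norm l r f = sqrt ((L2_norm {l<..<r} f)\<^sup>2 + (L2_norm {l<..<r} g)\<^sup>2 + (L2_norm {l<..<r} h)\<^sup>2)"
proof -
  have S: "open {l<..<r}" "is_interval {l<..<r}" by (auto simp: is_interval_oo)
  have c: "continuous_on {l..r} f" "continuous_on {l..r} g"
    using primitive_on_continuous_Icc p by blast+
  then have L: "f \<in> L2 {l<..<r}" "g \<in> L2 {l<..<r}" using lr by (auto intro!: L2_continuous)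
  then show "f \<in> H2 l r" using c h primitive_on_wd(1)[OF p(1)] primitive_on_wd(1)[OF p(2)]
    unfolding H2_def by blast
  have e1: "L2_norm {l<..<r} g = L2_norm {l<..<r} (wd {l<..<r} f)"
    by (rule L2_norm_cong_AE[OF _ L2D(1)[OF L(2)] primitive_on_wd(2)[OF p(1)]]) simp
  have p': "primitive_on {l<..<r} g h" by (rule primitive_on_subset[OF p(2)]) auto
  have "weak_deriv {l<..<r} (wd {l<..<r} f) h"
    by (rule weak_deriv_primitiveI[OF S p' primitive_on_wd(2)[OF p(1)]])
  then have "AE x in lebesgue_on {l<..<r}. h x = wd {l<..<r} (wd {l<..<r} f) x"
    by (rule weak_deriv_wd(2)[OF S])
  then have e2: "L2_norm {l<..<r} h = L2_norm {l<..<r} (wd {l<..<r} (wd {l<..<r} f))"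
    by (intro L2_norm_cong_AE[OF _ L2D(1)[OF h]]) auto
  show "H2_norm l r f = sqrt ((L2_norm {l<..<r} f)\<^sup>2 + (L2_norm {l<..<r} g)\<^sup>2 + (L2_norm {l<..<r} h)\<^sup>2)"
    unfolding H2_norm_def by (simp add: e1 e2)
qed

text \<open>The definition provides the first derivative as an L2 function only. Integrating
  \<open>h\<close> from the midpoint yields its continuous representative \<open>g\<close> on the
  closed interval: elements of H2 are C1 up to the endpoints.\<close>

lemma H2E:
  assumes lr: "l < r" and f: "f \<in> H2 l r"
  obtains g h where "primitive_on {l..r} f g" "primitive_on {l..r} g h" "h \<in> L2 {l<..<r}"
proof -
  have S: "open {l<..<r}" "is_interval {l<..<r}" by (auto simp: is_interval_oo)
  obtain g0 h where g: "g0 \<in> L2 {l<..<r}" "weak_deriv {l<..<r} f g0" "h \<in> L2 {l<..<r}" "weak_deriv {l<..<r} g0 h"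
    and c: "continuous_on {l..r} f"
    using f unfolding H2_def by auto
  obtain F where F: "primitive_on {l<..<r} F h" "AE x in lebesgue_on {l<..<r}. F x = g0 x"
    using weak_deriv_primitiveD[OF S g(4)] by auto
  have i: "integrable (lebesgue_on {l..r}) h" by (intro integrable_Ioo_Icc L2_integrable g)
  have hi: "integrable (lebesgue_on {x..y}) h" if "x \<in> {l..r}" "y \<in> {l..r}" for x y
    by (rule integrable_subinterval[OF i]) (use that in auto)
  define m where "m = (l + r) / 2"
  have m: "m \<in> {l<..<r}" using lr by (auto simp: m_def)
  define G where "G = (\<lambda>x. integral {m..x} h - integral {x..m} h)"
  have G: "primitive_on {l..r} G h"
    unfolding G_def by (rule primitive_on_exists[OF hi]) (use m in auto)
  have Gm: "G m = 0" by (simp add: G_def)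
  define g where "g = (\<lambda>x. G x + F m)"
  have pg: "primitive_on {l..r} g h" unfolding g_def by (rule primitive_on_add_const[OF G])
  have Fg: "F x = g x" if x: "x \<in> {l<..<r}" for x
  proof -
    have p2: "primitive_on {l<..<r} G h" by (rule primitive_on_subset[OF G]) auto
    show ?thesis using primitive_on_eq_diff[OF F(1) p2 x m] by (simp add: g_def Gm)
  qed
  have ae: "AE x in lebesgue_on {l<..<r}. g0 x = g x"
    using F(2) by (rule lebesgue_on_mono) (use Fg in auto)
  have cg: "continuous_on {l..r} g" by (rule primitive_on_continuous_Icc[OF pg])
  have "primitive_on {l..r} f g0" by (rule weak_deriv_primitive_on_Icc[OF lr c g(2,1)])
  then have "primitive_on {l<..<r} f g0" by (rule primitive_on_subset) auto
  then have "primitive_on {l<..<r} f g"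
    by (rule primitive_on_cong_AE[OF _ S(2) _ ae]) simp
  then have "primitive_on {l..r} f g"
    by (rule primitive_on_closure[OF lr c]) (rule continuous_imp_integrable_real[OF cg])
  then show thesis using that pg g(3) by blast
qed

text \<open>\<open>\<bar>f x\<bar>\<close> is at most \<open>\<bar>f y\<bar>\<close> plus the
  integral of \<open>\<bar>g\<bar>\<close>. Averaging over \<open>y\<close> produces the factor
  \<open>1 / (r - l)\<close>, and Cauchy-Schwarz against the constant 1 produces
  \<open>sqrt (r - l)\<close>.\<close>

lemma primitive_on_sup_bound:
  assumes lr: "l < r" and p: "primitive_on {l..r} f g" and g: "g \<in> L2 {l<..<r}" and x: "x \<in> {l..r}"
  shows "\<bar>f x\<bar> \<le> (1 / (r - l) + 1) * sqrt (r - l) * (L2_norm {l<..<r} f + L2_norm {l<..<r} g)"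
proof -
  let ?M = "lebesgue_on {l<..<r}"
  interpret finite_measure ?M by (rule emeasure_Ioo_finite)
  have c: "continuous_on {l..r} f" by (rule primitive_on_continuous_Icc[OF p])
  have fL: "f \<in> L2 {l<..<r}" using lr by (intro L2_continuous c) auto
  have fi: "integrable ?M f" and gi: "integrable ?M g" using L2_integrable fL g by auto
  have giI: "integrable (lebesgue_on {l..r}) g" by (rule integrable_Ioo_Icc[OF gi])
  have one: "(\<lambda>x. 1) \<in> L2 {l<..<r}" by (simp add: L2_def)
  have n1: "L2_norm {l<..<r} (\<lambda>x. 1) = sqrt (r - l)"
    using lr measure_Ioo[of l r] by (simp add: L2_norm_def)
  have CS: "(\<integral>y. \<bar>h y\<bar> \<partial>?M) \<le> L2_norm {l<..<r} h * sqrt (r - l)" if h: "h \<in> L2 {l<..<r}" for h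
  proof -
    have "(\<lambda>y. \<bar>h y\<bar>) \<in> L2 {l<..<r}" using h by (auto simp: L2_def)
    moreover have "L2_norm {l<..<r} (\<lambda>y. \<bar>h y\<bar>) = L2_norm {l<..<r} h" by (simp add: L2_norm_def)
    ultimately show ?thesis using L2_Cauchy_Schwarz[of "\<lambda>y. \<bar>h y\<bar>" "{l<..<r}", OF _ one] n1 by simp
  qed
  have gabs: "(\<lambda>t. \<bar>g t\<bar>) integrable_on {l..r}"
    using integrable_on_lebesgue_on[of "{l..r}" "\<lambda>t. \<bar>g t\<bar>"] giI by auto
  have gI: "integral {l..r} (\<lambda>t. \<bar>g t\<bar>) = (\<integral>y. \<bar>g y\<bar> \<partial>?M)"
  proof -
    have "integrable ?M (\<lambda>t. \<bar>g t\<bar>)" using gi by auto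
    then have "(\<integral>y. \<bar>g y\<bar> \<partial>?M) = integral {l<..<r} (\<lambda>t. \<bar>g t\<bar>)"
      by (rule lebesgue_integral_eq_integral) simp
    then show ?thesis by (simp add: integral_open_interval_real)
  qed
  have var: "\<bar>f b - f a\<bar> \<le> integral {l..r} (\<lambda>t. \<bar>g t\<bar>)" if ab: "a \<in> {l..r}" "b \<in> {l..r}" "a \<le> b" for a b
  proof -
    have i: "integrable (lebesgue_on {a..b}) g" and e: "f b - f a = integral {a..b} g"
      using primitive_onD[OF p ab] by auto
    have gab: "g integrable_on {a..b}" using integrable_on_lebesgue_on[OF i] by simp
    have gab': "(\<lambda>t. \<bar>g t\<bar>) integrable_on {a..b}"
      using integrable_on_lebesgue_on[of "{a..b}" "\<lambda>t. \<bar>g t\<bar>"] i by auto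
    have "\<bar>integral {a..b} g\<bar> \<le> integral {a..b} (\<lambda>t. \<bar>g t\<bar>)"
      using integral_norm_bound_integral[OF gab gab'] by auto
    also have "\<dots> \<le> integral {l..r} (\<lambda>t. \<bar>g t\<bar>)"
      by (rule integral_subset_le) (use ab gabs gab' in auto)
    finally show ?thesis by (simp add: e)
  qed
  have le: "\<bar>f x\<bar> - integral {l..r} (\<lambda>t. \<bar>g t\<bar>) \<le> \<bar>f y\<bar>" if y: "y \<in> {l<..<r}" for y
  proof -
    consider "x \<le> y" | "y \<le> x" by linarith
    then show ?thesis using var[of x y] var[of y x] x y by cases auto
  qed
  have "(\<integral>y. \<bar>f x\<bar> - integral {l..r} (\<lambda>t. \<bar>g t\<bar>) \<partial>?M) \<le> (\<integral>y. \<bar>f y\<bar> \<partial>?M)"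
    by (rule integral_mono) (use fi le in auto)
  then have "(r - l) * (\<bar>f x\<bar> - integral {l..r} (\<lambda>t. \<bar>g t\<bar>)) \<le> (\<integral>y. \<bar>f y\<bar> \<partial>?M)"
    using lr measure_Ioo[of l r] by simp
  also have "\<dots> \<le> L2_norm {l<..<r} f * sqrt (r - l)" by (rule CS[OF fL])
  finally have "\<bar>f x\<bar> \<le> integral {l..r} (\<lambda>t. \<bar>g t\<bar>) + L2_norm {l<..<r} f * sqrt (r - l) / (r - l)"
    using lr by (simp add: field_simps)
  also have "integral {l..r} (\<lambda>t. \<bar>g t\<bar>) \<le> L2_norm {l<..<r} g * sqrt (r - l)" unfolding gI by (rule CS[OF g])
  finally have 1: "\<bar>f x\<bar> \<le> L2_norm {l<..<r} g * sqrt (r - l) + L2_norm {l<..<r} f * sqrt (r - l) / (r - l)"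
    by simp
  define A B k where "A = L2_norm {l<..<r} f * sqrt (r - l)" and "B = L2_norm {l<..<r} g * sqrt (r - l)"
    and "k = 1 / (r - l)"
  have pos: "A \<ge> 0" "B \<ge> 0" "k \<ge> 0" using lr L2_norm_nonneg by (auto simp: A_def B_def k_def)
  have "\<bar>f x\<bar> \<le> B + A * k" using 1 by (simp add: A_def B_def k_def)
  also have "\<dots> \<le> (k + 1) * (A + B)" using pos by (simp add: distrib_left distrib_right mult.commute)
  finally show ?thesis by (simp add: A_def B_def k_def algebra_simps)
qed

text \<open>The embedding of H2 into C1: the sup bound is applied to \<open>f\<close> and to its
  derivative. The constant depends on the interval alone.\<close>

lemma H2_sup_bound:
  assumes lr: "l < r"
  obtains C where "C > 0" "\<And>f g h x. primitive_on {l..r} f g \<Longrightarrow> primitive_on {l..r} g h \<Longrightarrow> h \<in> L2 {l<..<r}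
    \<Longrightarrow> x \<in> {l..r} \<Longrightarrow> \<bar>f x\<bar> \<le> C * H2_norm l r f \<and> \<bar>g x\<bar> \<le> C * H2_norm l r f"
proof
  let ?K = "(1 / (r - l) + 1) * sqrt (r - l)"
  show "2 * ?K > 0" using lr by (auto intro!: mult_pos_pos add_pos_pos)
  then have K: "?K \<ge> 0" by linarith
  fix f g h x assume p: "primitive_on {l..r} f g" "primitive_on {l..r} g h" and h: "h \<in> L2 {l<..<r}"
    and x: "x \<in> {l..r}"
  have gL: "g \<in> L2 {l<..<r}" using lr primitive_on_continuous_Icc[OF p(2)] by (intro L2_continuous) auto
  note n = H2I(2)[OF lr p h]
  have "L2_norm {l<..<r} f \<le> H2_norm l r f" "L2_norm {l<..<r} g \<le> H2_norm l r f" "L2_norm {l<..<r} h \<le> H2_norm l r f"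
    unfolding n by (auto intro!: real_le_rsqrt)
  moreover have "\<bar>f x\<bar> \<le> ?K * (L2_norm {l<..<r} f + L2_norm {l<..<r} g)"
    by (rule primitive_on_sup_bound[OF lr p(1) gL x])
  moreover have "\<bar>g x\<bar> \<le> ?K * (L2_norm {l<..<r} g + L2_norm {l<..<r} h)"
    by (rule primitive_on_sup_bound[OF lr p(2) h x])
  moreover have "?K * (a + b) \<le> ?K * (H2_norm l r f + H2_norm l r f)"
    if "a \<le> H2_norm l r f" "b \<le> H2_norm l r f" for a b
    by (rule mult_left_mono[OF _ K]) (use that in linarith)
  ultimately have B: "\<bar>f x\<bar> \<le> ?K * (H2_norm l r f + H2_norm l r f)" "\<bar>g x\<bar> \<le> ?K * (H2_norm l r f + H2_norm l r f)"
    using order_trans by blast+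
  have e: "?K * (a + a) = 2 * ?K * a" for a :: real by (simp add: algebra_simps)
  show "\<bar>f x\<bar> \<le> 2 * ?K * H2_norm l r f \<and> \<bar>g x\<bar> \<le> 2 * ?K * H2_norm l r f"
    using B unfolding e by blast
qed

section \<open>Uniqueness of classical solutions\<close>

text \<open>With \<open>f s - f0\<close> and \<open>g s - g0\<close> as increments, the error splits
  into three products, each of which contains an increment and is controlled by
  Cauchy-Schwarz.\<close>

lemma L2_inner_tendsto:
  assumes f: "f0 \<in> L2 S" "\<And>s. s \<in> A \<Longrightarrow> f s \<in> L2 S" and g: "g0 \<in> L2 S" "\<And>s. s \<in> A \<Longrightarrow> g s \<in> L2 S"
    and ev: "eventually (\<lambda>s. s \<in> A) F"
    and lf: "((\<lambda>s. L2_norm S (\<lambda>x. f s x - f0 x)) \<longlongrightarrow> 0) F"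
    and lg: "((\<lambda>s. L2_norm S (\<lambda>x. g s x - g0 x)) \<longlongrightarrow> 0) F"
  shows "((\<lambda>s. \<integral>x. f s x * g s x \<partial>lebesgue_on S) \<longlongrightarrow> (\<integral>x. f0 x * g0 x \<partial>lebesgue_on S)) F"
proof -
  let ?M = "lebesgue_on S"
  let ?I = "\<lambda>s. \<integral>x. f s x * g s x \<partial>?M"
  let ?nf = "\<lambda>s. L2_norm S (\<lambda>x. f s x - f0 x)" and ?ng = "\<lambda>s. L2_norm S (\<lambda>x. g s x - g0 x)"
  have le: "\<bar>?I s - (\<integral>x. f0 x * g0 x \<partial>?M)\<bar> \<le> ?nf s * ?ng s + ?nf s * L2_norm S g0 + L2_norm S f0 * ?ng s"
    if s: "s \<in> A" for s
  proof -
    have d: "(\<lambda>x. f s x - f0 x) \<in> L2 S" "(\<lambda>x. g s x - g0 x) \<in> L2 S"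
      using f g s by (auto intro: L2_diff)
    have i: "integrable ?M (\<lambda>x. (f s x - f0 x) * (g s x - g0 x))" "integrable ?M (\<lambda>x. (f s x - f0 x) * g0 x)"
      "integrable ?M (\<lambda>x. f0 x * (g s x - g0 x))" "integrable ?M (\<lambda>x. f0 x * g0 x)" "integrable ?M (\<lambda>x. f s x * g s x)"
      using f g s d by (auto intro: L2_mult_integrable)
    have "?I s = (\<integral>x. ((f s x - f0 x) * (g s x - g0 x) + (f s x - f0 x) * g0 x) + f0 x * (g s x - g0 x) + f0 x * g0 x \<partial>?M)"
      by (rule Bochner_Integration.integral_cong) (auto simp: algebra_simps)
    also have "\<dots> = (\<integral>x. (f s x - f0 x) * (g s x - g0 x) \<partial>?M) + (\<integral>x. (f s x - f0 x) * g0 x \<partial>?M)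
        + (\<integral>x. f0 x * (g s x - g0 x) \<partial>?M) + (\<integral>x. f0 x * g0 x \<partial>?M)"
      using i(1-4) by (simp only: Bochner_Integration.integral_add Bochner_Integration.integrable_add)
    finally show ?thesis
      using L2_Cauchy_Schwarz[OF d] L2_Cauchy_Schwarz[OF d(1) g(1)] L2_Cauchy_Schwarz[OF f(1) d(2)]
      by linarith
  qed
  have "((\<lambda>s. ?nf s * ?ng s + ?nf s * L2_norm S g0 + L2_norm S f0 * ?ng s)
      \<longlongrightarrow> 0 * 0 + 0 * L2_norm S g0 + L2_norm S f0 * 0) F"
    by (intro tendsto_intros lf lg)
  then have "((\<lambda>s. ?nf s * ?ng s + ?nf s * L2_norm S g0 + L2_norm S f0 * ?ng s) \<longlongrightarrow> 0) F" by simp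
  moreover have "eventually (\<lambda>s. norm (?I s - (\<integral>x. f0 x * g0 x \<partial>?M))
      \<le> ?nf s * ?ng s + ?nf s * L2_norm S g0 + L2_norm S f0 * ?ng s) F"
    using ev by (rule eventually_mono) (use le in auto)
  ultimately have "((\<lambda>s. ?I s - (\<integral>x. f0 x * g0 x \<partial>?M)) \<longlongrightarrow> 0) F"
    by (rule Lim_null_comparison[rotated])
  then show ?thesis by (simp add: LIM_zero_iff)
qed

text \<open>The difference quotient of the energy is the inner product of the difference quotient of
  \<open>p\<close> with \<open>p s + p t\<close>, and both factors converge in L2.\<close>

lemma C1_path_energy:
  assumes p: "C1_path T (L2 S) (L2_norm S) p pt"
  shows "continuous_on {0..T} (\<lambda>t. \<integral>x. (p t x)\<^sup>2 \<partial>lebesgue_on S)"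
    and "t \<in> {0<..<T} \<Longrightarrow>
      ((\<lambda>t. \<integral>x. (p t x)\<^sup>2 \<partial>lebesgue_on S) has_real_derivative 2 * (\<integral>x. pt t x * p t x \<partial>lebesgue_on S)) (at t)"
proof -
  let ?M = "lebesgue_on S" and ?E = "\<lambda>t. \<integral>x. (p t x)\<^sup>2 \<partial>lebesgue_on S"
  have pL: "p t \<in> L2 S" "pt t \<in> L2 S" if "t \<in> {0..T}" for t
    using p that unfolding C1_path_def cont_path_def by auto
  have lim: "((\<lambda>s. L2_norm S (\<lambda>x. p s x - p t x)) \<longlongrightarrow> 0) (at t within {0..T})"
    "((\<lambda>s. L2_norm S (\<lambda>x. (p s x - p t x) / (s - t) - pt t x)) \<longlongrightarrow> 0) (at t within {0..T})"
    if "t \<in> {0..T}" for t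
    using p that unfolding C1_path_def cont_path_def by auto
  have ev: "eventually (\<lambda>s. s \<in> {0..T}) (at t within {0..T})" for t
    by (simp add: eventually_at_filter)
  show "continuous_on {0..T} ?E"
    unfolding continuous_on_def
  proof
    fix t assume t: "t \<in> {0..T}"
    show "(?E \<longlongrightarrow> ?E t) (at t within {0..T})"
      unfolding power2_eq_square
      by (rule L2_inner_tendsto[where A="{0..T}"]) (use pL lim t ev in auto)
  qed
  assume t: "t \<in> {0<..<T}"
  then have t': "t \<in> {0..T}" by auto
  have A: "((\<lambda>s. \<integral>x. ((p s x - p t x) / (s - t)) * (p s x + p t x) \<partial>?M) \<longlongrightarrow> (\<integral>x. pt t x * (p t x + p t x) \<partial>?M))
    (at t within {0..T})"
  proof (rule L2_inner_tendsto[where A="{0..T}"])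
    show "(\<lambda>x. (p s x - p t x) / (s - t)) \<in> L2 S" if "s \<in> {0..T}" for s
      using L2_cmult[OF L2_diff[OF pL(1)[OF that] pL(1)[OF t']], of "1/(s-t)"] by (simp add: field_simps)
    show "((\<lambda>s. L2_norm S (\<lambda>x. p s x + p t x - (p t x + p t x))) \<longlongrightarrow> 0) (at t within {0..T})"
      using lim(1)[OF t'] by simp
  qed (use pL t' lim(2)[OF t'] ev in \<open>auto intro: L2_add L2_cmult\<close>)
  have B: "(\<integral>x. pt t x * (p t x + p t x) \<partial>?M) = 2 * (\<integral>x. pt t x * p t x \<partial>?M)"
  proof -
    have "(\<integral>x. pt t x * (p t x + p t x) \<partial>?M) = (\<integral>x. 2 * (pt t x * p t x) \<partial>?M)"
      by (rule Bochner_Integration.integral_cong) (auto simp: algebra_simps)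
    then show ?thesis by simp
  qed
  have C: "eventually (\<lambda>s. (\<integral>x. ((p s x - p t x) / (s - t)) * (p s x + p t x) \<partial>?M) = (?E s - ?E t) / (s - t))
    (at t within {0..T})"
    using ev[of t]
  proof eventually_elim
    case (elim s)
    have "(?E s - ?E t) = (\<integral>x. (p s x)\<^sup>2 - (p t x)\<^sup>2 \<partial>?M)"
      using L2D(2)[OF pL(1)[OF elim]] L2D(2)[OF pL(1)[OF t']] by simp
    then have "(?E s - ?E t) / (s - t) = (\<integral>x. ((p s x)\<^sup>2 - (p t x)\<^sup>2) / (s - t) \<partial>?M)" by simp
    also have "\<dots> = (\<integral>x. ((p s x - p t x) / (s - t)) * (p s x + p t x) \<partial>?M)"
      by (rule Bochner_Integration.integral_cong) (auto simp: power2_eq_square algebra_simps)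
    finally show ?case by (rule sym)
  qed
  have "((\<lambda>s. (?E s - ?E t) / (s - t)) \<longlongrightarrow> 2 * (\<integral>x. pt t x * p t x \<partial>?M)) (at t within {0..T})"
    by (rule Lim_transform_eventually[OF A[unfolded B] C])
  then have "(?E has_real_derivative 2 * (\<integral>x. pt t x * p t x \<partial>?M)) (at t within {0..T})"
    by (simp add: has_field_derivative_iff)
  then show "(?E has_real_derivative 2 * (\<integral>x. pt t x * p t x \<partial>?M)) (at t)"
    using t by (simp add: at_within_Icc_at)
qed

lemma L2_norm_triangle_diff:
  assumes f: "f \<in> L2 S" and g: "g \<in> L2 S"
  shows "L2_norm S (\<lambda>x. f x - g x) \<le> L2_norm S f + L2_norm S g"
proof (rule power2_le_imp_le)
  have "(L2_norm S (\<lambda>x. f x - g x))\<^sup>2 = (\<integral>x. (f x)\<^sup>2 + (g x)\<^sup>2 - 2 * (f x * g x) \<partial>lebesgue_on S)"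
    unfolding L2_norm_sq by (rule Bochner_Integration.integral_cong) (auto simp: power2_diff)
  also have "\<dots> = (L2_norm S f)\<^sup>2 + (L2_norm S g)\<^sup>2 - 2 * (\<integral>x. f x * g x \<partial>lebesgue_on S)"
    using L2D(2)[OF f] L2D(2)[OF g] L2_mult_integrable[OF f g] by (simp add: L2_norm_sq)
  also have "\<dots> \<le> (L2_norm S f + L2_norm S g)\<^sup>2"
    using L2_Cauchy_Schwarz[OF f g] by (simp add: power2_sum)
  finally show "(L2_norm S (\<lambda>x. f x - g x))\<^sup>2 \<le> (L2_norm S f + L2_norm S g)\<^sup>2" .
qed (intro add_nonneg_nonneg L2_norm_nonneg)

lemma L2_norm_tendsto_diff:
  assumes ev: "eventually (\<lambda>s. s \<in> A) F" and L: "\<And>s. s \<in> A \<Longrightarrow> a s \<in> L2 S" "\<And>s. s \<in> A \<Longrightarrow> b s \<in> L2 S"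
    and lim: "((\<lambda>s. L2_norm S (a s)) \<longlongrightarrow> 0) F" "((\<lambda>s. L2_norm S (b s)) \<longlongrightarrow> 0) F"
    and c: "\<And>s x. c s x = a s x - b s x"
  shows "((\<lambda>s. L2_norm S (c s)) \<longlongrightarrow> 0) F"
proof (rule Lim_null_comparison)
  have "c s = (\<lambda>x. a s x - b s x)" for s using c by auto
  then show "eventually (\<lambda>s. norm (L2_norm S (c s)) \<le> L2_norm S (a s) + L2_norm S (b s)) F"
    using ev by (rule_tac eventually_mono[OF ev]) (simp add: L2_norm_nonneg L2_norm_triangle_diff L)
  show "((\<lambda>s. L2_norm S (a s) + L2_norm S (b s)) \<longlongrightarrow> 0) F"
    using tendsto_add[OF lim] by simp
qed

lemma cont_path_diff_L2:
  assumes p: "cont_path T (L2 S) (L2_norm S) p" and q: "cont_path T (L2 S) (L2_norm S) q"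
  shows "cont_path T (L2 S) (L2_norm S) (\<lambda>t x. p t x - q t x)"
  unfolding cont_path_def
proof (intro ballI conjI)
  fix t assume t: "t \<in> {0..T}"
  have L: "p s \<in> L2 S" "q s \<in> L2 S" if "s \<in> {0..T}" for s using p q that unfolding cont_path_def by auto
  show "(\<lambda>x. p t x - q t x) \<in> L2 S" using L[OF t] by (rule L2_diff)
  show "((\<lambda>s. L2_norm S (\<lambda>x. p s x - q s x - (p t x - q t x))) \<longlongrightarrow> 0) (at t within {0..T})"
  proof (rule L2_norm_tendsto_diff[where A="{0..T}" and a="\<lambda>s x. p s x - p t x" and b="\<lambda>s x. q s x - q t x"])
    show "eventually (\<lambda>s. s \<in> {0..T}) (at t within {0..T})" by (simp add: eventually_at_filter)
  qed (use p q t L in \<open>auto simp: cont_path_def intro: L2_diff\<close>)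
qed

lemma C1_path_diff:
  assumes p: "C1_path T (L2 S) (L2_norm S) p pt" and q: "C1_path T (L2 S) (L2_norm S) q qt"
  shows "C1_path T (L2 S) (L2_norm S) (\<lambda>t x. p t x - q t x) (\<lambda>t x. pt t x - qt t x)"
  unfolding C1_path_def
proof (intro ballI conjI)
  show "cont_path T (L2 S) (L2_norm S) (\<lambda>t x. p t x - q t x)"
    "cont_path T (L2 S) (L2_norm S) (\<lambda>t x. pt t x - qt t x)"
    using p q by (auto simp: C1_path_def intro: cont_path_diff_L2)
  fix t assume t: "t \<in> {0..T}"
  have L: "p s \<in> L2 S" "q s \<in> L2 S" "pt s \<in> L2 S" "qt s \<in> L2 S" if "s \<in> {0..T}" for s
    using p q that unfolding C1_path_def cont_path_def by auto
  show "((\<lambda>s. L2_norm S (\<lambda>x. (p s x - q s x - (p t x - q t x)) / (s - t) - (pt t x - qt t x))) \<longlongrightarrow> 0)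
    (at t within {0..T})"
  proof (rule L2_norm_tendsto_diff[where A="{0..T}" and a="\<lambda>s x. (p s x - p t x) / (s - t) - pt t x"
        and b="\<lambda>s x. (q s x - q t x) / (s - t) - qt t x"])
    show "eventually (\<lambda>s. s \<in> {0..T}) (at t within {0..T})" by (simp add: eventually_at_filter)
    fix s assume s: "s \<in> {0..T}"
    show "(\<lambda>x. (p s x - p t x) / (s - t) - pt t x) \<in> L2 S"
      using L2_diff[OF L2_cmult[OF L2_diff[OF L(1)[OF s] L(1)[OF t]], of "1/(s-t)"] L(3)[OF t]] by simp
    show "(\<lambda>x. (q s x - q t x) / (s - t) - qt t x) \<in> L2 S"
      using L2_diff[OF L2_cmult[OF L2_diff[OF L(2)[OF s] L(2)[OF t]], of "1/(s-t)"] L(4)[OF t]] by simp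
  next
    fix s x
    show "(p s x - q s x - (p t x - q t x)) / (s - t) - (pt t x - qt t x)
      = (p s x - p t x) / (s - t) - pt t x - ((q s x - q t x) / (s - t) - qt t x)"
      by (simp add: diff_divide_distrib)
  qed (use p q t in \<open>auto simp: C1_path_def\<close>)
qed

lemma integral_lebesgue_on_Ioo:
  fixes h :: "real \<Rightarrow> real"
  assumes "integrable (lebesgue_on {l..r}) h"
  shows "integrable (lebesgue_on {l<..<r}) h" "(\<integral>x. h x \<partial>lebesgue_on {l<..<r}) = (\<integral>x. h x \<partial>lebesgue_on {l..r})"
proof -
  have "set_integrable lebesgue {l..r} h"
    using assms by (simp add: integrable_restrict_space set_integrable_def)
  then have "set_integrable lebesgue {l<..<r} h"
    by (simp add: absolutely_integrable_on_Icc_iff_Ioo)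
  then show i: "integrable (lebesgue_on {l<..<r}) h" by (rule absolutely_integrable_imp_integrable) auto
  show "(\<integral>x. h x \<partial>lebesgue_on {l<..<r}) = (\<integral>x. h x \<partial>lebesgue_on {l..r})"
    using lebesgue_integral_eq_integral[OF i] lebesgue_integral_eq_integral[OF assms]
    by (simp add: integral_open_interval_real)
qed

lemma L2_norm_0_imp_eq_0:
  assumes "f \<in> L2 {l<..<r}" "(\<integral>x. (f x)\<^sup>2 \<partial>lebesgue_on {l<..<r}) \<le> 0" and lr: "l < r"
    and c: "continuous_on {l..r} f" and x: "x \<in> {l..r}"
  shows "f x = 0"
proof -
  have "(\<integral>x. (f x)\<^sup>2 \<partial>lebesgue_on {l<..<r}) = 0" using assms(2) by (intro antisym) auto
  then have "AE x in lebesgue_on {l<..<r}. (f x)\<^sup>2 = 0"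
    using integral_nonneg_eq_0_iff_AE[OF L2D(2)[OF assms(1)]] by auto
  then have ae: "AE x in lebesgue_on {l<..<r}. f x = 0" by auto
  have eq: "f y = 0" if "y \<in> {l<..<r}" for y
    by (rule AE_eq_continuous_imp_eq[OF _ _ _ ae that]) (auto intro: continuous_on_subset[OF c])
  show ?thesis
    by (rule continuous_constant_on_closure[of "{l<..<r}" f]) (use c eq lr x in simp_all)
qed

text \<open>The energy of the difference of two solutions decreases because \<open>f\<close> is monotone in \<open>u\<close>.\<close>

lemma classical_solution_unique:
  assumes T: "T > 0" and s1: "classical_solution T f p0 u0 h0 h1 p u" and s2: "classical_solution T f p0 u0 h0 h1 q v"
    and mono: "\<And>t x y z. t \<in> {0<..<T} \<Longrightarrow> x \<in> {0<..<1} \<Longrightarrow> 0 \<le> (f t x y - f t x z) * (y - z)"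
    and t: "t \<in> {0..T}" and x: "x \<in> {0..1}"
  shows "p t x = q t x" "u t x = v t x"
proof -
  let ?S = "{0<..<1::real}" let ?M = "lebesgue_on ?S"
  obtain pt ut where 1: "C1_path T (L2 ?S) (L2_norm ?S) p pt" "C1_path T (L2 ?S) (L2_norm ?S) u ut"
    "\<And>t. t \<in> {0<..<T} \<Longrightarrow> AE x in ?M. pt t x + wd ?S (u t) x = 0 \<and> ut t x + wd ?S (p t) x + f t x (u t x) = 0"
    using s1 unfolding classical_solution_def by auto
  obtain qt vt where 2: "C1_path T (L2 ?S) (L2_norm ?S) q qt" "C1_path T (L2 ?S) (L2_norm ?S) v vt"
    "\<And>t. t \<in> {0<..<T} \<Longrightarrow> AE x in ?M. qt t x + wd ?S (v t) x = 0 \<and> vt t x + wd ?S (q t) x + f t x (v t x) = 0"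
    using s2 unfolding classical_solution_def by auto
  have H: "p t \<in> H1 0 1" "u t \<in> H1 0 1" "q t \<in> H1 0 1" "v t \<in> H1 0 1" if "t \<in> {0..T}" for t
    using s1 s2 that unfolding classical_solution_def cont_path_def by auto
  have bc: "u t 0 = v t 0" "u t 1 = v t 1" if "t \<in> {0..T}" for t
    using s1 s2 that unfolding classical_solution_def by auto
  have ic: "p 0 x = q 0 x" "u 0 x = v 0 x" if "x \<in> {0..1}" for x
    using s1 s2 that unfolding classical_solution_def by auto
  define P U Pt Ut where "P = (\<lambda>t x. p t x - q t x)" and "U = (\<lambda>t x. u t x - v t x)"
    and "Pt = (\<lambda>t x. pt t x - qt t x)" and "Ut = (\<lambda>t x. ut t x - vt t x)"
  have CP: "C1_path T (L2 ?S) (L2_norm ?S) P Pt" and CU: "C1_path T (L2 ?S) (L2_norm ?S) U Ut"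
    unfolding P_def U_def Pt_def Ut_def using C1_path_diff 1 2 by blast+
  have L: "P t \<in> L2 ?S" "U t \<in> L2 ?S" "Pt t \<in> L2 ?S" "Ut t \<in> L2 ?S" if "t \<in> {0..T}" for t
    using CP CU that unfolding C1_path_def cont_path_def by auto
  define E where "E = (\<lambda>t. (\<integral>x. (P t x)\<^sup>2 \<partial>?M) + (\<integral>x. (U t x)\<^sup>2 \<partial>?M))"
  have cE: "continuous_on {0..T} E"
    unfolding E_def by (intro continuous_intros C1_path_energy(1)[OF CP] C1_path_energy(1)[OF CU])
  have dE: "\<exists>y. (E has_real_derivative y) (at t) \<and> y \<le> 0" if t: "0 < t" "t < T" for t
  proof (intro exI conjI)
    have t': "t \<in> {0<..<T}" "t \<in> {0..T}" using t by auto
    show "(E has_real_derivative 2 * (\<integral>x. Pt t x * P t x \<partial>?M) + 2 * (\<integral>x. Ut t x * U t x \<partial>?M)) (at t)"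
      unfolding E_def by (intro DERIV_add C1_path_energy(2)[OF CP t'(1)] C1_path_energy(2)[OF CU t'(1)])
    define Px Ux where "Px = (\<lambda>x. wd ?S (p t) x - wd ?S (q t) x)" and "Ux = (\<lambda>x. wd ?S (u t) x - wd ?S (v t) x)"
    have D: "primitive_on {0..1} (P t) Px" "primitive_on {0..1} (U t) Ux"
      using primitive_on_add[OF H1D(1)[OF _ H(1)[OF t'(2)]] primitive_on_cmult[OF H1D(1)[OF _ H(3)[OF t'(2)]], of "-1"]]
        primitive_on_add[OF H1D(1)[OF _ H(2)[OF t'(2)]] primitive_on_cmult[OF H1D(1)[OF _ H(4)[OF t'(2)]], of "-1"]]
      by (auto simp: P_def U_def Px_def Ux_def)
    \<comment> \<open>The cross terms of the energy balance are integrated by parts. The boundary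
      terms vanish because both solutions have the same boundary values of \<open>u\<close>, so only
      the monotone term survives.\<close>
    note parts = primitive_on_by_parts[OF D, simplified]
    have U0: "U t 0 = 0" "U t 1 = 0" using bc[OF t'(2)] by (auto simp: U_def)
    have i: "integrable ?M (\<lambda>x. P t x * Ux x)" "integrable ?M (\<lambda>x. Px x * U t x)"
      using integral_lebesgue_on_Ioo(1) parts(1,2) by blast+
    have "(\<integral>x. P t x * Ux x \<partial>?M) + (\<integral>x. Px x * U t x \<partial>?M) = 0"
      using parts(3) U0 integral_lebesgue_on_Ioo(2)[OF parts(1)] integral_lebesgue_on_Ioo(2)[OF parts(2)] by simp
    moreover have "(\<integral>x. Pt t x * P t x \<partial>?M) = (\<integral>x. - (P t x * Ux x) \<partial>?M)"
    proof (rule integral_cong_AE)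
      show "AE x in ?M. Pt t x * P t x = - (P t x * Ux x)"
        using 1(3)[OF t'(1)] 2(3)[OF t'(1)]
      proof eventually_elim
        case (elim x)
        then have "Pt t x = - Ux x" by (simp add: Pt_def Ux_def)
        then show ?case by simp
      qed
    qed (use L2_mult_integrable[OF L(3,1)] t'(2) i in auto)
    moreover have "(\<integral>x. Ut t x * U t x \<partial>?M) \<le> (\<integral>x. - (Px x * U t x) \<partial>?M)"
    proof (rule integral_mono_AE)
      have "AE x in ?M. x \<in> ?S" by (rule AE_I2) simp
      then show "AE x in ?M. Ut t x * U t x \<le> - (Px x * U t x)"
        using 1(3)[OF t'(1)] 2(3)[OF t'(1)]
      proof eventually_elim
        case (elim x)
        then have e: "Ut t x = - Px x - (f t x (u t x) - f t x (v t x))" by (simp add: Ut_def Px_def)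
        have "Ut t x * U t x = - (Px x * U t x) - (f t x (u t x) - f t x (v t x)) * (u t x - v t x)"
          unfolding e by (simp add: U_def algebra_simps)
        then show ?case using mono[OF t'(1) elim(1), of "u t x" "v t x"] by linarith
      qed
    qed (use L2_mult_integrable[OF L(4,2)] t'(2) i in auto)
    ultimately show "2 * (\<integral>x. Pt t x * P t x \<partial>?M) + 2 * (\<integral>x. Ut t x * U t x \<partial>?M) \<le> 0"
      by simp
  qed
  have "E 0 = 0"
  proof -
    have "(\<integral>x. (P 0 x)\<^sup>2 \<partial>?M) = (\<integral>x. 0 \<partial>?M)" "(\<integral>x. (U 0 x)\<^sup>2 \<partial>?M) = (\<integral>x. 0 \<partial>?M)"
      by (rule Bochner_Integration.integral_cong; use ic in \<open>simp add: P_def U_def\<close>)+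
    then show ?thesis by (simp add: E_def)
  qed
  moreover have "E t \<le> E 0"
  proof (cases "t = 0")
    case False
    then show ?thesis
      using t by (intro DERIV_nonpos_imp_decreasing_open[of 0 t E] dE continuous_on_subset[OF cE]) auto
  qed simp
  moreover have "0 \<le> (\<integral>x. (P t x)\<^sup>2 \<partial>?M)" "0 \<le> (\<integral>x. (U t x)\<^sup>2 \<partial>?M)" by auto
  ultimately have z: "(\<integral>x. (P t x)\<^sup>2 \<partial>?M) \<le> 0" "(\<integral>x. (U t x)\<^sup>2 \<partial>?M) \<le> 0"
    unfolding E_def by linarith+
  have c: "continuous_on {0..1} (P t)" "continuous_on {0..1} (U t)"
    using H[OF t] unfolding P_def U_def H1_def by (auto intro!: continuous_intros)
  show "p t x = q t x" using L2_norm_0_imp_eq_0[OF L(1)[OF t] z(1) _ c(1) x] by (simp add: P_def)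
  show "u t x = v t x" using L2_norm_0_imp_eq_0[OF L(2)[OF t] z(2) _ c(2) x] by (simp add: U_def)
qed

section \<open>Unfolding by reflection\<close>

text \<open>Functions on \<open>{0..1}\<close> are extended to the line by reflection at the integers, evenly as
  \<open>g (zigzag x)\<close> or oddly as \<open>sg x * g (zigzag x)\<close>.\<close>

definition sg :: "real \<Rightarrow> real" where "sg x = sgn (sin (pi * x))"

definition zigzag :: "real \<Rightarrow> real" where "zigzag x = arccos (cos (pi * x)) / pi"

text \<open>\<open>good t x\<close> says that none of \<open>x\<close>, \<open>x - t\<close>, \<open>x + t\<close> is an integer: the characteristics through
  \<open>(t, x)\<close> avoid the corners of the domain, where the time derivative of the solution may jump.\<close>

definition good :: "real \<Rightarrow> real \<Rightarrow> bool" where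
  "good t x \<longleftrightarrow> sin (pi * x) \<noteq> 0 \<and> (cos (pi * t))\<^sup>2 \<noteq> (cos (pi * x))\<^sup>2"

section \<open>Symmetries of the reflection and exceptional points\<close>

lemma sg_bounds: "\<bar>sg x\<bar> \<le> 1"
  by (simp add: sg_def sgn_if)

lemma sg_minus: "sg (- x) = - sg x"
  by (simp add: sg_def)

lemma sin_pi_add_2: "sin (pi * (x + 2)) = sin (pi * x)"
  using sin_periodic[of "pi * x"] by (simp add: algebra_simps)

lemma cos_pi_add_2: "cos (pi * (x + 2)) = cos (pi * x)"
  using cos_periodic[of "pi * x"] by (simp add: algebra_simps)

lemma sg_add_2: "sg (x + 2) = sg x"
  by (simp only: sg_def sin_pi_add_2)

lemma sin_pi_pos: "x \<in> {0<..<1} \<Longrightarrow> 0 < sin (pi * x)"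
  by (intro sin_gt_zero) auto

lemma sg_eq_1: "x \<in> {0<..<1} \<Longrightarrow> sg x = 1"
  using sin_pi_pos[of x] by (simp add: sg_def)

lemma zigzag_minus: "zigzag (- x) = zigzag x"
  by (simp add: zigzag_def)

lemma zigzag_add_2: "zigzag (x + 2) = zigzag x"
  by (simp only: zigzag_def cos_pi_add_2)

lemma zigzag_id: "x \<in> {0..1} \<Longrightarrow> zigzag x = x"
  by (simp add: zigzag_def arccos_cos)

lemma zigzag_range: "zigzag x \<in> {0..1}"
proof -
  have "0 \<le> arccos (cos (pi * x))" "arccos (cos (pi * x)) \<le> pi"
    by (auto intro!: arccos_lbound arccos_ubound)
  then show ?thesis by (auto simp: zigzag_def)
qed

lemma cos_zigzag: "cos (pi * zigzag x) = cos (pi * x)"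
  by (simp add: zigzag_def)

lemma zigzag_interior:
  assumes "sin (pi * x) \<noteq> 0"
  shows "zigzag x \<in> {0<..<1}"
proof -
  have c: "(cos (pi * x))\<^sup>2 \<noteq> 1"
  proof
    assume "(cos (pi * x))\<^sup>2 = 1"
    then have "(sin (pi * x))\<^sup>2 = 0" using sin_cos_squared_add[of "pi * x"] by linarith
    then show False using assms by simp
  qed
  have "zigzag x \<noteq> 0"
  proof
    assume "zigzag x = 0"
    then show False using cos_zigzag[of x] c by simp
  qed
  moreover have "zigzag x \<noteq> 1"
  proof
    assume "zigzag x = 1"
    then show False using cos_zigzag[of x] c by (metis cos_pi mult.right_neutral power_minus1_even power2_minus one_power2)
  qed
  ultimately show ?thesis using zigzag_range[of x] by auto
qed

lemma continuous_on_zigzag: "continuous_on S zigzag"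
proof -
  have "continuous_on S (\<lambda>x. arccos (cos (pi * x)))"
    by (rule continuous_on_compose2[OF continuous_on_arccos']) (auto intro!: continuous_intros)
  then show ?thesis unfolding zigzag_def by (auto intro!: continuous_intros)
qed

lemma isCont_zigzag: "isCont zigzag x"
  using continuous_on_zigzag[of UNIV] by (simp add: continuous_on_eq_continuous_at)

lemma isCont_sg: "sin (pi * x) \<noteq> 0 \<Longrightarrow> isCont sg x"
  unfolding sg_def by (intro continuous_sgn continuous_intros) auto

lemma borel_measurable_zigzag: "zigzag \<in> borel_measurable borel"
  by (rule borel_measurable_continuous_onI[OF continuous_on_zigzag])

lemma borel_measurable_sg: "sg \<in> borel_measurable borel"
  unfolding sg_def by measurable

lemma good_zigzag: "good t (zigzag x) \<longleftrightarrow> good t x"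
proof -
  have "(sin (pi * zigzag x))\<^sup>2 = (sin (pi * x))\<^sup>2"
    using sin_cos_squared_add[of "pi * zigzag x"] sin_cos_squared_add[of "pi * x"] unfolding cos_zigzag by linarith
  then have "sin (pi * zigzag x) = 0 \<longleftrightarrow> sin (pi * x) = 0"
    by (metis power2_eq_iff zero_eq_power2)
  then show ?thesis by (simp add: good_def cos_zigzag)
qed

lemma good_minus: "good t (- x) \<longleftrightarrow> good t x"
  by (simp add: good_def)

lemma sin_mult_eq_cos_diff: "sin (a - b) * sin (a + b) = (cos b)\<^sup>2 - (cos (a::real))\<^sup>2"
proof -
  have "sin (a - b) * sin (a + b) = (sin a)\<^sup>2 * (cos b)\<^sup>2 - (cos a)\<^sup>2 * (sin b)\<^sup>2"
    by (simp add: sin_diff sin_add power2_eq_square algebra_simps)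
  also have "\<dots> = (cos b)\<^sup>2 - (cos a)\<^sup>2"
    by (simp add: sin_squared_eq algebra_simps)
  finally show ?thesis .
qed

text \<open>The product formula turns the inequality of squared cosines into two conditions on
  \<open>x - t\<close> and \<open>x + t\<close>. In the cosine form of the definition the invariance
  under reflection is immediate.\<close>

lemma good_iff: "good t x \<longleftrightarrow> sin (pi * x) \<noteq> 0 \<and> sin (pi * (x - t)) \<noteq> 0 \<and> sin (pi * (x + t)) \<noteq> 0"
  using sin_mult_eq_cos_diff[of "pi * x" "pi * t"] by (auto simp: good_def algebra_simps)

lemma sin_pi_eq_0: "sin (pi * x) = 0 \<longleftrightarrow> x \<in> \<int>"
proof -
  have "sin (pi * x) = 0 \<longleftrightarrow> (\<exists>i::int. pi * x = of_int i * pi)" by (simp add: sin_zero_iff_int2)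
  also have "\<dots> \<longleftrightarrow> x \<in> \<int>" by (auto simp: Ints_def)
  finally show ?thesis .
qed

text \<open>An injective affine map sends a bounded interval into a bounded range, which contains
  finitely many integers.\<close>

lemma finite_affine_Ints:
  fixes c d :: real
  assumes "c \<noteq> 0"
  shows "finite {x \<in> {a..b}. c * x + d \<in> \<int>}"
proof -
  define R where "R = \<bar>c\<bar> * (\<bar>a\<bar> + \<bar>b\<bar>) + \<bar>d\<bar>"
  have "finite {k \<in> \<int>. - R \<le> k \<and> k \<le> R}" by (rule finite_int_segment)
  then have "finite ((\<lambda>x. c * x + d) -` {k \<in> \<int>. - R \<le> k \<and> k \<le> R})"
    by (rule finite_vimageI) (use assms in \<open>auto simp: inj_def\<close>)
  moreover have "{x \<in> {a..b}. c * x + d \<in> \<int>} \<subseteq> (\<lambda>x. c * x + d) -` {k \<in> \<int>. - R \<le> k \<and> k \<le> R}"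
  proof
    fix x assume x: "x \<in> {x \<in> {a..b}. c * x + d \<in> \<int>}"
    then have "\<bar>x\<bar> \<le> \<bar>a\<bar> + \<bar>b\<bar>" by auto
    then have "\<bar>c\<bar> * \<bar>x\<bar> \<le> \<bar>c\<bar> * (\<bar>a\<bar> + \<bar>b\<bar>)" by (rule mult_left_mono) auto
    then have "\<bar>c * x + d\<bar> \<le> R" 
      unfolding R_def using abs_triangle_ineq[of "c * x" d] abs_mult[of c x] by linarith
    then show "x \<in> (\<lambda>x. c * x + d) -` {k \<in> \<int>. - R \<le> k \<and> k \<le> R}" using x by auto
  qed
  ultimately show ?thesis by (rule finite_subset[rotated])
qed

lemma finite_bad_x: "finite {x \<in> {a..b}. \<not> good t x}"
proof -
  have "{x \<in> {a..b}. \<not> good t x} \<subseteq> {x \<in> {a..b}. 1 * x + 0 \<in> \<int>} \<union> {x \<in> {a..b}. 1 * x + (- t) \<in> \<int>} \<union> {x \<in> {a..b}. 1 * x + t \<in> \<int>}"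
    by (auto simp: good_iff sin_pi_eq_0)
  then show ?thesis by (rule finite_subset) (intro finite_UnI finite_affine_Ints; simp)
qed

lemma finite_bad_t:
  assumes "sin (pi * x) \<noteq> 0"
  shows "finite {t \<in> {a..b}. \<not> good t x}"
proof -
  have "{t \<in> {a..b}. \<not> good t x} \<subseteq> {t \<in> {a..b}. (-1) * t + x \<in> \<int>} \<union> {t \<in> {a..b}. 1 * t + x \<in> \<int>}"
  proof
    fix t assume t: "t \<in> {t \<in> {a..b}. \<not> good t x}"
    then have "x - t \<in> \<int> \<or> x + t \<in> \<int>" using assms by (simp add: good_iff sin_pi_eq_0)
    moreover have "(-1) * t + x = x - t" "1 * t + x = x + t" by auto
    ultimately show "t \<in> {t \<in> {a..b}. (-1) * t + x \<in> \<int>} \<union> {t \<in> {a..b}. 1 * t + x \<in> \<int>}"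
      using t by (metis (no_types, lifting) UnI1 UnI2 mem_Collect_eq)
  qed
  then show ?thesis by (rule finite_subset) (intro finite_UnI finite_affine_Ints; simp)
qed

lemma AE_affine_not_Ints:
  fixes c d :: real
  assumes "c \<noteq> 0"
  shows "AE s in lborel. c * s + d \<notin> \<int>"
proof -
  have "{s. c * s + d \<in> \<int>} \<subseteq> (\<lambda>i::int. (of_int i - d) / c) ` UNIV"
    using assms by (auto simp: Ints_def image_iff field_simps)
  then have "countable {s. c * s + d \<in> \<int>}" by (rule countable_subset) auto
  then show ?thesis by (intro AE_not_in[of "{s. c * s + d \<in> \<int>}", simplified] countable_imp_null_set_lborel)
qed

text \<open>Along \<open>x = \<xi> + s\<close> the difference \<open>x - s\<close> stays at
  \<open>\<xi>\<close>; only \<open>\<xi> + s\<close> and \<open>\<xi> + 2 * s\<close> can become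
  integers, for countably many \<open>s\<close>.\<close>

lemma AE_good_char:
  assumes "sin (pi * \<xi>) \<noteq> 0"
  shows "AE s in lborel. good s (\<xi> + s)"
proof -
  have "AE s in lborel. 1 * s + \<xi> \<notin> \<int>" "AE s in lborel. 2 * s + \<xi> \<notin> \<int>"
    by (rule AE_affine_not_Ints; simp)+
  then show ?thesis
  proof eventually_elim
    case (elim s)
    have "\<xi> + s + s = 2 * s + \<xi>" by simp
    then show ?case using elim assms by (auto simp: good_iff sin_pi_eq_0 add.commute)
  qed
qed

lemma AE_sin_pi: "c \<noteq> 0 \<Longrightarrow> AE s in lborel. sin (pi * (c * s + d)) \<noteq> 0"
  using AE_affine_not_Ints[of c d] by (simp add: sin_pi_eq_0)

section \<open>Time integrals of bounded Borel functions\<close>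

text \<open>The cutoff on the whole line makes this 0 for \<open>t \<le> 0\<close>, insensitive to
  the values of \<open>h\<close> at the end times, and directly accessible to Fubini and dominated
  convergence.\<close>

definition tint :: "real \<Rightarrow> (real \<Rightarrow> real) \<Rightarrow> real" where
  "tint t h = (\<integral>s. (if 0 < s \<and> s < t then h s else 0) \<partial>lborel)"

lemma tint_cong: "(\<And>s. 0 < s \<Longrightarrow> s < t \<Longrightarrow> h s = g s) \<Longrightarrow> tint t h = tint t g"
  unfolding tint_def by (rule Bochner_Integration.integral_cong) auto

lemma tint_nonpos: "t \<le> 0 \<Longrightarrow> tint t h = 0"
  unfolding tint_def by (subst Bochner_Integration.integral_cong[where g="\<lambda>_. 0"]) auto

lemma integrable_bounded_support:
  fixes h :: "real \<Rightarrow> real"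
  assumes m: "h \<in> borel_measurable borel" and b: "\<And>s. 0 < s \<Longrightarrow> s < t \<Longrightarrow> \<bar>h s\<bar> \<le> B"
  shows "integrable lborel (\<lambda>s. if 0 < s \<and> s < t then h s else 0)"
proof (rule integrableI_bounded_set[where A="{0..t}" and B="B"])
  show "(\<lambda>s. if 0 < s \<and> s < t then h s else 0) \<in> borel_measurable lborel" using m by measurable
  show "emeasure lborel {0..t} < \<infinity>" by (cases "0 \<le> t") auto
  have "norm (if 0 < s \<and> s < t then h s else 0) \<le> B" if "s \<in> {0..t}" "0 < t" for s
    using b[of s] b[of "t/2"] that by (auto intro: order_trans[OF abs_ge_zero])
  then show "AE s in lborel. s \<in> {0..t} \<longrightarrow> norm (if 0 < s \<and> s < t then h s else 0) \<le> B"
  proof (cases "0 < t")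
    case False
    have "AE s in lborel. s \<noteq> 0" by (rule AE_lborel_singleton)
    then show ?thesis by eventually_elim (use False in auto)
  qed (auto intro!: AE_I2)
qed auto

lemma tint_add:
  assumes "h \<in> borel_measurable borel" "\<And>s. 0 < s \<Longrightarrow> s < t \<Longrightarrow> \<bar>h s\<bar> \<le> B"
    and "g \<in> borel_measurable borel" "\<And>s. 0 < s \<Longrightarrow> s < t \<Longrightarrow> \<bar>g s\<bar> \<le> C"
  shows "tint t (\<lambda>s. h s + g s) = tint t h + tint t g"
proof -
  have "tint t (\<lambda>s. h s + g s) = (\<integral>s. (if 0 < s \<and> s < t then h s else 0) + (if 0 < s \<and> s < t then g s else 0) \<partial>lborel)"
    unfolding tint_def by (rule Bochner_Integration.integral_cong) auto
  then show ?thesis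
    using integrable_bounded_support[OF assms(1,2)] integrable_bounded_support[OF assms(3,4)]
    by (simp add: tint_def)
qed

lemma tint_cmult: "tint t (\<lambda>s. c * h s) = c * tint t h"
proof -
  have "tint t (\<lambda>s. c * h s) = (\<integral>s. c * (if 0 < s \<and> s < t then h s else 0) \<partial>lborel)"
    unfolding tint_def by (rule Bochner_Integration.integral_cong) auto
  then show ?thesis by (simp add: tint_def)
qed

lemma tint_diff:
  assumes "h \<in> borel_measurable borel" "\<And>s. 0 < s \<Longrightarrow> s < t \<Longrightarrow> \<bar>h s\<bar> \<le> B"
    and "g \<in> borel_measurable borel" "\<And>s. 0 < s \<Longrightarrow> s < t \<Longrightarrow> \<bar>g s\<bar> \<le> C"
  shows "tint t (\<lambda>s. h s - g s) = tint t h - tint t g"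
  using tint_add[OF assms(1,2), where g="\<lambda>s. (-1) * g s" and C=C] tint_cmult[of t "-1" g] assms(3,4) by simp

lemma tint_primitive:
  assumes m: "h \<in> borel_measurable borel" and b: "\<And>s. 0 < s \<Longrightarrow> s < T \<Longrightarrow> \<bar>h s\<bar> \<le> B"
  shows "primitive_on {0..T} (\<lambda>t. tint t h) h"
  unfolding primitive_on_def
proof (intro ballI impI conjI)
  fix x y assume xy: "x \<in> {0..T}" "y \<in> {0..T}" "x \<le> y"
  let ?h = "\<lambda>t s. if 0 < s \<and> s < t then h s else 0"
  have hi: "(h has_integral tint t h) {0..t}" if t: "t \<in> {0..T}" for t
  proof -
    have "integrable lborel (?h t)" 
      by (rule integrable_bounded_support[OF m, of _ B]) (use b t in auto)
    then have "(?h t has_integral tint t h) UNIV"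
      unfolding tint_def by (rule has_integral_integral_lborel)
    then have "((\<lambda>s. if s \<in> {0<..<t} then h s else 0) has_integral tint t h) UNIV" by simp
    then have "(h has_integral tint t h) {0<..<t}" by (simp only: has_integral_restrict_UNIV)
    then show ?thesis by (simp add: has_integral_Icc_iff_Ioo)
  qed
  have aT: "h absolutely_integrable_on {0..T}"
  proof -
    have "integrable lborel (?h T)" using integrable_bounded_support[OF m b] .
    then have "integrable lebesgue (?h T)" by (simp add: integrable_completion borel_measurable_integrable)
    then have "set_integrable lebesgue {0<..<T} h"
      unfolding set_integrable_def by (rule Bochner_Integration.integrable_cong[THEN iffD1, rotated -1]) (auto simp: indicator_def)
    then show ?thesis by (simp add: absolutely_integrable_on_Icc_iff_Ioo)
  qed
  have "h absolutely_integrable_on {x..y}"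
    by (rule absolutely_integrable_on_subinterval[OF aT]) (use xy in auto)
  then show i: "integrable (lebesgue_on {x..y}) h" by (rule absolutely_integrable_imp_integrable) auto
  have "integral {0..x} h + integral {x..y} h = integral {0..y} h"
    by (rule Henstock_Kurzweil_Integration.integral_combine) (use xy hi[of y] in auto)
  then show "tint y h - tint x h = integral {x..y} h"
    using hi[of x] hi[of y] xy by (simp add: integral_unique)
qed

lemma tint_mono_bound:
  assumes g: "integrable lborel (\<lambda>s. if 0 < s \<and> s < t then g s else 0)"
    and b: "\<And>s. 0 < s \<Longrightarrow> s < t \<Longrightarrow> \<bar>h s\<bar> \<le> g s"
  shows "\<bar>tint t h\<bar> \<le> tint t g"
proof -
  have "\<bar>tint t h\<bar> \<le> (\<integral>s. \<bar>if 0 < s \<and> s < t then h s else 0\<bar> \<partial>lborel)"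
    unfolding tint_def using integral_norm_bound[of lborel "\<lambda>s. if 0 < s \<and> s < t then h s else 0"] by simp
  also have "\<dots> \<le> tint t g"
    unfolding tint_def by (rule integral_mono'[OF g]) (use b in \<open>auto intro: order_trans[OF abs_ge_zero]\<close>)
  finally show ?thesis .
qed

lemma tint_continuous_eq:
  assumes "0 \<le> t" "\<And>x. (G has_real_derivative g x) (at x)" "continuous_on UNIV g"
  shows "tint t g = G t - G 0"
proof -
  have c: "continuous_on {0..t} g" by (rule continuous_on_subset[OF assms(3)]) simp
  then have "bounded (g ` {0..t})" by (intro compact_imp_bounded compact_continuous_image) auto
  then obtain B where B: "\<And>x. x \<in> {0..t} \<Longrightarrow> \<bar>g x\<bar> \<le> B"
    unfolding bounded_iff by (metis imageI real_norm_def)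
  have m: "g \<in> borel_measurable borel" by (rule borel_measurable_continuous_onI[OF assms(3)])
  have p: "primitive_on {0..t} (\<lambda>t. tint t g) g" by (rule tint_primitive[OF m, of _ B]) (use B in auto)
  have "tint t g - G t = tint 0 g - G 0"
    by (rule primitive_on_eq_diff[OF p primitive_on_C1[OF assms(2,3)]]) (use assms(1) in auto)
  then show ?thesis by (simp add: tint_nonpos)
qed

text \<open>Integrating the weight \<open>exp (l * s)\<close> gains a factor \<open>1 / l\<close>.
  The contraction and Gronwall arguments below consist in choosing \<open>l\<close> large
  enough.\<close>

lemma tint_exp_bound:
  assumes t: "0 \<le> t" and l: "l > 0" and M: "0 \<le> M"
    and b: "\<And>s. 0 < s \<Longrightarrow> s < t \<Longrightarrow> \<bar>h s\<bar> \<le> D + M * exp (l * s)"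
  shows "\<bar>tint t h\<bar> \<le> D * t + M * exp (l * t) / l"
proof -
  let ?g = "\<lambda>s. D + M * exp (l * s)"
  have "\<bar>tint t h\<bar> \<le> tint t ?g"
  proof (rule tint_mono_bound[OF integrable_bounded_support b])
    show "\<bar>?g s\<bar> \<le> \<bar>D\<bar> + M * exp (l * t)" if "0 < s" "s < t" for s
    proof -
      have "M * exp (l * s) \<le> M * exp (l * t)" using that l M by (intro mult_left_mono) auto
      moreover have "0 \<le> M * exp (l * s)" using M by simp
      ultimately show ?thesis by linarith
    qed
  qed auto
  also have "tint t ?g = (D * t + M * exp (l * t) / l) - (D * 0 + M * exp (l * 0) / l)"
    by (rule tint_continuous_eq[OF t]) (use l in \<open>auto intro!: derivative_eq_intros continuous_intros\<close>)
  also have "\<dots> \<le> D * t + M * exp (l * t) / l" using M l by simp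
  finally show ?thesis .
qed

lemma tint_bound:
  assumes t: "0 \<le> t" and b: "\<And>s. 0 < s \<Longrightarrow> s < t \<Longrightarrow> \<bar>h s\<bar> \<le> D"
  shows "\<bar>tint t h\<bar> \<le> D * t"
proof -
  have "\<bar>tint t h\<bar> \<le> D * t + 0 * exp (1 * t) / 1"
    by (rule tint_exp_bound[OF t]) (use b in auto)
  then show ?thesis by simp
qed

section \<open>Continuity and measurability of integrals with a parameter\<close>

lemma isCont_integral_param:
  fixes k :: "'p::metric_space \<Rightarrow> real \<Rightarrow> real"
  assumes m: "\<And>p. k p \<in> borel_measurable borel"
    and U: "open U" "p0 \<in> U" and b: "\<And>p s. p \<in> U \<Longrightarrow> \<bar>k p s\<bar> \<le> (if s \<in> {0..T} then B else 0)"
    and c: "AE s in lborel. isCont (\<lambda>p. k p s) p0"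
  shows "isCont (\<lambda>p. \<integral>s. k p s \<partial>lborel) p0"
  unfolding continuous_at_sequentially
proof (intro allI impI)
  fix p assume p: "p \<longlonglongrightarrow> p0"
  then have "eventually (\<lambda>n. p n \<in> U) sequentially" using U by (simp add: topological_tendstoD)
  then obtain N where N: "\<And>n. n \<ge> N \<Longrightarrow> p n \<in> U" by (auto simp: eventually_sequentially)
  have w: "integrable lborel (\<lambda>s. if s \<in> {0..T} then B else 0)"
  proof -
    have "integrable lborel (\<lambda>s. indicator {0..T} s *\<^sub>R B)" 
      by (intro integrable_real_indicator integrable_scaleR_left) (auto simp: emeasure_lborel_Icc_eq)
    then show ?thesis by (rule Bochner_Integration.integrable_cong[THEN iffD1, rotated -1]) (auto simp: indicator_def)
  qed
  have "(\<lambda>n. \<integral>s. k (p (n + N)) s \<partial>lborel) \<longlonglongrightarrow> (\<integral>s. k p0 s \<partial>lborel)"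
  proof (rule integral_dominated_convergence[OF _ _ w])
    show "AE s in lborel. (\<lambda>n. k (p (n + N)) s) \<longlonglongrightarrow> k p0 s"
      using c
    proof eventually_elim
      case (elim s)
      show ?case by (rule isCont_tendsto_compose[OF elim]) (rule LIMSEQ_ignore_initial_segment[OF p])
    qed
    show "AE s in lborel. norm (k (p (n + N)) s) \<le> (if s \<in> {0..T} then B else 0)" for n
      using b[OF N[of "n + N"]] by (intro AE_I2) simp
  qed (use m in auto)
  then show "((\<lambda>p. \<integral>s. k p s \<partial>lborel) \<circ> p) \<longlonglongrightarrow> (\<integral>s. k p0 s \<partial>lborel)"
    unfolding o_def by (rule LIMSEQ_offset)
qed

text \<open>Joint Borel measurability of a curried function; it passes to Borel substitutions and to
  integrals with a parameter, whereas measurability of the sections would not.\<close>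

definition bmeas2 :: "(real \<Rightarrow> real \<Rightarrow> real) \<Rightarrow> bool" where
  "bmeas2 z \<longleftrightarrow> (\<lambda>p. z (fst p) (snd p)) \<in> borel_measurable borel"

definition bmeas3 :: "(real \<Rightarrow> real \<Rightarrow> real \<Rightarrow> real) \<Rightarrow> bool" where
  "bmeas3 f \<longleftrightarrow> (\<lambda>p. f (fst p) (fst (snd p)) (snd (snd p))) \<in> borel_measurable borel"

lemma bmeas2_comp:
  assumes "bmeas2 z" "a \<in> borel_measurable M" "b \<in> borel_measurable M"
  shows "(\<lambda>x. z (a x) (b x)) \<in> borel_measurable M"
  using measurable_compose[OF borel_measurable_Pair[OF assms(2,3)] assms(1)[unfolded bmeas2_def]] by simp

lemma bmeas3_comp:
  assumes "bmeas3 f" "a \<in> borel_measurable M" "b \<in> borel_measurable M" "c \<in> borel_measurable M"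
  shows "(\<lambda>x. f (a x) (b x) (c x)) \<in> borel_measurable M"
  using measurable_compose[OF borel_measurable_Pair[OF assms(2) borel_measurable_Pair[OF assms(3,4)]] assms(1)[unfolded bmeas3_def]]
  by simp

lemma fst_snd_borel:
  "(\<lambda>p::real \<times> real. fst p) \<in> borel_measurable borel" "(\<lambda>p::real \<times> real. snd p) \<in> borel_measurable borel"
  by (intro borel_measurable_continuous_onI continuous_intros)+

lemma measurable_tint:
  assumes \<tau>: "\<tau> \<in> borel_measurable N" and k: "(\<lambda>q. k (fst q) (snd q)) \<in> borel_measurable (N \<Otimes>\<^sub>M lborel)"
  shows "(\<lambda>p. tint (\<tau> p) (k p)) \<in> borel_measurable N"
proof -
  have "(\<lambda>q. snd q) \<in> borel_measurable (N \<Otimes>\<^sub>M lborel)" by measurable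
  moreover have "(\<lambda>q. \<tau> (fst q)) \<in> borel_measurable (N \<Otimes>\<^sub>M lborel)"
    using measurable_compose[OF measurable_fst \<tau>] .
  ultimately have "(\<lambda>q. if 0 < snd q \<and> snd q < \<tau> (fst q) then k (fst q) (snd q) else 0) \<in> borel_measurable (N \<Otimes>\<^sub>M lborel)"
    using k by measurable
  then have "case_prod (\<lambda>p s. if 0 < s \<and> s < \<tau> p then k p s else 0) \<in> borel_measurable (N \<Otimes>\<^sub>M lborel)"
    by (simp add: case_prod_beta')
  then show ?thesis unfolding tint_def by (rule lborel.borel_measurable_lebesgue_integral)
qed

text \<open>Near \<open>p0\<close> the cutoff is constant in \<open>p\<close> unless
  \<open>s\<close> is exactly the upper limit \<open>\<tau> p0\<close>; that single \<open>s\<close>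
  is excluded.\<close>

lemma isCont_if_lt:
  assumes ne: "s \<noteq> \<tau> p0" and \<tau>: "isCont \<tau> p0" and g: "0 < s \<Longrightarrow> s < \<tau> p0 \<Longrightarrow> isCont g p0"
  shows "isCont (\<lambda>p. if 0 < s \<and> s < (\<tau> p :: real) then g p else (0::real)) p0"
proof (cases "0 < s \<and> s < \<tau> p0")
  case True
  have "eventually (\<lambda>p. s < \<tau> p) (at p0)"
    using \<tau> True unfolding isCont_def by (intro order_tendstoD(1)[of \<tau>]) auto
  then have "eventually (\<lambda>p. (if 0 < s \<and> s < \<tau> p then g p else 0) = g p) (at p0)"
    by (rule eventually_mono) (use True in auto)
  then show ?thesis
    using g True unfolding isCont_def by (simp add: tendsto_cong)
next
  case False
  have "eventually (\<lambda>p. \<not> (0 < s \<and> s < \<tau> p)) (at p0)"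
  proof (cases "0 < s")
    case True
    then have "\<tau> p0 < s" using False ne by auto
    then have "eventually (\<lambda>p. \<tau> p < s) (at p0)"
      using \<tau> unfolding isCont_def by (intro order_tendstoD(2)[of \<tau>]) auto
    then show ?thesis by (rule eventually_mono) auto
  qed auto
  then have "eventually (\<lambda>p. (if 0 < s \<and> s < \<tau> p then g p else 0) = 0) (at p0)"
    by (rule eventually_mono) auto
  then show ?thesis using False unfolding isCont_def by (simp add: tendsto_cong if_not_P)
qed

lemma isCont_tint:
  fixes k :: "'p::metric_space \<Rightarrow> real \<Rightarrow> real"
  assumes m: "\<And>p. k p \<in> borel_measurable borel"
    and U: "open U" "p0 \<in> U" and b: "\<And>p s. p \<in> U \<Longrightarrow> 0 < s \<Longrightarrow> s < \<tau> p \<Longrightarrow> \<bar>k p s\<bar> \<le> B"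
    and \<tau>: "\<And>p. p \<in> U \<Longrightarrow> \<tau> p \<le> T" "isCont \<tau> p0" and B: "0 \<le> B"
    and c: "AE s in lborel. 0 < s \<longrightarrow> s < \<tau> p0 \<longrightarrow> isCont (\<lambda>p. k p s) p0"
  shows "isCont (\<lambda>p. tint (\<tau> p) (k p)) p0"
  unfolding tint_def
proof (rule isCont_integral_param[OF _ U, where B=B and T=T])
  show "(\<lambda>s. if 0 < s \<and> s < \<tau> p then k p s else 0) \<in> borel_measurable borel" for p
    using m[of p] by measurable
  show "\<bar>if 0 < s \<and> s < \<tau> p then k p s else 0\<bar> \<le> (if s \<in> {0..T} then B else 0)" if "p \<in> U" for p s
    using b[OF that, of s] \<tau>(1)[OF that] B by auto
  show "AE s in lborel. isCont (\<lambda>p. if 0 < s \<and> s < \<tau> p then k p s else 0) p0"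
    using c AE_lborel_singleton[of "\<tau> p0"]
  proof eventually_elim
    case (elim s)
    show ?case by (rule isCont_if_lt[OF _ \<tau>(2)]) (use elim in auto)
  qed
qed

text \<open>Recovers a function that vanishes at time 0 from its time derivative
  \<open>z\<close>.\<close>

definition V :: "(real \<Rightarrow> real \<Rightarrow> real) \<Rightarrow> real \<Rightarrow> real \<Rightarrow> real" where
  "V z t x = tint t (\<lambda>s. z s x)"

text \<open>For the unfolded invariant this is the velocity up to the lift. It vanishes at 0, and
  also at 1 once \<open>v\<close> has period 2.\<close>

definition odd_part :: "(real \<Rightarrow> real \<Rightarrow> real) \<Rightarrow> real \<Rightarrow> real \<Rightarrow> real" where
  "odd_part v t y = (v t y - v t (- y)) / 2"

lemma odd_part_bound:
  assumes "\<bar>v t y\<bar> \<le> B" "\<bar>v t (- y)\<bar> \<le> B"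
  shows "\<bar>odd_part v t y\<bar> \<le> B"
proof -
  have "\<bar>v t y - v t (- y)\<bar> \<le> 2 * B" using assms by linarith
  then show ?thesis by (simp add: odd_part_def)
qed

lemma odd_part_diff: "odd_part v t y - odd_part w t y = odd_part (\<lambda>t x. v t x - w t x) t y"
  unfolding odd_part_def by (simp add: field_simps)

lemma bmeas2_V: "bmeas2 z \<Longrightarrow> bmeas2 (V z)"
  unfolding bmeas2_def[of "V z"] V_def
proof (rule measurable_tint[OF fst_snd_borel(1)])
  assume z: "bmeas2 z"
  have "(\<lambda>q::(real \<times> real) \<times> real. snd (fst q)) \<in> borel_measurable (borel \<Otimes>\<^sub>M lborel)"
    by (rule measurable_compose[OF measurable_fst fst_snd_borel(2)])
  moreover have "(\<lambda>q::(real \<times> real) \<times> real. snd q) \<in> borel_measurable (borel \<Otimes>\<^sub>M lborel)" by measurable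
  ultimately show "(\<lambda>q::(real \<times> real) \<times> real. z (snd q) (snd (fst q))) \<in> borel_measurable (borel \<Otimes>\<^sub>M lborel)"
    by (intro bmeas2_comp[OF z])
qed

lemma bmeas2_odd_part: "bmeas2 v \<Longrightarrow> bmeas2 (odd_part v)"
  unfolding bmeas2_def[of "odd_part v"] odd_part_def
  by (intro borel_measurable_divide borel_measurable_diff bmeas2_comp[of v] fst_snd_borel borel_measurable_uminus borel_measurable_const)

lemma bmeas2_sections:
  assumes "bmeas2 z"
  shows "(\<lambda>s. z s x) \<in> borel_measurable borel" "(\<lambda>x. z t x) \<in> borel_measurable borel"
    "(\<lambda>s. z s (c + s)) \<in> borel_measurable borel"
proof -
  show "(\<lambda>s. z s x) \<in> borel_measurable borel" by (intro bmeas2_comp[OF assms]) auto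
  show "(\<lambda>x. z t x) \<in> borel_measurable borel" by (intro bmeas2_comp[OF assms]) auto
  show "(\<lambda>s. z s (c + s)) \<in> borel_measurable borel" by (intro bmeas2_comp[OF assms]) auto
qed

text \<open>The open time strip without the lines where \<open>x - t\<close> is an integer, on which
  the time derivative may jump. Since the set is open, continuity on it is continuity at each of its
  points.\<close>

definition offchar :: "real \<Rightarrow> (real \<times> real) set" where
  "offchar T = {p. 0 < fst p \<and> fst p < T \<and> sin (pi * (snd p - fst p)) \<noteq> 0}"

lemma open_offchar: "open (offchar T)"
  unfolding offchar_def by (intro open_Collect_conj open_Collect_less open_Collect_neq continuous_intros)

lemma isCont_offchar:
  assumes "continuous_on (offchar T) (\<lambda>p. z (fst p) (snd p))" "0 < t" "t < T" "sin (pi * (x - t)) \<noteq> 0"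
  shows "isCont (\<lambda>p. z (fst p) (snd p)) (t, x)"
proof -
  have "(t, x) \<in> offchar T" using assms(2-4) by (simp add: offchar_def)
  then show ?thesis using assms(1) continuous_on_eq_continuous_at[OF open_offchar] by blast
qed

lemma isCont_comp2:
  assumes "isCont (\<lambda>p. z (fst p) (snd p)) (a p0, b p0)" "isCont a p0" "isCont b p0"
  shows "isCont (\<lambda>p. z (a p) (b p)) p0"
  using isCont_o2[OF continuous_Pair[OF assms(2,3)] assms(1)] by simp

lemma isCont_comp3:
  assumes "isCont (\<lambda>p. z (fst p) (fst (snd p)) (snd (snd p))) (a p0, b p0, c p0)" "isCont a p0" "isCont b p0" "isCont c p0"
  shows "isCont (\<lambda>p. z (a p) (b p) (c p)) p0"
  using isCont_o2[OF continuous_Pair[OF assms(2) continuous_Pair[OF assms(3,4)]] assms(1)] by simp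

text \<open>At fixed \<open>x\<close> the excluded lines are met at countably many times, so
  integration in time removes the jumps and \<open>V z\<close> is continuous at every point with
  interior time.\<close>

lemma isCont_V:
  assumes z: "bmeas2 z" and b: "\<And>s x. 0 < s \<Longrightarrow> s < T \<Longrightarrow> \<bar>z s x\<bar> \<le> R" and c: "continuous_on (offchar T) (\<lambda>p. z (fst p) (snd p))"
    and t: "0 < t" "t < T"
  shows "isCont (\<lambda>p. V z (fst p) (snd p)) (t, x)"
  unfolding V_def
proof (rule isCont_tint[where U="{p. fst p < T}" and B=R and T=T])
  show "open {p::real\<times>real. fst p < T}" by (intro open_Collect_less continuous_intros)
  show "0 \<le> R" using b[OF t, of 0] by linarith
  have "AE s in lborel. sin (pi * (-1 * s + x)) \<noteq> 0" by (rule AE_sin_pi) simp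
  then show "AE s in lborel. 0 < s \<longrightarrow> s < fst (t, x) \<longrightarrow> isCont (\<lambda>p::real\<times>real. z s (snd p)) (t, x)"
  proof eventually_elim
    case (elim s)
    show ?case
    proof (intro impI)
      assume s: "0 < s" "s < fst (t, x)"
      have zs: "isCont (\<lambda>p. z (fst p) (snd p)) (s, x)"
        by (rule isCont_offchar[OF c]) (use s t elim in \<open>auto simp: algebra_simps\<close>)
      show "isCont (\<lambda>p::real\<times>real. z s (snd p)) (t, x)"
        by (rule isCont_comp2[where a="\<lambda>_. s" and b=snd]) (use zs in simp_all)
    qed
  qed
qed (use t b bmeas2_sections[OF z] in \<open>auto intro!: continuous_intros\<close>)

lemma isCont_odd_part:
  assumes "isCont (\<lambda>p. v (fst p) (snd p)) (t, y)" "isCont (\<lambda>p. v (fst p) (snd p)) (t, - y)"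
  shows "isCont (\<lambda>p. odd_part v (fst p) (snd p)) (t, y)"
  unfolding odd_part_def
proof (intro continuous_intros assms)
  show "isCont (\<lambda>p. v (fst p) (- snd p)) (t, y)"
    by (rule isCont_comp2[where a=fst and b="\<lambda>p. - snd p"]) (use assms in \<open>auto intro!: continuous_intros\<close>)
qed auto

text \<open>Increments dominated by a geometric sequence are summable; the explicit tail bound is
  what later yields uniform convergence of the iterates.\<close>

lemma geometric_limit:
  fixes X :: "nat \<Rightarrow> real"
  assumes d: "\<And>n. \<bar>X (Suc n) - X n\<bar> \<le> c * (1/2) ^ n"
  shows "X \<longlonglongrightarrow> lim X" "\<bar>lim X - X n\<bar> \<le> 2 * c * (1/2) ^ n"
proof -
  have c0: "0 \<le> c" using d[of 0] by (auto intro: order_trans[OF abs_ge_zero])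
  have step: "\<bar>X (n + k) - X n\<bar> \<le> 2 * c * (1/2) ^ n * (1 - (1/2) ^ k)" for n k
  proof (induction k)
    case (Suc k)
    have "\<bar>X (n + Suc k) - X n\<bar> \<le> \<bar>X (Suc (n + k)) - X (n + k)\<bar> + \<bar>X (n + k) - X n\<bar>" by simp
    also have "\<dots> \<le> c * (1/2) ^ (n + k) + 2 * c * (1/2) ^ n * (1 - (1/2) ^ k)"
      using d[of "n + k"] Suc by linarith
    also have "\<dots> = 2 * c * (1/2) ^ n * (1 - (1/2) ^ Suc k)"
      by (simp add: power_add algebra_simps)
    finally show ?case .
  qed simp
  have bd: "\<bar>X (n + k) - X n\<bar> \<le> 2 * c * (1/2) ^ n" for n k
  proof -
    have "2 * c * (1/2) ^ n * (1 - (1/2) ^ k) \<le> 2 * c * (1/2) ^ n"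
      using c0 by (intro mult_left_le) auto
    then show ?thesis using step[of n k] by linarith
  qed
  have "Cauchy X"
  proof (rule CauchyI')
    fix e :: real assume e: "0 < e"
    have "(\<lambda>n. 2 * c * (1/2) ^ n) \<longlonglongrightarrow> 2 * c * 0" by (intro tendsto_intros LIMSEQ_realpow_zero) auto
    then have "eventually (\<lambda>n. 2 * c * (1/2) ^ n < e) sequentially" using e by (intro order_tendstoD) auto
    then obtain M where M: "2 * c * (1/2) ^ n < e" if "n \<ge> M" for n by (auto simp: eventually_sequentially)
    show "\<exists>M. \<forall>m\<ge>M. \<forall>n>m. dist (X m) (X n) < e"
    proof (intro exI allI impI)
      fix m n assume "M \<le> m" "m < n"
      then show "dist (X m) (X n) < e"
        using M[of m] bd[of m "n - m"] by (simp add: dist_real_def abs_minus_commute)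
    qed
  qed
  then show X: "X \<longlonglongrightarrow> lim X" using convergent_LIMSEQ_iff Cauchy_convergent_iff by blast
  have "(\<lambda>k. \<bar>X (k + n) - X n\<bar>) \<longlonglongrightarrow> \<bar>lim X - X n\<bar>"
    by (intro tendsto_intros LIMSEQ_ignore_initial_segment X)
  then show "\<bar>lim X - X n\<bar> \<le> 2 * c * (1/2) ^ n"
    by (rule LIMSEQ_le_const2) (use bd[of n] in \<open>auto simp: add.commute\<close>)
qed

section \<open>Fixed point iteration for the time derivative\<close>

text \<open>\<open>ft\<close> and \<open>fw\<close> are the partial derivatives of the forcing \<open>f t y w\<close> in \<open>t\<close> and \<open>w\<close>.\<close>

locale forcing =
  fixes T K :: real and f ft fw :: "real \<Rightarrow> real \<Rightarrow> real \<Rightarrow> real"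
  assumes T_pos: "0 < T" and K: "1 \<le> K"
    and f_meas: "bmeas3 f" and ft_meas: "bmeas3 ft" and fw_meas: "bmeas3 fw"
    and f_cont: "\<And>y. y \<in> {0<..<1} \<Longrightarrow> continuous_on ({0..T} \<times> UNIV) (\<lambda>q. f (fst q) y (snd q))"
    and f_isCont: "\<And>t y w. t \<in> {0<..<T} \<Longrightarrow> y \<in> {0<..<1} \<Longrightarrow>
      isCont (\<lambda>p. f (fst p) (fst (snd p)) (snd (snd p))) (t, y, w)"
    and f_deriv: "\<And>t y w. t \<in> {0<..<T} \<Longrightarrow> y \<in> {0<..<1} \<Longrightarrow> good t y \<Longrightarrow>
      ((\<lambda>q. f (fst q) y (snd q)) has_derivative (\<lambda>d. ft t y w * fst d + fw t y w * snd d)) (at (t, w))"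
    and ft_isCont: "\<And>t y w. t \<in> {0<..<T} \<Longrightarrow> y \<in> {0<..<1} \<Longrightarrow> good t y \<Longrightarrow>
      isCont (\<lambda>p. ft (fst p) (fst (snd p)) (snd (snd p))) (t, y, w)"
    and fw_isCont: "\<And>t y w. t \<in> {0<..<T} \<Longrightarrow> y \<in> {0<..<1} \<Longrightarrow> good t y \<Longrightarrow>
      isCont (\<lambda>p. fw (fst p) (fst (snd p)) (snd (snd p))) (t, y, w)"
    and f0_bound: "\<And>y. y \<in> {0..1} \<Longrightarrow> \<bar>f 0 y 0\<bar> \<le> K"
    and f0_isCont: "\<And>y. y \<in> {0<..<1} \<Longrightarrow> isCont (\<lambda>y. f 0 y 0) y"
    and ft_bound: "\<And>t y. t \<in> {0<..<T} \<Longrightarrow> y \<in> {0..1} \<Longrightarrow> \<bar>ft t y 0\<bar> \<le> K"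
    and ft_lip: "\<And>t y w w'. t \<in> {0<..<T} \<Longrightarrow> y \<in> {0..1} \<Longrightarrow> \<bar>ft t y w - ft t y w'\<bar> \<le> K * \<bar>w - w'\<bar>"
    and fw_bound: "\<And>t y w. t \<in> {0<..<T} \<Longrightarrow> y \<in> {0..1} \<Longrightarrow> \<bar>fw t y w\<bar> \<le> K"
    and fw_lip: "\<And>t y w w'. t \<in> {0<..<T} \<Longrightarrow> y \<in> {0..1} \<Longrightarrow> \<bar>fw t y w - fw t y w'\<bar> \<le> K * \<bar>w - w'\<bar>"
begin

text \<open>For \<open>v = V z\<close>, \<open>H z\<close> is the total time derivative of the oddly extended forcing
  \<open>- f t y (odd_part v t y)\<close>, and \<open>Phi\<close> is Duhamel's formula for \<open>v\<close> differentiated in time. Its fixed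
  point is therefore the time derivative of the solution.\<close>

definition H :: "(real \<Rightarrow> real \<Rightarrow> real) \<Rightarrow> real \<Rightarrow> real \<Rightarrow> real" where
  "H z t x = - sg x * (ft t (zigzag x) (odd_part (V z) t (zigzag x))
     + fw t (zigzag x) (odd_part (V z) t (zigzag x)) * odd_part z t (zigzag x))"

definition Phi :: "(real \<Rightarrow> real \<Rightarrow> real) \<Rightarrow> real \<Rightarrow> real \<Rightarrow> real" where
  "Phi z t x = - sg (x - t) * f 0 (zigzag (x - t)) 0 + tint (min t T) (\<lambda>s. H z s (x - t + s))"

section \<open>Invariant ball and contraction of the fixed-point map\<close>

text \<open>\<open>lam\<close> and \<open>MM\<close> make the weighted ball
  \<open>\<bar>z t x\<bar> \<le> MM * exp (lam * t)\<close> invariant: the constant contributions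
  \<open>K * (1 + T)\<close> are \<open>MM / 2\<close>, and \<open>2 * K / lam = 1/2\<close>.
  \<open>RR\<close> bounds the ball up to time \<open>T\<close>. \<open>mu\<close> is twice the
  Lipschitz constant \<open>K * (2 + RR)\<close> of \<open>H\<close> on the ball; \<open>RR\<close>
  enters because \<open>fw\<close> is multiplied by \<open>odd_part z\<close>.\<close>

definition "lam = 4 * K"
definition "MM = 2 * K * (1 + T)"
definition "RR = MM * exp (lam * T)"
definition "mu = 2 * K * (2 + RR)"

lemma constants: "1 \<le> lam" "0 < MM" "0 < RR" "1 \<le> mu" "0 < lam" "0 < mu"
proof -
  show "1 \<le> lam" "0 < lam" using K by (auto simp: lam_def)
  show M: "0 < MM" using K T_pos by (auto simp: MM_def)
  show R: "0 < RR" using M by (simp add: RR_def)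
  have "1 * 1 \<le> K * (2 + RR)" by (rule mult_mono) (use K R in auto)
  then show "1 \<le> mu" "0 < mu" by (auto simp: mu_def)
qed

lemma MM_le_RR: "t \<le> T \<Longrightarrow> MM * exp (lam * t) \<le> RR"
  unfolding RR_def using constants by (intro mult_left_mono) auto

text \<open>The set on which \<open>Phi\<close> is iterated: measurability serves the integrals, the
  weighted bound is the one preserved by \<open>Phi\<close>, and continuity is asked only where the
  time derivative can be continuous.\<close>

definition Q :: "(real \<Rightarrow> real \<Rightarrow> real) \<Rightarrow> bool" where
  "Q z \<longleftrightarrow> bmeas2 z \<and> (\<forall>t x. 0 < t \<longrightarrow> t < T \<longrightarrow> \<bar>z t x\<bar> \<le> MM * exp (lam * t)) \<and>
     continuous_on (offchar T) (\<lambda>p. z (fst p) (snd p))"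

lemma QD:
  assumes "Q z"
  shows "bmeas2 z" "\<And>t x. 0 < t \<Longrightarrow> t < T \<Longrightarrow> \<bar>z t x\<bar> \<le> MM * exp (lam * t)"
    "continuous_on (offchar T) (\<lambda>p. z (fst p) (snd p))" "\<And>t x. 0 < t \<Longrightarrow> t < T \<Longrightarrow> \<bar>z t x\<bar> \<le> RR"
proof -
  show "bmeas2 z" and b: "\<And>t x. 0 < t \<Longrightarrow> t < T \<Longrightarrow> \<bar>z t x\<bar> \<le> MM * exp (lam * t)"
    and "continuous_on (offchar T) (\<lambda>p. z (fst p) (snd p))" using assms by (auto simp: Q_def)
  show "\<bar>z t x\<bar> \<le> RR" if "0 < t" "t < T" for t x using b[OF that, of x] MM_le_RR[of t] that by linarith
qed

lemma bmeas2_H: "bmeas2 z \<Longrightarrow> bmeas2 (H z)"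
proof -
  assume z: "bmeas2 z"
  have r: "(\<lambda>p::real\<times>real. zigzag (snd p)) \<in> borel_measurable borel" "(\<lambda>p::real\<times>real. sg (snd p)) \<in> borel_measurable borel"
    by (rule measurable_compose[OF fst_snd_borel(2) borel_measurable_zigzag])
      (rule measurable_compose[OF fst_snd_borel(2) borel_measurable_sg])
  have o: "(\<lambda>p::real\<times>real. odd_part (V z) (fst p) (zigzag (snd p))) \<in> borel_measurable borel"
    "(\<lambda>p::real\<times>real. odd_part z (fst p) (zigzag (snd p))) \<in> borel_measurable borel"
    by (rule bmeas2_comp[OF bmeas2_odd_part[OF bmeas2_V[OF z]] fst_snd_borel(1) r(1)])
      (rule bmeas2_comp[OF bmeas2_odd_part[OF z] fst_snd_borel(1) r(1)])
  show ?thesis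
    unfolding bmeas2_def H_def
    by (intro borel_measurable_times borel_measurable_add borel_measurable_uminus bmeas3_comp[OF ft_meas] bmeas3_comp[OF fw_meas] o r fst_snd_borel)
qed

lemma bmeas2_Phi: "bmeas2 z \<Longrightarrow> bmeas2 (Phi z)"
proof -
  assume z: "bmeas2 z"
  have d: "(\<lambda>p::real\<times>real. snd p - fst p) \<in> borel_measurable borel" by (intro borel_measurable_diff fst_snd_borel)
  have r: "(\<lambda>p::real\<times>real. zigzag (snd p - fst p)) \<in> borel_measurable borel" "(\<lambda>p::real\<times>real. sg (snd p - fst p)) \<in> borel_measurable borel"
    by (rule measurable_compose[OF d borel_measurable_zigzag]) (rule measurable_compose[OF d borel_measurable_sg])
  have "(\<lambda>p::real\<times>real. tint (min (fst p) T) (\<lambda>s. H z s (snd p - fst p + s))) \<in> borel_measurable borel"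
  proof (rule measurable_tint)
    show "(\<lambda>p::real\<times>real. min (fst p) T) \<in> borel_measurable borel"
      by (intro borel_measurable_min fst_snd_borel borel_measurable_const)
    have "(\<lambda>q::(real \<times> real) \<times> real. snd (fst q) - fst (fst q)) \<in> borel_measurable (borel \<Otimes>\<^sub>M lborel)"
      by (rule measurable_compose[OF measurable_fst d])
    moreover have "(\<lambda>q::(real \<times> real) \<times> real. snd q) \<in> borel_measurable (borel \<Otimes>\<^sub>M lborel)" by measurable
    ultimately show "(\<lambda>q::(real \<times> real) \<times> real. H z (snd q) (snd (fst q) - fst (fst q) + snd q)) \<in> borel_measurable (borel \<Otimes>\<^sub>M lborel)"
      by (intro bmeas2_comp[OF bmeas2_H[OF z]] borel_measurable_add)
  qed
  then show ?thesis
    unfolding bmeas2_def Phi_def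
    by (intro borel_measurable_times borel_measurable_add borel_measurable_uminus bmeas3_comp[OF f_meas] r borel_measurable_const)
qed

lemma V_bound:
  assumes "0 \<le> t" "t \<le> T" "1 \<le> l" "0 \<le> m" "\<And>s x. 0 < s \<Longrightarrow> s < T \<Longrightarrow> \<bar>z s x\<bar> \<le> m * exp (l * s)"
  shows "\<bar>V z t x\<bar> \<le> m * exp (l * t)"
proof -
  have "\<bar>V z t x\<bar> \<le> 0 * t + m * exp (l * t) / l"
    unfolding V_def by (rule tint_exp_bound) (use assms in auto)
  also have "\<dots> \<le> m * exp (l * t)"
    using divide_left_mono[of 1 l "m * exp (l * t)"] assms(3,4) by simp
  finally show ?thesis .
qed

lemma H_bound:
  assumes t: "0 < t" "t < T" and b: "\<And>s x. 0 < s \<Longrightarrow> s < T \<Longrightarrow> \<bar>z s x\<bar> \<le> MM * exp (lam * s)"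
  shows "\<bar>H z t x\<bar> \<le> K + 2 * K * MM * exp (lam * t)"
proof -
  let ?y = "zigzag x" let ?w = "odd_part (V z) t (zigzag x)" let ?e = "MM * exp (lam * t)"
  have t': "t \<in> {0<..<T}" using t by auto
  have "\<bar>V z t y\<bar> \<le> ?e" for y by (rule V_bound) (use t b constants in auto)
  then have w: "\<bar>?w\<bar> \<le> ?e" by (intro odd_part_bound)
  have d: "\<bar>odd_part z t ?y\<bar> \<le> ?e" by (intro odd_part_bound b t)
  have "\<bar>ft t ?y ?w\<bar> \<le> K + K * ?e"
  proof -
    have "K * \<bar>?w - 0\<bar> \<le> K * ?e" using w K by (intro mult_left_mono) auto
    moreover have "\<bar>ft t ?y ?w\<bar> \<le> \<bar>ft t ?y 0\<bar> + \<bar>ft t ?y ?w - ft t ?y 0\<bar>" by simp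
    ultimately show ?thesis using ft_bound[OF t' zigzag_range, of x] ft_lip[OF t' zigzag_range, of x ?w 0] by linarith
  qed
  moreover have "\<bar>fw t ?y ?w * odd_part z t ?y\<bar> \<le> K * ?e"
    unfolding abs_mult by (rule mult_mono) (use fw_bound[OF t' zigzag_range] d K in auto)
  ultimately have "\<bar>ft t ?y ?w + fw t ?y ?w * odd_part z t ?y\<bar> \<le> K + 2 * K * ?e" by linarith
  moreover have "\<bar>H z t x\<bar> \<le> 1 * \<bar>ft t ?y ?w + fw t ?y ?w * odd_part z t ?y\<bar>"
    unfolding H_def abs_mult abs_minus_cancel by (intro mult_right_mono sg_bounds) auto
  ultimately show ?thesis by (simp add: mult.assoc)
qed

lemma Phi_bound:
  assumes t: "0 \<le> t" "t \<le> T" and b: "\<And>s x. 0 < s \<Longrightarrow> s < T \<Longrightarrow> \<bar>z s x\<bar> \<le> MM * exp (lam * s)"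
  shows "\<bar>Phi z t x\<bar> \<le> MM * exp (lam * t)"
proof -
  have "\<bar>tint t (\<lambda>s. H z s (x - t + s))\<bar> \<le> K * t + 2 * K * MM * exp (lam * t) / lam"
    by (rule tint_exp_bound) (use t H_bound[OF _ _ b] constants K in auto)
  also have "\<dots> \<le> K * T + MM * exp (lam * t) / 2"
    using t K by (intro add_mono mult_left_mono) (auto simp: lam_def)
  finally have 1: "\<bar>tint t (\<lambda>s. H z s (x - t + s))\<bar> \<le> K * T + MM * exp (lam * t) / 2" .
  have "\<bar>- sg (x - t) * f 0 (zigzag (x - t)) 0\<bar> \<le> 1 * K"
    unfolding abs_mult abs_minus_cancel by (intro mult_mono sg_bounds f0_bound zigzag_range) auto
  then have "\<bar>Phi z t x\<bar> \<le> K + K * T + MM * exp (lam * t) / 2"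
    using 1 t unfolding Phi_def by (simp add: min_absorb1)
  also have "K + K * T = MM / 2" by (simp add: MM_def algebra_simps)
  also have "MM / 2 \<le> MM * exp (lam * t) / 2"
    using constants t by (simp add: mult_le_cancel_left1)
  finally show ?thesis by simp
qed

text \<open>Because of the product \<open>fw * odd_part z\<close>, the Lipschitz estimate for
  \<open>H\<close> uses the ball: the difference of the two \<open>fw\<close> factors is multiplied
  by a function bounded by \<open>RR\<close>. The weight \<open>mu\<close> then reduces the
  Lipschitz constant to 1/2.\<close>

lemma Phi_contraction:
  assumes z: "bmeas2 z" "\<And>s x. 0 < s \<Longrightarrow> s < T \<Longrightarrow> \<bar>z s x\<bar> \<le> MM * exp (lam * s)"
    and y: "bmeas2 y" "\<And>s x. 0 < s \<Longrightarrow> s < T \<Longrightarrow> \<bar>y s x\<bar> \<le> MM * exp (lam * s)"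
    and m: "0 \<le> m" and d: "\<And>s x. 0 < s \<Longrightarrow> s < T \<Longrightarrow> \<bar>z s x - y s x\<bar> \<le> m * exp (mu * s)"
    and t: "0 \<le> t" "t \<le> T"
  shows "\<bar>Phi z t x - Phi y t x\<bar> \<le> m / 2 * exp (mu * t)"
proof -
  have zR: "\<bar>z s x\<bar> \<le> RR" "\<bar>y s x\<bar> \<le> RR" if "0 < s" "s < T" for s x
    using z(2)[OF that, of x] y(2)[OF that, of x] MM_le_RR[of s] that by linarith+
  have Vd: "\<bar>V z s x - V y s x\<bar> \<le> m * exp (mu * s)" if s: "0 < s" "s < T" for s x
  proof -
    have "V z s x - V y s x = V (\<lambda>t x. z t x - y t x) s x"
      unfolding V_def by (rule tint_diff[symmetric, of _ _ RR _ RR]) (use zR s bmeas2_sections z y in auto)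
    then show ?thesis using V_bound[of s mu m "\<lambda>t x. z t x - y t x" x] s d m constants by simp
  qed
  have Hd: "\<bar>H z s x - H y s x\<bar> \<le> K * (2 + RR) * m * exp (mu * s)" if s: "0 < s" "s < T" for s x
  proof -
    let ?y = "zigzag x" and ?w = "odd_part (V z) s (zigzag x)" and ?w' = "odd_part (V y) s (zigzag x)"
    let ?d = "odd_part z s (zigzag x)" and ?d' = "odd_part y s (zigzag x)" and ?e = "m * exp (mu * s)"
    have s': "s \<in> {0<..<T}" using s by auto
    have ww: "\<bar>?w - ?w'\<bar> \<le> ?e" unfolding odd_part_diff by (intro odd_part_bound Vd s)
    have dd: "\<bar>?d - ?d'\<bar> \<le> ?e" unfolding odd_part_diff by (intro odd_part_bound d s)
    have d': "\<bar>?d'\<bar> \<le> RR" by (intro odd_part_bound zR s)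
    have Kww: "K * \<bar>?w - ?w'\<bar> \<le> K * ?e" using ww K by (intro mult_left_mono) auto
    have 1: "\<bar>ft s ?y ?w - ft s ?y ?w'\<bar> \<le> K * ?e"
      using ft_lip[OF s' zigzag_range, of x ?w ?w'] Kww by linarith
    have 2: "\<bar>fw s ?y ?w * (?d - ?d')\<bar> \<le> K * ?e"
      unfolding abs_mult by (rule mult_mono) (use fw_bound[OF s' zigzag_range] dd K in auto)
    have "\<bar>fw s ?y ?w - fw s ?y ?w'\<bar> \<le> K * ?e"
      using fw_lip[OF s' zigzag_range, of x ?w ?w'] Kww by linarith
    then have 3: "\<bar>(fw s ?y ?w - fw s ?y ?w') * ?d'\<bar> \<le> (K * ?e) * RR"
      unfolding abs_mult by (rule mult_mono) (use d' K m in auto)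
    have "H z s x - H y s x = - sg x * ((ft s ?y ?w - ft s ?y ?w') + fw s ?y ?w * (?d - ?d') + (fw s ?y ?w - fw s ?y ?w') * ?d')"
      unfolding H_def by (simp add: algebra_simps)
    then have "\<bar>H z s x - H y s x\<bar> = \<bar>sg x\<bar> * \<bar>(ft s ?y ?w - ft s ?y ?w') + fw s ?y ?w * (?d - ?d') + (fw s ?y ?w - fw s ?y ?w') * ?d'\<bar>"
      by (simp add: abs_mult)
    also have "\<dots> \<le> 1 * (K * ?e + K * ?e + K * ?e * RR)"
      by (rule mult_mono) (use 1 2 3 sg_bounds in \<open>auto\<close>)
    finally show ?thesis by (simp add: algebra_simps)
  qed
  have Hb: "\<bar>H w s x\<bar> \<le> K + 2 * K * RR" if "0 < s" "s < T" "\<And>s x. 0 < s \<Longrightarrow> s < T \<Longrightarrow> \<bar>w s x\<bar> \<le> MM * exp (lam * s)" for w s x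
  proof -
    have "2 * K * (MM * exp (lam * s)) \<le> 2 * K * RR"
      by (rule mult_left_mono) (use MM_le_RR[of s] that K in auto)
    moreover have "\<bar>H w s x\<bar> \<le> K + 2 * K * MM * exp (lam * s)" by (rule H_bound[OF that])
    ultimately show ?thesis by (simp add: mult.assoc)
  qed
  have "Phi z t x - Phi y t x = tint t (\<lambda>s. H z s (x - t + s)) - tint t (\<lambda>s. H y s (x - t + s))"
    using t unfolding Phi_def by (simp add: min_absorb1)
  also have "\<dots> = tint t (\<lambda>s. H z s (x - t + s) - H y s (x - t + s))"
    by (rule tint_diff[symmetric, of _ _ "K + 2 * K * RR" _ "K + 2 * K * RR"])
      (use t Hb[OF _ _ z(2)] Hb[OF _ _ y(2)] bmeas2_sections(3)[OF bmeas2_H] z(1) y(1) in auto)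
  finally have "\<bar>Phi z t x - Phi y t x\<bar> \<le> 0 * t + K * (2 + RR) * m * exp (mu * t) / mu"
    using tint_exp_bound[OF t(1), of mu "K * (2 + RR) * m" "\<lambda>s. H z s (x - t + s) - H y s (x - t + s)" 0]
      Hd t constants m K by auto
  also have "\<dots> = m / 2 * exp (mu * t)" using constants K by (simp add: mu_def field_simps)
  finally show ?thesis .
qed

text \<open>At a good point \<open>sg\<close> is continuous, \<open>zigzag\<close> takes values in
  the open interval where \<open>ft\<close> and \<open>fw\<close> are continuous, and both reflected
  points used by \<open>odd_part z\<close> avoid the jump lines.\<close>

lemma isCont_H:
  assumes z: "Q z" and t: "0 < t" "t < T" and g: "good t x"
  shows "isCont (\<lambda>p. H z (fst p) (snd p)) (t, x)"
proof -
  have t': "t \<in> {0<..<T}" using t by auto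
  have s: "sin (pi * x) \<noteq> 0" using g by (simp add: good_def)
  have y: "zigzag x \<in> {0<..<1}" by (rule zigzag_interior[OF s])
  have gr: "good t (zigzag x)" using g by (simp add: good_zigzag)
  have gm: "good t (- zigzag x)" using gr by (simp add: good_minus)
  have cr: "isCont (\<lambda>p::real\<times>real. zigzag (snd p)) (t, x)"
    by (rule isCont_o2[of "(t, x)" snd zigzag]) (auto intro!: continuous_intros isCont_zigzag)
  have csg: "isCont (\<lambda>p::real\<times>real. sg (snd p)) (t, x)"
    by (rule isCont_o2[of "(t, x)" snd sg]) (auto intro!: continuous_intros isCont_sg s)
  have cf: "isCont (\<lambda>p::real\<times>real. fst p) (t, x)" by (auto intro!: continuous_intros)
  have zc: "isCont (\<lambda>p. z (fst p) (snd p)) (t, w)" if "good t w" for w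
    by (rule isCont_offchar[OF QD(3)[OF z] t]) (use that in \<open>simp add: good_iff\<close>)
  have Vc: "isCont (\<lambda>p. V z (fst p) (snd p)) (t, w)" for w
    by (rule isCont_V[OF QD(1)[OF z] QD(4)[OF z] QD(3)[OF z] t])
  have oV: "isCont (\<lambda>p. odd_part (V z) (fst p) (zigzag (snd p))) (t, x)"
    by (rule isCont_comp2[where a=fst and b="\<lambda>p. zigzag (snd p)"]) (use isCont_odd_part[OF Vc Vc] cf cr in simp_all)
  have oz: "isCont (\<lambda>p. odd_part z (fst p) (zigzag (snd p))) (t, x)"
    by (rule isCont_comp2[where a=fst and b="\<lambda>p. zigzag (snd p)"]) (use isCont_odd_part[OF zc[OF gr] zc[OF gm]] cf cr in simp_all)
  have cft: "isCont (\<lambda>p. ft (fst p) (zigzag (snd p)) (odd_part (V z) (fst p) (zigzag (snd p)))) (t, x)"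
    by (rule isCont_comp3[where a=fst and b="\<lambda>p. zigzag (snd p)" and c="\<lambda>p. odd_part (V z) (fst p) (zigzag (snd p))"])
      (use ft_isCont[OF t' y gr] cf cr oV in simp_all)
  have cfw: "isCont (\<lambda>p. fw (fst p) (zigzag (snd p)) (odd_part (V z) (fst p) (zigzag (snd p)))) (t, x)"
    by (rule isCont_comp3[where a=fst and b="\<lambda>p. zigzag (snd p)" and c="\<lambda>p. odd_part (V z) (fst p) (zigzag (snd p))"])
      (use fw_isCont[OF t' y gr] cf cr oV in simp_all)
  show ?thesis unfolding H_def by (intro continuous_intros csg cft cfw oz)
qed

lemma H_bound_RR:
  assumes "Q z" "0 < s" "s < T"
  shows "\<bar>H z s x\<bar> \<le> K + 2 * K * RR"
proof -
  have "2 * K * (MM * exp (lam * s)) \<le> 2 * K * RR"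
    by (rule mult_left_mono) (use MM_le_RR[of s] assms K in auto)
  moreover have "\<bar>H z s x\<bar> \<le> K + 2 * K * MM * exp (lam * s)"
    by (rule H_bound[OF assms(2,3)]) (rule QD(2)[OF assms(1)], assumption, assumption)
  ultimately show ?thesis by (simp add: mult.assoc)
qed

text \<open>Almost every point of the characteristic through \<open>(t, x)\<close> is good, so the
  integral depends continuously on \<open>(t, x)\<close>. Cutting the upper limit at
  \<open>T\<close> gives continuity at every \<open>t\<close>, including the end times.\<close>

lemma isCont_Phi:
  assumes z: "Q z" and x: "sin (pi * (x - t)) \<noteq> 0"
  shows "isCont (\<lambda>p. Phi z (fst p) (snd p)) (t, x)"
proof -
  have d: "isCont (\<lambda>p::real\<times>real. snd p - fst p) (t, x)" by (intro continuous_intros)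
  have csg: "isCont (\<lambda>p::real\<times>real. sg (snd p - fst p)) (t, x)"
    using isCont_o2[OF d, of sg] isCont_sg[OF x] by simp
  have cf: "isCont (\<lambda>x. f 0 (zigzag x) 0) (x - t)"
    by (rule isCont_o2[OF isCont_zigzag f0_isCont[OF zigzag_interior[OF x]]])
  have cf2: "isCont (\<lambda>p::real\<times>real. f 0 (zigzag (snd p - fst p)) 0) (t, x)"
    using isCont_o2[OF d, of "\<lambda>x. f 0 (zigzag x) 0"] cf by simp
  have ct: "isCont (\<lambda>p::real\<times>real. tint (min (fst p) T) (\<lambda>s. H z s (snd p - fst p + s))) (t, x)"
  proof (rule isCont_tint[where U=UNIV and T=T and B="K + 2 * K * RR" and \<tau>="\<lambda>p. min (fst p) T"
        and k="\<lambda>p s. H z s (snd p - fst p + s)"])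
    show "(\<lambda>s. H z s (snd p - fst p + s)) \<in> borel_measurable borel" for p :: "real \<times> real"
      by (rule bmeas2_sections(3)[OF bmeas2_H[OF QD(1)[OF z]]])
    show "\<bar>H z s (snd p - fst p + s)\<bar> \<le> K + 2 * K * RR" if "0 < s" "s < min (fst p) T" for p :: "real \<times> real" and s
      by (rule H_bound_RR[OF z]) (use that in auto)
    show "isCont (\<lambda>p::real\<times>real. min (fst p) T) (t, x)" by (intro continuous_intros)
    show "0 \<le> K + 2 * K * RR" using K constants by simp
    show "AE s in lborel. 0 < s \<longrightarrow> s < min (fst (t, x)) T \<longrightarrow> isCont (\<lambda>p::real\<times>real. H z s (snd p - fst p + s)) (t, x)"
      using AE_good_char[OF x]
    proof eventually_elim
      case (elim s)
      show ?case
      proof (intro impI)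
        assume s: "0 < s" "s < min (fst (t, x)) T"
        have "isCont (\<lambda>p. H z (fst p) (snd p)) (s, x - t + s)"
          by (rule isCont_H[OF z _ _ elim]) (use s in auto)
        then show "isCont (\<lambda>p::real\<times>real. H z s (snd p - fst p + s)) (t, x)"
          by (rule_tac isCont_comp2[where a="\<lambda>_. s" and b="\<lambda>p. snd p - fst p + s"]) (simp_all add: d isCont_add)
      qed
    qed
  qed auto
  show ?thesis unfolding Phi_def by (intro isCont_add isCont_mult isCont_minus csg cf2 ct)
qed

lemma Q_Phi:
  assumes "Q z"
  shows "Q (Phi z)"
  unfolding Q_def
proof (intro conjI allI impI)
  show "bmeas2 (Phi z)" by (rule bmeas2_Phi[OF QD(1)[OF assms]])
  show "\<bar>Phi z t x\<bar> \<le> MM * exp (lam * t)" if "0 < t" "t < T" for t x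
    by (rule Phi_bound) (use that in \<open>auto intro: QD(2)[OF assms]\<close>)
  show "continuous_on (offchar T) (\<lambda>p. Phi z (fst p) (snd p))"
    unfolding continuous_on_eq_continuous_at[OF open_offchar]
  proof
    fix p assume "p \<in> offchar T"
    then show "isCont (\<lambda>p. Phi z (fst p) (snd p)) p"
      using isCont_Phi[OF assms, of "snd p" "fst p"] by (simp add: offchar_def)
  qed
qed

section \<open>Picard iterates and their limit\<close>

definition iter :: "nat \<Rightarrow> real \<Rightarrow> real \<Rightarrow> real" where
  "iter n = (Phi ^^ n) (\<lambda>_ _. 0)"

lemma Q_iter: "Q (iter n)"
proof (induction n)
  case 0
  show ?case unfolding iter_def Q_def bmeas2_def using constants by auto
next
  case (Suc n)
  then show ?case using Q_Phi[of "iter n"] by (simp add: iter_def)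
qed

lemma iter_step:
  assumes "0 < t" "t < T"
  shows "\<bar>iter (Suc n) t x - iter n t x\<bar> \<le> RR * (1/2) ^ n * exp (mu * t)"
  using assms
proof (induction n arbitrary: t x)
  case 0
  have "\<bar>iter 1 t x\<bar> \<le> RR" by (rule QD(4)[OF Q_iter 0])
  also have "\<dots> \<le> RR * exp (mu * t)" using constants 0 by (simp add: mult_le_cancel_left1)
  finally show ?case by (simp add: iter_def)
next
  case (Suc n)
  have "\<bar>Phi (iter (Suc n)) t x - Phi (iter n) t x\<bar> \<le> RR * (1/2) ^ n / 2 * exp (mu * t)"
    by (rule Phi_contraction)
      (use QD[OF Q_iter] Suc constants in auto)
  then show ?case by (simp add: iter_def)
qed

definition zlim :: "real \<Rightarrow> real \<Rightarrow> real" where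
  "zlim t x = lim (\<lambda>n. iter n t x)"

lemma zlim:
  assumes t: "0 < t" "t < T"
  shows "(\<lambda>n. iter n t x) \<longlonglongrightarrow> zlim t x" "\<bar>zlim t x - iter n t x\<bar> \<le> 2 * RR * (1/2) ^ n * exp (mu * t)"
proof -
  have d: "\<bar>iter (Suc n) t x - iter n t x\<bar> \<le> (RR * exp (mu * t)) * (1/2) ^ n" for n
    using iter_step[OF t, of n x] by (simp add: mult_ac)
  show "(\<lambda>n. iter n t x) \<longlonglongrightarrow> zlim t x" unfolding zlim_def by (rule geometric_limit(1)[of "\<lambda>n. iter n t x", OF d])
  show "\<bar>zlim t x - iter n t x\<bar> \<le> 2 * RR * (1/2) ^ n * exp (mu * t)"
    unfolding zlim_def using geometric_limit(2)[of "\<lambda>n. iter n t x", OF d, of n] by (simp add: mult_ac)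
qed

text \<open>The geometric bound is uniform over the strip because \<open>exp (mu * t)\<close> is at
  most \<open>exp (mu * T)\<close>; continuity therefore passes to the limit, while bounds and
  measurability pass pointwise.\<close>

lemma Q_zlim: "Q zlim"
  unfolding Q_def
proof (intro conjI allI impI)
  show "bmeas2 zlim"
    unfolding bmeas2_def zlim_def
    by (rule borel_measurable_lim_metric) (use QD(1)[OF Q_iter] in \<open>simp add: bmeas2_def\<close>)
  show "\<bar>zlim t x\<bar> \<le> MM * exp (lam * t)" if t: "0 < t" "t < T" for t x
    by (rule LIMSEQ_le_const2[OF tendsto_rabs[OF zlim(1)[OF t]]]) (use QD(2)[OF Q_iter t] in auto)
  have "uniform_limit (offchar T) (\<lambda>n p. iter n (fst p) (snd p)) (\<lambda>p. zlim (fst p) (snd p)) sequentially"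
  proof (rule uniform_limitI)
    fix e :: real assume e: "0 < e"
    have "(\<lambda>n. 2 * RR * (1/2) ^ n * exp (mu * T)) \<longlonglongrightarrow> 2 * RR * 0 * exp (mu * T)"
      by (intro tendsto_intros LIMSEQ_realpow_zero) auto
    then have "eventually (\<lambda>n. 2 * RR * (1/2) ^ n * exp (mu * T) < e) sequentially"
      using e by (intro order_tendstoD) auto
    then show "eventually (\<lambda>n. \<forall>p\<in>offchar T. dist (iter n (fst p) (snd p)) (zlim (fst p) (snd p)) < e) sequentially"
    proof eventually_elim
      case (elim n)
      show ?case
      proof
        fix p assume "p \<in> offchar T"
        then have t: "0 < fst p" "fst p < T" by (auto simp: offchar_def)
        have "2 * RR * (1/2) ^ n * exp (mu * fst p) \<le> 2 * RR * (1/2) ^ n * exp (mu * T)"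
          using t constants by (intro mult_left_mono) auto
        then show "dist (iter n (fst p) (snd p)) (zlim (fst p) (snd p)) < e"
          using zlim(2)[OF t, of "snd p" n] elim by (simp add: dist_real_def abs_minus_commute)
      qed
    qed
  qed
  then show "continuous_on (offchar T) (\<lambda>p. zlim (fst p) (snd p))"
    by (rule uniform_limit_theorem[rotated]) (use QD(3)[OF Q_iter] in auto)
qed

lemma Phi_zlim:
  assumes t: "0 < t" "t < T"
  shows "Phi zlim t x = zlim t x"
proof -
  have "\<bar>Phi zlim t x - iter (Suc n) t x\<bar> \<le> RR * exp (mu * t) * (1/2) ^ n" for n
  proof -
    have "\<bar>Phi zlim t x - Phi (iter n) t x\<bar> \<le> (2 * RR * (1/2) ^ n) / 2 * exp (mu * t)"
    proof (rule Phi_contraction)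
      show "bmeas2 zlim" "bmeas2 (iter n)" by (rule QD(1)[OF Q_zlim]) (rule QD(1)[OF Q_iter])
      fix s x assume s: "0 < s" "s < T"
      show "\<bar>zlim s x\<bar> \<le> MM * exp (lam * s)" by (rule QD(2)[OF Q_zlim s])
      show "\<bar>iter n s x\<bar> \<le> MM * exp (lam * s)" by (rule QD(2)[OF Q_iter s])
      show "\<bar>zlim s x - iter n s x\<bar> \<le> 2 * RR * (1/2) ^ n * exp (mu * s)" by (rule zlim(2)[OF s])
    qed (use t constants in auto)
    then show ?thesis by (simp add: iter_def mult_ac)
  qed
  then have ev: "eventually (\<lambda>n. norm (iter (Suc n) t x - Phi zlim t x) \<le> RR * exp (mu * t) * (1/2) ^ n) sequentially"
    by (simp add: abs_minus_commute)
  have "(\<lambda>n. (1/2::real) ^ n) \<longlonglongrightarrow> 0" by (rule LIMSEQ_realpow_zero) auto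
  then have "(\<lambda>n. RR * exp (mu * t) * (1/2) ^ n) \<longlonglongrightarrow> RR * exp (mu * t) * 0" by (rule tendsto_mult_left)
  then have "(\<lambda>n. RR * exp (mu * t) * (1/2) ^ n) \<longlonglongrightarrow> 0" by simp
  from LIM_zero_cancel[OF Lim_null_comparison[OF ev this]]
  have "(\<lambda>n. iter (Suc n) t x) \<longlonglongrightarrow> Phi zlim t x" .
  from LIMSEQ_unique[OF this LIMSEQ_Suc[OF zlim(1)[OF t]]] show ?thesis .
qed

text \<open>\<open>zlim\<close> is controlled only for \<open>0 < t < T\<close>. One more
  application of \<open>Phi\<close> agrees with it there and supplies values at the end times, with
  continuity across them off the jump lines.\<close>

definition sol :: "real \<Rightarrow> real \<Rightarrow> real" where
  "sol = Phi zlim"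

lemma sol_eq_zlim: "0 < t \<Longrightarrow> t < T \<Longrightarrow> sol t x = zlim t x"
  unfolding sol_def by (rule Phi_zlim)

lemma Q_sol: "Q sol"
  unfolding sol_def by (rule Q_Phi[OF Q_zlim])

lemma sol_bound: "0 \<le> t \<Longrightarrow> t \<le> T \<Longrightarrow> \<bar>sol t x\<bar> \<le> RR"
proof -
  assume t: "0 \<le> t" "t \<le> T"
  have "\<bar>Phi zlim t x\<bar> \<le> MM * exp (lam * t)"
    by (rule Phi_bound) (use t in \<open>auto intro: QD(2)[OF Q_zlim]\<close>)
  then show ?thesis using MM_le_RR[OF t(2)] by (simp add: sol_def)
qed

lemma isCont_sol: "sin (pi * (x - t)) \<noteq> 0 \<Longrightarrow> isCont (\<lambda>p. sol (fst p) (snd p)) (t, x)"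
  unfolding sol_def by (rule isCont_Phi[OF Q_zlim])

text \<open>\<open>Phi\<close> sees its argument only at times in the open interval, through
  \<open>tint\<close>, and there \<open>sol\<close> and \<open>zlim\<close> coincide.\<close>

lemma sol_fixpoint: "sol t x = Phi sol t x"
proof -
  have V: "V sol s x = V zlim s x" if "s < T" for s x
    unfolding V_def by (rule tint_cong) (use that sol_eq_zlim in auto)
  have "H sol s x = H zlim s x" if "0 < s" "s < T" for s x
    unfolding H_def odd_part_def using V[OF that(2)] sol_eq_zlim[OF that] by simp
  then have "tint (min t T) (\<lambda>s. H sol s (x - t + s)) = tint (min t T) (\<lambda>s. H zlim s (x - t + s))"
    by (intro tint_cong) auto
  then show ?thesis unfolding sol_def[THEN fun_cong, THEN fun_cong, of t x] unfolding Phi_def by simp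
qed

end

section \<open>Increments of primitives and a change of variables on a triangle\<close>

lemma primitive_on_increment_bound:
  assumes p: "primitive_on S G g" and ab: "a \<in> S" "b \<in> S" "a \<le> b"
    and g: "\<And>s. a \<le> s \<Longrightarrow> s \<le> b \<Longrightarrow> \<bar>g s - c\<bar> \<le> e"
  shows "\<bar>G b - G a - c * (b - a)\<bar> \<le> e * (b - a)"
proof -
  have i: "g integrable_on {a..b}" and e: "G b - G a = integral {a..b} g"
    using primitive_onD[OF p ab] by auto
  have i2: "(\<lambda>s. g s - c) integrable_on {a..b}" using i by (intro integrable_diff) auto
  have "integral {a..b} (\<lambda>s. g s - c) = G b - G a - c * (b - a)"
    using i ab by (subst Henstock_Kurzweil_Integration.integral_diff) (auto simp: e)
  moreover have "norm (integral {a..b} (\<lambda>s. g s - c)) \<le> integral {a..b} (\<lambda>s. e)"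
    by (rule integral_norm_bound_integral[OF i2]) (use g in auto)
  ultimately show ?thesis using ab by (simp add: mult.commute)
qed

lemma tint_cong_AE:
  assumes "h \<in> borel_measurable borel" "g \<in> borel_measurable borel" "AE s in lborel. 0 < s \<longrightarrow> s < t \<longrightarrow> h s = g s"
  shows "tint t h = tint t g"
  unfolding tint_def
proof (rule integral_cong_AE)
  show "AE s in lborel. (if 0 < s \<and> s < t then h s else 0) = (if 0 < s \<and> s < t then g s else 0)"
    using assms(3) by eventually_elim auto
qed (use assms(1,2) in measurable)

lemma tint_reflect: "tint t h = tint t (\<lambda>s. h (t - s))"
proof -
  have "tint t h = (\<integral>s. (if 0 < t + (-1) * s \<and> t + (-1) * s < t then h (t + (-1) * s) else 0) \<partial>lborel)"
    unfolding tint_def by (subst lborel_integral_real_affine[where c="-1" and t=t]) auto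
  also have "\<dots> = tint t (\<lambda>s. h (t - s))"
    unfolding tint_def by (rule Bochner_Integration.integral_cong) auto
  finally show ?thesis .
qed

text \<open>Fubini, then for fixed \<open>r\<close> the substitution of \<open>t + r - s\<close> for
  \<open>s\<close>, which reverses the segment from \<open>r\<close> to \<open>t\<close>. Integrals
  along the characteristics through the points \<open>(s, x)\<close> become time integrals at the
  fixed points \<open>x - t + s\<close>, taken along the single characteristic through
  \<open>(t, x)\<close>.\<close>

lemma tint_triangle_reflect:
  assumes h: "bmeas2 h" and b: "\<And>s x. 0 < s \<Longrightarrow> s < t \<Longrightarrow> \<bar>h s x\<bar> \<le> B"
  shows "tint t (\<lambda>s. tint s (\<lambda>r. h r (x - s + r))) = tint t (\<lambda>s. tint s (\<lambda>r. h r (x - t + s)))"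
proof -
  define A where "A = {p::real\<times>real. 0 < snd p \<and> snd p < fst p \<and> fst p < t}"
  have mfs: "(\<lambda>p. fst p) \<in> borel_measurable (lborel \<Otimes>\<^sub>M lborel)" "(\<lambda>p. snd p) \<in> borel_measurable (lborel \<Otimes>\<^sub>M (lborel :: real measure))"
    for x :: real by measurable
  have fub: "tint t (\<lambda>s. tint s (\<lambda>r. k s r)) = (\<integral>r. (\<integral>s. (if 0 < r \<and> r < s \<and> s < t then k s r else 0) \<partial>lborel) \<partial>lborel)"
    if k: "(\<lambda>p. k (fst p) (snd p)) \<in> borel_measurable (lborel \<Otimes>\<^sub>M lborel)"
      and kb: "\<And>s r. 0 < r \<Longrightarrow> r < t \<Longrightarrow> \<bar>k s r\<bar> \<le> B" for k :: "real \<Rightarrow> real \<Rightarrow> real"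
  proof -
    have "integrable (lborel \<Otimes>\<^sub>M lborel) (\<lambda>p. if 0 < snd p \<and> snd p < fst p \<and> fst p < t then k (fst p) (snd p) else 0)"
    proof (rule integrableI_bounded_set[where A="{0..t} \<times> {0..t}" and B="\<bar>B\<bar>"])
      show "{0..t} \<times> {0..t} \<in> sets (lborel \<Otimes>\<^sub>M (lborel :: real measure))" by auto
      show "(\<lambda>p. if 0 < snd p \<and> snd p < fst p \<and> fst p < t then k (fst p) (snd p) else 0) \<in> borel_measurable (lborel \<Otimes>\<^sub>M lborel)"
        using k mfs by measurable
      show "emeasure (lborel \<Otimes>\<^sub>M lborel) ({0..t} \<times> {0..t}) < \<infinity>"
        by (subst lborel.emeasure_pair_measure_Times) (auto simp: emeasure_lborel_Icc_eq ennreal_mult_less_top)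
      show "AE p in lborel \<Otimes>\<^sub>M lborel. p \<in> {0..t} \<times> {0..t} \<longrightarrow>
          norm (if 0 < snd p \<and> snd p < fst p \<and> fst p < t then k (fst p) (snd p) else 0) \<le> \<bar>B\<bar>"
        using order_trans[OF kb abs_ge_self] by (intro AE_I2) auto
      show "AE p in lborel \<Otimes>\<^sub>M lborel. p \<notin> {0..t} \<times> {0..t} \<longrightarrow>
          (if 0 < snd p \<and> snd p < fst p \<and> fst p < t then k (fst p) (snd p) else 0) = 0"
        by (intro AE_I2) auto
    qed
    then have i: "integrable (lborel \<Otimes>\<^sub>M lborel) (case_prod (\<lambda>s r. if 0 < r \<and> r < s \<and> s < t then k s r else 0))"
      by (simp add: case_prod_beta')
    have "tint t (\<lambda>s. tint s (\<lambda>r. k s r)) = (\<integral>s. (\<integral>r. (if 0 < r \<and> r < s \<and> s < t then k s r else 0) \<partial>lborel) \<partial>lborel)"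
      unfolding tint_def
    proof (rule Bochner_Integration.integral_cong)
      fix s :: real
      have z: "(\<integral>r. (if 0 < r \<and> r < s \<and> s < t then k s r else 0) \<partial>lborel) = 0" if "\<not> (0 < s \<and> s < t)"
        by (subst Bochner_Integration.integral_cong[where g="\<lambda>_. 0"]) (use that in auto)
      show "(if 0 < s \<and> s < t then \<integral>r. (if 0 < r \<and> r < s then k s r else 0) \<partial>lborel else 0)
        = (\<integral>r. (if 0 < r \<and> r < s \<and> s < t then k s r else 0) \<partial>lborel)"
        using z by (auto intro!: Bochner_Integration.integral_cong)
    qed simp
    also have "\<dots> = (\<integral>r. (\<integral>s. (if 0 < r \<and> r < s \<and> s < t then k s r else 0) \<partial>lborel) \<partial>lborel)"
      by (rule lborel_pair.Fubini_integral[OF i, symmetric])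
    finally show ?thesis .
  qed
  have "tint t (\<lambda>s. tint s (\<lambda>r. h r (x - s + r)))
      = (\<integral>r. (\<integral>s. (if 0 < r \<and> r < s \<and> s < t then h r (x - s + r) else 0) \<partial>lborel) \<partial>lborel)"
    by (rule fub) (use b in \<open>auto intro!: bmeas2_comp[OF h] borel_measurable_add borel_measurable_diff mfs\<close>)
  also have "\<dots> = (\<integral>r. (\<integral>s. (if 0 < r \<and> r < s \<and> s < t then h r (x - t + s) else 0) \<partial>lborel) \<partial>lborel)"
  proof (rule Bochner_Integration.integral_cong)
    fix r :: real
    have "(\<integral>s. (if 0 < r \<and> r < s \<and> s < t then h r (x - s + r) else 0) \<partial>lborel)
        = (\<integral>s. (if 0 < r \<and> r < (t + r) + (-1) * s \<and> (t + r) + (-1) * s < t then h r (x - ((t + r) + (-1) * s) + r) else 0) \<partial>lborel)"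
      by (subst lborel_integral_real_affine[where c="-1" and t="t + r"]) auto
    also have "\<dots> = (\<integral>s. (if 0 < r \<and> r < s \<and> s < t then h r (x - t + s) else 0) \<partial>lborel)"
      by (rule Bochner_Integration.integral_cong) (auto simp: algebra_simps)
    finally show "(\<integral>s. (if 0 < r \<and> r < s \<and> s < t then h r (x - s + r) else 0) \<partial>lborel)
        = (\<integral>s. (if 0 < r \<and> r < s \<and> s < t then h r (x - t + s) else 0) \<partial>lborel)" .
  qed simp
  also have "\<dots> = tint t (\<lambda>s. tint s (\<lambda>r. h r (x - t + s)))"
    by (rule fub[symmetric]) (use b in \<open>auto intro!: bmeas2_comp[OF h] borel_measurable_add borel_measurable_diff mfs\<close>)
  finally show ?thesis .
qed

section \<open>The transport equation in integrated form\<close>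

context forcing
begin

text \<open>The right-hand side of the transport equation for \<open>V sol\<close>; at the integers,
  where the odd extension may jump, \<open>sg\<close> gives it the value 0.\<close>

definition F :: "real \<Rightarrow> real \<Rightarrow> real" where
  "F t x = - sg x * f t (zigzag x) (odd_part (V sol) t (zigzag x))"

lemma bmeas2_sol: "bmeas2 sol"
  by (rule QD(1)[OF Q_sol])

lemma bmeas2_F: "bmeas2 F"
proof -
  have r: "(\<lambda>p::real\<times>real. zigzag (snd p)) \<in> borel_measurable borel" "(\<lambda>p::real\<times>real. sg (snd p)) \<in> borel_measurable borel"
    by (rule measurable_compose[OF fst_snd_borel(2) borel_measurable_zigzag])
      (rule measurable_compose[OF fst_snd_borel(2) borel_measurable_sg])
  have o: "(\<lambda>p::real\<times>real. odd_part (V sol) (fst p) (zigzag (snd p))) \<in> borel_measurable borel"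
    by (rule bmeas2_comp[OF bmeas2_odd_part[OF bmeas2_V[OF bmeas2_sol]] fst_snd_borel(1) r(1)])
  show ?thesis
    unfolding bmeas2_def F_def
    by (intro borel_measurable_times borel_measurable_uminus bmeas3_comp[OF f_meas] o r fst_snd_borel)
qed

lemma V_primitive: "primitive_on {0..T} (\<lambda>t. V sol t x) (\<lambda>s. sol s x)"
  unfolding V_def by (rule tint_primitive[OF bmeas2_sections(1)[OF bmeas2_sol], of _ _ RR]) (use sol_bound in auto)

lemma V_0: "V sol 0 x = 0"
  by (simp add: V_def tint_nonpos)

lemma V_lipschitz:
  assumes "s \<in> {0..T}" "t \<in> {0..T}"
  shows "\<bar>V sol t x - V sol s x\<bar> \<le> RR * \<bar>t - s\<bar>"
proof -
  have *: "\<bar>V sol t x - V sol s x\<bar> \<le> RR * (t - s)" if "s \<in> {0..T}" "t \<in> {0..T}" "s \<le> t" for s t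
    using primitive_on_increment_bound[OF V_primitive[of x] that, where c=0 and e=RR] sol_bound that by auto
  consider "s \<le> t" | "t \<le> s" by linarith
  then show ?thesis using *[OF assms] *[OF assms(2,1)] by cases (auto simp: abs_minus_commute)
qed

lemma isCont_V_sol: "0 < t \<Longrightarrow> t < T \<Longrightarrow> isCont (\<lambda>p. V sol (fst p) (snd p)) (t, x)"
  by (rule isCont_V[OF QD(1)[OF Q_sol] QD(4)[OF Q_sol] QD(3)[OF Q_sol]])

lemma isCont_sol_time: "sin (pi * (x - t)) \<noteq> 0 \<Longrightarrow> isCont (\<lambda>s. sol s x) t"
  by (rule isCont_comp2[where a="\<lambda>s. s" and b="\<lambda>_. x"]) (auto intro: isCont_sol)

lemma V_has_derivative:
  assumes "0 < t" "t < T" "sin (pi * (x - t)) \<noteq> 0"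
  shows "((\<lambda>t. V sol t x) has_real_derivative sol t x) (at t)"
  by (rule primitive_on_has_derivative[OF primitive_on_subset[OF V_primitive], of "{0<..<T}"])
    (use assms isCont_sol_time in \<open>auto simp: is_interval_oo\<close>)

lemma V_bound_sol: "t \<in> {0..T} \<Longrightarrow> \<bar>V sol t x\<bar> \<le> RR * T"
  using V_lipschitz[of 0 t x] T_pos constants by (auto simp: V_0 intro: order_trans mult_left_mono)

lemma continuous_odd_part_V: "continuous_on {0..T} (\<lambda>t. odd_part (V sol) t y)"
  unfolding odd_part_def
  by (intro continuous_intros primitive_on_continuous_Icc[OF V_primitive]) auto

lemma continuous_f_sol:
  assumes "y \<in> {0<..<1}"
  shows "continuous_on {0..T} (\<lambda>t. f t y (odd_part (V sol) t y))"
proof -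
  have c: "continuous_on {0..T} (\<lambda>t. (t, odd_part (V sol) t y))"
    by (intro continuous_on_Pair continuous_on_id continuous_odd_part_V)
  have "continuous_on {0..T} (\<lambda>t. f (fst (t, odd_part (V sol) t y)) y (snd (t, odd_part (V sol) t y)))"
    by (rule continuous_on_compose2[OF f_cont[OF assms] c]) auto
  then show ?thesis by simp
qed

lemma F_0: "F 0 x = - sg x * f 0 (zigzag x) 0"
  by (simp add: F_def odd_part_def V_0)

text \<open>At fixed \<open>x\<close>, \<open>H sol\<close> is the total time derivative of
  \<open>F\<close> except at finitely many bad times. Since \<open>F\<close> is continuous in time,
  the fundamental theorem of calculus tolerates these.\<close>

lemma F_duhamel:
  assumes x: "sin (pi * x) \<noteq> 0" and t: "t \<in> {0..T}"
  shows "F t x = F 0 x + tint t (\<lambda>s. H sol s x)"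
proof -
  let ?y = "zigzag x" let ?u = "\<lambda>s. odd_part (V sol) s (zigzag x)" let ?du = "\<lambda>s. odd_part sol s (zigzag x)"
  have y: "?y \<in> {0<..<1}" by (rule zigzag_interior[OF x])
  let ?\<phi> = "\<lambda>s. f s ?y (?u s)" let ?\<phi>' = "\<lambda>s. ft s ?y (?u s) + fw s ?y (?u s) * ?du s"
  have sy: "sin (pi * zigzag x) \<noteq> 0" using sin_pi_pos[OF y] by simp
  have "(?\<phi>' has_integral (?\<phi> t - ?\<phi> 0)) {0..t}"
  proof (rule fundamental_theorem_of_calculus_interior_strong[where S="{s \<in> {0..T}. \<not> good s ?y}"])
    show "finite {s \<in> {0..T}. \<not> good s ?y}" by (rule finite_bad_t[OF sy])
    show "0 \<le> t" using t by simp
    show "continuous_on {0..t} ?\<phi>" by (rule continuous_on_subset[OF continuous_f_sol[OF y]]) (use t in auto)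
    fix s assume s: "s \<in> {0<..<t} - {s \<in> {0..T}. \<not> good s ?y}"
    then have s': "0 < s" "s < T" "good s ?y" using t by auto
    have g1: "sin (pi * (?y - s)) \<noteq> 0" using s'(3) by (simp add: good_iff)
    have g2: "sin (pi * (- ?y - s)) \<noteq> 0"
      using s'(3) good_minus[of s ?y] by (simp add: good_iff)
    have du: "(?u has_real_derivative ?du s) (at s)"
      unfolding odd_part_def
      by (intro DERIV_cdivide DERIV_diff V_has_derivative s' g1 g2)
    have "((\<lambda>s. (s, ?u s)) has_derivative (\<lambda>h. (h, ?du s * h))) (at s)"
      by (intro has_derivative_Pair has_derivative_ident) (use du in \<open>simp add: has_field_derivative_def\<close>)
    from diff_chain_at[OF this, of "\<lambda>q. f (fst q) ?y (snd q)"] f_deriv[of s ?y "?u s"] s' y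
    have "((\<lambda>q. f (fst q) ?y (snd q)) \<circ> (\<lambda>s. (s, ?u s)) has_derivative
        (\<lambda>d. ft s ?y (?u s) * fst d + fw s ?y (?u s) * snd d) \<circ> (\<lambda>h. (h, ?du s * h))) (at s)"
      by auto
    then have "(?\<phi> has_derivative (\<lambda>h. ?\<phi>' s * h)) (at s)"
      by (simp add: o_def algebra_simps)
    then show "(?\<phi> has_vector_derivative ?\<phi>' s) (at s)"
      by (simp add: has_field_derivative_def flip: has_real_derivative_iff_has_vector_derivative)
  qed
  then have "((\<lambda>s. - sg x * ?\<phi>' s) has_integral (- sg x * (?\<phi> t - ?\<phi> 0))) {0..t}"
    by (rule has_integral_mult_right)
  from integral_unique[OF this] have "integral {0..t} (\<lambda>s. H sol s x) = F t x - F 0 x"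
    unfolding H_def F_def by (simp only: right_diff_distrib)
  moreover have "primitive_on {0..T} (\<lambda>t. tint t (\<lambda>s. H sol s x)) (\<lambda>s. H sol s x)"
    by (rule tint_primitive[OF bmeas2_sections(1)[OF bmeas2_H[OF bmeas2_sol]], of _ _ "K + 2 * K * RR"])
      (use H_bound_RR[OF Q_sol] in auto)
  then have "tint t (\<lambda>s. H sol s x) - tint 0 (\<lambda>s. H sol s x) = integral {0..t} (\<lambda>s. H sol s x)"
    by (rule primitive_onD(2)) (use t T_pos in auto)
  ultimately show ?thesis by (simp add: tint_nonpos)
qed

definition "FB = K + (K + 2 * K * RR) * T"

lemma F_bound:
  assumes t: "t \<in> {0..T}"
  shows "\<bar>F t x\<bar> \<le> FB"
proof (cases "sin (pi * x) = 0")
  case True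
  then show ?thesis using constants K T_pos by (simp add: F_def sg_def FB_def)
next
  case False
  have "\<bar>tint t (\<lambda>s. H sol s x)\<bar> \<le> (K + 2 * K * RR) * t"
    by (rule tint_bound) (use t H_bound_RR[OF Q_sol] in auto)
  also have "\<dots> \<le> (K + 2 * K * RR) * T" using t K constants by (intro mult_left_mono) auto
  finally have 1: "\<bar>tint t (\<lambda>s. H sol s x)\<bar> \<le> (K + 2 * K * RR) * T" .
  have "\<bar>F 0 x\<bar> \<le> 1 * K"
    unfolding F_0 abs_mult abs_minus_cancel by (intro mult_mono sg_bounds f0_bound zigzag_range) auto
  then show ?thesis using F_duhamel[OF False t] 1 by (simp add: FB_def)
qed

text \<open>Undoes the differentiation in time. Integrating the fixed-point equation gives a double
  integral of \<open>H\<close>; the triangle substitution moves it onto the characteristic through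
  \<open>(t, x)\<close>, and \<open>F_duhamel\<close> recombines it with \<open>F 0\<close> into
  \<open>F s\<close>.\<close>

lemma V_mild:
  assumes t: "t \<in> {0..T}"
  shows "V sol t x = tint t (\<lambda>s. F s (x - t + s))"
proof -
  have Hm: "bmeas2 (H sol)" by (rule bmeas2_H[OF bmeas2_sol])
  have F0m: "(\<lambda>s. F 0 (c + s)) \<in> borel_measurable borel" "(\<lambda>s. F 0 (c - s)) \<in> borel_measurable borel" for c
    by (intro bmeas2_comp[OF bmeas2_F]; measurable)+
  have Hint: "(\<lambda>s. tint s (\<lambda>r. H sol r (a s + b r))) \<in> borel_measurable borel"
    if "a \<in> borel_measurable borel" "b \<in> borel_measurable borel" for a b :: "real \<Rightarrow> real"
    by (rule measurable_tint[of "\<lambda>s. s"]) (auto intro!: bmeas2_comp[OF Hm] borel_measurable_add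
        measurable_compose[OF measurable_fst that(1)] measurable_compose[OF measurable_snd] simp: that)
  have Hint1: "(\<lambda>s. tint s (\<lambda>r. H sol r (x - s + r))) \<in> borel_measurable borel"
    by (rule Hint[of "\<lambda>s. x - s" "\<lambda>r. r"]) auto
  have Hint2: "(\<lambda>s. tint s (\<lambda>r. H sol r (x - t + s))) \<in> borel_measurable borel"
    using Hint[of "\<lambda>s. x - t + s" "\<lambda>r. 0"] by simp
  have Hb: "\<bar>tint s (\<lambda>r. H sol r (c r))\<bar> \<le> (K + 2 * K * RR) * T" if "0 < s" "s < t" for s c
  proof -
    have "\<bar>tint s (\<lambda>r. H sol r (c r))\<bar> \<le> (K + 2 * K * RR) * s"
      by (rule tint_bound) (use that t H_bound_RR[OF Q_sol] in auto)
    also have "\<dots> \<le> (K + 2 * K * RR) * T" using that t K constants by (intro mult_left_mono) auto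
    finally show ?thesis .
  qed
  have T0: "0 \<in> {0..T}" using T_pos by simp
  have "V sol t x = tint t (\<lambda>s. F 0 (x - s) + tint s (\<lambda>r. H sol r (x - s + r)))"
    unfolding V_def
  proof (rule tint_cong)
    fix s assume s: "0 < s" "s < t"
    have "sol s x = Phi sol s x" by (rule sol_fixpoint)
    then show "sol s x = F 0 (x - s) + tint s (\<lambda>r. H sol r (x - s + r))"
      using s t by (simp add: Phi_def F_0 min_absorb1)
  qed
  also have "\<dots> = tint t (\<lambda>s. F 0 (x - s)) + tint t (\<lambda>s. tint s (\<lambda>r. H sol r (x - s + r)))"
    by (rule tint_add[of _ _ FB _ "(K + 2 * K * RR) * T"]) (use F0m Hint1 F_bound[OF T0] Hb in auto)
  also have "tint t (\<lambda>s. F 0 (x - s)) = tint t (\<lambda>s. F 0 (x - t + s))"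
    by (subst tint_reflect) (simp add: algebra_simps)
  also have "tint t (\<lambda>s. tint s (\<lambda>r. H sol r (x - s + r))) = tint t (\<lambda>s. tint s (\<lambda>r. H sol r (x - t + s)))"
    by (rule tint_triangle_reflect[OF Hm, of _ "K + 2 * K * RR"]) (use H_bound_RR[OF Q_sol] t in auto)
  also have "tint t (\<lambda>s. F 0 (x - t + s)) + tint t (\<lambda>s. tint s (\<lambda>r. H sol r (x - t + s)))
      = tint t (\<lambda>s. F 0 (x - t + s) + tint s (\<lambda>r. H sol r (x - t + s)))"
    by (rule tint_add[of _ _ FB _ "(K + 2 * K * RR) * T", symmetric]) (use F0m(1)[of "x - t"] Hint2 F_bound[OF T0] Hb in auto)
  also have "\<dots> = tint t (\<lambda>s. F s (x - t + s))"
  proof (rule tint_cong_AE)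
    have "AE s in lborel. sin (pi * (1 * s + (x - t))) \<noteq> 0" by (rule AE_sin_pi) simp
    then show "AE s in lborel. 0 < s \<longrightarrow> s < t \<longrightarrow> F 0 (x - t + s) + tint s (\<lambda>r. H sol r (x - t + s)) = F s (x - t + s)"
    proof eventually_elim
      case (elim s)
      then have e: "sin (pi * (x - t + s)) \<noteq> 0" by (simp add: add.commute)
      show ?case using F_duhamel[OF e, of s] t by auto
    qed
    show "(\<lambda>s. F s (x - t + s)) \<in> borel_measurable borel" by (rule bmeas2_sections(3)[OF bmeas2_F])
  qed (intro borel_measurable_add F0m Hint2)
  finally show ?thesis .
qed

end

lemma AE_lborel_imp_lebesgue_on:
  assumes "AE x in lborel. P x" "S \<in> sets lebesgue"
  shows "AE x in lebesgue_on S. P x"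
proof -
  have "AE x in lebesgue. P x" by (rule AE_completion[OF assms(1)])
  then show ?thesis using assms(2) by (auto simp: AE_restrict_space_iff elim!: eventually_mono)
qed

lemma borel_measurable_lebesgue_onI:
  fixes h :: "real \<Rightarrow> real"
  assumes "h \<in> borel_measurable borel"
  shows "h \<in> borel_measurable (lebesgue_on S)"
proof -
  have "h \<in> borel_measurable lborel" using assms by simp
  then show ?thesis by (intro measurable_restrict_space1 measurable_completion)
qed

lemma bounded_borel_integrable:
  fixes h :: "real \<Rightarrow> real"
  assumes "h \<in> borel_measurable borel" "\<And>s. s \<in> {a..b} \<Longrightarrow> \<bar>h s\<bar> \<le> B"
  shows "integrable (lebesgue_on {a..b}) h"
proof -
  interpret finite_measure "lebesgue_on {a..b}" by (rule finite_measure_lebesgue_on) auto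
  show ?thesis
    by (rule integrable_const_bound[of _ B]) (use assms in \<open>auto intro!: AE_I2 borel_measurable_lebesgue_onI\<close>)
qed

section \<open>The space derivative of the invariant\<close>

context forcing
begin

lemma isCont_F:
  assumes t: "0 < t" "t < T" and x: "sin (pi * x) \<noteq> 0"
  shows "isCont (\<lambda>p. F (fst p) (snd p)) (t, x)"
proof -
  have t': "t \<in> {0<..<T}" using t by auto
  have y: "zigzag x \<in> {0<..<1}" by (rule zigzag_interior[OF x])
  have cr: "isCont (\<lambda>p::real\<times>real. zigzag (snd p)) (t, x)"
    by (rule isCont_o2[of "(t, x)" snd zigzag]) (auto intro!: continuous_intros isCont_zigzag)
  have csg: "isCont (\<lambda>p::real\<times>real. sg (snd p)) (t, x)"
    by (rule isCont_o2[of "(t, x)" snd sg]) (auto intro!: continuous_intros isCont_sg x)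
  have cf: "isCont (\<lambda>p::real\<times>real. fst p) (t, x)" by (auto intro!: continuous_intros)
  have Vc: "isCont (\<lambda>p. V sol (fst p) (snd p)) (t, w)" for w by (rule isCont_V_sol[OF t])
  have oV: "isCont (\<lambda>p. odd_part (V sol) (fst p) (zigzag (snd p))) (t, x)"
    by (rule isCont_comp2[where a=fst and b="\<lambda>p. zigzag (snd p)"]) (use isCont_odd_part[OF Vc Vc] cf cr in simp_all)
  have "isCont (\<lambda>p. f (fst p) (zigzag (snd p)) (odd_part (V sol) (fst p) (zigzag (snd p)))) (t, x)"
    by (rule isCont_comp3[where a=fst and b="\<lambda>p. zigzag (snd p)" and c="\<lambda>p. odd_part (V sol) (fst p) (zigzag (snd p))"])
      (use f_isCont[OF t' y] cf cr oV in simp_all)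
  then show ?thesis unfolding F_def by (intro continuous_intros csg)
qed

text \<open>\<open>(t, x + k)\<close> and \<open>(t - k, x)\<close> lie on one characteristic, so by
  the mild formula the difference is the signed integral of \<open>F\<close> over the piece between
  them. Continuity of \<open>F\<close> at \<open>(t, x)\<close> gives the derivative; no
  differentiability of \<open>F\<close> in space is involved.\<close>

lemma V_shift_derivative:
  assumes t: "0 < t" "t < T" and x: "sin (pi * x) \<noteq> 0"
  shows "((\<lambda>k. V sol t (x + k) - V sol (t - k) x) has_real_derivative F t x) (at 0)"
proof -
  let ?D = "\<lambda>k. V sol t (x + k) - V sol (t - k) x"
  have "((\<lambda>k. (?D k - ?D 0) / (k - 0)) \<longlongrightarrow> F t x) (at 0)"
  proof (rule tendstoI)
    fix e :: real assume e: "0 < e"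
    obtain d where d: "d > 0" "\<And>p. dist p (t, x) < d \<Longrightarrow> dist (F (fst p) (snd p)) (F t x) < e / 2"
      using isCont_F[OF t x] e unfolding continuous_at_eps_delta by (metis fst_conv half_gt_zero snd_conv)
    \<comment> \<open>Points of the piece deviate from \<open>(t, x)\<close> by at most
      \<open>\<bar>k\<bar>\<close> in time and \<open>2 * \<bar>k\<bar>\<close> in space, hence
      \<open>d / 3\<close>. The other bounds keep \<open>t - k\<close> inside the time
      interval.\<close>
    define d' where "d' = min (d / 3) (min t (T - t))"
    have d': "d' > 0" using d(1) t by (auto simp: d'_def)
    have "dist ((?D k - ?D 0) / (k - 0)) (F t x) < e" if k: "k \<noteq> 0" "dist k 0 < d'" for k
    proof -
      have kd: "\<bar>k\<bar> < d / 3" "\<bar>k\<bar> < t" "\<bar>k\<bar> < T - t" using k(2) by (auto simp: d'_def)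
      let ?g = "\<lambda>s. F s (x + k - t + s)"
      have tk: "t \<in> {0..T}" "t - k \<in> {0..T}" using t kd by auto
      have Dk: "?D k = tint t ?g - tint (t - k) ?g"
        using V_mild[OF tk(1), of "x + k"] V_mild[OF tk(2), of x] by (simp add: algebra_simps)
      have p: "primitive_on {0..T} (\<lambda>r. tint r ?g) ?g"
        by (rule tint_primitive[OF bmeas2_sections(3)[OF bmeas2_F], of _ _ FB]) (use F_bound in auto)
      have g: "\<bar>?g s - F t x\<bar> \<le> e / 2" if s: "\<bar>s - t\<bar> \<le> \<bar>k\<bar>" for s
      proof -
        have "dist (s, x + k - t + s) (t, x) \<le> \<bar>s - t\<bar> + \<bar>x + k - t + s - x\<bar>"
          using dist_Pair_Pair[of s "x + k - t + s" t x] sqrt_sum_squares_le_sum_abs[of "s - t" "x + k - t + s - x"]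
          by (simp add: dist_real_def)
        also have "\<dots> < d" using s kd by linarith
        finally show ?thesis using d(2)[of "(s, x + k - t + s)"] by (simp add: dist_real_def)
      qed
      have "\<bar>?D k - F t x * k\<bar> \<le> e / 2 * \<bar>k\<bar>"
      proof (cases "0 < k")
        case True
        have "\<bar>tint t ?g - tint (t - k) ?g - F t x * (t - (t - k))\<bar> \<le> e / 2 * (t - (t - k))"
          by (rule primitive_on_increment_bound[OF p tk(2,1)]) (use True g in auto)
        then show ?thesis using True by (simp add: Dk)
      next
        case False
        have "\<bar>tint (t - k) ?g - tint t ?g - F t x * ((t - k) - t)\<bar> \<le> e / 2 * ((t - k) - t)"
          by (rule primitive_on_increment_bound[OF p tk(1,2)]) (use False g in auto)
        moreover have "tint (t - k) ?g - tint t ?g - F t x * ((t - k) - t) = - (?D k - F t x * k)"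
          unfolding Dk by (simp add: right_diff_distrib)
        ultimately show ?thesis using False by (simp add: abs_minus_commute)
      qed
      then have "\<bar>?D k - F t x * k\<bar> / \<bar>k\<bar> \<le> e / 2" using k(1) by (simp add: divide_le_eq)
      moreover have "(?D k - ?D 0) / (k - 0) - F t x = (?D k - F t x * k) / k"
        using k(1) by (simp add: field_simps)
      ultimately have "\<bar>(?D k - ?D 0) / (k - 0) - F t x\<bar> \<le> e / 2" by (metis abs_divide)
      then show ?thesis using e unfolding dist_real_def by linarith
    qed
    then show "eventually (\<lambda>k. dist ((?D k - ?D 0) / (k - 0)) (F t x) < e) (at 0)"
      unfolding eventually_at using d' by blast
  qed
  then show ?thesis by (simp add: has_field_derivative_iff)
qed

text \<open>A space shift is a shift along the characteristic plus a backward shift in time; the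
  first contributes \<open>F t x\<close>, the second \<open>- sol t x\<close>.\<close>

lemma V_x_derivative:
  assumes t: "0 < t" "t < T" and x: "sin (pi * x) \<noteq> 0" "sin (pi * (x - t)) \<noteq> 0"
  shows "(V sol t has_real_derivative (F t x - sol t x)) (at x)"
proof -
  have "((\<lambda>k. V sol (t - k) x) has_real_derivative sol t x * (-1)) (at 0)"
    by (rule DERIV_chain2[where f="\<lambda>s. V sol s x" and g="\<lambda>k. t - k"])
      (use V_has_derivative[OF t x(2)] in \<open>auto intro!: derivative_eq_intros\<close>)
  from DERIV_add[OF V_shift_derivative[OF t x(1)] this]
  have "((\<lambda>k. V sol t (k + x)) has_real_derivative (F t x - sol t x)) (at 0)"
    by (simp add: add.commute)
  then show ?thesis using DERIV_shift[of "V sol t" "F t x - sol t x" 0 x] by simp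
qed

lemma V_x_integrable:
  assumes t: "t \<in> {0..T}"
  shows "integrable (lebesgue_on {x..y}) (\<lambda>\<xi>. F t \<xi> - sol t \<xi>)"
proof (rule bounded_borel_integrable[of _ _ _ "FB + RR"])
  show "(\<lambda>\<xi>. F t \<xi> - sol t \<xi>) \<in> borel_measurable borel"
    by (intro borel_measurable_diff bmeas2_sections(2) bmeas2_F bmeas2_sol)
  show "\<bar>F t s - sol t s\<bar> \<le> FB + RR" for s
    using F_bound[OF t, of s] sol_bound[of t s] t by auto
qed

lemma V_x_primitive_interior:
  assumes t: "0 < t" "t < T"
  shows "primitive_on UNIV (V sol t) (\<lambda>\<xi>. F t \<xi> - sol t \<xi>)"
  unfolding primitive_on_def
proof (intro ballI impI conjI)
  fix x y :: real assume xy: "x \<le> y"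
  show "integrable (lebesgue_on {x..y}) (\<lambda>\<xi>. F t \<xi> - sol t \<xi>)" using V_x_integrable t by auto
  have "((\<lambda>\<xi>. F t \<xi> - sol t \<xi>) has_integral (V sol t y - V sol t x)) {x..y}"
  proof (rule fundamental_theorem_of_calculus_interior_strong[OF finite_bad_x[where t=t] xy])
    show "(V sol t has_vector_derivative F t \<xi> - sol t \<xi>) (at \<xi>)"
      if "\<xi> \<in> {x<..<y} - {\<xi> \<in> {x..y}. \<not> good t \<xi>}" for \<xi>
    proof -
      have "good t \<xi>" using that by auto
      then show ?thesis
        using V_x_derivative[OF t, of \<xi>] by (simp add: good_iff flip: has_real_derivative_iff_has_vector_derivative)
    qed
    have "isCont (V sol t) \<xi>" for \<xi>
      by (rule isCont_comp2[where a="\<lambda>_. t" and b="\<lambda>x. x"]) (auto intro: isCont_V_sol t)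
    then show "continuous_on {x..y} (V sol t)" by (simp add: continuous_at_imp_continuous_on)
  qed
  then show "V sol t y - V sol t x = integral {x..y} (\<lambda>\<xi>. F t \<xi> - sol t \<xi>)" by (simp add: integral_unique)
qed

text \<open>The end times are reached from interior times by dominated convergence; both sides of
  the identity converge.\<close>

lemma V_x_primitive:
  assumes t: "t \<in> {0..T}"
  shows "primitive_on UNIV (V sol t) (\<lambda>\<xi>. F t \<xi> - sol t \<xi>)"
  unfolding primitive_on_def
proof (intro ballI impI conjI)
  fix x y :: real assume xy: "x \<le> y"
  let ?M = "lebesgue_on {x..y}"
  let ?G = "\<lambda>t \<xi>. F t \<xi> - sol t \<xi>"
  show i: "integrable ?M (?G t)" by (rule V_x_integrable[OF t])
  \<comment> \<open>Times moving from \<open>T / 2\<close> to \<open>t\<close>, so that they stay in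
    the open interval even when \<open>t\<close> is 0 or \<open>T\<close>.\<close>
  define s where "s = (\<lambda>n::nat. t + (T / 2 - t) * inverse (real (Suc n)))"
  have st: "s \<longlonglongrightarrow> t"
  proof -
    have "(\<lambda>n. t + (T / 2 - t) * inverse (real (Suc n))) \<longlonglongrightarrow> t + (T / 2 - t) * 0"
      by (intro tendsto_intros LIMSEQ_inverse_real_of_nat)
    then show ?thesis by (simp add: s_def)
  qed
  have s: "0 < s n" "s n < T" for n
  proof -
    define \<theta> where "\<theta> = inverse (real (Suc n))"
    have th: "0 < \<theta>" "\<theta> \<le> 1" by (auto simp: \<theta>_def inverse_le_1_iff)
    have e: "s n = t * (1 - \<theta>) + T / 2 * \<theta>" by (simp add: s_def \<theta>_def algebra_simps)
    have "0 \<le> t * (1 - \<theta>)" "0 < T / 2 * \<theta>" using t th T_pos by auto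
    then show "0 < s n" unfolding e by linarith
    have "t * (1 - \<theta>) \<le> T * (1 - \<theta>)" using t th by (intro mult_right_mono) auto
    moreover have "T / 2 * \<theta> < T * \<theta>" using th T_pos by simp
    ultimately show "s n < T" unfolding e by (simp add: right_diff_distrib)
  qed
  then have s': "s n \<in> {0..T}" for n by (simp add: less_imp_le)
  have cV: "(\<lambda>n. V sol (s n) w) \<longlonglongrightarrow> V sol t w" for w
    by (rule continuous_on_tendsto_compose[OF primitive_on_continuous_Icc[OF V_primitive] st t]) (use s' in auto)
  have "(\<lambda>n. \<integral>\<xi>. ?G (s n) \<xi> \<partial>?M) \<longlonglongrightarrow> (\<integral>\<xi>. ?G t \<xi> \<partial>?M)"
  proof (rule integral_dominated_convergence[where w="\<lambda>_. FB + RR"])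
    have "AE \<xi> in lborel. sin (pi * (1 * \<xi> + 0)) \<noteq> 0" "AE \<xi> in lborel. sin (pi * (1 * \<xi> + (- t))) \<noteq> 0"
      by (rule AE_sin_pi; simp)+
    then have "AE \<xi> in lborel. (\<lambda>n. ?G (s n) \<xi>) \<longlonglongrightarrow> ?G t \<xi>"
    proof eventually_elim
      case (elim \<xi>)
      have "(\<lambda>n. f (s n) (zigzag \<xi>) (odd_part (V sol) (s n) (zigzag \<xi>))) \<longlonglongrightarrow> f t (zigzag \<xi>) (odd_part (V sol) t (zigzag \<xi>))"
        by (rule continuous_on_tendsto_compose[OF continuous_f_sol st t]) (use s' zigzag_interior[of \<xi>] elim in auto)
      then have "(\<lambda>n. F (s n) \<xi>) \<longlonglongrightarrow> F t \<xi>" unfolding F_def by (intro tendsto_intros)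
      moreover have "(\<lambda>n. sol (s n) \<xi>) \<longlonglongrightarrow> sol t \<xi>"
        by (rule isCont_tendsto_compose[OF isCont_sol_time st]) (use elim in simp)
      ultimately show ?case by (intro tendsto_diff)
    qed
    then show "AE \<xi> in ?M. (\<lambda>n. ?G (s n) \<xi>) \<longlonglongrightarrow> ?G t \<xi>" by (rule AE_lborel_imp_lebesgue_on) simp
    show "AE \<xi> in ?M. norm (?G (s n) \<xi>) \<le> FB + RR" for n
    proof (rule AE_I2)
      fix \<xi>
      show "norm (?G (s n) \<xi>) \<le> FB + RR" using F_bound[OF s'[of n], of \<xi>] sol_bound[of "s n" \<xi>] s'[of n] by auto
    qed
  qed (use V_x_integrable[OF s'] i in auto)
  moreover have "(\<integral>\<xi>. ?G (s n) \<xi> \<partial>?M) = V sol (s n) y - V sol (s n) x" for n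
    using primitive_onD(1,2)[OF V_x_primitive_interior[OF s, of n] UNIV_I UNIV_I xy] lebesgue_integral_eq_integral
    by (metis UNIV_I V_x_integrable s' atLeastAtMost_borel sets_completionI_sets sets_lborel)
  ultimately have "(\<lambda>n. V sol (s n) y - V sol (s n) x) \<longlonglongrightarrow> (\<integral>\<xi>. ?G t \<xi> \<partial>?M)" by simp
  moreover have "(\<lambda>n. V sol (s n) y - V sol (s n) x) \<longlonglongrightarrow> V sol t y - V sol t x"
    by (intro tendsto_diff cV)
  ultimately have "V sol t y - V sol t x = (\<integral>\<xi>. ?G t \<xi> \<partial>?M)" by (rule LIMSEQ_unique[rotated])
  then show "V sol t y - V sol t x = integral {x..y} (?G t)"
    using lebesgue_integral_eq_integral[OF i] by simp
qed

text \<open>Period 2 identifies the values at -1 and 1, which is the boundary condition of the odd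
  part at \<open>x = 1\<close>.\<close>

lemma sol_periodic: "sol t (x + 2) = sol t x"
proof -
  have e: "x + 2 - t = (x - t) + 2" "\<And>s. (x - t) + 2 + s = (x - t + s) + 2" by auto
  have "H sol s (y + 2) = H sol s y" for s y by (simp add: H_def sg_add_2 zigzag_add_2)
  then have "Phi sol t (x + 2) = Phi sol t x"
    unfolding Phi_def e by (simp only: sg_add_2 zigzag_add_2)
  then show ?thesis using sol_fixpoint by metis
qed

lemma solution_exists:
  "\<exists>v z R. bmeas2 v \<and> bmeas2 z \<and> 0 < R
    \<and> (\<forall>x. primitive_on {0..T} (\<lambda>t. v t x) (\<lambda>t. z t x)) \<and> (\<forall>x. v 0 x = 0)
    \<and> (\<forall>t\<in>{0..T}. \<forall>x. \<bar>z t x\<bar> \<le> R \<and> \<bar>v t x\<bar> \<le> R * T \<and> \<bar>f t (zigzag x) (odd_part v t (zigzag x)) * sg x\<bar> \<le> R)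
    \<and> (\<forall>t x. sin (pi * (x - t)) \<noteq> 0 \<longrightarrow> isCont (\<lambda>p. z (fst p) (snd p)) (t, x))
    \<and> (\<forall>t x. 0 < t \<longrightarrow> t < T \<longrightarrow> isCont (\<lambda>p. v (fst p) (snd p)) (t, x))
    \<and> (\<forall>t x. v t (x + 2) = v t x)
    \<and> (\<forall>y\<in>{0<..<1}. continuous_on {0..T} (\<lambda>t. f t y (odd_part v t y)))
    \<and> (\<forall>t\<in>{0..T}. \<forall>x. v t x =
        tint t (\<lambda>s. - sg (x - t + s) * f s (zigzag (x - t + s)) (odd_part v s (zigzag (x - t + s)))))
    \<and> (\<forall>t\<in>{0..T}. primitive_on UNIV (v t)
        (\<lambda>\<xi>. - sg \<xi> * f t (zigzag \<xi>) (odd_part v t (zigzag \<xi>)) - z t \<xi>))"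
proof (rule exI[of _ "V sol"], rule exI[of _ sol], rule exI[of _ "max RR FB"], intro conjI ballI allI impI)
  show "bmeas2 (V sol)" "bmeas2 sol" by (intro bmeas2_V bmeas2_sol)+
  show "0 < max RR FB" using constants by auto
  show "primitive_on {0..T} (\<lambda>t. V sol t x) (\<lambda>t. sol t x)" for x by (rule V_primitive)
  show "V sol 0 x = 0" for x by (rule V_0)
  fix t x assume t: "t \<in> {0..T}"
  show "\<bar>sol t x\<bar> \<le> max RR FB" using sol_bound[of t x] t by auto
  have "RR * T \<le> max RR FB * T" using T_pos by (intro mult_right_mono) auto
  then show "\<bar>V sol t x\<bar> \<le> max RR FB * T" using V_bound_sol[OF t, of x] by linarith
  show "\<bar>f t (zigzag x) (odd_part (V sol) t (zigzag x)) * sg x\<bar> \<le> max RR FB"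
    using F_bound[OF t, of x] by (simp add: F_def abs_mult mult.commute)
next
  show "isCont (\<lambda>p. sol (fst p) (snd p)) (t, x)" if "sin (pi * (x - t)) \<noteq> 0" for t x by (rule isCont_sol[OF that])
  show "isCont (\<lambda>p. V sol (fst p) (snd p)) (t, x)" if "0 < t" "t < T" for t x by (rule isCont_V_sol[OF that])
  show "V sol t (x + 2) = V sol t x" for t x by (simp add: V_def sol_periodic)
  show "continuous_on {0..T} (\<lambda>t. f t y (odd_part (V sol) t y))" if "y \<in> {0<..<1}" for y
    by (rule continuous_f_sol[OF that])
  show "V sol t x = tint t (\<lambda>s. - sg (x - t + s) * f s (zigzag (x - t + s)) (odd_part (V sol) s (zigzag (x - t + s))))"
    if "t \<in> {0..T}" for t x using V_mild[OF that, of x] by (simp add: F_def)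
  show "primitive_on UNIV (V sol t) (\<lambda>\<xi>. - sg \<xi> * f t (zigzag \<xi>) (odd_part (V sol) t (zigzag \<xi>)) - sol t \<xi>)"
    if "t \<in> {0..T}" for t using V_x_primitive[OF that] by (simp add: F_def)
qed

end

section \<open>Existence of classical solutions\<close>

text \<open>Dominated convergence along sequences of times: a bounded family that tends to 0 at
  almost every \<open>x\<close> also tends to 0 in L2.\<close>

lemma L2_norm_tendsto_0:
  fixes \<phi> :: "real \<Rightarrow> real \<Rightarrow> real"
  assumes m: "\<And>s. s \<in> A \<Longrightarrow> \<phi> s \<in> borel_measurable (lebesgue_on {0<..<1})"
    and b: "\<And>s x. s \<in> A \<Longrightarrow> x \<in> {0<..<1} \<Longrightarrow> \<bar>\<phi> s x\<bar> \<le> B"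
    and ae: "AE x in lebesgue_on {0<..<1}. ((\<lambda>s. \<phi> s x) \<longlongrightarrow> 0) (at t within A)"
  shows "((\<lambda>s. L2_norm {0<..<1} (\<phi> s)) \<longlongrightarrow> 0) (at t within A)"
  unfolding tendsto_at_iff_sequentially
proof (intro allI impI)
  fix X :: "nat \<Rightarrow> real" assume X: "\<forall>i. X i \<in> A - {t}" "X \<longlonglongrightarrow> t"
  let ?M = "lebesgue_on {0<..<1::real}"
  interpret finite_measure ?M by (rule emeasure_Ioo_finite)
  have "(\<lambda>i. \<integral>x. (\<phi> (X i) x)\<^sup>2 \<partial>?M) \<longlonglongrightarrow> (\<integral>x. 0 \<partial>?M)"
  proof (rule integral_dominated_convergence[where w="\<lambda>_. B\<^sup>2"])
    show "AE x in ?M. (\<lambda>i. (\<phi> (X i) x)\<^sup>2) \<longlonglongrightarrow> 0"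
      using ae
    proof eventually_elim
      case (elim x)
      then have "(\<lambda>i. \<phi> (X i) x) \<longlonglongrightarrow> 0"
        using X unfolding tendsto_at_iff_sequentially by (auto simp: o_def)
      then have "(\<lambda>i. (\<phi> (X i) x)\<^sup>2) \<longlonglongrightarrow> 0\<^sup>2" by (rule tendsto_power)
      then show ?case by simp
    qed
    show "AE x in ?M. norm ((\<phi> (X i) x)\<^sup>2) \<le> B\<^sup>2" for i
    proof (rule AE_I2)
      fix x assume "x \<in> space ?M"
      then have "\<bar>\<phi> (X i) x\<bar> \<le> B" using b X by auto
      then have "\<bar>\<phi> (X i) x\<bar>\<^sup>2 \<le> B\<^sup>2" by (intro power_mono) auto
      then show "norm ((\<phi> (X i) x)\<^sup>2) \<le> B\<^sup>2" by simp
    qed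
    show "(\<lambda>x. (\<phi> (X i) x)\<^sup>2) \<in> borel_measurable ?M" for i
      using m X by (intro borel_measurable_power) auto
  qed auto
  then have "(\<lambda>i. sqrt (\<integral>x. (\<phi> (X i) x)\<^sup>2 \<partial>?M)) \<longlonglongrightarrow> sqrt 0" by (intro tendsto_intros) simp
  then show "((\<lambda>s. L2_norm {0<..<1} (\<phi> s)) \<circ> X) \<longlonglongrightarrow> 0" by (simp add: o_def L2_norm_def)
qed

lemma cont_path_L2I:
  assumes m: "\<And>s. s \<in> {0..T} \<Longrightarrow> \<phi> s \<in> borel_measurable (lebesgue_on {0<..<1})"
    and b: "\<And>s x. s \<in> {0..T} \<Longrightarrow> x \<in> {0<..<1} \<Longrightarrow> \<bar>\<phi> s x\<bar> \<le> B"
    and ae: "\<And>t. t \<in> {0..T} \<Longrightarrow> AE x in lebesgue_on {0<..<1}. ((\<lambda>s. \<phi> s x) \<longlongrightarrow> \<phi> t x) (at t within {0..T})"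
  shows "cont_path T (L2 {0<..<1}) (L2_norm {0<..<1}) \<phi>"
  unfolding cont_path_def
proof (intro ballI conjI)
  fix t assume t: "t \<in> {0..T}"
  show "\<phi> t \<in> L2 {0<..<1}" by (rule L2_bounded(1)[OF m[OF t] b[OF t]]) auto
  show "((\<lambda>s. L2_norm {0<..<1} (\<lambda>x. \<phi> s x - \<phi> t x)) \<longlongrightarrow> 0) (at t within {0..T})"
  proof (rule L2_norm_tendsto_0[where B="2 * B"])
    show "(\<lambda>x. \<phi> s x - \<phi> t x) \<in> borel_measurable (lebesgue_on {0<..<1})" if "s \<in> {0..T}" for s
      using m[OF that] m[OF t] by simp
    show "\<bar>\<phi> s x - \<phi> t x\<bar> \<le> 2 * B" if "s \<in> {0..T}" "x \<in> {0<..<1}" for s x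
      using b[OF that] b[OF t that(2)] by linarith
    show "AE x in lebesgue_on {0<..<1}. ((\<lambda>s. \<phi> s x - \<phi> t x) \<longlongrightarrow> 0) (at t within {0..T})"
      using ae[OF t] by (simp add: LIM_zero_iff)
  qed
qed

lemma primitive_on_deriv_within:
  assumes p: "primitive_on {0..T} G g" and t: "t \<in> {0..T}" and c: "(g \<longlongrightarrow> g t) (at t within {0..T})"
  shows "((\<lambda>s. (G s - G t) / (s - t)) \<longlongrightarrow> g t) (at t within {0..T})"
proof -
  have i: "g integrable_on {0..T}" by (rule primitive_onD(3)[OF p]) (use t in auto)
  have "((\<lambda>u. integral {0..u} g) has_vector_derivative g t) (at t within ({0..T} - {}))"
    by (rule integral_has_vector_derivative_continuous_at[OF i]) (use t c in \<open>auto simp: continuous_within\<close>)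
  then have "((\<lambda>u. G 0 + integral {0..u} g) has_vector_derivative g t) (at t within {0..T})"
    by (auto intro!: derivative_eq_intros)
  then have d: "((\<lambda>u. G 0 + integral {0..u} g) has_real_derivative g t) (at t within {0..T})"
    by (simp add: has_real_derivative_iff_has_vector_derivative)
  have "(G has_real_derivative g t) (at t within {0..T})"
  proof (rule has_field_derivative_transform_within[OF d zero_less_one t])
    fix u assume u: "u \<in> {0..T}"
    have "G u - G 0 = integral {0..u} g" by (rule primitive_onD(2)[OF p]) (use u in auto)
    then show "G 0 + integral {0..u} g = G u" by simp
  qed
  then show ?thesis by (simp add: has_field_derivative_iff)
qed

lemma time_lipschitz:
  assumes p: "primitive_on {0..T} G g" and b: "\<And>s. s \<in> {0..T} \<Longrightarrow> \<bar>g s\<bar> \<le> B" and st: "s \<in> {0..T}" "t \<in> {0..T}"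
  shows "\<bar>G s - G t\<bar> \<le> B * \<bar>s - t\<bar>"
proof -
  have *: "\<bar>G t - G s\<bar> \<le> B * (t - s)" if "s \<in> {0..T}" "t \<in> {0..T}" "s \<le> t" for s t
    using primitive_on_increment_bound[OF p that, of 0 B] b that by auto
  consider "s \<le> t" | "t \<le> s" by linarith
  then show ?thesis using *[OF st] *[OF st(2,1)] by cases (auto simp: abs_minus_commute)
qed

text \<open>Difference quotients are bounded by the Lipschitz constant \<open>B\<close> and converge
  at almost every \<open>x\<close>, which is what dominated convergence asks. At each time the jump
  lines exclude only a null set of \<open>x\<close>.\<close>

lemma C1_path_L2I:
  assumes m: "\<And>s. s \<in> {0..T} \<Longrightarrow> p s \<in> borel_measurable (lebesgue_on {0<..<1})"
      "\<And>s. s \<in> {0..T} \<Longrightarrow> pt s \<in> borel_measurable (lebesgue_on {0<..<1})"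
    and b: "\<And>s x. s \<in> {0..T} \<Longrightarrow> x \<in> {0<..<1} \<Longrightarrow> \<bar>pt s x\<bar> \<le> B" "\<And>s x. s \<in> {0..T} \<Longrightarrow> x \<in> {0<..<1} \<Longrightarrow> \<bar>p s x\<bar> \<le> B"
    and tp: "\<And>x. x \<in> {0<..<1} \<Longrightarrow> primitive_on {0..T} (\<lambda>t. p t x) (\<lambda>t. pt t x)"
    and ae: "\<And>t. t \<in> {0..T} \<Longrightarrow> AE x in lebesgue_on {0<..<1}. ((\<lambda>s. pt s x) \<longlongrightarrow> pt t x) (at t within {0..T})"
  shows "C1_path T (L2 {0<..<1}) (L2_norm {0<..<1}) p pt"
  unfolding C1_path_def
proof (intro ballI conjI)
  show "cont_path T (L2 {0<..<1}) (L2_norm {0<..<1}) pt" by (rule cont_path_L2I[OF m(2) b(1) ae])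
  show "cont_path T (L2 {0<..<1}) (L2_norm {0<..<1}) p"
  proof (rule cont_path_L2I[OF m(1) b(2)])
    fix t assume t: "t \<in> {0..T}"
    show "AE x in lebesgue_on {0<..<1}. ((\<lambda>s. p s x) \<longlongrightarrow> p t x) (at t within {0..T})"
    proof (rule AE_I2)
      fix x :: real assume "x \<in> space (lebesgue_on {0<..<1})"
      then have "continuous_on {0..T} (\<lambda>t. p t x)" by (intro primitive_on_continuous_Icc[OF tp]) simp
      then show "((\<lambda>s. p s x) \<longlongrightarrow> p t x) (at t within {0..T})" using t by (auto simp: continuous_on_def)
    qed
  qed
  fix t assume t: "t \<in> {0..T}"
  show "((\<lambda>s. L2_norm {0<..<1} (\<lambda>x. (p s x - p t x) / (s - t) - pt t x)) \<longlongrightarrow> 0) (at t within {0..T})"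
  proof (rule L2_norm_tendsto_0[where B="2 * B"])
    show "(\<lambda>x. (p s x - p t x) / (s - t) - pt t x) \<in> borel_measurable (lebesgue_on {0<..<1})" if "s \<in> {0..T}" for s
      using m(1)[OF that] m(1)[OF t] m(2)[OF t] by simp
    show "\<bar>(p s x - p t x) / (s - t) - pt t x\<bar> \<le> 2 * B" if s: "s \<in> {0..T}" and x: "x \<in> {0<..<1}" for s x
    proof -
      have "\<bar>p s x - p t x\<bar> \<le> B * \<bar>s - t\<bar>"
        by (rule time_lipschitz[OF tp[OF x]]) (use b x s t in auto)
      moreover have "0 \<le> B" using b(1)[OF t x] by linarith
      ultimately have "\<bar>(p s x - p t x) / (s - t)\<bar> \<le> B"
        by (cases "s = t") (auto simp: abs_divide divide_le_eq)
      then show ?thesis using b(1)[OF t x] by linarith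
    qed
    have "AE x in lebesgue_on {0<..<1}. x \<in> {0<..<1::real}" by (rule AE_I2) simp
    then show "AE x in lebesgue_on {0<..<1}. ((\<lambda>s. (p s x - p t x) / (s - t) - pt t x) \<longlongrightarrow> 0) (at t within {0..T})"
      using ae[OF t]
    proof eventually_elim
      case (elim x)
      then show ?case using primitive_on_deriv_within[OF tp[of x] t] by (simp add: LIM_zero_iff)
    qed
  qed
qed

lemma cont_path_H1I:
  assumes p: "\<And>t. t \<in> {0..T} \<Longrightarrow> primitive_on {0..1} (p t) (px t)"
    and m: "\<And>s. s \<in> {0..T} \<Longrightarrow> px s \<in> borel_measurable (lebesgue_on {0<..<1})"
    and b: "\<And>s x. s \<in> {0..T} \<Longrightarrow> x \<in> {0<..<1} \<Longrightarrow> \<bar>px s x\<bar> \<le> B"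
    and ae: "\<And>t. t \<in> {0..T} \<Longrightarrow> AE x in lebesgue_on {0<..<1}. ((\<lambda>s. px s x) \<longlongrightarrow> px t x) (at t within {0..T})"
    and pc: "cont_path T (L2 {0<..<1}) (L2_norm {0<..<1}) p"
  shows "cont_path T (H1 0 1) (H1_norm 0 1) p"
  unfolding cont_path_def
proof (intro ballI conjI)
  have pxc: "cont_path T (L2 {0<..<1}) (L2_norm {0<..<1}) px" by (rule cont_path_L2I[OF m b ae])
  fix t assume t: "t \<in> {0..T}"
  have L: "px s \<in> L2 {0<..<1}" if "s \<in> {0..T}" for s using pxc that by (auto simp: cont_path_def)
  show "p t \<in> H1 0 1" by (rule H1I(1)[OF _ p[OF t] L[OF t]]) simp
  have e: "H1_norm 0 1 (\<lambda>x. p s x - p t x)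
      = sqrt ((L2_norm {0<..<1} (\<lambda>x. p s x - p t x))\<^sup>2 + (L2_norm {0<..<1} (\<lambda>x. px s x - px t x))\<^sup>2)"
    if s: "s \<in> {0..T}" for s
  proof (rule H1I(2))
    show "primitive_on {0..1} (\<lambda>x. p s x - p t x) (\<lambda>x. px s x - px t x)"
      using primitive_on_add[OF p[OF s] primitive_on_cmult[OF p[OF t], of "-1"]] by simp
    show "(\<lambda>x. px s x - px t x) \<in> L2 {0<..<1}" by (rule L2_diff[OF L[OF s] L[OF t]])
  qed simp
  have "((\<lambda>s. sqrt ((L2_norm {0<..<1} (\<lambda>x. p s x - p t x))\<^sup>2 + (L2_norm {0<..<1} (\<lambda>x. px s x - px t x))\<^sup>2))
      \<longlongrightarrow> sqrt (0\<^sup>2 + 0\<^sup>2)) (at t within {0..T})"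
    using pc pxc t by (intro tendsto_intros) (auto simp: cont_path_def)
  moreover have "eventually (\<lambda>s. sqrt ((L2_norm {0<..<1} (\<lambda>x. p s x - p t x))\<^sup>2 + (L2_norm {0<..<1} (\<lambda>x. px s x - px t x))\<^sup>2)
      = H1_norm 0 1 (\<lambda>x. p s x - p t x)) (at t within {0..T})"
    unfolding eventually_at_filter by (rule always_eventually) (use e in auto)
  ultimately have "((\<lambda>s. H1_norm 0 1 (\<lambda>x. p s x - p t x)) \<longlongrightarrow> sqrt (0\<^sup>2 + 0\<^sup>2)) (at t within {0..T})"
    by (rule Lim_transform_eventually)
  then show "((\<lambda>s. H1_norm 0 1 (\<lambda>x. p s x - p t x)) \<longlongrightarrow> 0) (at t within {0..T})" by simp
qed

lemma primitive_on_reflect: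
  assumes "primitive_on UNIV F g"
  shows "primitive_on UNIV (\<lambda>x. F (- x)) (\<lambda>x. - g (- x))"
  unfolding primitive_on_def
proof (intro ballI impI conjI)
  fix x y :: real assume xy: "x \<le> y"
  have i: "integrable (lebesgue_on {-y..-x}) g" "F (- x) - F (- y) = integral {-y..-x} g"
    using primitive_onD[OF assms, of "-y" "-x"] xy by auto
  have "g absolutely_integrable_on {-y..-x}"
    using i(1) by (simp add: integrable_restrict_space set_integrable_def)
  then have "(\<lambda>x. g (- x)) absolutely_integrable_on {x..y}"
    using absolutely_integrable_reflect_real[where f=g and a="-y" and b="-x"] by simp
  then have "integrable (lebesgue_on {x..y}) (\<lambda>x. g (- x))" by (rule absolutely_integrable_imp_integrable) auto
  then show "integrable (lebesgue_on {x..y}) (\<lambda>x. - g (- x))" by simp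
  have "integral {x..y} (\<lambda>x. g (- x)) = integral {-y..-x} g"
    using Henstock_Kurzweil_Integration.integral_reflect_real[where f=g and a="-y" and b="-x"] by simp
  then show "F (- y) - F (- x) = integral {x..y} (\<lambda>x. - g (- x))" using i(2) by simp
qed

text \<open>For the unfolded invariant this is the pressure, up to a function of time.\<close>

definition even_part :: "(real \<Rightarrow> real \<Rightarrow> real) \<Rightarrow> real \<Rightarrow> real \<Rightarrow> real" where
  "even_part v t y = (v t y + v t (- y)) / 2"

lemma continuous_bounded_Icc:
  fixes g :: "real \<Rightarrow> real"
  assumes "continuous_on UNIV g"
  shows "\<exists>B. \<forall>t\<in>{a..b}. \<bar>g t\<bar> \<le> B"
proof -
  have "bounded (g ` {a..b})"
    by (intro compact_imp_bounded compact_continuous_image continuous_on_subset[OF assms]) auto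
  then show ?thesis unfolding bounded_iff by auto
qed

lemma abs_convex_combination_le:
  fixes y r s B :: real
  assumes "y \<in> {0..1}" "\<bar>r\<bar> \<le> B" "\<bar>s\<bar> \<le> B"
  shows "\<bar>(1 - y) * r + y * s\<bar> \<le> B"
proof -
  have "\<bar>(1 - y) * r + y * s\<bar> \<le> (1 - y) * \<bar>r\<bar> + y * \<bar>s\<bar>"
    using abs_triangle_ineq[of "(1 - y) * r" "y * s"] assms(1) by (simp add: abs_mult)
  also have "\<dots> \<le> (1 - y) * B + y * B" using assms by (intro add_mono mult_left_mono) auto
  finally show ?thesis by (simp add: algebra_simps)
qed

text \<open>Mild form of the wave equation with zero data and forcing \<open>-\<phi>\<close>: \<open>v\<close> is the outgoing Riemann
  invariant, unfolded by reflection at the boundary to a function on the real line.\<close>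

definition mild :: "real \<Rightarrow> (real \<Rightarrow> real \<Rightarrow> real) \<Rightarrow> (real \<Rightarrow> real \<Rightarrow> real) \<Rightarrow> bool" where
  "mild T \<phi> v \<longleftrightarrow> bmeas2 \<phi> \<and> bmeas2 v \<and> (\<exists>B. \<forall>t\<in>{0..T}. \<forall>x. \<bar>\<phi> t (zigzag x) * sg x\<bar> \<le> B \<and> \<bar>v t x\<bar> \<le> B) \<and>
     (\<forall>t\<in>{0..T}. \<forall>x. v t x = tint t (\<lambda>s. - sg (x - t + s) * \<phi> s (zigzag (x - t + s))))"

lemma mild_integrand:
  assumes "bmeas2 \<phi>"
  shows "(\<lambda>s. - sg (c + s) * \<phi> s (zigzag (c + s))) \<in> borel_measurable borel"
proof -
  have a: "(\<lambda>s::real. c + s) \<in> borel_measurable borel" by simp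
  have "(\<lambda>s. sg (c + s)) \<in> borel_measurable borel" "(\<lambda>s. zigzag (c + s)) \<in> borel_measurable borel"
    by (rule measurable_compose[OF a borel_measurable_sg]) (rule measurable_compose[OF a borel_measurable_zigzag])
  then show ?thesis by (intro borel_measurable_times borel_measurable_uminus bmeas2_comp[OF assms]) auto
qed

text \<open>With \<open>\<phi>\<close> regarded as a given function the formula is linear.
  Differences of solutions of nonlinear problems are therefore mild solutions again, and one
  Gronwall inequality covers all comparisons.\<close>

lemma mild_lincomb:
  assumes v: "mild T \<phi> v" and w: "mild T \<psi> w"
  shows "mild T (\<lambda>t y. a * \<phi> t y + b * \<psi> t y) (\<lambda>t x. a * v t x + b * w t x)"
proof -
  obtain B where B: "\<And>t x. t \<in> {0..T} \<Longrightarrow> \<bar>\<phi> t (zigzag x) * sg x\<bar> \<le> B" "\<And>t x. t \<in> {0..T} \<Longrightarrow> \<bar>v t x\<bar> \<le> B"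
    using v unfolding mild_def by blast
  obtain C where C: "\<And>t x. t \<in> {0..T} \<Longrightarrow> \<bar>\<psi> t (zigzag x) * sg x\<bar> \<le> C" "\<And>t x. t \<in> {0..T} \<Longrightarrow> \<bar>w t x\<bar> \<le> C"
    using w unfolding mild_def by blast
  have m: "bmeas2 \<phi>" "bmeas2 \<psi>" "bmeas2 v" "bmeas2 w" using v w by (auto simp: mild_def)
  have le: "\<bar>a * r + b * q\<bar> \<le> \<bar>a\<bar> * B + \<bar>b\<bar> * C" if "\<bar>r\<bar> \<le> B" "\<bar>q\<bar> \<le> C" for r q
  proof -
    have "\<bar>a * r + b * q\<bar> \<le> \<bar>a\<bar> * \<bar>r\<bar> + \<bar>b\<bar> * \<bar>q\<bar>"
      using abs_triangle_ineq[of "a * r" "b * q"] by (simp add: abs_mult)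
    also have "\<dots> \<le> \<bar>a\<bar> * B + \<bar>b\<bar> * C" using that by (intro add_mono mult_left_mono) auto
    finally show ?thesis .
  qed
  show ?thesis
    unfolding mild_def
  proof (intro conjI exI ballI allI)
    show "bmeas2 (\<lambda>t y. a * \<phi> t y + b * \<psi> t y)"
      using m(1,2) unfolding bmeas2_def by (intro borel_measurable_add borel_measurable_times borel_measurable_const)
    show "bmeas2 (\<lambda>t x. a * v t x + b * w t x)"
      using m(3,4) unfolding bmeas2_def by (intro borel_measurable_add borel_measurable_times borel_measurable_const)
    fix t x assume t: "t \<in> {0..T}"
    show "\<bar>a * v t x + b * w t x\<bar> \<le> \<bar>a\<bar> * B + \<bar>b\<bar> * C" by (rule le[OF B(2)[OF t] C(2)[OF t]])
    show "\<bar>(a * \<phi> t (zigzag x) + b * \<psi> t (zigzag x)) * sg x\<bar> \<le> \<bar>a\<bar> * B + \<bar>b\<bar> * C"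
      using le[OF B(1)[OF t, of x] C(1)[OF t, of x]] by (simp add: distrib_right mult.assoc)
    let ?f = "\<lambda>s. - sg (x - t + s) * \<phi> s (zigzag (x - t + s))" and ?g = "\<lambda>s. - sg (x - t + s) * \<psi> s (zigzag (x - t + s))"
    have fb: "\<bar>a * ?f s\<bar> \<le> \<bar>a\<bar> * B" if "0 < s" "s < t" for s
    proof -
      have "\<bar>\<phi> s (zigzag (x - t + s)) * sg (x - t + s)\<bar> \<le> B" by (rule B(1)) (use that t in auto)
      then have "\<bar>a\<bar> * \<bar>\<phi> s (zigzag (x - t + s)) * sg (x - t + s)\<bar> \<le> \<bar>a\<bar> * B" by (rule mult_left_mono) simp
      then show ?thesis by (simp only: abs_mult abs_minus_cancel mult_ac)
    qed
    have gb: "\<bar>b * ?g s\<bar> \<le> \<bar>b\<bar> * C" if "0 < s" "s < t" for s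
    proof -
      have "\<bar>\<psi> s (zigzag (x - t + s)) * sg (x - t + s)\<bar> \<le> C" by (rule C(1)) (use that t in auto)
      then have "\<bar>b\<bar> * \<bar>\<psi> s (zigzag (x - t + s)) * sg (x - t + s)\<bar> \<le> \<bar>b\<bar> * C" by (rule mult_left_mono) simp
      then show ?thesis by (simp only: abs_mult abs_minus_cancel mult_ac)
    qed
    have "v t x = tint t ?f" using v t unfolding mild_def by blast
    moreover have "w t x = tint t ?g" using w t unfolding mild_def by blast
    ultimately have "a * v t x + b * w t x = a * tint t ?f + b * tint t ?g" by (simp only:)
    also have "\<dots> = tint t (\<lambda>s. a * ?f s + b * ?g s)"
      unfolding tint_cmult[symmetric]
    proof (rule tint_add[symmetric, OF _ fb _ gb])
      show "(\<lambda>s. a * ?f s) \<in> borel_measurable borel"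
        by (rule borel_measurable_times[OF borel_measurable_const mild_integrand[OF m(1)]])
      show "(\<lambda>s. b * ?g s) \<in> borel_measurable borel"
        by (rule borel_measurable_times[OF borel_measurable_const mild_integrand[OF m(2)]])
    qed
    also have "(\<lambda>s. a * ?f s + b * ?g s) = (\<lambda>s. - sg (x - t + s) * (a * \<phi> s (zigzag (x - t + s)) + b * \<psi> s (zigzag (x - t + s))))"
      by (auto simp: algebra_simps)
    finally show "a * v t x + b * w t x
        = tint t (\<lambda>s. - sg (x - t + s) * (a * \<phi> s (zigzag (x - t + s)) + b * \<psi> s (zigzag (x - t + s))))" .
  qed
qed

lemma mild_diff:
  assumes "mild T \<phi> v" "mild T \<psi> w"
  shows "mild T (\<lambda>t y. \<phi> t y - \<psi> t y) (\<lambda>t x. v t x - w t x)"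
  using mild_lincomb[OF assms, of 1 "-1"] by simp

text \<open>Gronwall's inequality, by iterating a bound with the weight \<open>exp (2 * K * t)\<close>.\<close>

lemma mild_gronwall:
  assumes v: "mild T \<phi> v" and K: "0 < K" and D: "0 \<le> D"
    and b: "\<And>s y. s \<in> {0<..<T} \<Longrightarrow> y \<in> {0<..<1} \<Longrightarrow> \<bar>\<phi> s y\<bar> \<le> D + K * \<bar>odd_part v s y\<bar>"
    and t: "t \<in> {0..T}"
  shows "\<bar>v t x\<bar> \<le> 2 * D * T * exp (2 * K * T)"
proof -
  obtain B where B: "\<And>t x. t \<in> {0..T} \<Longrightarrow> \<bar>v t x\<bar> \<le> B"
    using v unfolding mild_def by blast
  have B0: "0 \<le> B" using B[OF t, of 0] by linarith
  have T: "0 \<le> T" using t by simp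
  have it: "\<bar>v t x\<bar> \<le> (2 * D * T + B * (1/2) ^ n) * exp (2 * K * t)" if "t \<in> {0..T}" for n t x
    using that
  proof (induction n arbitrary: t x)
    case 0
    have "1 \<le> exp (2 * K * t)" using 0 K by simp
    have "\<bar>v t x\<bar> \<le> B" by (rule B[OF 0])
    also have "B \<le> 2 * D * T + B" using D T by simp
    also have "\<dots> \<le> (2 * D * T + B) * exp (2 * K * t)"
      using \<open>1 \<le> exp (2 * K * t)\<close> D T B0 mult_left_mono[of 1 "exp (2 * K * t)" "2 * D * T + B"] by simp
    finally show ?case by simp
  next
    case (Suc n)
    let ?M = "2 * D * T + B * (1/2) ^ n"
    have M: "0 \<le> ?M" using D T B0 by simp
    have "\<bar>v t x\<bar> = \<bar>tint t (\<lambda>s. - sg (x - t + s) * \<phi> s (zigzag (x - t + s)))\<bar>"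
      using v Suc.prems unfolding mild_def by metis
    \<comment> \<open>The rate \<open>2 * K\<close> of the weight halves the previous bound, so the
      a priori bound \<open>B\<close> dies out; \<open>2 * D * T\<close> is the fixed point of
      \<open>D * T + m / 2\<close> as a map in \<open>m\<close>.\<close>
    also have "\<dots> \<le> D * t + (K * ?M) * exp (2 * K * t) / (2 * K)"
    proof (rule tint_exp_bound)
      fix s assume s: "0 < s" "s < t"
      let ?x = "x - t + s"
      show "\<bar>- sg ?x * \<phi> s (zigzag ?x)\<bar> \<le> D + K * ?M * exp (2 * K * s)"
      \<comment> \<open>At integers the factor \<open>sg\<close> vanishes; elsewhere
        \<open>zigzag\<close> is interior, where the hypothesis on \<open>\<phi>\<close> is
        available.\<close>
      proof (cases "sin (pi * ?x) = 0")
        case True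
        then show ?thesis using D K M by (simp add: sg_def)
      next
        case False
        have s': "s \<in> {0<..<T}" "s \<in> {0..T}" using s Suc.prems by auto
        have "\<bar>odd_part v s (zigzag ?x)\<bar> \<le> ?M * exp (2 * K * s)"
          by (intro odd_part_bound Suc.IH s')
        then have "K * \<bar>odd_part v s (zigzag ?x)\<bar> \<le> K * (?M * exp (2 * K * s))" using K by (intro mult_left_mono) auto
        then have 1: "\<bar>\<phi> s (zigzag ?x)\<bar> \<le> D + K * ?M * exp (2 * K * s)"
          using b[OF s'(1) zigzag_interior[OF False]] by (simp add: mult.assoc)
        have "\<bar>- sg ?x * \<phi> s (zigzag ?x)\<bar> \<le> 1 * \<bar>\<phi> s (zigzag ?x)\<bar>"
          unfolding abs_mult abs_minus_cancel by (intro mult_right_mono sg_bounds) simp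
        then show ?thesis using 1 by linarith
      qed
    qed (use Suc.prems K M in auto)
    also have "\<dots> = D * t + ?M / 2 * exp (2 * K * t)" using K by simp
    also have "\<dots> \<le> D * T * exp (2 * K * t) + ?M / 2 * exp (2 * K * t)"
    proof -
      have "D * t \<le> D * T" using Suc.prems D by (intro mult_left_mono) auto
      also have "\<dots> \<le> D * T * exp (2 * K * t)"
        using mult_left_mono[of 1 "exp (2 * K * t)" "D * T"] D T K Suc.prems by simp
      finally show ?thesis by simp
    qed
    also have "\<dots> = (2 * D * T + B * (1/2) ^ Suc n) * exp (2 * K * t)" by (simp add: field_simps)
    finally show ?case .
  qed
  have "(\<lambda>n. (2 * D * T + B * (1/2) ^ n) * exp (2 * K * t)) \<longlonglongrightarrow> (2 * D * T + B * 0) * exp (2 * K * t)"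
    by (intro tendsto_intros LIMSEQ_realpow_zero) auto
  then have "\<bar>v t x\<bar> \<le> (2 * D * T + B * 0) * exp (2 * K * t)"
    by (rule LIMSEQ_le_const) (use it[OF t] in auto)
  also have "\<dots> \<le> 2 * D * T * exp (2 * K * T)"
    using D T t K mult_left_mono[of "exp (2 * K * t)" "exp (2 * K * T)" "2 * D * T"] by simp
  finally show ?thesis .
qed

context forcing
begin

text \<open>The boundary values \<open>\<gamma>0\<close>, \<open>\<gamma>1\<close> are lifted by the affine function \<open>G t\<close>.\<close>

lemma classical_solution_exists:
  fixes \<gamma>0 \<gamma>1 \<delta>0 \<delta>1 :: "real \<Rightarrow> real" and fC :: "real \<Rightarrow> real \<Rightarrow> real \<Rightarrow> real"
  defines "G \<equiv> \<lambda>t y. (1 - y) * \<gamma>0 t + y * \<gamma>1 t" and "G' \<equiv> \<lambda>t y. (1 - y) * \<delta>0 t + y * \<delta>1 t"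
  assumes c\<gamma>: "continuous_on UNIV \<gamma>0" "continuous_on UNIV \<gamma>1" and c\<delta>: "continuous_on UNIV \<delta>0" "continuous_on UNIV \<delta>1"
    and p: "primitive_on {0..T} \<gamma>0 \<delta>0" "primitive_on {0..T} \<gamma>1 \<delta>1" and z: "\<gamma>0 0 = 0" "\<gamma>1 0 = 0"
    and bc: "\<And>t. t \<in> {0..T} \<Longrightarrow> h0 t = \<gamma>0 t \<and> h1 t = \<gamma>1 t"
    and fC: "\<And>t y w. t \<in> {0<..<T} \<Longrightarrow> y \<in> {0<..<1} \<Longrightarrow> f t y w = fC t y (w + G t y) + G' t y"
  shows "\<exists>v z R pp. bmeas2 v \<and> bmeas2 z \<and> 0 < R
    \<and> (\<forall>x. primitive_on {0..T} (\<lambda>t. v t x) (\<lambda>t. z t x)) \<and> (\<forall>t\<in>{0..T}. \<forall>x. \<bar>z t x\<bar> \<le> R \<and> \<bar>v t x\<bar> \<le> R)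
    \<and> (\<forall>t x. sin (pi * (x - t)) \<noteq> 0 \<longrightarrow> isCont (\<lambda>p. z (fst p) (snd p)) (t, x))
    \<and> (\<forall>t x. 0 < t \<longrightarrow> t < T \<longrightarrow> isCont (\<lambda>p. v (fst p) (snd p)) (t, x))
    \<and> (\<forall>x. v 0 x = 0)
    \<and> mild T (\<lambda>t y. f t y (odd_part v t y)) v
    \<and> classical_solution T fC c 0 h0 h1 pp (\<lambda>t y. odd_part v t y + G t y)
    \<and> (\<forall>t. pp t 0 - pp t 1 = v t 0 - v t 1)"
proof -
  obtain v z R where vz: "bmeas2 v \<and> bmeas2 z \<and> 0 < R
    \<and> (\<forall>x. primitive_on {0..T} (\<lambda>t. v t x) (\<lambda>t. z t x)) \<and> (\<forall>x. v 0 x = 0)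
    \<and> (\<forall>t\<in>{0..T}. \<forall>x. \<bar>z t x\<bar> \<le> R \<and> \<bar>v t x\<bar> \<le> R * T \<and> \<bar>f t (zigzag x) (odd_part v t (zigzag x)) * sg x\<bar> \<le> R)
    \<and> (\<forall>t x. sin (pi * (x - t)) \<noteq> 0 \<longrightarrow> isCont (\<lambda>p. z (fst p) (snd p)) (t, x))
    \<and> (\<forall>t x. 0 < t \<longrightarrow> t < T \<longrightarrow> isCont (\<lambda>p. v (fst p) (snd p)) (t, x))
    \<and> (\<forall>t x. v t (x + 2) = v t x)
    \<and> (\<forall>y\<in>{0<..<1}. continuous_on {0..T} (\<lambda>t. f t y (odd_part v t y)))
    \<and> (\<forall>t\<in>{0..T}. \<forall>x. v t x =
        tint t (\<lambda>s. - sg (x - t + s) * f s (zigzag (x - t + s)) (odd_part v s (zigzag (x - t + s)))))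
    \<and> (\<forall>t\<in>{0..T}. primitive_on UNIV (v t)
        (\<lambda>\<xi>. - sg \<xi> * f t (zigzag \<xi>) (odd_part v t (zigzag \<xi>)) - z t \<xi>))"
    using solution_exists by (elim exE) (rule that, assumption)
  have v: "bmeas2 v" "bmeas2 z" "0 < R"
    "\<And>x. primitive_on {0..T} (\<lambda>t. v t x) (\<lambda>t. z t x)" "\<And>x. v 0 x = 0"
    "\<And>t x. t \<in> {0..T} \<Longrightarrow> \<bar>z t x\<bar> \<le> R" "\<And>t x. t \<in> {0..T} \<Longrightarrow> \<bar>v t x\<bar> \<le> R * T"
    "\<And>t x. t \<in> {0..T} \<Longrightarrow> \<bar>f t (zigzag x) (odd_part v t (zigzag x)) * sg x\<bar> \<le> R"
    "\<And>t x. sin (pi * (x - t)) \<noteq> 0 \<Longrightarrow> isCont (\<lambda>p. z (fst p) (snd p)) (t, x)"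
    "\<And>t x. 0 < t \<Longrightarrow> t < T \<Longrightarrow> isCont (\<lambda>p. v (fst p) (snd p)) (t, x)"
    "\<And>t x. v t (x + 2) = v t x"
    "\<And>y. y \<in> {0<..<1} \<Longrightarrow> continuous_on {0..T} (\<lambda>t. f t y (odd_part v t y))"
    "\<And>t x. t \<in> {0..T} \<Longrightarrow> v t x = tint t (\<lambda>s. - sg (x - t + s) * f s (zigzag (x - t + s)) (odd_part v s (zigzag (x - t + s))))"
    "\<And>t. t \<in> {0..T} \<Longrightarrow> primitive_on UNIV (v t) (\<lambda>\<xi>. - sg \<xi> * f t (zigzag \<xi>) (odd_part v t (zigzag \<xi>)) - z t \<xi>)"
    using vz by (elim conjE; blast)+
  let ?S = "{0<..<1::real}" let ?M = "lebesgue_on ?S"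
  \<comment> \<open>The slope of the affine lift \<open>G\<close>, integrated in time. Subtracting
    it from the pressure compensates the space derivative of \<open>G\<close> in the first equation;
    being constant in space, it changes neither the second equation nor the pressure drop.\<close>
  define \<Gamma> where "\<Gamma> = (\<lambda>t. tint t (\<lambda>s. \<gamma>1 s - \<gamma>0 s))"
  define u where "u = (\<lambda>t y. odd_part v t y + G t y)"
  define q where "q = (\<lambda>t y. even_part v t y + (c - \<Gamma> t))"
  define ut where "ut = (\<lambda>t y. odd_part z t y + G' t y)"
  define qt where "qt = (\<lambda>t y. even_part z t y + (\<gamma>0 t - \<gamma>1 t))"
  \<comment> \<open>The extended forcing is odd in space, so it cancels in \<open>ux\<close> and
    appears in full in \<open>qx\<close>.\<close>
  define ux where "ux = (\<lambda>t y. - even_part z t y + (\<gamma>1 t - \<gamma>0 t))"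
  define qx where "qx = (\<lambda>t y. - sg y * f t (zigzag y) (odd_part v t (zigzag y)) - odd_part z t y)"
  obtain Bg where Bg: "0 \<le> Bg" "\<And>t. t \<in> {0..T} \<Longrightarrow> \<bar>\<gamma>0 t\<bar> \<le> Bg" "\<And>t. t \<in> {0..T} \<Longrightarrow> \<bar>\<gamma>1 t\<bar> \<le> Bg"
    "\<And>t. t \<in> {0..T} \<Longrightarrow> \<bar>\<delta>0 t\<bar> \<le> Bg" "\<And>t. t \<in> {0..T} \<Longrightarrow> \<bar>\<delta>1 t\<bar> \<le> Bg"
  proof -
    from continuous_bounded_Icc[OF c\<gamma>(1), where a=0 and b=T] continuous_bounded_Icc[OF c\<gamma>(2), where a=0 and b=T]
      continuous_bounded_Icc[OF c\<delta>(1), where a=0 and b=T] continuous_bounded_Icc[OF c\<delta>(2), where a=0 and b=T]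
    obtain B1 B2 B3 B4 where B: "\<And>t. t \<in> {0..T} \<Longrightarrow> \<bar>\<gamma>0 t\<bar> \<le> B1" "\<And>t. t \<in> {0..T} \<Longrightarrow> \<bar>\<gamma>1 t\<bar> \<le> B2"
      "\<And>t. t \<in> {0..T} \<Longrightarrow> \<bar>\<delta>0 t\<bar> \<le> B3" "\<And>t. t \<in> {0..T} \<Longrightarrow> \<bar>\<delta>1 t\<bar> \<le> B4" by blast
    show thesis
    proof (rule that[of "\<bar>B1\<bar> + \<bar>B2\<bar> + \<bar>B3\<bar> + \<bar>B4\<bar>"])
      fix t assume t: "t \<in> {0..T}"
      show "\<bar>\<gamma>0 t\<bar> \<le> \<bar>B1\<bar> + \<bar>B2\<bar> + \<bar>B3\<bar> + \<bar>B4\<bar>" using B(1)[OF t] by linarith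
      show "\<bar>\<gamma>1 t\<bar> \<le> \<bar>B1\<bar> + \<bar>B2\<bar> + \<bar>B3\<bar> + \<bar>B4\<bar>" using B(2)[OF t] by linarith
      show "\<bar>\<delta>0 t\<bar> \<le> \<bar>B1\<bar> + \<bar>B2\<bar> + \<bar>B3\<bar> + \<bar>B4\<bar>" using B(3)[OF t] by linarith
      show "\<bar>\<delta>1 t\<bar> \<le> \<bar>B1\<bar> + \<bar>B2\<bar> + \<bar>B3\<bar> + \<bar>B4\<bar>" using B(4)[OF t] by linarith
    qed simp
  qed
  have ev: "\<bar>even_part w t y\<bar> \<le> B" if "\<bar>w t y\<bar> \<le> B" "\<bar>w t (- y)\<bar> \<le> B" for w t y B
  proof -
    have "\<bar>w t y + w t (- y)\<bar> \<le> 2 * B" using that by linarith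
    then show ?thesis by (simp add: even_part_def)
  qed
  have p\<Gamma>: "primitive_on {0..T} \<Gamma> (\<lambda>s. \<gamma>1 s - \<gamma>0 s)"
    unfolding \<Gamma>_def
  proof (rule tint_primitive)
    show "(\<lambda>s. \<gamma>1 s - \<gamma>0 s) \<in> borel_measurable borel"
      by (intro borel_measurable_continuous_onI continuous_intros c\<gamma>)
    show "\<bar>\<gamma>1 s - \<gamma>0 s\<bar> \<le> 2 * Bg" if "0 < s" "s < T" for s using Bg(2,3)[of s] that by auto
  qed
  have \<Gamma>0: "\<Gamma> 0 = 0" by (simp add: \<Gamma>_def tint_nonpos)
  have half: "primitive_on S (\<lambda>x. (F1 x + F2 x) / 2) (\<lambda>x. (g1 x + g2 x) / 2)"
    "primitive_on S (\<lambda>x. (F1 x - F2 x) / 2) (\<lambda>x. (g1 x - g2 x) / 2)"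
    if "primitive_on S F1 g1" "primitive_on S F2 g2" for S F1 F2 g1 g2
    using primitive_on_cmult[OF primitive_on_add[OF that], of "1/2"]
      primitive_on_cmult[OF primitive_on_add[OF that(1) primitive_on_cmult[OF that(2), of "-1"]], of "1/2"] by simp_all
  have ut_prim: "primitive_on {0..T} (\<lambda>t. u t y) (\<lambda>t. ut t y)" for y
    unfolding u_def ut_def G_def G'_def odd_part_def
    by (intro primitive_on_add primitive_on_cmult half v p)
  have qt_prim: "primitive_on {0..T} (\<lambda>t. q t y) (\<lambda>t. qt t y)" for y
  proof -
    have "primitive_on {0..T} (\<lambda>t. even_part v t y + (-1) * \<Gamma> t) (\<lambda>t. even_part z t y + (-1) * (\<gamma>1 t - \<gamma>0 t))"
      unfolding even_part_def by (intro primitive_on_add primitive_on_cmult half v p\<Gamma>)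
    from primitive_on_add_const[OF this, of c] show ?thesis unfolding q_def qt_def by (simp add: algebra_simps)
  qed
  have x_prim: "primitive_on UNIV (\<lambda>y. odd_part v t y) (\<lambda>y. - even_part z t y)"
    "primitive_on UNIV (\<lambda>y. even_part v t y) (qx t)" if t: "t \<in> {0..T}" for t
  proof -
    define g where "g = (\<lambda>\<xi>. - sg \<xi> * f t (zigzag \<xi>) (odd_part v t (zigzag \<xi>)) - z t \<xi>)"
    have P: "primitive_on UNIV (v t) g" using v(14)[OF t] by (simp only: g_def)
    have P': "primitive_on UNIV (\<lambda>x. v t (- x)) (\<lambda>x. - g (- x))" by (rule primitive_on_reflect[OF P])
    have e1: "(\<lambda>x. (g x - - g (- x)) / 2) = (\<lambda>y. - even_part z t y)"
      by (rule ext) (simp add: g_def even_part_def sg_minus zigzag_minus field_simps)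
    have e2: "(\<lambda>x. (g x + - g (- x)) / 2) = qx t"
    proof
      fix x
      have "g x = - sg x * f t (zigzag x) (odd_part v t (zigzag x)) - z t x"
        "g (- x) = sg x * f t (zigzag x) (odd_part v t (zigzag x)) - z t (- x)"
        by (simp_all add: g_def sg_minus zigzag_minus)
      moreover have "odd_part z t x = (z t x - z t (- x)) / 2" by (simp add: odd_part_def)
      ultimately show "(g x + - g (- x)) / 2 = qx t x" unfolding qx_def by (simp add: field_simps)
    qed
    have "primitive_on UNIV (\<lambda>x. (v t x - v t (- x)) / 2) (\<lambda>x. (g x - - g (- x)) / 2)"
      by (rule half(2)[OF P P'])
    then show "primitive_on UNIV (\<lambda>y. odd_part v t y) (\<lambda>y. - even_part z t y)"
      by (simp only: e1 odd_part_def)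
    have "primitive_on UNIV (\<lambda>x. (v t x + v t (- x)) / 2) (\<lambda>x. (g x + - g (- x)) / 2)"
      by (rule half(1)[OF P P'])
    then show "primitive_on UNIV (\<lambda>y. even_part v t y) (qx t)"
      by (simp only: e2 even_part_def)
  qed
  have lin: "primitive_on {0..1} (\<lambda>y. (1 - y) * a + y * b) (\<lambda>y. b - a)" for a b :: real
    by (rule primitive_on_C1) (auto intro!: derivative_eq_intros)
  have ux_prim: "primitive_on {0..1} (u t) (ux t)" if "t \<in> {0..T}" for t
    unfolding u_def ux_def G_def
    by (intro primitive_on_add lin primitive_on_subset[OF x_prim(1)[OF that]]) auto
  have qx_prim: "primitive_on {0..1} (q t) (qx t)" if "t \<in> {0..T}" for t
    unfolding q_def by (intro primitive_on_add_const primitive_on_subset[OF x_prim(2)[OF that]]) auto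
  define B where "B = 2 * R + R * T + \<bar>c\<bar> + 2 * Bg * T + 2 * Bg"
  have pos: "0 \<le> R" "0 \<le> R * T" "0 \<le> 2 * Bg * T" using v(3) T_pos Bg(1) by auto
  have \<phi>m: "bmeas2 (\<lambda>t y. f t y (odd_part v t y))"
    unfolding bmeas2_def
    by (rule bmeas3_comp[OF f_meas fst_snd_borel]) (use bmeas2_odd_part[OF v(1)] in \<open>simp add: bmeas2_def\<close>)
  have evm: "(\<lambda>y. even_part w t y) \<in> borel_measurable borel" "(\<lambda>y. odd_part w t y) \<in> borel_measurable borel" if "bmeas2 w" for w t
  proof -
    have n: "(\<lambda>y. w t y) \<in> borel_measurable borel" "(\<lambda>y. w t (- y)) \<in> borel_measurable borel"
      by (rule bmeas2_comp[OF that]; simp)+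
    show "(\<lambda>y. even_part w t y) \<in> borel_measurable borel"
      unfolding even_part_def by (rule borel_measurable_divide[OF borel_measurable_add[OF n] borel_measurable_const])
    show "(\<lambda>y. odd_part w t y) \<in> borel_measurable borel"
      unfolding odd_part_def by (rule borel_measurable_divide[OF borel_measurable_diff[OF n] borel_measurable_const])
  qed
  have Gm: "(\<lambda>y. (1 - y) * a + y * b) \<in> borel_measurable borel" for a b :: real by simp
  have meas: "u t \<in> borel_measurable ?M" "q t \<in> borel_measurable ?M" "ut t \<in> borel_measurable ?M"
    "qt t \<in> borel_measurable ?M" "ux t \<in> borel_measurable ?M" "qx t \<in> borel_measurable ?M" for t
  proof -
    have "u t \<in> borel_measurable borel" unfolding u_def G_def by (intro borel_measurable_add evm v Gm)
    then show "u t \<in> borel_measurable ?M" by (rule borel_measurable_lebesgue_onI)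
    have "q t \<in> borel_measurable borel" unfolding q_def by (intro borel_measurable_add evm v borel_measurable_const)
    then show "q t \<in> borel_measurable ?M" by (rule borel_measurable_lebesgue_onI)
    have "ut t \<in> borel_measurable borel" unfolding ut_def G'_def by (intro borel_measurable_add evm v Gm)
    then show "ut t \<in> borel_measurable ?M" by (rule borel_measurable_lebesgue_onI)
    have "qt t \<in> borel_measurable borel" unfolding qt_def by (intro borel_measurable_add evm v borel_measurable_const)
    then show "qt t \<in> borel_measurable ?M" by (rule borel_measurable_lebesgue_onI)
    have "ux t \<in> borel_measurable borel"
      unfolding ux_def by (intro borel_measurable_add borel_measurable_uminus evm v borel_measurable_const)
    then show "ux t \<in> borel_measurable ?M" by (rule borel_measurable_lebesgue_onI)
    have "(\<lambda>y. f t (zigzag y) (odd_part v t (zigzag y))) \<in> borel_measurable borel"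
      by (rule bmeas2_comp[OF \<phi>m _ borel_measurable_zigzag]) simp
    then have "qx t \<in> borel_measurable borel"
      unfolding qx_def
      by (intro borel_measurable_diff borel_measurable_times borel_measurable_uminus borel_measurable_sg evm v)
    then show "qx t \<in> borel_measurable ?M" by (rule borel_measurable_lebesgue_onI)
  qed
  have bnd: "\<bar>u t y\<bar> \<le> B" "\<bar>q t y\<bar> \<le> B" "\<bar>ut t y\<bar> \<le> B" "\<bar>qt t y\<bar> \<le> B" "\<bar>ux t y\<bar> \<le> B" "\<bar>qx t y\<bar> \<le> B"
    if t: "t \<in> {0..T}" and y: "y \<in> {0<..<1}" for t y
  proof -
    have y': "y \<in> {0..1}" using y by auto
    have G: "\<bar>G t y\<bar> \<le> Bg" "\<bar>G' t y\<bar> \<le> Bg" unfolding G_def G'_def by (intro abs_convex_combination_le y' Bg t)+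
    have o: "\<bar>odd_part v t y\<bar> \<le> R * T" "\<bar>odd_part z t y\<bar> \<le> R" by (intro odd_part_bound v t)+
    have e: "\<bar>even_part v t y\<bar> \<le> R * T" "\<bar>even_part z t y\<bar> \<le> R" by (intro ev v t)+
    have g: "\<bar>\<gamma>1 t - \<gamma>0 t\<bar> \<le> 2 * Bg" using Bg(2,3)[OF t] by linarith
    have "\<bar>\<Gamma> t - \<Gamma> 0\<bar> \<le> 2 * Bg * \<bar>t - 0\<bar>"
    proof (rule time_lipschitz[OF p\<Gamma> _ t])
      show "\<bar>\<gamma>1 s - \<gamma>0 s\<bar> \<le> 2 * Bg" if "s \<in> {0..T}" for s using Bg(2,3)[OF that] by linarith
    qed (use t in auto)
    also have "2 * Bg * \<bar>t - 0\<bar> \<le> 2 * Bg * T" using t Bg(1) by (intro mult_left_mono) auto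
    finally have \<Gamma>: "\<bar>\<Gamma> t\<bar> \<le> 2 * Bg * T" by (simp add: \<Gamma>0)
    have \<phi>: "\<bar>sg y * f t (zigzag y) (odd_part v t (zigzag y))\<bar> \<le> R" using v(8)[OF t, of y] by (simp add: mult.commute)
    show "\<bar>u t y\<bar> \<le> B" unfolding u_def B_def using o G pos Bg(1) by linarith
    show "\<bar>q t y\<bar> \<le> B" unfolding q_def B_def using e \<Gamma> pos Bg(1) by linarith
    show "\<bar>ut t y\<bar> \<le> B" unfolding ut_def B_def using o G pos Bg(1) by linarith
    show "\<bar>qt t y\<bar> \<le> B" unfolding qt_def B_def using e g pos Bg(1) by linarith
    show "\<bar>ux t y\<bar> \<le> B" unfolding ux_def B_def using e g pos Bg(1) by linarith
    show "\<bar>qx t y\<bar> \<le> B" unfolding qx_def B_def using o \<phi> pos Bg(1) by linarith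
  qed
  have tl: "(h \<longlongrightarrow> h t) (at t within {0..T})" if "isCont h t" for h :: "real \<Rightarrow> real" and t
    using that unfolding isCont_def by (rule tendsto_within_subset) simp
  have lim: "AE x in ?M. ((\<lambda>s. ut s x) \<longlongrightarrow> ut t x) (at t within {0..T})
      \<and> ((\<lambda>s. qt s x) \<longlongrightarrow> qt t x) (at t within {0..T})
      \<and> ((\<lambda>s. ux s x) \<longlongrightarrow> ux t x) (at t within {0..T})
      \<and> ((\<lambda>s. qx s x) \<longlongrightarrow> qx t x) (at t within {0..T})" if t: "t \<in> {0..T}" for t
  proof -
    have "AE x in lborel. sin (pi * (1 * x + (- t))) \<noteq> 0" "AE x in lborel. sin (pi * (1 * x + t)) \<noteq> 0"
      by (rule AE_sin_pi; simp)+
    then have "AE x in lborel. sin (pi * (x - t)) \<noteq> 0 \<and> sin (pi * (- x - t)) \<noteq> 0"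
    proof eventually_elim
      case (elim x)
      have "pi * (- x - t) = - (pi * (x + t))" by (simp add: algebra_simps)
      then show ?case using elim by simp
    qed
    then have 1: "AE x in ?M. sin (pi * (x - t)) \<noteq> 0 \<and> sin (pi * (- x - t)) \<noteq> 0"
      by (rule AE_lborel_imp_lebesgue_on) simp
    have 2: "AE x in ?M. x \<in> ?S" by (rule AE_I2) simp
    from 1 2 show ?thesis
    proof eventually_elim
      case (elim x)
      have zt: "((\<lambda>s. z s w) \<longlongrightarrow> z t w) (at t within {0..T})" if "sin (pi * (w - t)) \<noteq> 0" for w
        by (rule tl[where h="\<lambda>s. z s w"], rule isCont_comp2[where a="\<lambda>s. s" and b="\<lambda>_. w"]) (use v(9)[OF that] in auto)
      have gt: "(\<gamma>0 \<longlongrightarrow> \<gamma>0 t) (at t within {0..T})" "(\<gamma>1 \<longlongrightarrow> \<gamma>1 t) (at t within {0..T})"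
        "(\<delta>0 \<longlongrightarrow> \<delta>0 t) (at t within {0..T})" "(\<delta>1 \<longlongrightarrow> \<delta>1 t) (at t within {0..T})"
        by (rule tl; use c\<gamma> c\<delta> in \<open>simp add: continuous_on_eq_continuous_at\<close>)+
      have x: "x \<in> {0<..<1}" "x \<in> {0..1}" using elim by auto
      have fl: "((\<lambda>s. f s (zigzag x) (odd_part v s (zigzag x))) \<longlongrightarrow> f t (zigzag x) (odd_part v t (zigzag x))) (at t within {0..T})"
        using v(12)[of x] x t by (simp add: zigzag_id continuous_on_def)
      show ?case
        unfolding ut_def qt_def ux_def qx_def G'_def even_part_def odd_part_def[of z]
        by (intro conjI tendsto_intros zt gt fl) (use elim in auto)
    qed
  qed
  have limD: "AE x in ?M. ((\<lambda>s. ut s x) \<longlongrightarrow> ut t x) (at t within {0..T})"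
    "AE x in ?M. ((\<lambda>s. qt s x) \<longlongrightarrow> qt t x) (at t within {0..T})"
    "AE x in ?M. ((\<lambda>s. ux s x) \<longlongrightarrow> ux t x) (at t within {0..T})"
    "AE x in ?M. ((\<lambda>s. qx s x) \<longlongrightarrow> qx t x) (at t within {0..T})" if t: "t \<in> {0..T}" for t
    using lim[OF t] by (rule eventually_mono, simp)+
  have C1u: "C1_path T (L2 ?S) (L2_norm ?S) u ut"
    by (rule C1_path_L2I[OF meas(1,3) bnd(3,1) ut_prim limD(1)])
  have C1q: "C1_path T (L2 ?S) (L2_norm ?S) q qt"
    by (rule C1_path_L2I[OF meas(2,4) bnd(4,2) qt_prim limD(2)])
  have Hu: "cont_path T (H1 0 1) (H1_norm 0 1) u"
    by (rule cont_path_H1I[OF ux_prim meas(5) bnd(5) limD(3)]) (use C1u in \<open>simp_all add: C1_path_def\<close>)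
  have Hq: "cont_path T (H1 0 1) (H1_norm 0 1) q"
    by (rule cont_path_H1I[OF qx_prim meas(6) bnd(6) limD(4)]) (use C1q in \<open>simp_all add: C1_path_def\<close>)
  have vm1: "v t (- 1) = v t 1" for t using v(11)[of t "-1"] by simp
  have cs: "classical_solution T fC c 0 h0 h1 q u"
    unfolding classical_solution_def
  proof (intro conjI Hu Hq exI ballI)
    show "C1_path T (L2 ?S) (L2_norm ?S) q qt" "C1_path T (L2 ?S) (L2_norm ?S) u ut" by (fact C1q C1u)+
    show "AE x in ?M. qt t x + wd ?S (u t) x = 0 \<and> ut t x + wd ?S (q t) x + fC t x (u t x) = 0"
      if t: "t \<in> {0<..<T}" for t
    proof -
      have t': "t \<in> {0..T}" using t by auto
      have 2: "AE x in ?M. x \<in> ?S" by (rule AE_I2) simp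
      from primitive_on_wd(2)[OF ux_prim[OF t']] primitive_on_wd(2)[OF qx_prim[OF t']] 2 show ?thesis
      proof eventually_elim
        case (elim x)
        have "zigzag x = x" "sg x = 1" using elim(3) by (auto intro: zigzag_id sg_eq_1)
        \<comment> \<open>Inside \<open>{0<..<1}\<close> the reflections are trivial, and the term
          \<open>G'\<close> contained in \<open>f\<close> cancels the one contributed by the lift to
          \<open>ut\<close>.\<close>
        then have "qx t x = - (fC t x (u t x) + G' t x) - odd_part z t x"
          using fC[OF t elim(3), of "odd_part v t x"] by (simp add: qx_def u_def)
        then have "ut t x + qx t x + fC t x (u t x) = 0" by (simp add: ut_def)
        moreover have "qt t x + ux t x = 0" by (simp add: qt_def ux_def)
        ultimately show ?case by (simp only: elim(1,2))
      qed
    qed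
    show "u t 0 = h0 t" "u t 1 = h1 t" if "t \<in> {0..T}" for t
      using bc[OF that] by (simp_all add: u_def G_def odd_part_def vm1)
    show "q 0 x = c" "u 0 x = 0" for x
      by (simp_all add: q_def u_def G_def odd_part_def even_part_def v(5) \<Gamma>0 z)
  qed
  have ml: "mild T (\<lambda>t y. f t y (odd_part v t y)) v"
    unfolding mild_def
  proof (intro conjI \<phi>m v(1) exI[of _ "R + R * T"] ballI allI)
    fix t x assume t: "t \<in> {0..T}"
    show "\<bar>f t (zigzag x) (odd_part v t (zigzag x)) * sg x\<bar> \<le> R + R * T" "\<bar>v t x\<bar> \<le> R + R * T"
      using v(8)[OF t, of x] v(7)[OF t, of x] pos by linarith+
    show "v t x = tint t (\<lambda>s. - sg (x - t + s) * f s (zigzag (x - t + s)) (odd_part v s (zigzag (x - t + s))))"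
      by (rule v(13)[OF t])
  qed
  show ?thesis
  proof (rule exI[of _ v], rule exI[of _ z], rule exI[of _ "R + R * T"], rule exI[of _ q], intro conjI)
    show "bmeas2 v" "bmeas2 z" by (fact v)+
    show "0 < R + R * T" using v(3) pos by linarith
    show "\<forall>t\<in>{0..T}. \<forall>x. \<bar>z t x\<bar> \<le> R + R * T \<and> \<bar>v t x\<bar> \<le> R + R * T"
      using v(6,7) pos by (meson add_increasing add_increasing2 order_trans le_add_same_cancel1 le_add_same_cancel2)
    show "classical_solution T fC c 0 h0 h1 q (\<lambda>t y. odd_part v t y + G t y)" using cs by (simp only: u_def)
    show "\<forall>t. q t 0 - q t 1 = v t 0 - v t 1" by (simp add: q_def even_part_def vm1)
  qed (use v ml in auto)
qed

end

section \<open>States and sensitivities\<close>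

text \<open>Each weak derivative has a primitive, so the second derivative is continuous. The
  bounds, known almost everywhere, hold everywhere because preimages of closed intervals under
  continuous functions are closed.\<close>

lemma A1_C2:
  assumes "A1 a0 a1 a2 a3 A"
  obtains d e where "\<And>x. (A has_real_derivative d x) (at x)" "\<And>x. (d has_real_derivative e x) (at x)"
    "continuous_on UNIV e" "\<And>x. a0 \<le> d x" "\<And>x. d x \<le> a1" "\<And>x. \<bar>e x\<bar> \<le> a2"
proof -
  have S: "open (UNIV :: real set)" "is_interval (UNIV :: real set)" by (auto simp: is_interval_univ)
  obtain d1 d2 d3 where d: "weak_deriv UNIV A d1" "weak_deriv UNIV d1 d2" "weak_deriv UNIV d2 d3"
    and ae: "AE x in lebesgue. a0 \<le> d1 x \<and> d1 x \<le> a1 \<and> \<bar>d2 x\<bar> \<le> a2 \<and> \<bar>d3 x\<bar> \<le> a3"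
    and cA: "continuous_on UNIV A"
    using assms unfolding A1_def by blast
  obtain e where e: "primitive_on UNIV e d3" "AE x in lebesgue_on UNIV. e x = d2 x"
    using weak_deriv_primitiveD[OF S d(3)] by blast
  obtain D where D: "primitive_on UNIV D d2" "AE x in lebesgue_on UNIV. D x = d1 x"
    using weak_deriv_primitiveD[OF S d(2)] by blast
  obtain A' where A': "primitive_on UNIV A' d1" "AE x in lebesgue_on UNIV. A' x = A x"
    using weak_deriv_primitiveD[OF S d(1)] by blast
  have "A' x = A x" for x
    by (rule AE_eq_continuous_imp_eq[OF S(1) primitive_on_continuous[OF A'(1) S] cA A'(2)]) simp
  then have "primitive_on UNIV A d1" using primitive_on_cong[OF A'(1)] by blast
  then have pA: "primitive_on UNIV A D"
    by (rule primitive_on_cong_AE[OF _ S(2)]) (use D(2) in auto)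
  have pD: "primitive_on UNIV D e"
    by (rule primitive_on_cong_AE[OF D(1) S(2)]) (use e(2) in auto)
  have ce: "continuous_on UNIV e" and cD: "continuous_on UNIV D"
    using primitive_on_continuous[OF e(1) S] primitive_on_continuous[OF pD S] by auto
  have "AE x in lebesgue. D x \<in> {a0..a1}" "AE x in lebesgue. e x \<in> {-a2..a2}"
    using ae D(2) e(2) unfolding lebesgue_on_UNIV_eq by (eventually_elim, force)+
  then have "x \<in> D -` {a0..a1}" "x \<in> e -` {-a2..a2}" for x
    using mem_closed_if_AE_lebesgue[of "D -` {a0..a1}" x] mem_closed_if_AE_lebesgue[of "e -` {-a2..a2}" x]
      continuous_closed_vimage[of "{a0..a1}" D] continuous_closed_vimage[of "{-a2..a2}" e] cD ce
    by (auto simp: continuous_on_eq_continuous_at)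
  then have b: "D x \<in> {a0..a1}" "e x \<in> {-a2..a2}" for x by auto
  show thesis
  proof (rule that[of D e])
    show "(A has_real_derivative D x) (at x)" for x
      by (rule primitive_on_has_derivative[OF pA S]) (use cD in \<open>auto simp: continuous_on_eq_continuous_at\<close>)
    show "(D has_real_derivative e x) (at x)" for x
      by (rule primitive_on_has_derivative[OF pD S]) (use ce in \<open>auto simp: continuous_on_eq_continuous_at\<close>)
    show "a0 \<le> D x" "D x \<le> a1" for x using b(1)[of x] by auto
    show "\<bar>e x\<bar> \<le> a2" for x using b(2)[of x] by auto
  qed (rule ce)
qed

text \<open>Composition with the clamp onto \<open>{0..T}\<close> extends the derivatives
  continuously to the line; they remain derivatives inside the time interval, where the forcing is
  differentiated. Uniqueness of the one-sided derivative at 0 gives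
  \<open>\<delta> 0 = 0\<close>.\<close>

lemma boundary_data_C2:
  assumes T: "0 < T" and g: "C_k_on_interval 4 T g" and g0: "g 0 = 0"
    and d0: "(g has_real_derivative 0) (at 0 within {0..T})"
  obtains \<gamma> \<delta> \<eta> where "continuous_on UNIV \<gamma>" "continuous_on UNIV \<delta>" "continuous_on UNIV \<eta>"
    "\<And>t. t \<in> {0..T} \<Longrightarrow> \<gamma> t = g t" "\<gamma> 0 = 0" "\<delta> 0 = 0" "primitive_on {0..T} \<gamma> \<delta>"
    "\<And>t. 0 < t \<Longrightarrow> t < T \<Longrightarrow> (\<gamma> has_real_derivative \<delta> t) (at t)"
    "\<And>t. 0 < t \<Longrightarrow> t < T \<Longrightarrow> (\<delta> has_real_derivative \<eta> t) (at t)"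
proof -
  obtain D :: "nat \<Rightarrow> real \<Rightarrow> real" where D: "D 0 = g"
    "\<And>j t. j < 4 \<Longrightarrow> t \<in> {0..T} \<Longrightarrow> (D j has_real_derivative D (Suc j) t) (at t within {0..T})"
    using g unfolding C_k_on_interval_def by auto
  have c: "continuous_on {0..T} (D j)" if "j < 4" for j
    by (rule DERIV_continuous_on) (use D(2)[OF that] in auto)
  define cl where "cl = (\<lambda>t::real. max 0 (min T t))"
  have cl: "cl t \<in> {0..T}" "t \<in> {0..T} \<Longrightarrow> cl t = t" for t using T by (auto simp: cl_def)
  have ccl: "continuous_on UNIV (\<lambda>t. D j (cl t))" if "j < 4" for j
    by (rule continuous_on_compose2[OF c[OF that]]) (use cl in \<open>auto simp: cl_def intro!: continuous_intros\<close>)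
  have dcl: "((\<lambda>t. D j (cl t)) has_real_derivative D (Suc j) (cl t)) (at t)" if "j < 4" "0 < t" "t < T" for j t
  proof (rule has_field_derivative_transform_within_open[where S="{0<..<T}"])
    have "t \<in> {0..T}" using that by auto
    from D(2)[OF that(1) this] show "(D j has_real_derivative D (Suc j) (cl t)) (at t)"
      using that cl(2)[of t] by (simp add: at_within_Icc_at)
    show "D j s = D j (cl s)" if "s \<in> {0<..<T}" for s using cl(2)[of s] that by auto
  qed (use that in auto)
  have T0: "0 \<in> {0..T}" using T by simp
  have nb: "at 0 within {0..T} \<noteq> bot" using T by (simp add: at_within_Icc_at_right)
  have D1: "D 1 0 = 0"
    using tendsto_unique[OF nb] D(2)[of 0 0] T0 d0 D(1) unfolding has_field_derivative_iff by auto
  show thesis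
  proof (rule that[of "\<lambda>t. D 0 (cl t)" "\<lambda>t. D 1 (cl t)" "\<lambda>t. D 2 (cl t)"])
    show "continuous_on UNIV (\<lambda>t. D 0 (cl t))" "continuous_on UNIV (\<lambda>t. D 1 (cl t))" "continuous_on UNIV (\<lambda>t. D 2 (cl t))"
      by (rule ccl; simp)+
    show "D 0 (cl t) = g t" if "t \<in> {0..T}" for t using cl(2)[OF that] by (simp add: D(1))
    show "D 0 (cl 0) = 0" "D 1 (cl 0) = 0" using cl(2)[OF T0] g0 D1 by (simp_all add: D(1))
    show "((\<lambda>t. D 0 (cl t)) has_real_derivative D 1 (cl t)) (at t)" if "0 < t" "t < T" for t
      using dcl[of 0 t] that by simp
    show "((\<lambda>t. D 1 (cl t)) has_real_derivative D 2 (cl t)) (at t)" if "0 < t" "t < T" for t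
      using dcl[of 1 t] that by (simp add: numeral_2_eq_2)
    show "primitive_on {0..T} (\<lambda>t. D 0 (cl t)) (\<lambda>t. D 1 (cl t))"
      unfolding primitive_on_def
    proof (intro ballI impI conjI)
      fix x y assume xy: "x \<in> {0..T}" "y \<in> {0..T}" "x \<le> y"
      have c1: "continuous_on UNIV (\<lambda>t. D 1 (cl t))" by (rule ccl) simp
      show "integrable (lebesgue_on {x..y}) (\<lambda>t. D 1 (cl t))"
        by (rule continuous_imp_integrable_real[OF continuous_on_subset[OF c1]]) simp
      have c0: "continuous_on {x..y} (\<lambda>t. D 0 (cl t))" by (rule continuous_on_subset[OF ccl]) auto
      have "((\<lambda>t. D 1 (cl t)) has_integral (D 0 (cl y) - D 0 (cl x))) {x..y}"
      proof (rule fundamental_theorem_of_calculus_interior[OF xy(3) c0])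
        fix t assume "t \<in> {x<..<y}"
        then have "0 < t" "t < T" using xy by auto
        then show "((\<lambda>t. D 0 (cl t)) has_vector_derivative D 1 (cl t)) (at t)"
          using dcl[of 0 t] by (simp flip: has_real_derivative_iff_has_vector_derivative)
      qed
      then show "D 0 (cl y) - D 0 (cl x) = integral {x..y} (\<lambda>t. D 1 (cl t))" by (simp add: integral_unique)
    qed
  qed
qed

text \<open>The derivative is continued by its endpoint values, which keeps its bound, and
  integrated back. It supplies a forcing defined for all arguments from a direction given on an
  interval only.\<close>

lemma C1_extension:
  assumes lr: "l < r" and p: "primitive_on {l..r} b \<beta>" and c: "continuous_on {l..r} \<beta>"
    and bd: "\<And>y. y \<in> {l..r} \<Longrightarrow> \<bar>\<beta> y\<bar> \<le> S"
  obtains b' \<beta>' where "\<And>y. y \<in> {l..r} \<Longrightarrow> b' y = b y" "\<And>y. (b' has_real_derivative \<beta>' y) (at y)"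
    "continuous_on UNIV \<beta>'" "\<And>y. \<bar>\<beta>' y\<bar> \<le> S"
proof -
  define cl where "cl = (\<lambda>y::real. max l (min r y))"
  have cl: "cl y \<in> {l..r}" "y \<in> {l..r} \<Longrightarrow> cl y = y" for y using lr by (auto simp: cl_def)
  define \<beta>' where "\<beta>' = (\<lambda>y. \<beta> (cl y))"
  have c': "continuous_on UNIV \<beta>'"
    unfolding \<beta>'_def
    by (rule continuous_on_compose2[OF c]) (use cl in \<open>auto simp: cl_def intro!: continuous_intros\<close>)
  define b' where "b' = (\<lambda>y. integral {l..y} \<beta>' - integral {y..l} \<beta>' + b l)"
  have p': "primitive_on UNIV b' \<beta>'"
    unfolding b'_def
    by (intro primitive_on_add_const primitive_on_exists continuous_imp_integrable_real continuous_on_subset[OF c']) auto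
  show thesis
  proof (rule that[of b' \<beta>'])
    show "b' y = b y" if y: "y \<in> {l..r}" for y
    proof -
      have "b' y - b' l = integral {l..y} \<beta>'" by (rule primitive_onD(2)[OF p']) (use y in auto)
      also have "\<dots> = integral {l..y} \<beta>"
        by (rule Henstock_Kurzweil_Integration.integral_cong) (use y cl in \<open>auto simp: \<beta>'_def\<close>)
      also have "\<dots> = b y - b l" by (rule primitive_onD(2)[OF p, symmetric]) (use y lr in auto)
      finally show ?thesis by (simp add: b'_def)
    qed
    show "(b' has_real_derivative \<beta>' y) (at y)" for y
      by (rule primitive_on_has_derivative[OF p']) (use c' in \<open>auto simp: continuous_on_eq_continuous_at is_interval_univ\<close>)
    show "\<bar>\<beta>' y\<bar> \<le> S" for y unfolding \<beta>'_def by (rule bd[OF cl(1)])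
  qed (rule c')
qed

lemma lipschitz_of_derivative:
  fixes h :: "real \<Rightarrow> real"
  assumes "\<And>x. (h has_real_derivative h' x) (at x)" "\<And>x. \<bar>h' x\<bar> \<le> L"
  shows "\<bar>h x - h y\<bar> \<le> L * \<bar>x - y\<bar>"
  using field_differentiable_bound[of UNIV h h' L x y] assms by auto

lemma bmeas3_continuous:
  assumes "\<And>q. isCont (\<lambda>p. f (fst p) (fst (snd p)) (snd (snd p))) q"
  shows "bmeas3 f"
  unfolding bmeas3_def using assms by (intro borel_measurable_continuous_onI continuous_at_imp_continuous_on) auto

text \<open>The equation sees the nonlinearity only along the solution; this permits replacing a
  direction \<open>b\<close> by its extension.\<close>

lemma classical_solution_cong:
  assumes s: "classical_solution T f p0 u0 h0 h1 p u"
    and eq: "\<And>t x. t \<in> {0<..<T} \<Longrightarrow> x \<in> {0<..<1} \<Longrightarrow> f t x (u t x) = f' t x (u t x)"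
  shows "classical_solution T f' p0 u0 h0 h1 p u"
proof -
  let ?S = "{0<..<1::real}"
  let ?eqn = "\<lambda>f pt ut t. AE x in lebesgue_on ?S. pt t x + wd ?S (u t) x = 0 \<and> ut t x + wd ?S (p t) x + f t x (u t x) = 0"
  obtain pt ut where 1: "C1_path T (L2 ?S) (L2_norm ?S) p pt" "C1_path T (L2 ?S) (L2_norm ?S) u ut"
    "\<And>t. t \<in> {0<..<T} \<Longrightarrow> ?eqn f pt ut t"
    using s unfolding classical_solution_def by auto
  have 2: "?eqn f' pt ut t" if t: "t \<in> {0<..<T}" for t
  proof -
    have "AE x in lebesgue_on ?S. x \<in> ?S" by (rule AE_I2) simp
    with 1(3)[OF t] show ?thesis
    proof eventually_elim
      case (elim x)
      then show ?case using eq[OF t elim(2)] by simp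
    qed
  qed
  have ex: "\<exists>pt ut. C1_path T (L2 ?S) (L2_norm ?S) p pt \<and> C1_path T (L2 ?S) (L2_norm ?S) u ut \<and> (\<forall>t\<in>{0<..<T}. ?eqn f' pt ut t)"
    by (rule exI[of _ pt], rule exI[of _ ut]) (use 1(1,2) 2 in blast)
  show ?thesis using s ex unfolding classical_solution_def by (elim conjE) (intro conjI; assumption)
qed

section \<open>Construction of states and sensitivities\<close>

locale boundary_problem =
  fixes T a0 a1 a2 a3 c ul ur :: real and g0 g1 \<gamma>0 \<gamma>1 \<delta>0 \<delta>1 \<eta>0 \<eta>1 :: "real \<Rightarrow> real"
  assumes T_pos: "0 < T" and a0_pos: "0 < a0" and a1_pos: "0 < a1" and a2_pos: "0 < a2" and ul_ur: "ul < ur"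
    and c\<gamma>: "continuous_on UNIV \<gamma>0" "continuous_on UNIV \<gamma>1"
    and c\<delta>: "continuous_on UNIV \<delta>0" "continuous_on UNIV \<delta>1"
    and c\<eta>: "continuous_on UNIV \<eta>0" "continuous_on UNIV \<eta>1"
    and \<gamma>_eq: "\<And>t. t \<in> {0..T} \<Longrightarrow> g0 t = \<gamma>0 t \<and> g1 t = \<gamma>1 t"
    and zero: "\<gamma>0 0 = 0" "\<gamma>1 0 = 0" "\<delta>0 0 = 0" "\<delta>1 0 = 0"
    and prim: "primitive_on {0..T} \<gamma>0 \<delta>0" "primitive_on {0..T} \<gamma>1 \<delta>1"
    and d\<gamma>: "\<And>t. 0 < t \<Longrightarrow> t < T \<Longrightarrow> (\<gamma>0 has_real_derivative \<delta>0 t) (at t)"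
      "\<And>t. 0 < t \<Longrightarrow> t < T \<Longrightarrow> (\<gamma>1 has_real_derivative \<delta>1 t) (at t)"
    and d\<delta>: "\<And>t. 0 < t \<Longrightarrow> t < T \<Longrightarrow> (\<delta>0 has_real_derivative \<eta>0 t) (at t)"
      "\<And>t. 0 < t \<Longrightarrow> t < T \<Longrightarrow> (\<delta>1 has_real_derivative \<eta>1 t) (at t)"
    and range: "\<And>a p u t x. A1 a0 a1 a2 a3 a \<Longrightarrow> state_solution T c g0 g1 a p u \<Longrightarrow> t \<in> {0..T} \<Longrightarrow> x \<in> {0..1} \<Longrightarrow>
      u t x \<in> {ul..ur}"
begin

definition G :: "real \<Rightarrow> real \<Rightarrow> real" where "G t y = (1 - y) * \<gamma>0 t + y * \<gamma>1 t"
definition G1 :: "real \<Rightarrow> real \<Rightarrow> real" where "G1 t y = (1 - y) * \<delta>0 t + y * \<delta>1 t"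
definition G2 :: "real \<Rightarrow> real \<Rightarrow> real" where "G2 t y = (1 - y) * \<eta>0 t + y * \<eta>1 t"

lemma isCont_G: "isCont (\<lambda>p. G (fst p) (snd p)) q" "isCont (\<lambda>p. G1 (fst p) (snd p)) q" "isCont (\<lambda>p. G2 (fst p) (snd p)) q"
proof -
  have c: "isCont (\<lambda>p::real\<times>real. h (fst p)) q" if "continuous_on UNIV h" for h :: "real \<Rightarrow> real"
    by (rule isCont_o2[of q fst h]) (use that in \<open>auto simp: continuous_on_eq_continuous_at intro!: continuous_intros\<close>)
  have s: "isCont (\<lambda>p::real\<times>real. snd p) q" by (intro continuous_intros)
  show "isCont (\<lambda>p. G (fst p) (snd p)) q" unfolding G_def
    by (intro isCont_add isCont_mult isCont_diff continuous_const s c c\<gamma>)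
  show "isCont (\<lambda>p. G1 (fst p) (snd p)) q" unfolding G1_def
    by (intro isCont_add isCont_mult isCont_diff continuous_const s c c\<delta>)
  show "isCont (\<lambda>p. G2 (fst p) (snd p)) q" unfolding G2_def
    by (intro isCont_add isCont_mult isCont_diff continuous_const s c c\<eta>)
qed

lemma G_deriv:
  assumes "0 < t" "t < T"
  shows "((\<lambda>t. G t y) has_real_derivative G1 t y) (at t)" "((\<lambda>t. G1 t y) has_real_derivative G2 t y) (at t)"
  unfolding G_def G1_def G2_def
  by (intro DERIV_add DERIV_cmult d\<gamma> d\<delta> assms)+

lemma bmeas2_isCont: "(\<And>q. isCont (\<lambda>p. h (fst p) (snd p)) q) \<Longrightarrow> bmeas2 h"
  unfolding bmeas2_def by (intro borel_measurable_continuous_onI continuous_at_imp_continuous_on) auto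

lemma bmeas2_G: "bmeas2 G" "bmeas2 G1" "bmeas2 G2"
  by (rule bmeas2_isCont[OF isCont_G(1)]) (rule bmeas2_isCont[OF isCont_G(2)], rule bmeas2_isCont[OF isCont_G(3)])

lemma G_bound: "\<exists>B\<ge>0. \<forall>t\<in>{0..T}. \<forall>y\<in>{0..1}. \<bar>G1 t y\<bar> \<le> B \<and> \<bar>G2 t y\<bar> \<le> B"
proof -
  obtain B1 where B1: "\<And>t. t \<in> {0..T} \<Longrightarrow> \<bar>\<delta>0 t\<bar> \<le> B1" using continuous_bounded_Icc[OF c\<delta>(1)] by blast
  obtain B2 where B2: "\<And>t. t \<in> {0..T} \<Longrightarrow> \<bar>\<delta>1 t\<bar> \<le> B2" using continuous_bounded_Icc[OF c\<delta>(2)] by blast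
  obtain B3 where B3: "\<And>t. t \<in> {0..T} \<Longrightarrow> \<bar>\<eta>0 t\<bar> \<le> B3" using continuous_bounded_Icc[OF c\<eta>(1)] by blast
  obtain B4 where B4: "\<And>t. t \<in> {0..T} \<Longrightarrow> \<bar>\<eta>1 t\<bar> \<le> B4" using continuous_bounded_Icc[OF c\<eta>(2)] by blast
  define B where "B = \<bar>B1\<bar> + \<bar>B2\<bar> + \<bar>B3\<bar> + \<bar>B4\<bar>"
  show ?thesis
  proof (intro exI[of _ B] conjI ballI)
    show "0 \<le> B" by (simp add: B_def)
    fix t y assume t: "t \<in> {0..T}" and y: "y \<in> {0..1::real}"
    have "\<bar>\<delta>0 t\<bar> \<le> B" "\<bar>\<delta>1 t\<bar> \<le> B" "\<bar>\<eta>0 t\<bar> \<le> B" "\<bar>\<eta>1 t\<bar> \<le> B"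
      using B1[OF t] B2[OF t] B3[OF t] B4[OF t] unfolding B_def by linarith+
    then show "\<bar>G1 t y\<bar> \<le> B" "\<bar>G2 t y\<bar> \<le> B"
      unfolding G1_def G2_def by (auto intro!: abs_convex_combination_le[OF y])
  qed
qed

text \<open>\<open>v\<close> encodes the state \<open>u = odd_part v + G\<close> for the parameter \<open>A\<close> with derivatives \<open>d\<close>, \<open>e\<close>;
  \<open>z\<close> is the time derivative of \<open>v\<close>.\<close>

definition state_data where
  "state_data A d e v z R \<longleftrightarrow> A1 a0 a1 a2 a3 A \<and>
    (\<forall>x. (A has_real_derivative d x) (at x)) \<and> (\<forall>x. (d has_real_derivative e x) (at x)) \<and> continuous_on UNIV e \<and>
    (\<forall>x. a0 \<le> d x \<and> d x \<le> a1 \<and> \<bar>e x\<bar> \<le> a2) \<and>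
    bmeas2 v \<and> bmeas2 z \<and> 0 < R \<and> (\<forall>x. primitive_on {0..T} (\<lambda>t. v t x) (\<lambda>t. z t x)) \<and>
    (\<forall>t\<in>{0..T}. \<forall>x. \<bar>z t x\<bar> \<le> R \<and> \<bar>v t x\<bar> \<le> R) \<and>
    (\<forall>t x. sin (pi * (x - t)) \<noteq> 0 \<longrightarrow> isCont (\<lambda>p. z (fst p) (snd p)) (t, x)) \<and>
    (\<forall>t x. 0 < t \<longrightarrow> t < T \<longrightarrow> isCont (\<lambda>p. v (fst p) (snd p)) (t, x)) \<and> (\<forall>x. v 0 x = 0) \<and>
    mild T (\<lambda>t y. A (odd_part v t y + G t y) + G1 t y) v \<and>
    (\<forall>p u t x. (p, u) = the_state T c g0 g1 A \<longrightarrow> t \<in> {0..T} \<longrightarrow> x \<in> {0..1} \<longrightarrow> u t x = odd_part v t x + G t x \<and> u t x \<in> {ul..ur}) \<and>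
    (\<forall>p u t. (p, u) = the_state T c g0 g1 A \<longrightarrow> t \<in> {0..T} \<longrightarrow> p t 0 - p t 1 = v t 0 - v t 1)"

text \<open>Subtracting the lift turns the problem into one with zero boundary values and forcing
  \<open>A (w + G) + G1\<close>, where \<open>G1\<close> is the time derivative of the lift. Bounds
  on \<open>d\<close> and \<open>e\<close> then verify the locale \<open>forcing\<close>.\<close>

lemma state_data_exists:
  assumes A: "A1 a0 a1 a2 a3 A"
  shows "\<exists>d e v z R. state_data A d e v z R"
proof -
  obtain d e where dA: "\<And>x. (A has_real_derivative d x) (at x)" and de: "\<And>x. (d has_real_derivative e x) (at x)"
    and ce: "continuous_on UNIV e" and b: "\<And>x. a0 \<le> d x" "\<And>x. d x \<le> a1" "\<And>x. \<bar>e x\<bar> \<le> a2"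
    using A1_C2[OF A] by blast
  have cA: "isCont A x" and cd: "isCont d x" for x using dA de DERIV_isCont by blast+
  have A0: "A 0 = 0" using A by (simp add: A1_def)
  obtain B where B: "0 \<le> B" "\<And>t y. t \<in> {0..T} \<Longrightarrow> y \<in> {0..1} \<Longrightarrow> \<bar>G1 t y\<bar> \<le> B"
    "\<And>t y. t \<in> {0..T} \<Longrightarrow> y \<in> {0..1} \<Longrightarrow> \<bar>G2 t y\<bar> \<le> B" using G_bound by blast
  \<comment> \<open>Sums the separate requirements: \<open>a1 * B + B\<close> for \<open>ft\<close>
    at 0, \<open>a2 * B\<close> and \<open>a2\<close> for the Lipschitz constants of
    \<open>ft\<close> and \<open>fw\<close>, and \<open>a1\<close> for \<open>fw\<close>.\<close>
  define K where "K = 1 + a1 * B + B + a2 * B + a1 + a2"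
  have Kpos: "0 \<le> a1 * B" "0 \<le> a2 * B" using a1_pos a2_pos B by auto
  have db: "\<bar>d x\<bar> \<le> a1" for x using b(1)[of x] b(2)[of x] a0_pos by auto
  have dl: "\<bar>d x - d y\<bar> \<le> a2 * \<bar>x - y\<bar>" for x y by (rule lipschitz_of_derivative[OF de b(3)])
  define f where "f = (\<lambda>t y w. A (w + G t y) + G1 t y)"
  define ft where "ft = (\<lambda>t y w. d (w + G t y) * G1 t y + G2 t y)"
  define fw where "fw = (\<lambda>t y w. d (w + G t y))"
  have cG: "isCont (\<lambda>p::real\<times>real\<times>real. h (fst p) (fst (snd p))) q" if "\<And>q. isCont (\<lambda>p. h (fst p) (snd p)) q" for h q
    by (rule isCont_comp2[where z=h and a=fst and b="\<lambda>p. fst (snd p)"]) (auto intro!: that continuous_intros)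
  have cw: "isCont (\<lambda>p::real\<times>real\<times>real. snd (snd p) + G (fst p) (fst (snd p))) q" for q
    by (intro isCont_add cG isCont_G) (intro continuous_intros)
  have cAw: "isCont (\<lambda>p. A (snd (snd p) + G (fst p) (fst (snd p)))) q" for q by (rule isCont_o2[OF cw cA])
  have cdw: "isCont (\<lambda>p. d (snd (snd p) + G (fst p) (fst (snd p)))) q" for q by (rule isCont_o2[OF cw cd])
  have cf: "isCont (\<lambda>p. f (fst p) (fst (snd p)) (snd (snd p))) q"
    and cft: "isCont (\<lambda>p. ft (fst p) (fst (snd p)) (snd (snd p))) q"
    and cfw: "isCont (\<lambda>p. fw (fst p) (fst (snd p)) (snd (snd p))) q" for q
    unfolding f_def ft_def fw_def by (intro isCont_add isCont_mult cAw cdw cG isCont_G)+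
  interpret forcing T K f ft fw
  proof
    show "0 < T" by (rule T_pos)
    show "1 \<le> K" using Kpos B(1) a1_pos a2_pos by (simp add: K_def)
    show "bmeas3 f" "bmeas3 ft" "bmeas3 fw" by (rule bmeas3_continuous[OF cf] bmeas3_continuous[OF cft] bmeas3_continuous[OF cfw])+
    show "isCont (\<lambda>p. f (fst p) (fst (snd p)) (snd (snd p))) q"
      "isCont (\<lambda>p. ft (fst p) (fst (snd p)) (snd (snd p))) q" "isCont (\<lambda>p. fw (fst p) (fst (snd p)) (snd (snd p))) q" for q
      by (rule cf cft cfw)+
    show "continuous_on ({0..T} \<times> UNIV) (\<lambda>q. f (fst q) y (snd q))" for y
    proof (rule continuous_at_imp_continuous_on, rule ballI)
      fix q :: "real \<times> real"
      show "isCont (\<lambda>q. f (fst q) y (snd q)) q"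
        by (rule isCont_comp3[where z=f and a=fst and b="\<lambda>_. y" and c=snd]) (auto intro!: continuous_intros cf)
    qed
    show "((\<lambda>q. f (fst q) y (snd q)) has_derivative (\<lambda>h. ft t y w * fst h + fw t y w * snd h)) (at (t, w))"
      if t: "t \<in> {0<..<T}" for t y w
    proof -
      have t': "0 < t" "t < T" using t by auto
      have g: "((\<lambda>q::real\<times>real. h (fst q)) has_derivative (\<lambda>k. fst k * h')) (at (t, w))"
        if "(h has_real_derivative h') (at t)" for h h'
        by (rule DERIV_compose_FDERIV[of h h' fst "(t, w)" fst UNIV]) (use that in \<open>auto intro!: has_derivative_fst has_derivative_ident\<close>)
      have "((\<lambda>q. snd q + G (fst q) y) has_derivative (\<lambda>k. snd k + fst k * G1 t y)) (at (t, w))"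
        by (intro has_derivative_add has_derivative_snd has_derivative_ident g G_deriv t')
      then have "((\<lambda>q. A (snd q + G (fst q) y)) has_derivative (\<lambda>k. (snd k + fst k * G1 t y) * d (w + G t y))) (at (t, w))"
        by (intro DERIV_compose_FDERIV[where f=A]) (use dA in auto)
      from has_derivative_add[OF this g[OF G_deriv(2)[OF t', of y]]] show ?thesis
        unfolding f_def ft_def fw_def by (simp add: algebra_simps)
    qed
    \<comment> \<open>Compatibility of the data: \<open>A 0 = 0\<close> and the vanishing of the
      boundary values and their slopes at time 0 make the initial forcing 0.\<close>
    show "\<bar>f 0 y 0\<bar> \<le> K" for y
      using Kpos B(1) a1_pos a2_pos by (simp add: f_def G_def G1_def zero A0 K_def)
    show "isCont (\<lambda>y. f 0 y 0) y" for y by (simp add: f_def G_def G1_def zero)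
    fix t y assume t: "t \<in> {0<..<T}" and y: "y \<in> {0..1::real}"
    have t': "t \<in> {0..T}" using t by auto
    have GB: "\<bar>G1 t y\<bar> \<le> B" "\<bar>G2 t y\<bar> \<le> B" using B t' y by auto
    have "\<bar>d (0 + G t y) * G1 t y\<bar> \<le> a1 * B" unfolding abs_mult by (intro mult_mono db GB) (use a1_pos in auto)
    then show "\<bar>ft t y 0\<bar> \<le> K" unfolding ft_def K_def using GB Kpos a1_pos a2_pos B(1) by linarith
    fix w w'
    have le: "k * \<bar>w - w'\<bar> \<le> K * \<bar>w - w'\<bar>" if "k \<le> K" for k using that by (intro mult_right_mono) auto
    have "\<bar>ft t y w - ft t y w'\<bar> = \<bar>d (w + G t y) - d (w' + G t y)\<bar> * \<bar>G1 t y\<bar>"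
      unfolding ft_def by (simp add: abs_mult[symmetric] left_diff_distrib)
    also have "\<dots> \<le> (a2 * \<bar>w - w'\<bar>) * B"
      by (rule mult_mono) (use dl[of "w + G t y" "w' + G t y"] GB a2_pos in auto)
    also have "\<dots> = (a2 * B) * \<bar>w - w'\<bar>" by simp
    also have "\<dots> \<le> K * \<bar>w - w'\<bar>" by (rule le) (use Kpos B(1) a1_pos a2_pos in \<open>simp add: K_def\<close>)
    finally show "\<bar>ft t y w - ft t y w'\<bar> \<le> K * \<bar>w - w'\<bar>" .
    have "a1 \<le> K" "a2 \<le> K" using Kpos B(1) a1_pos a2_pos by (auto simp: K_def)
    then show "\<bar>fw t y w\<bar> \<le> K" unfolding fw_def using db[of "w + G t y"] by linarith
    show "\<bar>fw t y w - fw t y w'\<bar> \<le> K * \<bar>w - w'\<bar>"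
      unfolding fw_def using dl[of "w + G t y" "w' + G t y"] le[OF \<open>a2 \<le> K\<close>] by simp
  qed
  obtain v z R pp where v: "bmeas2 v" "bmeas2 z" "0 < R" "\<forall>x. primitive_on {0..T} (\<lambda>t. v t x) (\<lambda>t. z t x)"
    "\<forall>t\<in>{0..T}. \<forall>x. \<bar>z t x\<bar> \<le> R \<and> \<bar>v t x\<bar> \<le> R"
    "\<forall>t x. sin (pi * (x - t)) \<noteq> 0 \<longrightarrow> isCont (\<lambda>p. z (fst p) (snd p)) (t, x)"
    "\<forall>t x. 0 < t \<longrightarrow> t < T \<longrightarrow> isCont (\<lambda>p. v (fst p) (snd p)) (t, x)" "\<forall>x. v 0 x = 0"
    "mild T (\<lambda>t y. f t y (odd_part v t y)) v"
    "classical_solution T (\<lambda>t x u. A u) c 0 g0 g1 pp (\<lambda>t y. odd_part v t y + ((1 - y) * \<gamma>0 t + y * \<gamma>1 t))"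
    "\<forall>t. pp t 0 - pp t 1 = v t 0 - v t 1"
    using classical_solution_exists[OF c\<gamma> c\<delta> prim zero(1,2) \<gamma>_eq, of "\<lambda>t x u. A u" c]
    unfolding f_def G_def G1_def by blast
  have ss: "state_solution T c g0 g1 A pp (\<lambda>t y. odd_part v t y + G t y)"
    using v(10) by (simp add: state_solution_def G_def)
  have mono: "0 \<le> (A y - A z) * (y - z)" for y z
  proof -
    have m: "A y \<le> A z" if "y \<le> z" for y z
      by (rule DERIV_nonneg_imp_nondecreasing[OF that]) (use dA b(1) a0_pos in \<open>meson less_imp_le order_trans\<close>)
    show ?thesis using m[of y z] m[of z y] by (cases "y \<le> z") (auto simp: mult_nonneg_nonneg mult_nonpos_nonpos)
  qed
  \<comment> \<open>\<open>the_state\<close> is a Hilbert choice among solutions: existence makes it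
    a solution, and uniqueness makes it the constructed one.\<close>
  have un: "p t x = pp t x" "u t x = odd_part v t x + G t x" "u t x \<in> {ul..ur}"
    if pu: "(p, u) = the_state T c g0 g1 A" and t: "t \<in> {0..T}" and x: "x \<in> {0..1}" for p u t x
  proof -
    have "case the_state T c g0 g1 A of (p, u) \<Rightarrow> state_solution T c g0 g1 A p u"
      unfolding the_state_def by (rule someI[of "\<lambda>(p, u). state_solution T c g0 g1 A p u" "(pp, \<lambda>t y. odd_part v t y + G t y)"]) (use ss in simp)
    then have s: "state_solution T c g0 g1 A p u" unfolding pu[symmetric] by simp
    note uniq = classical_solution_unique[OF T_pos s[unfolded state_solution_def] ss[unfolded state_solution_def] mono t x]
    show "p t x = pp t x" "u t x = odd_part v t x + G t x" by (fact uniq)+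
    show "u t x \<in> {ul..ur}" by (rule range[OF A s t x])
  qed
  have "state_data A d e v z R"
    unfolding state_data_def
  proof (intro conjI)
    show "A1 a0 a1 a2 a3 A" by (rule A)
    show "mild T (\<lambda>t y. A (odd_part v t y + G t y) + G1 t y) v" using v(9) by (simp add: f_def)
    show "\<forall>p u t x. (p, u) = the_state T c g0 g1 A \<longrightarrow> t \<in> {0..T} \<longrightarrow> x \<in> {0..1} \<longrightarrow> u t x = odd_part v t x + G t x \<and> u t x \<in> {ul..ur}"
      using un(2,3) by blast
    show "\<forall>p u t. (p, u) = the_state T c g0 g1 A \<longrightarrow> t \<in> {0..T} \<longrightarrow> p t 0 - p t 1 = v t 0 - v t 1"
      using un(1)[of _ _ _ 0] un(1)[of _ _ _ 1] v(11) by fastforce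
  qed (use dA de ce b v in blast)+
  then show ?thesis by blast
qed

text \<open>The forcing is affine in \<open>w\<close>, with coefficients evaluated along the state.
  The time derivative of the state is continuous only at good points, hence the form of the
  assumptions of \<open>forcing\<close>. Uniqueness transfers the boundary difference to
  \<open>the_sensitivity\<close>.\<close>

lemma sensitivity_data_exists:
  assumes S: "state_data A d e v z R" and b: "primitive_on {ul..ur} b \<beta>" "continuous_on {ul..ur} \<beta>"
    and pu: "(p, u) = the_state T c g0 g1 A"
  shows "\<exists>r b'. (\<forall>y\<in>{ul..ur}. b' y = b y) \<and> mild T (\<lambda>t y. d (odd_part v t y + G t y) * odd_part r t y + b' (odd_part v t y + G t y)) r \<and>
    (\<forall>q w t. (q, w) = the_sensitivity T A u b \<longrightarrow> t \<in> {0..T} \<longrightarrow> q t 0 - q t 1 = r t 0 - r t 1)"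
proof -
  have dA: "\<And>x. (A has_real_derivative d x) (at x)" and de: "\<And>x. (d has_real_derivative e x) (at x)"
    and ce: "continuous_on UNIV e" and db: "\<And>x. a0 \<le> d x" "\<And>x. d x \<le> a1" "\<And>x. \<bar>e x\<bar> \<le> a2"
    and vm: "bmeas2 v" "bmeas2 z" and R: "0 < R" and vp: "\<And>x. primitive_on {0..T} (\<lambda>t. v t x) (\<lambda>t. z t x)"
    and zR: "\<And>t x. t \<in> {0..T} \<Longrightarrow> \<bar>z t x\<bar> \<le> R"
    and zc: "\<And>t x. sin (pi * (x - t)) \<noteq> 0 \<Longrightarrow> isCont (\<lambda>p. z (fst p) (snd p)) (t, x)"
    and vc: "\<And>t x. 0 < t \<Longrightarrow> t < T \<Longrightarrow> isCont (\<lambda>p. v (fst p) (snd p)) (t, x)" and v0: "\<And>x. v 0 x = 0"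
    and us: "\<And>t x. t \<in> {0..T} \<Longrightarrow> x \<in> {0..1} \<Longrightarrow> u t x = odd_part v t x + G t x \<and> u t x \<in> {ul..ur}"
    using S pu unfolding state_data_def by blast+
  have "bounded (\<beta> ` {ul..ur})" by (intro compact_imp_bounded compact_continuous_image b) auto
  then obtain M0 where M0: "\<And>y. y \<in> {ul..ur} \<Longrightarrow> \<bar>\<beta> y\<bar> \<le> M0" unfolding bounded_iff by (metis imageI real_norm_def)
  define M where "M = \<bar>M0\<bar>"
  have M: "0 \<le> M" "\<And>y. y \<in> {ul..ur} \<Longrightarrow> \<bar>\<beta> y\<bar> \<le> M" using M0 by (auto simp: M_def intro: order_trans[OF _ abs_ge_self])
  obtain b' \<beta>' where b': "\<And>y. y \<in> {ul..ur} \<Longrightarrow> b' y = b y" "\<And>y. (b' has_real_derivative \<beta>' y) (at y)"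
    "continuous_on UNIV \<beta>'" "\<And>y. \<bar>\<beta>' y\<bar> \<le> M"
    using C1_extension[OF ul_ur b M(2)] by blast
  have cd: "isCont d x" and ce': "isCont e x" and cb: "isCont b' x" and c\<beta>: "isCont \<beta>' x" for x
    using DERIV_isCont[OF de] DERIV_isCont[OF b'(2)] ce b'(3) by (auto simp: continuous_on_eq_continuous_at)
  define us where "us = (\<lambda>t y. odd_part v t y + G t y)"
  define ut where "ut = (\<lambda>t y. odd_part z t y + G1 t y)"
  have um: "bmeas2 us" "bmeas2 ut"
    unfolding us_def ut_def bmeas2_def
    by (rule borel_measurable_add[OF bmeas2_odd_part[OF vm(1), unfolded bmeas2_def] bmeas2_G(1)[unfolded bmeas2_def]])
      (rule borel_measurable_add[OF bmeas2_odd_part[OF vm(2), unfolded bmeas2_def] bmeas2_G(2)[unfolded bmeas2_def]])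
  have uc: "isCont (\<lambda>p. us (fst p) (snd p)) (t, y)" if "0 < t" "t < T" for t y
    unfolding us_def by (intro isCont_add isCont_odd_part vc that isCont_G)
  have utc: "isCont (\<lambda>p. ut (fst p) (snd p)) (t, y)" if "good t y" for t y
  proof -
    have "good t (- y)" using that by (simp add: good_minus)
    then show ?thesis
      unfolding ut_def by (intro isCont_add isCont_odd_part zc isCont_G) (use that in \<open>auto simp: good_iff\<close>)
  qed
  have ud: "((\<lambda>t. us t y) has_real_derivative ut t y) (at t)" if t: "0 < t" "t < T" and g: "good t y" for t y
  proof -
    have vd: "((\<lambda>t. v t w) has_real_derivative z t w) (at t)" if "good t w" for w
    proof (rule primitive_on_has_derivative[OF primitive_on_subset[OF vp], of "{0<..<T}"])
      show "isCont (\<lambda>t. z t w) t"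
        by (rule isCont_comp2[where a="\<lambda>s. s" and b="\<lambda>_. w"]) (use zc that in \<open>auto simp: good_iff\<close>)
    qed (use t in \<open>auto simp: is_interval_oo\<close>)
    show ?thesis
      unfolding us_def ut_def odd_part_def
      by (intro DERIV_add DERIV_cdivide DERIV_diff vd G_deriv t) (use g good_minus in auto)
  qed
  have u0: "us 0 y = 0" for y by (simp add: us_def odd_part_def v0 G_def zero)
  obtain B where B: "0 \<le> B" "\<And>t y. t \<in> {0..T} \<Longrightarrow> y \<in> {0..1} \<Longrightarrow> \<bar>G1 t y\<bar> \<le> B" using G_bound by blast
  have utb: "\<bar>ut t y\<bar> \<le> R + B" if "t \<in> {0..T}" "y \<in> {0..1}" for t y
    unfolding ut_def using odd_part_bound[of z t y R] zR that B(2)[OF that] by (intro order_trans[OF abs_triangle_ineq] add_mono) auto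
  \<comment> \<open>\<open>R + B\<close> bounds the time derivative of the state; it is multiplied
    by the bounds \<open>M\<close> on \<open>\<beta>'\<close> and \<open>a2\<close> on
    \<open>e\<close> in \<open>ft\<close>.\<close>
  define K where "K = 1 + M * (R + B) + a2 * (R + B) + a1 + \<bar>b' 0\<bar>"
  have Kpos: "0 \<le> M * (R + B)" "0 \<le> a2 * (R + B)" using M a2_pos R B by auto
  define f where "f = (\<lambda>t y w. d (us t y) * w + b' (us t y))"
  define ft where "ft = (\<lambda>t y w. e (us t y) * ut t y * w + \<beta>' (us t y) * ut t y)"
  define fw where "fw = (\<lambda>t y w::real. d (us t y))"
  have m: "h \<in> borel_measurable borel" if "\<And>x. isCont h x" for h :: "real \<Rightarrow> real"
    using that by (intro borel_measurable_continuous_onI continuous_at_imp_continuous_on) auto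
  have m3: "(\<lambda>p::real\<times>real\<times>real. fst p) \<in> borel_measurable borel" "(\<lambda>p::real\<times>real\<times>real. fst (snd p)) \<in> borel_measurable borel"
    "(\<lambda>p::real\<times>real\<times>real. snd (snd p)) \<in> borel_measurable borel"
    by (intro borel_measurable_continuous_onI continuous_intros)+
  have um3: "(\<lambda>p::real\<times>real\<times>real. us (fst p) (fst (snd p))) \<in> borel_measurable borel"
    "(\<lambda>p::real\<times>real\<times>real. ut (fst p) (fst (snd p))) \<in> borel_measurable borel"
    by (rule bmeas2_comp[OF um(1) m3(1,2)]) (rule bmeas2_comp[OF um(2) m3(1,2)])
  have hm3: "(\<lambda>p::real\<times>real\<times>real. h (us (fst p) (fst (snd p)))) \<in> borel_measurable borel" if "\<And>x. isCont h x" for h :: "real \<Rightarrow> real"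
    by (rule measurable_compose[OF um3(1) m[OF that]])
  have uc3: "isCont (\<lambda>p::real\<times>real\<times>real. us (fst p) (fst (snd p))) (t, y, w)" if "0 < t" "t < T" for t y w
    by (rule isCont_comp2[where z=us and a=fst and b="\<lambda>p. fst (snd p)"]) (use uc[OF that] in \<open>auto intro!: continuous_intros\<close>)
  have utc3: "isCont (\<lambda>p::real\<times>real\<times>real. ut (fst p) (fst (snd p))) (t, y, w)" if "good t y" for t y w
    by (rule isCont_comp2[where z=ut and a=fst and b="\<lambda>p. fst (snd p)"]) (use utc[OF that] in \<open>auto intro!: continuous_intros\<close>)
  have hc3: "isCont (\<lambda>p::real\<times>real\<times>real. h (us (fst p) (fst (snd p)))) (t, y, w)"
    if "\<And>x. isCont h x" "0 < t" "t < T" for h :: "real \<Rightarrow> real" and t y w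
    by (rule isCont_o2[OF uc3[OF that(2,3)] that(1)])
  have w3: "isCont (\<lambda>p::real\<times>real\<times>real. snd (snd p)) q" for q by (intro continuous_intros)
  have us_cont: "continuous_on {0..T} (\<lambda>t. us t y)" for y
    unfolding us_def odd_part_def G_def
    by (intro continuous_intros primitive_on_continuous_Icc[OF vp] continuous_on_subset[OF c\<gamma>(1)] continuous_on_subset[OF c\<gamma>(2)]) auto
  interpret forcing T K f ft fw
  proof
    show "0 < T" by (rule T_pos)
    show "1 \<le> K" using Kpos a1_pos by (simp add: K_def)
    show "bmeas3 f" "bmeas3 ft" "bmeas3 fw"
      unfolding bmeas3_def f_def ft_def fw_def
      by (intro borel_measurable_add borel_measurable_times hm3 um3 m3 cd ce' cb c\<beta>)+
    show "continuous_on ({0..T} \<times> UNIV) (\<lambda>q. f (fst q) y (snd q))" for y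
    proof -
      have 1: "continuous_on ({0..T} \<times> UNIV) (\<lambda>q::real\<times>real. us (fst q) y)"
        by (rule continuous_on_compose2[OF us_cont[of y]]) (auto intro!: continuous_intros)
      have h: "continuous_on ({0..T} \<times> UNIV) (\<lambda>q::real\<times>real. h (us (fst q) y))" if "\<And>x. isCont h x" for h :: "real \<Rightarrow> real"
        by (rule continuous_on_compose2[OF continuous_at_imp_continuous_on[of UNIV h] 1]) (use that in auto)
      show ?thesis unfolding f_def by (intro continuous_on_add continuous_on_mult h cd cb continuous_on_snd continuous_on_id)
    qed
    show "\<bar>f 0 y 0\<bar> \<le> K" for y using Kpos a1_pos by (simp add: f_def u0 K_def)
    show "isCont (\<lambda>y. f 0 y 0) y" for y by (simp add: f_def u0)
    fix t :: real assume t: "t \<in> {0<..<T}"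
    then have t': "0 < t" "t < T" "t \<in> {0..T}" by auto
    show "isCont (\<lambda>p. f (fst p) (fst (snd p)) (snd (snd p))) (t, y, w)" for y w
      unfolding f_def by (intro isCont_add isCont_mult hc3 cd cb w3 t')
    show "((\<lambda>q. f (fst q) y (snd q)) has_derivative (\<lambda>h. ft t y w * fst h + fw t y w * snd h)) (at (t, w))"
      if g: "good t y" for y w
    proof -
      have h: "((\<lambda>q::real\<times>real. h (fst q)) has_derivative (\<lambda>k. fst k * h')) (at (t, w))"
        if "(h has_real_derivative h') (at t)" for h h'
        by (rule DERIV_compose_FDERIV[of h h' fst "(t, w)" fst UNIV]) (use that in \<open>auto intro!: has_derivative_fst has_derivative_ident\<close>)
      have 1: "((\<lambda>t. d (us t y)) has_real_derivative e (us t y) * ut t y) (at t)"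
        "((\<lambda>t. b' (us t y)) has_real_derivative \<beta>' (us t y) * ut t y) (at t)"
        by (rule DERIV_chain2[OF _ ud[OF t'(1,2) g]], rule de b'(2))+
      have "((\<lambda>q. d (us (fst q) y) * snd q + b' (us (fst q) y)) has_derivative
          (\<lambda>k. (d (us (fst (t, w)) y) * snd k + fst k * (e (us t y) * ut t y) * snd (t, w)) + fst k * (\<beta>' (us t y) * ut t y))) (at (t, w))"
        by (intro has_derivative_add has_derivative_mult h 1 has_derivative_snd has_derivative_ident)
      then show ?thesis unfolding f_def ft_def fw_def by (simp add: algebra_simps)
    qed
    show "isCont (\<lambda>p. ft (fst p) (fst (snd p)) (snd (snd p))) (t, y, w)" if "good t y" for y w
      unfolding ft_def by (intro isCont_add isCont_mult hc3 ce' c\<beta> w3 t' utc3 that)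
    show "isCont (\<lambda>p. fw (fst p) (fst (snd p)) (snd (snd p))) (t, y, w)" for y w
      unfolding fw_def by (intro hc3 cd t')
    fix y assume y: "y \<in> {0..1::real}"
    note utB = utb[OF t'(3) y]
    have "\<bar>\<beta>' (us t y) * ut t y\<bar> \<le> M * (R + B)" unfolding abs_mult by (intro mult_mono b' utB) (use M in auto)
    then show "\<bar>ft t y 0\<bar> \<le> K" unfolding ft_def K_def using Kpos a1_pos by simp
    fix w w'
    have le: "k * \<bar>w - w'\<bar> \<le> K * \<bar>w - w'\<bar>" if "k \<le> K" for k using that by (intro mult_right_mono) auto
    have "\<bar>e (us t y) * ut t y\<bar> \<le> a2 * (R + B)" unfolding abs_mult by (intro mult_mono db utB) (use a2_pos in auto)
    then have k: "\<bar>e (us t y) * ut t y\<bar> \<le> K" unfolding K_def using Kpos a1_pos by simp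
    have "ft t y w - ft t y w' = (e (us t y) * ut t y) * (w - w')" unfolding ft_def by (simp add: algebra_simps)
    then show "\<bar>ft t y w - ft t y w'\<bar> \<le> K * \<bar>w - w'\<bar>" using le[OF k] by (simp add: abs_mult)
    show "\<bar>fw t y w\<bar> \<le> K"
      unfolding fw_def K_def using db(1)[of "us t y"] db(2)[of "us t y"] a0_pos Kpos by simp
    show "\<bar>fw t y w - fw t y w'\<bar> \<le> K * \<bar>w - w'\<bar>" using le[of 0] Kpos a1_pos by (simp add: fw_def K_def)
  qed
  have c0: "continuous_on UNIV (\<lambda>_::real. 0::real)" by simp
  have p0: "primitive_on {0..T} (\<lambda>_. 0) (\<lambda>_. 0)" by (simp add: primitive_on_def)
  obtain r rr where r: "mild T (\<lambda>t y. f t y (odd_part r t y)) r"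
    "classical_solution T (\<lambda>t x w. d (us t x) * w + b' (us t x)) 0 0 (\<lambda>_. 0) (\<lambda>_. 0) rr (\<lambda>t y. odd_part r t y + ((1 - y) * 0 + y * 0))"
    "\<forall>t. rr t 0 - rr t 1 = r t 0 - r t 1"
    using classical_solution_exists[OF c0 c0 c0 c0 p0 p0, of "\<lambda>_. 0" "\<lambda>_. 0" "\<lambda>t x w. d (us t x) * w + b' (us t x)" 0]
    unfolding f_def by auto
  have dA': "deriv A = d" using dA by (auto intro: DERIV_imp_deriv)
  \<comment> \<open>The state takes values in \<open>{ul..ur}\<close>, where the extension
    \<open>b'\<close> agrees with \<open>b\<close>.\<close>
  have eq: "deriv A (u t x) * w + b (u t x) = d (us t x) * w + b' (us t x)" if "t \<in> {0<..<T}" "x \<in> {0<..<1}" for t x w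
    using us[of t x] b'(1)[of "u t x"] that by (auto simp: dA' us_def)
  have sens: "sensitivity_solution T A u b rr (odd_part r)"
  proof -
    have 1: "classical_solution T (\<lambda>t x w. d (us t x) * w + b' (us t x)) 0 0 (\<lambda>_. 0) (\<lambda>_. 0) rr (odd_part r)"
      using r(2) by simp
    show ?thesis
      unfolding sensitivity_solution_def by (rule classical_solution_cong[OF 1]) (simp add: eq)
  qed
  have val: "q t 0 - q t 1 = r t 0 - r t 1" if qw: "(q, w) = the_sensitivity T A u b" and t: "t \<in> {0..T}" for q w t
  proof -
    have "case the_sensitivity T A u b of (q, w) \<Rightarrow> sensitivity_solution T A u b q w"
      unfolding the_sensitivity_def by (rule someI[of "\<lambda>(q, w). sensitivity_solution T A u b q w" "(rr, odd_part r)"]) (use sens in simp)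
    then have s: "sensitivity_solution T A u b q w" unfolding qw[symmetric] by simp
    have mono: "0 \<le> (deriv A (u t x) * y + b (u t x) - (deriv A (u t x) * z + b (u t x))) * (y - z)" for t x y z
    proof -
      have "(deriv A (u t x) * y + b (u t x) - (deriv A (u t x) * z + b (u t x))) * (y - z) = d (u t x) * (y - z)\<^sup>2"
        by (simp add: dA' power2_eq_square algebra_simps)
      moreover have "0 \<le> d (u t x)" using db(1)[of "u t x"] a0_pos by linarith
      ultimately show ?thesis by simp
    qed
    have "q t x = rr t x" if "x \<in> {0..1}" for x
      by (rule classical_solution_unique(1)[OF T_pos s[unfolded sensitivity_solution_def] sens[unfolded sensitivity_solution_def] mono t that])
    then show ?thesis using r(3) by simp
  qed
  show ?thesis
    using b'(1) r(1) val unfolding f_def us_def by blast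
qed

end

section \<open>Stability estimates\<close>

lemma H2_lincomb:
  assumes lr: "l < r" and f: "f \<in> H2 l r" and g: "g \<in> H2 l r"
  shows "(\<lambda>x. a * f x + b * g x) \<in> H2 l r"
proof -
  obtain f1 f2 where F: "primitive_on {l..r} f f1" "primitive_on {l..r} f1 f2" "f2 \<in> L2 {l<..<r}"
    using H2E[OF lr f] by blast
  obtain g1 g2 where G: "primitive_on {l..r} g g1" "primitive_on {l..r} g1 g2" "g2 \<in> L2 {l<..<r}"
    using H2E[OF lr g] by blast
  show ?thesis
    by (rule H2I(1)[OF lr primitive_on_add[OF primitive_on_cmult[OF F(1)] primitive_on_cmult[OF G(1)]]
          primitive_on_add[OF primitive_on_cmult[OF F(2)] primitive_on_cmult[OF G(2)]]
          L2_add[OF L2_cmult[OF F(3)] L2_cmult[OF G(3)]]])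
qed

lemma H2_diff: "l < r \<Longrightarrow> f \<in> H2 l r \<Longrightarrow> g \<in> H2 l r \<Longrightarrow> (\<lambda>x. f x - g x) \<in> H2 l r"
  using H2_lincomb[of l r f g 1 "-1"] by simp

lemma H2_norm_nonneg: "0 \<le> H2_norm l r f"
  by (simp add: H2_norm_def)

lemma H2_C1_bound:
  assumes lr: "l < r"
  obtains C where "C > 0" "\<And>f x. f \<in> H2 l r \<Longrightarrow> x \<in> {l..r} \<Longrightarrow> \<bar>f x\<bar> \<le> C * H2_norm l r f"
    "\<And>f x y. f \<in> H2 l r \<Longrightarrow> x \<in> {l..r} \<Longrightarrow> y \<in> {l..r} \<Longrightarrow> \<bar>f x - f y\<bar> \<le> C * H2_norm l r f * \<bar>x - y\<bar>"
proof -
  obtain C where C: "C > 0" "\<And>f g h x. primitive_on {l..r} f g \<Longrightarrow> primitive_on {l..r} g h \<Longrightarrow> h \<in> L2 {l<..<r}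
    \<Longrightarrow> x \<in> {l..r} \<Longrightarrow> \<bar>f x\<bar> \<le> C * H2_norm l r f \<and> \<bar>g x\<bar> \<le> C * H2_norm l r f"
    using H2_sup_bound[OF lr] by blast
  show thesis
  proof (rule that[OF C(1)])
    fix f x assume f: "f \<in> H2 l r" and x: "x \<in> {l..r}"
    obtain g h where g: "primitive_on {l..r} f g" "primitive_on {l..r} g h" "h \<in> L2 {l<..<r}"
      using H2E[OF lr f] by blast
    show "\<bar>f x\<bar> \<le> C * H2_norm l r f" using C(2)[OF g x] by blast
    fix y assume y: "y \<in> {l..r}"
    let ?S = "C * H2_norm l r f"
    have inc: "\<bar>f y - f x\<bar> \<le> ?S * (y - x)" if "x \<in> {l..r}" "y \<in> {l..r}" "x \<le> y" for x y
      by (rule primitive_on_increment_bound[OF g(1) that, of 0 ?S, simplified]) (use C(2)[OF g] that in auto)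
    consider "x \<le> y" | "y \<le> x" by linarith
    then show "\<bar>f x - f y\<bar> \<le> ?S * \<bar>x - y\<bar>"
      using inc[OF x y] inc[OF y x] by cases (auto simp: abs_minus_commute)
  qed
qed

text \<open>Difference quotients from inside the interval determine the derivative, also at the
  endpoints. Parameters are known only there, while \<open>d\<close> and \<open>d'\<close> are
  derivatives of extensions.\<close>

lemma derivative_le_lipschitz:
  fixes h :: "real \<Rightarrow> real"
  assumes lr: "l < r" and y: "y \<in> {l..r}" and h: "(h has_real_derivative h') (at y)"
    and lip: "\<And>x. x \<in> {l..r} \<Longrightarrow> \<bar>h x - h y\<bar> \<le> S * \<bar>x - y\<bar>"
  shows "\<bar>h'\<bar> \<le> S"
proof (rule tendsto_upperbound)
  have "(h has_real_derivative h') (at y within {l..r})" by (rule has_field_derivative_at_within[OF h])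
  then show "((\<lambda>x. \<bar>(h x - h y) / (x - y)\<bar>) \<longlongrightarrow> \<bar>h'\<bar>) (at y within {l..r})"
    unfolding has_field_derivative_iff by (rule tendsto_rabs)
  show "eventually (\<lambda>x. \<bar>(h x - h y) / (x - y)\<bar> \<le> S) (at y within {l..r})"
    unfolding eventually_at_filter
    by (rule always_eventually) (auto simp: abs_divide divide_le_eq intro: lip[simplified])
  show "at y within {l..r} \<noteq> bot"
    using lr y by (simp add: trivial_limit_within islimpt_Icc)
qed

text \<open>Mean value inequality for \<open>A z - d x * z\<close> as a function of \<open>z\<close>
  on the segment between \<open>x\<close> and \<open>y\<close>, where its derivative is at most
  \<open>K * \<bar>y - x\<bar>\<close>.\<close>

lemma taylor_remainder_le:
  fixes A :: "real \<Rightarrow> real"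
  assumes A: "\<And>x. (A has_real_derivative d x) (at x)" and d: "\<And>x y. \<bar>d x - d y\<bar> \<le> K * \<bar>x - y\<bar>" and K: "0 \<le> K"
  shows "\<bar>A y - A x - d x * (y - x)\<bar> \<le> K * \<bar>y - x\<bar>\<^sup>2"
proof -
  have "norm ((A y - d x * y) - (A x - d x * x)) \<le> (K * \<bar>y - x\<bar>) * norm (y - x)"
  proof (rule field_differentiable_bound[of "closed_segment x y" "\<lambda>z. A z - d x * z" "\<lambda>z. d z - d x"])
    show "((\<lambda>z. A z - d x * z) has_real_derivative d z - d x) (at z within closed_segment x y)" for z
      by (auto intro!: derivative_eq_intros has_field_derivative_at_within[OF A])
    show "norm (d z - d x) \<le> K * \<bar>y - x\<bar>" if "z \<in> closed_segment x y" for z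
    proof -
      have "\<bar>z - x\<bar> \<le> \<bar>y - x\<bar>" using that by (auto simp: closed_segment_eq_real_ivl split: if_splits)
      then have "K * \<bar>z - x\<bar> \<le> K * \<bar>y - x\<bar>" using K by (rule mult_left_mono)
      then show ?thesis using d[of z x] by simp
    qed
  qed auto
  then show ?thesis by (simp add: algebra_simps power2_eq_square)
qed

lemma odd_part_lincomb: "odd_part (\<lambda>t x. a * v t x + b * w t x) s y = a * odd_part v s y + b * odd_part w s y"
  by (simp add: odd_part_def field_simps)

section \<open>Gronwall estimates in the sup norm\<close>

context boundary_problem
begin

text \<open>The Gronwall factor for \<open>K = a1\<close>: the amplification of a unit error in the
  forcing up to time \<open>T\<close>.\<close>

definition gain :: real where "gain = 2 * T * exp (2 * a1 * T)"

abbreviation sens where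
  "sens d v b r \<equiv> mild T (\<lambda>t y. d (odd_part v t y + G t y) * odd_part r t y + b (odd_part v t y + G t y)) r"

lemma gain_pos: "0 < gain" using T_pos by (simp add: gain_def)

lemma mild_bound:
  assumes "mild T \<phi> w" "0 \<le> D"
    and "\<And>s y. s \<in> {0<..<T} \<Longrightarrow> y \<in> {0<..<1} \<Longrightarrow> \<bar>\<phi> s y\<bar> \<le> D + a1 * \<bar>odd_part w s y\<bar>" "t \<in> {0..T}"
  shows "\<bar>w t x\<bar> \<le> gain * D"
  using mild_gronwall[OF assms(1) a1_pos assms(2,3,4), of x] by (simp add: gain_def mult_ac)

lemma state_dataD:
  assumes "state_data A d e v z R"
  shows "\<And>x. (A has_real_derivative d x) (at x)" "\<And>x. \<bar>d x\<bar> \<le> a1"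
    "\<And>x y. \<bar>d x - d y\<bar> \<le> a2 * \<bar>x - y\<bar>" "\<And>x y. \<bar>A x - A y\<bar> \<le> a1 * \<bar>x - y\<bar>"
    "mild T (\<lambda>t y. A (odd_part v t y + G t y) + G1 t y) v"
    "\<And>s y. s \<in> {0<..<T} \<Longrightarrow> y \<in> {0<..<1} \<Longrightarrow> odd_part v s y + G s y \<in> {ul..ur}"
    "\<And>t x. t \<in> {0..T} \<Longrightarrow> \<bar>v t x\<bar> \<le> R"
proof -
  have dA: "\<And>x. (A has_real_derivative d x) (at x)" and de: "\<And>x. (d has_real_derivative e x) (at x)"
    and b: "\<And>x. a0 \<le> d x" "\<And>x. d x \<le> a1" "\<And>x. \<bar>e x\<bar> \<le> a2"
    using assms unfolding state_data_def by blast+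
  show dA': "(A has_real_derivative d x) (at x)" for x by (rule dA)
  show db: "\<bar>d x\<bar> \<le> a1" for x using b(1)[of x] b(2)[of x] a0_pos by auto
  show "\<bar>d x - d y\<bar> \<le> a2 * \<bar>x - y\<bar>" for x y by (rule lipschitz_of_derivative[OF de b(3)])
  show "\<bar>A x - A y\<bar> \<le> a1 * \<bar>x - y\<bar>" for x y by (rule lipschitz_of_derivative[OF dA db])
  show "mild T (\<lambda>t y. A (odd_part v t y + G t y) + G1 t y) v" "\<And>t x. t \<in> {0..T} \<Longrightarrow> \<bar>v t x\<bar> \<le> R"
    using assms unfolding state_data_def by blast+
  fix s y assume s: "s \<in> {0<..<T}" and y: "y \<in> {0<..<1::real}"
  obtain p u where pu: "(p, u) = the_state T c g0 g1 A" by (metis surj_pair)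
  have "s \<in> {0..T}" "y \<in> {0..1}" using s y by auto
  then have "u s y = odd_part v s y + G s y \<and> u s y \<in> {ul..ur}"
    using assms pu unfolding state_data_def by blast
  then show "odd_part v s y + G s y \<in> {ul..ur}" by simp
qed

text \<open>\<open>A\<close> at the perturbed state is added and subtracted: \<open>A' - A\<close>
  is then evaluated at a value of a state, hence in \<open>{ul..ur}\<close>, and the Lipschitz part
  is absorbed by Gronwall.\<close>

lemma state_diff_bound:
  assumes v: "state_data A d e v z R" and v': "state_data A' d' e' v' z' R'"
    and S: "\<And>y. y \<in> {ul..ur} \<Longrightarrow> \<bar>A' y - A y\<bar> \<le> S" and t: "t \<in> {0..T}"
  shows "\<bar>v' t x - v t x\<bar> \<le> gain * S"
proof (rule mild_bound[OF mild_diff[OF state_dataD(5)[OF v'] state_dataD(5)[OF v]] _ _ t])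
  show "0 \<le> S" using S[of ul] ul_ur by auto
  fix s y assume s: "s \<in> {0<..<T}" "y \<in> {0<..<1::real}"
  let ?u = "odd_part v s y + G s y" and ?u' = "odd_part v' s y + G s y"
  have "\<bar>A' ?u' - A ?u'\<bar> \<le> S" by (rule S[OF state_dataD(6)[OF v' s]])
  moreover have "\<bar>A ?u' - A ?u\<bar> \<le> a1 * \<bar>?u' - ?u\<bar>" by (rule state_dataD(4)[OF v])
  ultimately show "\<bar>A' ?u' + G1 s y - (A ?u + G1 s y)\<bar> \<le> S + a1 * \<bar>odd_part (\<lambda>t x. v' t x - v t x) s y\<bar>"
    unfolding odd_part_diff[symmetric] by simp
qed

lemma abs_slope_le: "\<bar>x\<bar> \<le> K \<Longrightarrow> \<bar>x * y\<bar> \<le> K * \<bar>y\<bar>" for x y K :: real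
  unfolding abs_mult by (auto intro: mult_right_mono)

lemma sens_bound:
  assumes v: "state_data A d e v z R" and r: "sens d v b r"
    and S: "\<And>y. y \<in> {ul..ur} \<Longrightarrow> \<bar>b y\<bar> \<le> S" and t: "t \<in> {0..T}"
  shows "\<bar>r t x\<bar> \<le> gain * S"
proof (rule mild_bound[OF r _ _ t])
  show "0 \<le> S" using S[of ul] ul_ur by auto
  fix s y assume s: "s \<in> {0<..<T}" "y \<in> {0<..<1::real}"
  let ?u = "odd_part v s y + G s y"
  have "\<bar>b ?u\<bar> \<le> S" by (rule S[OF state_dataD(6)[OF v s]])
  moreover have "\<bar>d ?u * odd_part r s y\<bar> \<le> a1 * \<bar>odd_part r s y\<bar>" by (rule abs_slope_le[OF state_dataD(2)[OF v]])
  ultimately show "\<bar>d ?u * odd_part r s y + b ?u\<bar> \<le> S + a1 * \<bar>odd_part r s y\<bar>" by linarith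
qed

text \<open>The defect solves the homogeneous equation, for which the Gronwall bound is 0. An
  argument is required because the three functions come from separate choices.\<close>

lemma sens_linear:
  assumes v: "state_data A d e v z R" and r: "sens d v b1 r1" "sens d v b2 r2" "sens d v b r"
    and b: "\<And>y. y \<in> {ul..ur} \<Longrightarrow> b y = k1 * b1 y + k2 * b2 y" and t: "t \<in> {0..T}"
  shows "r t x = k1 * r1 t x + k2 * r2 t x"
proof -
  have "\<bar>r t x - (k1 * r1 t x + k2 * r2 t x)\<bar> \<le> gain * 0"
  proof (rule mild_bound[OF mild_diff[OF r(3) mild_lincomb[OF r(1,2)]] _ _ t])
    fix s y assume s: "s \<in> {0<..<T}" "y \<in> {0<..<1::real}"
    let ?u = "odd_part v s y + G s y" and ?r = "odd_part r s y - (k1 * odd_part r1 s y + k2 * odd_part r2 s y)"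
    have "d ?u * odd_part r s y + b ?u - (k1 * (d ?u * odd_part r1 s y + b1 ?u) + k2 * (d ?u * odd_part r2 s y + b2 ?u)) = d ?u * ?r"
      unfolding b[OF state_dataD(6)[OF v s]] by (simp add: algebra_simps)
    then show "\<bar>d ?u * odd_part r s y + b ?u - (k1 * (d ?u * odd_part r1 s y + b1 ?u) + k2 * (d ?u * odd_part r2 s y + b2 ?u))\<bar>
        \<le> 0 + a1 * \<bar>odd_part (\<lambda>t x. r t x - (k1 * r1 t x + k2 * r2 t x)) s y\<bar>"
      unfolding odd_part_diff[symmetric] odd_part_lincomb using abs_slope_le[OF state_dataD(2)[OF v, of ?u], of ?r] by simp
  qed simp
  then show ?thesis by simp
qed

lemma odd_state_diff_bound:
  assumes v: "state_data A d e v z R" and v': "state_data A' d' e' v' z' R'"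
    and S: "\<And>y. y \<in> {ul..ur} \<Longrightarrow> \<bar>A' y - A y\<bar> \<le> S" and t: "t \<in> {0<..<T}"
  shows "\<bar>odd_part v' t y - odd_part v t y\<bar> \<le> gain * S"
proof -
  have t': "t \<in> {0..T}" using t by auto
  have "\<bar>odd_part (\<lambda>t x. v' t x - v t x) t y\<bar> \<le> gain * S"
    by (rule odd_part_bound; rule state_diff_bound[OF v v' S t'])
  then show ?thesis by (simp only: odd_part_diff[symmetric])
qed

text \<open>The forcing of the remainder has three parts: \<open>A' - A\<close> at two states that
  are \<open>gain * S\<close> apart, where its Lipschitz constant \<open>S\<close> makes the product
  quadratic; the Taylor remainder of \<open>A\<close>; and \<open>d\<close> times the remainder
  itself, absorbed by Gronwall.\<close>

lemma state_remainder_bound: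
  assumes v: "state_data A d e v z R" and v': "state_data A' d' e' v' z' R'" and r: "sens d v b r"
    and b: "\<And>y. y \<in> {ul..ur} \<Longrightarrow> b y = A' y - A y"
    and S: "\<And>y. y \<in> {ul..ur} \<Longrightarrow> \<bar>A' y - A y\<bar> \<le> S"
    and L: "\<And>x y. x \<in> {ul..ur} \<Longrightarrow> y \<in> {ul..ur} \<Longrightarrow> \<bar>(A' x - A x) - (A' y - A y)\<bar> \<le> S * \<bar>x - y\<bar>"
    and t: "t \<in> {0..T}"
  shows "\<bar>v' t x - v t x - r t x\<bar> \<le> gain * (gain * (1 + a2 * gain)) * S\<^sup>2"
proof -
  have S0: "0 \<le> S" using S[of ul] ul_ur by auto
  have "\<bar>v' t x - v t x - r t x\<bar> \<le> gain * (S * (gain * S) + a2 * (gain * S)\<^sup>2)"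
  proof (rule mild_bound[OF mild_diff[OF mild_diff[OF state_dataD(5)[OF v'] state_dataD(5)[OF v]] r] _ _ t])
    show "0 \<le> S * (gain * S) + a2 * (gain * S)\<^sup>2" using S0 gain_pos a2_pos by simp
    fix s y assume s: "s \<in> {0<..<T}" "y \<in> {0<..<1::real}"
    let ?u = "odd_part v s y + G s y" and ?u' = "odd_part v' s y + G s y"
    let ?\<rho> = "odd_part v' s y - odd_part v s y - odd_part r s y"
    have uu: "?u \<in> {ul..ur}" "?u' \<in> {ul..ur}" by (rule state_dataD(6)[OF v s], rule state_dataD(6)[OF v' s])
    have D: "\<bar>?u' - ?u\<bar> \<le> gain * S" using odd_state_diff_bound[OF v v' S s(1), of y] by simp
    have "\<bar>(A' ?u' - A ?u') - (A' ?u - A ?u)\<bar> \<le> S * \<bar>?u' - ?u\<bar>" by (rule L[OF uu(2,1)])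
    also have "\<dots> \<le> S * (gain * S)" by (rule mult_left_mono[OF D S0])
    finally have 1: "\<bar>(A' ?u' - A ?u') - (A' ?u - A ?u)\<bar> \<le> S * (gain * S)" .
    have "\<bar>A ?u' - A ?u - d ?u * (?u' - ?u)\<bar> \<le> a2 * \<bar>?u' - ?u\<bar>\<^sup>2"
      by (rule taylor_remainder_le[OF state_dataD(1)[OF v] state_dataD(3)[OF v]]) (use a2_pos in simp)
    also have "\<dots> \<le> a2 * (gain * S)\<^sup>2" using a2_pos D by (intro mult_left_mono power_mono) auto
    finally have 2: "\<bar>A ?u' - A ?u - d ?u * (?u' - ?u)\<bar> \<le> a2 * (gain * S)\<^sup>2" .
    have 3: "\<bar>d ?u * ?\<rho>\<bar> \<le> a1 * \<bar>?\<rho>\<bar>" by (rule abs_slope_le[OF state_dataD(2)[OF v]])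
    have "(A' ?u' + G1 s y - (A ?u + G1 s y)) - (d ?u * odd_part r s y + b ?u)
        = ((A' ?u' - A ?u') - (A' ?u - A ?u)) + (A ?u' - A ?u - d ?u * (?u' - ?u)) + d ?u * ?\<rho>"
      unfolding b[OF uu(1)] by (simp add: algebra_simps)
    then show "\<bar>(A' ?u' + G1 s y - (A ?u + G1 s y)) - (d ?u * odd_part r s y + b ?u)\<bar>
        \<le> S * (gain * S) + a2 * (gain * S)\<^sup>2 + a1 * \<bar>odd_part (\<lambda>t x. v' t x - v t x - r t x) s y\<bar>"
      unfolding odd_part_diff[symmetric] using 1 2 3 by linarith
  qed
  then show ?thesis by (simp add: power2_eq_square algebra_simps)
qed

text \<open>Changing the parameter changes the coefficient \<open>d\<close>, which multiplies a
  sensitivity of size \<open>gain * M\<close>, and shifts the point at which \<open>b\<close> is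
  evaluated by at most \<open>gain * S\<close>. Both effects are of order
  \<open>S * M\<close>.\<close>

lemma sens_diff_bound:
  assumes v: "state_data A d e v z R" and v': "state_data A' d' e' v' z' R'" and r: "sens d v b r" "sens d' v' b' r'"
    and b: "\<And>y. y \<in> {ul..ur} \<Longrightarrow> b' y = b y" and M: "\<And>y. y \<in> {ul..ur} \<Longrightarrow> \<bar>b y\<bar> \<le> M"
    and bL: "\<And>x y. x \<in> {ul..ur} \<Longrightarrow> y \<in> {ul..ur} \<Longrightarrow> \<bar>b x - b y\<bar> \<le> M * \<bar>x - y\<bar>"
    and S: "\<And>y. y \<in> {ul..ur} \<Longrightarrow> \<bar>A' y - A y\<bar> \<le> S" "\<And>y. y \<in> {ul..ur} \<Longrightarrow> \<bar>d' y - d y\<bar> \<le> S"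
    and t: "t \<in> {0..T}"
  shows "\<bar>r' t x - r t x\<bar> \<le> gain * (gain * (2 + a2 * gain)) * (S * M)"
proof -
  have S0: "0 \<le> S" "0 \<le> M" using S(1)[of ul] M[of ul] ul_ur by auto
  have "\<bar>r' t x - r t x\<bar> \<le> gain * ((a2 * (gain * S) + S) * (gain * M) + M * (gain * S))"
  proof (rule mild_bound[OF mild_diff[OF r(2,1)] _ _ t])
    show "0 \<le> (a2 * (gain * S) + S) * (gain * M) + M * (gain * S)" using S0 gain_pos a2_pos by simp
    fix s y assume s: "s \<in> {0<..<T}" "y \<in> {0<..<1::real}"
    let ?u = "odd_part v s y + G s y" and ?u' = "odd_part v' s y + G s y"
    let ?\<rho> = "odd_part r' s y - odd_part r s y"
    have s': "s \<in> {0..T}" using s by auto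
    have uu: "?u \<in> {ul..ur}" "?u' \<in> {ul..ur}" by (rule state_dataD(6)[OF v s], rule state_dataD(6)[OF v' s])
    have D: "\<bar>?u' - ?u\<bar> \<le> gain * S" using odd_state_diff_bound[OF v v' S(1) s(1), of y] by simp
    have "\<bar>d' ?u' - d ?u\<bar> \<le> \<bar>d' ?u' - d ?u'\<bar> + \<bar>d ?u' - d ?u\<bar>" by linarith
    also have "\<dots> \<le> S + a2 * \<bar>?u' - ?u\<bar>" by (intro add_mono S(2) uu state_dataD(3)[OF v])
    also have "\<dots> \<le> a2 * (gain * S) + S" using mult_left_mono[OF D, of a2] a2_pos by simp
    finally have dd: "\<bar>d' ?u' - d ?u\<bar> \<le> a2 * (gain * S) + S" .
    have ro: "\<bar>odd_part r' s y\<bar> \<le> gain * M"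
      by (rule odd_part_bound; rule sens_bound[OF v' r(2) _ s']) (simp_all add: b M)
    have 1: "\<bar>(d' ?u' - d ?u) * odd_part r' s y\<bar> \<le> (a2 * (gain * S) + S) * (gain * M)"
      unfolding abs_mult by (rule mult_mono[OF dd ro]) (use S0 gain_pos a2_pos in auto)
    have "\<bar>b ?u' - b ?u\<bar> \<le> M * \<bar>?u' - ?u\<bar>" by (rule bL[OF uu(2,1)])
    also have "\<dots> \<le> M * (gain * S)" by (rule mult_left_mono[OF D S0(2)])
    finally have 2: "\<bar>b ?u' - b ?u\<bar> \<le> M * (gain * S)" .
    have 3: "\<bar>d ?u * ?\<rho>\<bar> \<le> a1 * \<bar>?\<rho>\<bar>" by (rule abs_slope_le[OF state_dataD(2)[OF v]])
    have "(d' ?u' * odd_part r' s y + b' ?u') - (d ?u * odd_part r s y + b ?u)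
        = (d' ?u' - d ?u) * odd_part r' s y + (b ?u' - b ?u) + d ?u * ?\<rho>"
      unfolding b[OF uu(2)] by (simp add: algebra_simps)
    then show "\<bar>(d' ?u' * odd_part r' s y + b' ?u') - (d ?u * odd_part r s y + b ?u)\<bar>
        \<le> (a2 * (gain * S) + S) * (gain * M) + M * (gain * S) + a1 * \<bar>odd_part (\<lambda>t x. r' t x - r t x) s y\<bar>"
      unfolding odd_part_diff[symmetric] using 1 2 3 by linarith
  qed
  then show ?thesis by (simp add: algebra_simps)
qed

section \<open>The operators on parameter space\<close>

text \<open>The estimates hold at every point, hence for the traces at 0 and 1; the finite time
  interval converts sup into L2 with the factor \<open>sqrt T\<close>.\<close>

lemma trace_L2:
  assumes w: "bmeas2 w" and E: "\<And>t x. t \<in> {0..T} \<Longrightarrow> \<bar>w t x\<bar> \<le> E"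
    and h: "\<And>t. t \<in> {0..T} \<Longrightarrow> h t = w t 0 - w t 1"
  shows "h \<in> L2 {0<..<T}" "L2_norm {0<..<T} h \<le> sqrt T * (2 * E)"
proof -
  have "(\<lambda>t. w t x) \<in> borel_measurable borel" for x by (rule bmeas2_comp[OF w]) auto
  then have "(\<lambda>t. w t 0 - w t 1) \<in> borel_measurable borel" by (intro borel_measurable_diff)
  then have "(\<lambda>t. w t 0 - w t 1) \<in> borel_measurable (lebesgue_on {0<..<T})" by (rule borel_measurable_lebesgue_onI)
  then have m: "h \<in> borel_measurable (lebesgue_on {0<..<T})"
    by (rule measurable_cong[THEN iffD2, rotated]) (use h in auto)
  have b: "\<bar>h t\<bar> \<le> 2 * E" if "t \<in> {0<..<T}" for t
  proof -
    have t: "t \<in> {0..T}" using that by auto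
    show ?thesis unfolding h[OF t] using E[OF t, of 0] E[OF t, of 1] by linarith
  qed
  have E0: "0 \<le> 2 * E" using E[of 0 0] T_pos by auto
  show "h \<in> L2 {0<..<T}" by (rule L2_bounded(1)[OF m b]) (use T_pos in auto)
  show "L2_norm {0<..<T} h \<le> sqrt T * (2 * E)" using L2_norm_bounded[OF m b _ E0] T_pos by simp
qed

abbreviation fwd where "fwd \<equiv> forward_op T a0 a1 a2 a3 ul ur c g0 g1"
abbreviation dfwd where "dfwd \<equiv> forward_deriv T a0 a1 a2 a3 ul ur c g0 g1"
abbreviation ext where "ext \<equiv> extension a0 a1 a2 a3 ul ur"
abbreviation params where "params \<equiv> DF a0 a1 a2 a3 ul ur"

text \<open>Frees the estimates from Hilbert choice: both operators become boundary differences of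
  mild solutions, with one state \<open>v\<close> common to all directions \<open>b\<close>.\<close>

definition trace_data where
  "trace_data a d e v z R \<longleftrightarrow> state_data (ext a) d e v z R \<and> (\<forall>y\<in>{ul..ur}. ext a y = a y) \<and>
    (\<forall>t\<in>{0..T}. fwd a t = v t 0 - v t 1) \<and>
    (\<forall>b\<in>H2 ul ur. \<exists>r b'. (\<forall>y\<in>{ul..ur}. b' y = b y) \<and> sens d v b' r \<and> (\<forall>t\<in>{0..T}. dfwd a b t = r t 0 - r t 1))"

lemma trace_dataD:
  assumes "trace_data a d e v z R"
  shows "state_data (ext a) d e v z R" "\<And>y. y \<in> {ul..ur} \<Longrightarrow> ext a y = a y"
    "\<And>t. t \<in> {0..T} \<Longrightarrow> fwd a t = v t 0 - v t 1"
    "\<And>b. b \<in> H2 ul ur \<Longrightarrow> \<exists>r b'. (\<forall>y\<in>{ul..ur}. b' y = b y) \<and> sens d v b' r \<and> (\<forall>t\<in>{0..T}. dfwd a b t = r t 0 - r t 1)"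
  using assms unfolding trace_data_def by blast+

lemma trace_data_exists:
  assumes a: "a \<in> params"
  shows "\<exists>d e v z R. trace_data a d e v z R"
proof -
  have "\<exists>A. A1 a0 a1 a2 a3 A \<and> (\<forall>y\<in>{ul..ur}. A y = a y)" using a by (simp add: DF_def)
  then have "A1 a0 a1 a2 a3 (ext a) \<and> (\<forall>y\<in>{ul..ur}. ext a y = a y)"
    unfolding extension_def by (rule someI_ex)
  then have A: "A1 a0 a1 a2 a3 (ext a)" "\<And>y. y \<in> {ul..ur} \<Longrightarrow> ext a y = a y" by auto
  obtain d e v z R where S: "state_data (ext a) d e v z R" using state_data_exists[OF A(1)] by blast
  obtain p u where pu: "(p, u) = the_state T c g0 g1 (ext a)" by (metis surj_pair)
  have "trace_data a d e v z R"
    unfolding trace_data_def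
  proof (intro conjI ballI S A(2))
    fix t assume t: "t \<in> {0..T}"
    have "fwd a t = p t 0 - p t 1" unfolding forward_op_def pu[symmetric] by simp
    also have "\<dots> = v t 0 - v t 1" using S pu t unfolding state_data_def by blast
    finally show "fwd a t = v t 0 - v t 1" .
  next
    fix b assume b: "b \<in> H2 ul ur"
    obtain g h where g: "primitive_on {ul..ur} b g" "primitive_on {ul..ur} g h"
      using H2E[OF ul_ur b] by blast
    obtain r b' where r: "\<forall>y\<in>{ul..ur}. b' y = b y" "sens d v b' r"
      "\<forall>q w t. (q, w) = the_sensitivity T (ext a) u b \<longrightarrow> t \<in> {0..T} \<longrightarrow> q t 0 - q t 1 = r t 0 - r t 1"
      using sensitivity_data_exists[OF S g(1) primitive_on_continuous_Icc[OF g(2)] pu] by blast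
    obtain q w where qw: "(q, w) = the_sensitivity T (ext a) u b" by (metis surj_pair)
    have "dfwd a b t = q t 0 - q t 1" for t
      unfolding forward_deriv_def Let_def pu[symmetric] by (simp add: qw[symmetric])
    moreover have "q t 0 - q t 1 = r t 0 - r t 1" if "t \<in> {0..T}" for t using r(3) qw that by blast
    ultimately have "\<forall>t\<in>{0..T}. dfwd a b t = r t 0 - r t 1" by simp
    then show "\<exists>r b'. (\<forall>y\<in>{ul..ur}. b' y = b y) \<and> sens d v b' r \<and> (\<forall>t\<in>{0..T}. dfwd a b t = r t 0 - r t 1)"
      using r(1,2) by blast
  qed
  then show ?thesis by blast
qed

lemma params_diff_derivative:
  assumes v: "state_data A d e v z R" and v': "state_data A' d' e' v' z' R'"
    and L: "\<And>x y. x \<in> {ul..ur} \<Longrightarrow> y \<in> {ul..ur} \<Longrightarrow> \<bar>(A' x - A x) - (A' y - A y)\<bar> \<le> S * \<bar>x - y\<bar>"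
    and y: "y \<in> {ul..ur}"
  shows "\<bar>d' y - d y\<bar> \<le> S"
  by (rule derivative_le_lipschitz[OF ul_ur y DERIV_diff[OF state_dataD(1)[OF v'] state_dataD(1)[OF v]] L[OF _ y]])

lemma mild_bmeas2: "mild T \<phi> w \<Longrightarrow> bmeas2 w"
  by (simp add: mild_def)

lemma forward_op_L2:
  assumes a: "a \<in> params"
  shows "fwd a \<in> L2 {0<..<T}"
proof -
  obtain d e v z R where V: "trace_data a d e v z R" using trace_data_exists[OF a] by blast
  note v = trace_dataD(1,3)[OF V]
  show ?thesis by (rule trace_L2(1)[OF mild_bmeas2[OF state_dataD(5)[OF v(1)]] state_dataD(7)[OF v(1)] v(2)])
qed

lemma forward_deriv_bounded_linear:
  assumes a: "a \<in> params"
  shows "bounded_linear_H2_L2 ul ur T (dfwd a)"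
proof -
  obtain C where C: "C > 0" "\<And>f x. f \<in> H2 ul ur \<Longrightarrow> x \<in> {ul..ur} \<Longrightarrow> \<bar>f x\<bar> \<le> C * H2_norm ul ur f"
    using H2_C1_bound[OF ul_ur] by metis
  obtain d e v z R where V: "trace_data a d e v z R" using trace_data_exists[OF a] by blast
  note v = trace_dataD(1)[OF V] and xa = trace_dataD(2)[OF V] and fv = trace_dataD(3)[OF V] and ex = trace_dataD(4)[OF V]
  have lin: "AE t in lebesgue_on {0<..<T}. dfwd a (\<lambda>y. k1 * b1 y + k2 * b2 y) t = k1 * dfwd a b1 t + k2 * dfwd a b2 t"
    if b: "b1 \<in> H2 ul ur" "b2 \<in> H2 ul ur" for b1 b2 k1 k2
  proof (rule AE_I2)
    fix t assume "t \<in> space (lebesgue_on {0<..<T})"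
    then have t: "t \<in> {0..T}" by auto
    obtain r1 b1' where 1: "\<forall>y\<in>{ul..ur}. b1' y = b1 y" "sens d v b1' r1" "\<forall>t\<in>{0..T}. dfwd a b1 t = r1 t 0 - r1 t 1"
      using ex[OF b(1)] by blast
    obtain r2 b2' where 2: "\<forall>y\<in>{ul..ur}. b2' y = b2 y" "sens d v b2' r2" "\<forall>t\<in>{0..T}. dfwd a b2 t = r2 t 0 - r2 t 1"
      using ex[OF b(2)] by blast
    obtain r b' where 3: "\<forall>y\<in>{ul..ur}. b' y = k1 * b1 y + k2 * b2 y" "sens d v b' r"
      "\<forall>t\<in>{0..T}. dfwd a (\<lambda>y. k1 * b1 y + k2 * b2 y) t = r t 0 - r t 1"
      using ex[OF H2_lincomb[OF ul_ur b]] by blast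
    have lin: "r t x = k1 * r1 t x + k2 * r2 t x" for x
      by (rule sens_linear[OF v 1(2) 2(2) 3(2) _ t]) (use 1(1) 2(1) 3(1) in simp)
    show "dfwd a (\<lambda>y. k1 * b1 y + k2 * b2 y) t = k1 * dfwd a b1 t + k2 * dfwd a b2 t"
      unfolding bspec[OF 1(3) t] bspec[OF 2(3) t] bspec[OF 3(3) t] lin by (simp add: algebra_simps)
  qed
  have bd: "dfwd a b \<in> L2 {0<..<T} \<and> L2_norm {0<..<T} (dfwd a b) \<le> sqrt T * 2 * gain * C * H2_norm ul ur b"
    if b: "b \<in> H2 ul ur" for b
  proof -
    obtain r b' where r: "\<forall>y\<in>{ul..ur}. b' y = b y" "sens d v b' r" "\<forall>t\<in>{0..T}. dfwd a b t = r t 0 - r t 1"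
      using ex[OF b] by blast
    have "\<bar>r t x\<bar> \<le> gain * (C * H2_norm ul ur b)" if "t \<in> {0..T}" for t x
      by (rule sens_bound[OF v r(2) _ that]) (use r(1) C(2)[OF b] in simp)
    from trace_L2[OF mild_bmeas2[OF r(2)] this] r(3) show ?thesis by (simp add: mult_ac)
  qed
  show ?thesis
    unfolding bounded_linear_H2_L2_def
  proof (intro conjI ballI allI)
    show "AE t in lebesgue_on {0<..<T}. dfwd a (\<lambda>y. b1 y + b2 y) t = dfwd a b1 t + dfwd a b2 t"
      if "b1 \<in> H2 ul ur" "b2 \<in> H2 ul ur" for b1 b2
      using lin[OF that, of 1 1] by simp
    show "AE t in lebesgue_on {0<..<T}. dfwd a (\<lambda>y. k * b y) t = k * dfwd a b t" if "b \<in> H2 ul ur" for k b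
      using lin[OF that that, of k 0] by simp
    show "\<exists>C. \<forall>b\<in>H2 ul ur. L2_norm {0<..<T} (dfwd a b) \<le> C * H2_norm ul ur b"
      using bd by blast
  qed (use bd in blast)
qed

text \<open>The remainder is quadratic in the H2 distance, uniformly in time; dividing by the
  distance leaves a factor that tends to 0.\<close>

lemma forward_op_frechet:
  assumes a: "a \<in> params"
  shows "has_frechet_derivative_within ul ur T fwd (dfwd a) a params"
  unfolding has_frechet_derivative_within_def
proof (intro conjI forward_deriv_bounded_linear[OF a] allI impI)
  fix \<epsilon> :: real assume \<epsilon>: "\<epsilon> > 0"
  obtain C where C: "C > 0" "\<And>f x. f \<in> H2 ul ur \<Longrightarrow> x \<in> {ul..ur} \<Longrightarrow> \<bar>f x\<bar> \<le> C * H2_norm ul ur f"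
    "\<And>f x y. f \<in> H2 ul ur \<Longrightarrow> x \<in> {ul..ur} \<Longrightarrow> y \<in> {ul..ur} \<Longrightarrow> \<bar>f x - f y\<bar> \<le> C * H2_norm ul ur f * \<bar>x - y\<bar>"
    by (rule H2_C1_bound[OF ul_ur]) (rule that; blast)
  obtain d e v z R where V: "trace_data a d e v z R" using trace_data_exists[OF a] by blast
  note v = trace_dataD(1)[OF V] and xa = trace_dataD(2)[OF V] and fv = trace_dataD(3)[OF V] and ex = trace_dataD(4)[OF V]
  \<comment> \<open>The trace factor \<open>2 * sqrt T\<close>, the constant of the remainder
    estimate, and the square of the embedding constant \<open>C\<close>.\<close>
  define K where "K = sqrt T * (2 * (gain * (gain * (1 + a2 * gain)) * C\<^sup>2))"
  have K: "0 < K" unfolding K_def using T_pos gain_pos a2_pos C(1) by (intro mult_pos_pos add_pos_pos) auto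
  have est: "L2_norm {0<..<T} (\<lambda>t. fwd a' t - fwd a t - dfwd a (\<lambda>y. a' y - a y) t) \<le> K * (H2_norm ul ur (\<lambda>y. a' y - a y))\<^sup>2"
    if a': "a' \<in> params" for a'
  proof -
    let ?b = "\<lambda>y. a' y - a y"
    have b: "?b \<in> H2 ul ur" by (rule H2_diff[OF ul_ur]) (use a a' in \<open>auto simp: DF_def\<close>)
    let ?S = "C * H2_norm ul ur ?b"
    obtain d' e' v' z' R' where V': "trace_data a' d' e' v' z' R'" using trace_data_exists[OF a'] by blast
    note v' = trace_dataD(1)[OF V'] and xa' = trace_dataD(2)[OF V'] and fv' = trace_dataD(3)[OF V'] and ex' = trace_dataD(4)[OF V']
    obtain r b' where r: "\<forall>y\<in>{ul..ur}. b' y = ?b y" "sens d v b' r" "\<forall>t\<in>{0..T}. dfwd a ?b t = r t 0 - r t 1"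
      using ex[OF b] by blast
    have m: "bmeas2 (\<lambda>t x. v' t x - v t x - r t x)"
      by (rule mild_bmeas2[OF mild_diff[OF mild_diff[OF state_dataD(5)[OF v'] state_dataD(5)[OF v]] r(2)]])
    have "\<bar>v' t x - v t x - r t x\<bar> \<le> gain * (gain * (1 + a2 * gain)) * ?S\<^sup>2" if t: "t \<in> {0..T}" for t x
    proof (rule state_remainder_bound[OF v v' r(2) _ _ _ t])
      show "b' y = ext a' y - ext a y" if "y \<in> {ul..ur}" for y using r(1) xa xa' that by simp
      show "\<bar>ext a' y - ext a y\<bar> \<le> ?S" if "y \<in> {ul..ur}" for y using C(2)[OF b that] xa[OF that] xa'[OF that] by simp
      show "\<bar>ext a' x - ext a x - (ext a' y - ext a y)\<bar> \<le> ?S * \<bar>x - y\<bar>" if "x \<in> {ul..ur}" "y \<in> {ul..ur}" for x y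
        using C(3)[OF b that] by (simp only: xa xa' that)
    qed
    from trace_L2(2)[OF m this, of "\<lambda>t. fwd a' t - fwd a t - dfwd a ?b t"]
    have "L2_norm {0<..<T} (\<lambda>t. fwd a' t - fwd a t - dfwd a ?b t) \<le> sqrt T * (2 * (gain * (gain * (1 + a2 * gain)) * ?S\<^sup>2))"
      using fv fv' r(3) by simp
    then show ?thesis by (simp add: K_def power_mult_distrib mult_ac)
  qed
  show "\<exists>\<delta>>0. \<forall>a'\<in>params. 0 < H2_norm ul ur (\<lambda>y. a' y - a y) \<and> H2_norm ul ur (\<lambda>y. a' y - a y) < \<delta> \<longrightarrow>
      L2_norm {0<..<T} (\<lambda>t. fwd a' t - fwd a t - dfwd a (\<lambda>y. a' y - a y) t) / H2_norm ul ur (\<lambda>y. a' y - a y) < \<epsilon>"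
  proof (intro exI[of _ "\<epsilon> / K"] conjI ballI impI)
    show "0 < \<epsilon> / K" using \<epsilon> K by simp
    fix a' assume a': "a' \<in> params" and n: "0 < H2_norm ul ur (\<lambda>y. a' y - a y) \<and> H2_norm ul ur (\<lambda>y. a' y - a y) < \<epsilon> / K"
    let ?n = "H2_norm ul ur (\<lambda>y. a' y - a y)"
    have "L2_norm {0<..<T} (\<lambda>t. fwd a' t - fwd a t - dfwd a (\<lambda>y. a' y - a y) t) / ?n \<le> K * ?n"
      using est[OF a'] n by (simp add: divide_le_eq power2_eq_square mult.assoc)
    also have "K * ?n < \<epsilon>" using n K by (simp add: less_divide_eq mult.commute)
    finally show "L2_norm {0<..<T} (\<lambda>t. fwd a' t - fwd a t - dfwd a (\<lambda>y. a' y - a y) t) / ?n < \<epsilon>" .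
  qed
qed

text \<open>The sup-norm difference of two sensitivities is bilinear in the distance of the
  parameters and the size of the direction. Each is measured in H2 through the C1 embedding, whence
  \<open>C\<^sup>2\<close> in \<open>L\<close>.\<close>

lemma forward_deriv_lipschitz:
  "\<exists>L. \<forall>a\<in>params. \<forall>a'\<in>params. onorm_H2_L2 ul ur T (\<lambda>b t. dfwd a b t - dfwd a' b t) \<le> L * H2_norm ul ur (\<lambda>y. a y - a' y)"
proof -
  obtain C where C: "C > 0" "\<And>f x. f \<in> H2 ul ur \<Longrightarrow> x \<in> {ul..ur} \<Longrightarrow> \<bar>f x\<bar> \<le> C * H2_norm ul ur f"
    "\<And>f x y. f \<in> H2 ul ur \<Longrightarrow> x \<in> {ul..ur} \<Longrightarrow> y \<in> {ul..ur} \<Longrightarrow> \<bar>f x - f y\<bar> \<le> C * H2_norm ul ur f * \<bar>x - y\<bar>"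
    by (rule H2_C1_bound[OF ul_ur]) (rule that; blast)
  define L where "L = sqrt T * (2 * (gain * (gain * (2 + a2 * gain)) * C\<^sup>2))"
  have L: "0 \<le> L" unfolding L_def using T_pos gain_pos a2_pos by simp
  have "onorm_H2_L2 ul ur T (\<lambda>b t. dfwd a b t - dfwd a' b t) \<le> L * H2_norm ul ur (\<lambda>y. a y - a' y)"
    if a: "a \<in> params" and a': "a' \<in> params" for a a'
    unfolding onorm_H2_L2_def
  proof (rule cSUP_least)
    show "H2 ul ur \<noteq> {}" using a by (auto simp: DF_def)
    fix b assume b: "b \<in> H2 ul ur"
    let ?n = "H2_norm ul ur (\<lambda>y. a y - a' y)" and ?m = "H2_norm ul ur b"
    have D: "(\<lambda>y. a y - a' y) \<in> H2 ul ur" by (rule H2_diff[OF ul_ur]) (use a a' in \<open>auto simp: DF_def\<close>)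
    obtain d e v z R where V: "trace_data a d e v z R" using trace_data_exists[OF a] by blast
    note v = trace_dataD(1)[OF V] and xa = trace_dataD(2)[OF V] and fv = trace_dataD(3)[OF V] and ex = trace_dataD(4)[OF V]
    obtain d' e' v' z' R' where V': "trace_data a' d' e' v' z' R'" using trace_data_exists[OF a'] by blast
    note v' = trace_dataD(1)[OF V'] and xa' = trace_dataD(2)[OF V'] and fv' = trace_dataD(3)[OF V'] and ex' = trace_dataD(4)[OF V']
    obtain r b1 where r: "\<forall>y\<in>{ul..ur}. b1 y = b y" "sens d v b1 r" "\<forall>t\<in>{0..T}. dfwd a b t = r t 0 - r t 1"
      using ex[OF b] by blast
    obtain r' b2 where r': "\<forall>y\<in>{ul..ur}. b2 y = b y" "sens d' v' b2 r'" "\<forall>t\<in>{0..T}. dfwd a' b t = r' t 0 - r' t 1"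
      using ex'[OF b] by blast
    have lip: "\<bar>ext a x - ext a' x - (ext a y - ext a' y)\<bar> \<le> C * ?n * \<bar>x - y\<bar>" if "x \<in> {ul..ur}" "y \<in> {ul..ur}" for x y
      using C(3)[OF D that] by (simp only: xa xa' that)
    have "\<bar>r t x - r' t x\<bar> \<le> gain * (gain * (2 + a2 * gain)) * (C * ?n * (C * ?m))" if t: "t \<in> {0..T}" for t x
    \<comment> \<open>The two parameters exchange roles, so that the differences appear as
      \<open>a - a'\<close>.\<close>
    proof (rule sens_diff_bound[OF v' v r'(2) r(2) _ _ _ _ _ t])
      show "b1 y = b2 y" if "y \<in> {ul..ur}" for y using r(1) r'(1) that by simp
      show "\<bar>b2 y\<bar> \<le> C * ?m" if "y \<in> {ul..ur}" for y using C(2)[OF b that] r'(1) that by simp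
      show "\<bar>b2 x - b2 y\<bar> \<le> C * ?m * \<bar>x - y\<bar>" if "x \<in> {ul..ur}" "y \<in> {ul..ur}" for x y
        using C(3)[OF b that] r'(1) that by simp
      show "\<bar>ext a y - ext a' y\<bar> \<le> C * ?n" if "y \<in> {ul..ur}" for y
        using C(2)[OF D that] by (simp only: xa xa' that)
      show "\<bar>d y - d' y\<bar> \<le> C * ?n" if "y \<in> {ul..ur}" for y by (rule params_diff_derivative[OF v' v lip that])
    qed
    from trace_L2(2)[OF mild_bmeas2[OF mild_diff[OF r(2) r'(2)]] this, of "\<lambda>t. dfwd a b t - dfwd a' b t"]
    have "L2_norm {0<..<T} (\<lambda>t. dfwd a b t - dfwd a' b t) \<le> sqrt T * (2 * (gain * (gain * (2 + a2 * gain)) * (C * ?n * (C * ?m))))"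
      using r(3) r'(3) by simp
    also have "\<dots> = L * ?n * ?m" by (simp add: L_def power2_eq_square mult_ac)
    finally have le: "L2_norm {0<..<T} (\<lambda>t. dfwd a b t - dfwd a' b t) \<le> L * ?n * ?m" .
    show "L2_norm {0<..<T} (\<lambda>t. dfwd a b t - dfwd a' b t) / ?m \<le> L * ?n"
    proof (cases "?m = 0")
      \<comment> \<open>Division by 0 yields 0, so a direction of norm 0 contributes 0 to the
        supremum.\<close>
      case True
      then show ?thesis using L H2_norm_nonneg by simp
    next
      case False
      then have "0 < ?m" using H2_norm_nonneg[of ul ur b] by linarith
      then show ?thesis using le by (simp add: divide_le_eq)
    qed
  qed
  then show ?thesis by blast
qed

end

theorem theorem4p3:
  fixes T a0 a1 a2 a3 c ul ur :: real and g0 g1 :: "real \<Rightarrow> real"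
  assumes "T > 0" and "a0 > 0" and "a1 > 0" and "a2 > 0" and "a3 > 0"
    and "C_k_on_interval 4 T g0" and "C_k_on_interval 4 T g1"
    and "g0 0 = 0" and "g1 0 = 0"
    and "(g0 has_real_derivative 0) (at 0 within {0..T})"
    and "(g1 has_real_derivative 0) (at 0 within {0..T})"
    and "ul < ur"
    and "\<forall>a p u. A1 a0 a1 a2 a3 a \<and> state_solution T c g0 g1 a p u \<longrightarrow>
           (\<forall>t\<in>{0..T}. \<forall>x\<in>{0..1}. ul \<le> u t x \<and> u t x \<le> ur)"
  shows "(\<forall>a\<in>DF a0 a1 a2 a3 ul ur. forward_op T a0 a1 a2 a3 ul ur c g0 g1 a \<in> L2 {0<..<T}) \<and>
    (\<forall>a\<in>DF a0 a1 a2 a3 ul ur.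
       has_frechet_derivative_within ul ur T (forward_op T a0 a1 a2 a3 ul ur c g0 g1)
         (forward_deriv T a0 a1 a2 a3 ul ur c g0 g1 a) a (DF a0 a1 a2 a3 ul ur)) \<and>
    (\<exists>L. \<forall>a\<in>DF a0 a1 a2 a3 ul ur. \<forall>a'\<in>DF a0 a1 a2 a3 ul ur.
       onorm_H2_L2 ul ur T (\<lambda>b t. forward_deriv T a0 a1 a2 a3 ul ur c g0 g1 a b t
           - forward_deriv T a0 a1 a2 a3 ul ur c g0 g1 a' b t)
         \<le> L * H2_norm ul ur (\<lambda>y. a y - a' y))"
proof -
  \<comment> \<open>The boundary data are replaced by continuous functions on the whole line that
    agree with them on \<open>{0..T}\<close>; classical solutions see them only there.\<close>
  obtain \<gamma>0 \<delta>0 \<eta>0 where 0: "continuous_on UNIV \<gamma>0" "continuous_on UNIV \<delta>0" "continuous_on UNIV \<eta>0"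
    "\<And>t. t \<in> {0..T} \<Longrightarrow> \<gamma>0 t = g0 t" "\<gamma>0 0 = 0" "\<delta>0 0 = 0" "primitive_on {0..T} \<gamma>0 \<delta>0"
    "\<And>t. 0 < t \<Longrightarrow> t < T \<Longrightarrow> (\<gamma>0 has_real_derivative \<delta>0 t) (at t)"
    "\<And>t. 0 < t \<Longrightarrow> t < T \<Longrightarrow> (\<delta>0 has_real_derivative \<eta>0 t) (at t)"
    by (rule boundary_data_C2[OF assms(1,6,8,10)]) (rule that; (assumption | simp))
  obtain \<gamma>1 \<delta>1 \<eta>1 where 1: "continuous_on UNIV \<gamma>1" "continuous_on UNIV \<delta>1" "continuous_on UNIV \<eta>1"
    "\<And>t. t \<in> {0..T} \<Longrightarrow> \<gamma>1 t = g1 t" "\<gamma>1 0 = 0" "\<delta>1 0 = 0" "primitive_on {0..T} \<gamma>1 \<delta>1"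
    "\<And>t. 0 < t \<Longrightarrow> t < T \<Longrightarrow> (\<gamma>1 has_real_derivative \<delta>1 t) (at t)"
    "\<And>t. 0 < t \<Longrightarrow> t < T \<Longrightarrow> (\<delta>1 has_real_derivative \<eta>1 t) (at t)"
    by (rule boundary_data_C2[OF assms(1,7,9,11)]) (rule that; (assumption | simp))
  interpret boundary_problem T a0 a1 a2 a3 c ul ur g0 g1 \<gamma>0 \<gamma>1 \<delta>0 \<delta>1 \<eta>0 \<eta>1
  proof
    show "0 < T" "0 < a0" "0 < a1" "0 < a2" "ul < ur" by (rule assms)+
    show "continuous_on UNIV \<gamma>0" "continuous_on UNIV \<gamma>1" "continuous_on UNIV \<delta>0" "continuous_on UNIV \<delta>1"
      "continuous_on UNIV \<eta>0" "continuous_on UNIV \<eta>1" by (fact 0(1-3) 1(1-3))+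
    show "\<gamma>0 0 = 0" "\<gamma>1 0 = 0" "\<delta>0 0 = 0" "\<delta>1 0 = 0" by (fact 0(5,6) 1(5,6))+
    show "primitive_on {0..T} \<gamma>0 \<delta>0" "primitive_on {0..T} \<gamma>1 \<delta>1" by (fact 0(7) 1(7))+
    show "g0 t = \<gamma>0 t \<and> g1 t = \<gamma>1 t" if "t \<in> {0..T}" for t using 0(4)[OF that] 1(4)[OF that] by simp
    show "(\<gamma>0 has_real_derivative \<delta>0 t) (at t)" if "0 < t" "t < T" for t by (rule 0(8)[OF that])
    show "(\<gamma>1 has_real_derivative \<delta>1 t) (at t)" if "0 < t" "t < T" for t by (rule 1(8)[OF that])
    show "(\<delta>0 has_real_derivative \<eta>0 t) (at t)" if "0 < t" "t < T" for t by (rule 0(9)[OF that])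
    show "(\<delta>1 has_real_derivative \<eta>1 t) (at t)" if "0 < t" "t < T" for t by (rule 1(9)[OF that])
    show "u t x \<in> {ul..ur}"
      if "A1 a0 a1 a2 a3 a" "state_solution T c g0 g1 a p u" "t \<in> {0..T}" "x \<in> {0..1}" for a p u t x
      using assms(13)[rule_format, OF conjI[OF that(1,2)] that(3,4)] by simp
  qed
  show ?thesis
    using forward_op_L2 forward_op_frechet forward_deriv_lipschitz by blast
qed

end
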